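(* Assume the setting described in the context, let $u_0\in H$, and let $u\in\mathcal{W}^p(0,T)$ be the solution of $$u' + Au = f \ \text{ in } L^q(0,T;V^* ),\qquad u(0)=u_0 \ \text{ in } H .$$ For step sizes $k=\frac{T}{N}$, $N\in\mathbb{N}$, let $U^k$ and $U_\ell^k$ be the piecewise constant prolongations of the sum splitting scheme, as defined in the context. Then $$U^k(t)\to u(t)\ \text{ in } H \quad\text{as } k\to0,\quad\text{for every } t\in[0,T].$$ If, moreover, the common constant $\eta$ in the monotonicity inequalities $\langle A(t)v-A(t)w,v-w\rangle_{V^*\times V}\ge\eta|v-w|_V^p$ for all $t\in[0,T]$, $v,w\in V$, and $\langle A_\ell(t)v-A_\ell(t)w,v-w\rangle_{V_\ell^*\times V_\ell}\ge\eta|v-w|_{V_\ell}^p$ for all $t\in[0,T]$, $v,w\in V_\ell$, $\ell\in\{1,\dots,s\}$, is strictly positive, then $(U_\ell^k)_{k>0}$ converges strongly to $u$ in $L^p(0,T;V_\ell)$ as $k\to 0$ for every $\ell\in\{1,\dots,s\}$.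
   Context: Setting. $T>0$, $p>1$, $q=\frac{p}{p-1}$, $s\in\mathbb{N}$. (A1) Spaces. $(H,(\cdot,\cdot)_H,\|\cdot\|_H)$ is a real separable Hilbert space and $(V,\|\cdot\|_V)$ is a real, separable, reflexive Banach space continuously and densely embedded into $H$. There exist a seminorm $|\cdot|_V$ on $V$ and $c_V\in(0,\infty)$ with $\|\cdot\|_V\le c_V(\|\cdot\|_H+|\cdot|_V)$. For $\ell\in\{1,\dots,s\}$, $(V_\ell,\|\cdot\|_{V_\ell})$ are real reflexive Banach spaces continuously and densely embedded into $H$, with $\bigcap_{\ell=1}^s V_\ell=V$ and $\sum_{\ell=1}^s\|\cdot\|_{V_\ell}$ equivalent to $\|\cdot\|_V$ on $V$. For every $\ell$ there exist a seminorm $|\cdot|_{V_\ell}$ on $V_\ell$ and $c_{V_\ell}\in(0,\infty)$ with $\|\cdot\|_{V_\ell}\le c_{V_\ell}(\|\cdot\|_H+|\cdot|_{V_\ell})$, and $\sum_{\ell=1}^s|\cdot|_{V_\ell}$ is equivalent to $|\cdot|_V$ on $V$. $H$ is identified with $H^*$, giving Gelfand triples $V\hookrightarrow H\cong H^*\hookrightarrow V^*$ and $V_\ell\hookrightarrow H\cong H^*\hookrightarrow V_\ell^*$; elements of $V_\ell^*$ are regarded as elements of $V^*$ by restriction to $V$. $\langle\cdot,\cdot\rangle_{X^*\times X}$ denotes the duality pairing. (A2) Conditions on a family $\{A(t)\}_{t\in[0,T]}$ of operators $A(t):X\to X^*$, where $X$ carries a seminorm $|\cdot|_X$ as in (A1):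 (1) for each $v\in X$ the map $t\mapsto A(t)v$, $[0,T]\to X^*$, is continuous; (2) for each $t$, and $u,v,w\in X$, $\tau\mapsto\langle A(t)(u+\tau v),w\rangle_{X^*\times X}$ is continuous on $[0,1]$; (3) there is $\eta\ge0$ with $\langle A(t)v-A(t)w,v-w\rangle_{X^*\times X}\ge\eta|v-w|_X^p$ for all $t$ and $v,w\in X$; (4) there is $\beta>0$ with $\|A(t)v\|_{X^*}\le\beta(1+\|v\|_X^{p-1})$ for all $t$ and $v\in X$; (5) there are $\mu>0$, $\lambda\ge0$ with $\langle A(t)v,v\rangle_{X^*\times X}+\lambda\ge\mu|v|_X^p$ for all $t$ and $v\in X$. (A3) Decomposition. $\{A(t)\}_{t\in[0,T]}$ satisfies (A2) with $X=V$; for each $\ell\in\{1,\dots,s\}$, $\{A_\ell(t)\}_{t\in[0,T]}$ satisfies (A2) with $X=V_\ell$; and $\sum_{\ell=1}^sA_\ell(t)v=A(t)v$ in $V^*$ for all $t\in[0,T]$, $v\in V$. For simplicity the constants $\beta,\eta,\lambda,\mu$ are the same for all of these families. The same symbols $A,A_\ell$ also denote the Nemytskii operators $(Av)(t)=A(t)v(t)$, $A:L^p(0,T;V)\to L^q(0,T;V^* )$ and $(A_\ell v)(t)=A_\ell(t)v(t)$, $A_\ell:L^p(0,T;V_\ell)\to L^q(0,T;V_\ell^* )$. (A4) Source term. $f\in L^q(0,T;V^* )$ and there are $f_\ell\in L^q(0,T;V_\ell^* )$, $\ell\in\{1,\dots,s\}$, with $\sum_{\ell=1}^sf_\ell(t)=f(t)$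 in $V^*$ and $\|f_\ell(t)\|_{V_\ell^*}\le\|f(t)\|_{V^*}$ for a.e. $t\in(0,T)$. Solution space. $\mathcal{W}^p(0,T)=\{v\in L^p(0,T;V): v'\in L^q(0,T;V^* )\}$ ($v'$ the weak derivative), which embeds into $C([0,T];H)$; pointwise values refer to the continuous representative. The problem $u'+Au=f$, $u(0)=u_0$ has a unique solution in $\mathcal{W}^p(0,T)$ (known). Sum splitting scheme. For $N\in\mathbb{N}$ let $k=T/N$, $t_n=nk$, $\mathbf{A}_\ell^n=A_\ell(t_n)$, $\mathbf{f}_\ell^n=\frac1k\int_{t_{n-1}}^{t_n}f_\ell(t)\,\mathrm{d}t$. With $\mathbf{U}^0=u_0$, the elements $\mathbf{U}_\ell^n\in V_\ell$ and $\mathbf{U}^n\in H$, $n\in\{1,\dots,N\}$, are given by $$\frac{\mathbf{U}_\ell^n-\mathbf{U}^{n-1}}{k}+s\mathbf{A}_\ell^n\mathbf{U}_\ell^n=s\mathbf{f}_\ell^n\ \text{ in }V_\ell^*,\ \ell\in\{1,\dots,s\},\qquad \mathbf{U}^n=\frac1s\sum_{\ell=1}^s\mathbf{U}_\ell^n\ \text{ in }H$$ (this recursion is uniquely solvable). Prolongations. For $t\in(t_{n-1},t_n]$, $n\in\{1,\dots,N\}$: $U_\ell^k(t)=\mathbf{U}_\ell^n$ and $U^k(t)=\mathbf{U}^n$; moreover $U_\ell^k(0)=U^k(0)=u_0$. *)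

theory Defs
  imports "HOL-Analysis.Analysis" "HOL-Library.Function_Algebras"
begin

text \<open>
  All the spaces \<open>V\<close>, \<open>V\<^sub>1, \<dots>, V\<^sub>s\<close> are linear subspaces of one Hilbert space and each carries its own
  norm, so a normed space is represented by a carrier set \<open>X\<close> in a real vector space together with a
  norm function \<open>n\<close> that is meaningful on \<open>X\<close> only. Functionals on \<open>X\<close> are functions that vanish
  outside \<open>X\<close>; hence dual spaces are again carrier sets in a (function) vector space, equality in
  the dual space is equality of functions, and the same notions apply to a space, its dual and its
  bidual.
\<close>

instantiation "fun" :: (type, real_vector) real_vector
begin

definition "c *\<^sub>R f = (\<lambda>x. c *\<^sub>R f x)"

instance
  by standard (simp_all add: scaleR_fun_def fun_eq_iff scaleR_add_right scaleR_add_left)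

end


section \<open>Normed spaces with explicit carrier\<close>

definition seminorm_on :: "'a::real_vector set \<Rightarrow> ('a \<Rightarrow> real) \<Rightarrow> bool" where
  "seminorm_on X n \<longleftrightarrow>
     (\<forall>x\<in>X. 0 \<le> n x) \<and>
     (\<forall>x\<in>X. \<forall>y\<in>X. n (x + y) \<le> n x + n y) \<and>
     (\<forall>c. \<forall>x\<in>X. n (c *\<^sub>R x) = \<bar>c\<bar> * n x)"

definition normed_on :: "'a::real_vector set \<Rightarrow> ('a \<Rightarrow> real) \<Rightarrow> bool" where
  "normed_on X n \<longleftrightarrow> subspace X \<and> seminorm_on X n \<and> (\<forall>x\<in>X. n x = 0 \<longrightarrow> x = 0)"

definition banach_on :: "'a::real_vector set \<Rightarrow> ('a \<Rightarrow> real) \<Rightarrow> bool" where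
  "banach_on X n \<longleftrightarrow> normed_on X n \<and>
     (\<forall>\<sigma> :: nat \<Rightarrow> 'a.
        range \<sigma> \<subseteq> X \<and> (\<forall>e>0. \<exists>K. \<forall>i\<ge>K. \<forall>j\<ge>K. n (\<sigma> i - \<sigma> j) < e) \<longrightarrow>
        (\<exists>x\<in>X. (\<lambda>i. n (\<sigma> i - x)) \<longlonglongrightarrow> 0))"

definition separable_on :: "'a::real_vector set \<Rightarrow> ('a \<Rightarrow> real) \<Rightarrow> bool" where
  "separable_on X n \<longleftrightarrow>
     (\<exists>D\<subseteq>X. countable D \<and> (\<forall>x\<in>X. \<forall>e>0. \<exists>d\<in>D. n (x - d) < e))"

definition dual_space :: "'a::real_vector set \<Rightarrow> ('a \<Rightarrow> real) \<Rightarrow> ('a \<Rightarrow> real) set" where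
  "dual_space X n = {\<phi>.
     (\<forall>x\<in>X. \<forall>y\<in>X. \<phi> (x + y) = \<phi> x + \<phi> y) \<and>
     (\<forall>c. \<forall>x\<in>X. \<phi> (c *\<^sub>R x) = c * \<phi> x) \<and>
     (\<exists>C. \<forall>x\<in>X. \<bar>\<phi> x\<bar> \<le> C * n x) \<and>
     (\<forall>x. x \<notin> X \<longrightarrow> \<phi> x = 0)}"

definition dual_norm :: "'a::real_vector set \<Rightarrow> ('a \<Rightarrow> real) \<Rightarrow> ('a \<Rightarrow> real) \<Rightarrow> real" where
  "dual_norm X n \<phi> = (SUP x\<in>{x\<in>X. n x \<le> 1}. \<bar>\<phi> x\<bar>)"

text \<open>Surjectivity of the canonical map from \<open>X\<close> into its bidual.\<close>

definition reflexive_on :: "'a::real_vector set \<Rightarrow> ('a \<Rightarrow> real) \<Rightarrow> bool" where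
  "reflexive_on X n \<longleftrightarrow>
     (\<forall>\<Phi>\<in>dual_space (dual_space X n) (dual_norm X n).
        \<exists>x\<in>X. \<forall>\<phi>\<in>dual_space X n. \<Phi> \<phi> = \<phi> x)"

definition equivalent_on :: "'a set \<Rightarrow> ('a \<Rightarrow> real) \<Rightarrow> ('a \<Rightarrow> real) \<Rightarrow> bool" where
  "equivalent_on X n m \<longleftrightarrow>
     (\<exists>c>0. \<exists>C>0. \<forall>x\<in>X. c * n x \<le> m x \<and> m x \<le> C * n x)"

text \<open>A reflexive Banach space \<open>X\<close> continuously and densely embedded in the Hilbert space \<open>'h\<close>,
  with a seminorm \<open>sn\<close> that together with the Hilbert space norm dominates the norm of \<open>X\<close>.\<close>

definition gelfand_space ::
  "'h::real_inner set \<Rightarrow> ('h \<Rightarrow> real) \<Rightarrow> ('h \<Rightarrow> real) \<Rightarrow> bool" where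
  "gelfand_space X n sn \<longleftrightarrow>
     banach_on X n \<and> reflexive_on X n \<and>
     (\<exists>C. \<forall>x\<in>X. norm x \<le> C * n x) \<and> closure X = UNIV \<and>
     seminorm_on X sn \<and> (\<exists>c>0. \<forall>x\<in>X. n x \<le> c * (norm x + sn x))"

text \<open>The embedding of \<open>'h\<close>, identified with its dual, into the dual of \<open>X\<close>.\<close>

definition gelfand_emb :: "'h::real_inner set \<Rightarrow> 'h \<Rightarrow> ('h \<Rightarrow> real)" where
  "gelfand_emb X h = (\<lambda>w. if w \<in> X then inner h w else 0)"

definition space_decomposition ::
  "nat \<Rightarrow> 'h::real_inner set \<Rightarrow> ('h \<Rightarrow> real) \<Rightarrow> ('h \<Rightarrow> real) \<Rightarrow>
   (nat \<Rightarrow> 'h set) \<Rightarrow> (nat \<Rightarrow> 'h \<Rightarrow> real) \<Rightarrow> (nat \<Rightarrow> 'h \<Rightarrow> real) \<Rightarrow> bool" where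
  "space_decomposition s V nV sV Vl nl sl \<longleftrightarrow>
     gelfand_space V nV sV \<and> separable_on V nV \<and>
     (\<forall>l\<in>{1..s}. gelfand_space (Vl l) (nl l) (sl l)) \<and>
     (\<Inter>l\<in>{1..s}. Vl l) = V \<and>
     equivalent_on V (\<lambda>v. \<Sum>l=1..s. nl l v) nV \<and>
     equivalent_on V (\<lambda>v. \<Sum>l=1..s. sl l v) sV"


section \<open>Bochner integral and Bochner spaces\<close>

text \<open>
  The Bochner integral of the library needs a separable Banach space that is a type; the
  following repeats its definition relative to a carrier. Functions are representatives of classes
  modulo null sets, and need to take values in the carrier almost everywhere only.
\<close>

definition simple_on :: "real measure \<Rightarrow> 'a set \<Rightarrow> (real \<Rightarrow> 'a) \<Rightarrow> bool" where
  "simple_on M X \<sigma> \<longleftrightarrow> simple_function M \<sigma> \<and> \<sigma> ` space M \<subseteq> X"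

definition strongly_measurable_on ::
  "real measure \<Rightarrow> 'a::real_vector set \<Rightarrow> ('a \<Rightarrow> real) \<Rightarrow> (real \<Rightarrow> 'a) \<Rightarrow> bool" where
  "strongly_measurable_on M X n g \<longleftrightarrow>
     (\<exists>\<sigma> :: nat \<Rightarrow> real \<Rightarrow> 'a. (\<forall>i. simple_on M X (\<sigma> i)) \<and>
        (AE t in M. g t \<in> X \<and> (\<lambda>i. n (\<sigma> i t - g t)) \<longlonglongrightarrow> 0))"

definition has_bochner_integral_on ::
  "real measure \<Rightarrow> 'a::real_vector set \<Rightarrow> ('a \<Rightarrow> real) \<Rightarrow> (real \<Rightarrow> 'a) \<Rightarrow> 'a \<Rightarrow> bool" where
  "has_bochner_integral_on M X n g I \<longleftrightarrow>
     I \<in> X \<and> strongly_measurable_on M X n g \<and>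
     (\<exists>\<sigma> :: nat \<Rightarrow> real \<Rightarrow> 'a. (\<forall>i. simple_on M X (\<sigma> i)) \<and>
        (\<lambda>i. \<integral>\<^sup>+ t. ennreal (n (g t - \<sigma> i t)) \<partial>M) \<longlonglongrightarrow> 0 \<and>
        (\<lambda>i. n (Bochner_Integration.simple_bochner_integral M (\<sigma> i) - I)) \<longlonglongrightarrow> 0)"

definition bochner_integral_on ::
  "real measure \<Rightarrow> 'a::real_vector set \<Rightarrow> ('a \<Rightarrow> real) \<Rightarrow> (real \<Rightarrow> 'a) \<Rightarrow> 'a" where
  "bochner_integral_on M X n g = (THE I. has_bochner_integral_on M X n g I)"

text \<open>\<open>Lp_space T p X n\<close> is \<open>L\<^sup>p(0,T;X)\<close>.\<close>

definition Lp_space ::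
  "real \<Rightarrow> real \<Rightarrow> 'a::real_vector set \<Rightarrow> ('a \<Rightarrow> real) \<Rightarrow> (real \<Rightarrow> 'a) set" where
  "Lp_space T p X n = {g.
     strongly_measurable_on (lebesgue_on {0<..<T}) X n g \<and>
     integrable (lebesgue_on {0<..<T}) (\<lambda>t. n (g t) powr p)}"

definition Lp_norm :: "real \<Rightarrow> real \<Rightarrow> ('a \<Rightarrow> real) \<Rightarrow> (real \<Rightarrow> 'a) \<Rightarrow> real" where
  "Lp_norm T p n g = (\<integral>t. n (g t) powr p \<partial>(lebesgue_on {0<..<T})) powr (1 / p)"

definition test_functions :: "real \<Rightarrow> (real \<Rightarrow> real) set" where
  "test_functions T = {\<phi>.
     (\<forall>m x. ((deriv ^^ m) \<phi>) differentiable (at x)) \<and>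
     compact (closure {t. \<phi> t \<noteq> 0}) \<and> closure {t. \<phi> t \<noteq> 0} \<subseteq> {0<..<T}}"

text \<open>\<open>g\<close>, with values in the dual of \<open>V\<close>, is the weak derivative of \<open>v\<close>, with values in \<open>V\<close>.\<close>

definition weak_derivative ::
  "real \<Rightarrow> 'h::real_inner set \<Rightarrow> ('h \<Rightarrow> real) \<Rightarrow> (real \<Rightarrow> 'h) \<Rightarrow> (real \<Rightarrow> 'h \<Rightarrow> real) \<Rightarrow> bool" where
  "weak_derivative T V nV v g \<longleftrightarrow>
     (\<forall>\<phi>\<in>test_functions T.
        bochner_integral_on (lebesgue_on {0<..<T}) (dual_space V nV) (dual_norm V nV)
          (\<lambda>t. deriv \<phi> t *\<^sub>R gelfand_emb V (v t)) =
        - bochner_integral_on (lebesgue_on {0<..<T}) (dual_space V nV) (dual_norm V nV)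
          (\<lambda>t. \<phi> t *\<^sub>R g t))"


section \<open>Operators, source terms and the evolution equation\<close>

text \<open>\<open>A t v w\<close> is the duality pairing of \<open>A(t)v\<close>, an element of the dual of \<open>X\<close>, with \<open>w\<close>.\<close>

definition operator_family ::
  "real \<Rightarrow> real \<Rightarrow> real \<Rightarrow> real \<Rightarrow> real \<Rightarrow> real \<Rightarrow>
   'h::real_inner set \<Rightarrow> ('h \<Rightarrow> real) \<Rightarrow> ('h \<Rightarrow> real) \<Rightarrow> (real \<Rightarrow> 'h \<Rightarrow> 'h \<Rightarrow> real) \<Rightarrow> bool" where
  "operator_family T p \<beta> \<eta> lam \<mu> X n sn A \<longleftrightarrow>
     (\<forall>t\<in>{0..T}. \<forall>v\<in>X. A t v \<in> dual_space X n) \<and>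
     (\<forall>v\<in>X. \<forall>t\<in>{0..T}.
        ((\<lambda>r. dual_norm X n (A r v - A t v)) \<longlongrightarrow> 0) (at t within {0..T})) \<and>
     (\<forall>t\<in>{0..T}. \<forall>u\<in>X. \<forall>v\<in>X. \<forall>w\<in>X.
        continuous_on {0..1} (\<lambda>\<tau>::real. A t (u + \<tau> *\<^sub>R v) w)) \<and>
     (\<forall>t\<in>{0..T}. \<forall>v\<in>X. \<forall>w\<in>X. (A t v - A t w) (v - w) \<ge> \<eta> * sn (v - w) powr p) \<and>
     (\<forall>t\<in>{0..T}. \<forall>v\<in>X. dual_norm X n (A t v) \<le> \<beta> * (1 + n v powr (p - 1))) \<and>
     (\<forall>t\<in>{0..T}. \<forall>v\<in>X. A t v v + lam \<ge> \<mu> * sn v powr p)"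

definition operator_decomposition ::
  "nat \<Rightarrow> real \<Rightarrow> 'h set \<Rightarrow>
   (real \<Rightarrow> 'h \<Rightarrow> 'h \<Rightarrow> real) \<Rightarrow> (nat \<Rightarrow> real \<Rightarrow> 'h \<Rightarrow> 'h \<Rightarrow> real) \<Rightarrow> bool" where
  "operator_decomposition s T V A Al \<longleftrightarrow>
     (\<forall>t\<in>{0..T}. \<forall>v\<in>V. \<forall>w\<in>V. (\<Sum>l=1..s. Al l t v w) = A t v w)"

definition source_decomposition ::
  "nat \<Rightarrow> real \<Rightarrow> real \<Rightarrow> 'h::real_inner set \<Rightarrow> ('h \<Rightarrow> real) \<Rightarrow> (nat \<Rightarrow> 'h set) \<Rightarrow>
   (nat \<Rightarrow> 'h \<Rightarrow> real) \<Rightarrow> (real \<Rightarrow> 'h \<Rightarrow> real) \<Rightarrow> (nat \<Rightarrow> real \<Rightarrow> 'h \<Rightarrow> real) \<Rightarrow> bool" where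
  "source_decomposition s T q V nV Vl nl f fl \<longleftrightarrow>
     f \<in> Lp_space T q (dual_space V nV) (dual_norm V nV) \<and>
     (\<forall>l\<in>{1..s}. fl l \<in> Lp_space T q (dual_space (Vl l) (nl l)) (dual_norm (Vl l) (nl l))) \<and>
     (AE t in lebesgue_on {0<..<T}.
        (\<forall>w\<in>V. (\<Sum>l=1..s. fl l t w) = f t w) \<and>
        (\<forall>l\<in>{1..s}. dual_norm (Vl l) (nl l) (fl l t) \<le> dual_norm V nV (f t)))"

text \<open>\<open>Wp_space T p V nV\<close> is \<open>W\<^sup>p(0,T)\<close>.\<close>

definition Wp_space :: "real \<Rightarrow> real \<Rightarrow> 'h::real_inner set \<Rightarrow> ('h \<Rightarrow> real) \<Rightarrow> (real \<Rightarrow> 'h) set" where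
  "Wp_space T p V nV = {v\<in>Lp_space T p V nV.
     \<exists>g\<in>Lp_space T (p / (p - 1)) (dual_space V nV) (dual_norm V nV). weak_derivative T V nV v g}"

text \<open>The function \<open>u\<close> is the representative that is continuous on \<open>[0,T]\<close> with values in \<open>'h\<close>.\<close>

definition evolution_solution ::
  "real \<Rightarrow> real \<Rightarrow> 'h::real_inner set \<Rightarrow> ('h \<Rightarrow> real) \<Rightarrow> (real \<Rightarrow> 'h \<Rightarrow> 'h \<Rightarrow> real) \<Rightarrow>
   (real \<Rightarrow> 'h \<Rightarrow> real) \<Rightarrow> 'h \<Rightarrow> (real \<Rightarrow> 'h) \<Rightarrow> bool" where
  "evolution_solution T p V nV A f u0 u \<longleftrightarrow>
     u \<in> Wp_space T p V nV \<and> continuous_on {0..T} u \<and> u 0 = u0 \<and>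
     (\<exists>u'\<in>Lp_space T (p / (p - 1)) (dual_space V nV) (dual_norm V nV).
        weak_derivative T V nV u u' \<and>
        (AE t in lebesgue_on {0<..<T}. u' t + A t (u t) = f t))"


section \<open>The sum splitting scheme\<close>

definition source_mean ::
  "real \<Rightarrow> 'h::real_inner set \<Rightarrow> ('h \<Rightarrow> real) \<Rightarrow> (real \<Rightarrow> 'h \<Rightarrow> real) \<Rightarrow> nat \<Rightarrow> 'h \<Rightarrow> real" where
  "source_mean k X n g i = (1 / k) *\<^sub>R
     bochner_integral_on (lebesgue_on {(real i - 1) * k<..<real i * k})
       (dual_space X n) (dual_norm X n) g"

definition sum_splitting ::
  "nat \<Rightarrow> real \<Rightarrow> nat \<Rightarrow> (nat \<Rightarrow> 'h::real_inner set) \<Rightarrow> (nat \<Rightarrow> 'h \<Rightarrow> real) \<Rightarrow>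
   (nat \<Rightarrow> real \<Rightarrow> 'h \<Rightarrow> 'h \<Rightarrow> real) \<Rightarrow> (nat \<Rightarrow> real \<Rightarrow> 'h \<Rightarrow> real) \<Rightarrow> 'h \<Rightarrow>
   (nat \<Rightarrow> 'h) \<Rightarrow> (nat \<Rightarrow> nat \<Rightarrow> 'h) \<Rightarrow> bool" where
  "sum_splitting s T N Vl nl Al fl u0 U Ul \<longleftrightarrow>
     (let k = T / real N in
       U 0 = u0 \<and>
       (\<forall>n\<in>{1..N}.
          (\<forall>l\<in>{1..s}. Ul l n \<in> Vl l \<and>
             gelfand_emb (Vl l) ((1 / k) *\<^sub>R (Ul l n - U (n - 1)))
               + real s *\<^sub>R Al l (real n * k) (Ul l n)
             = real s *\<^sub>R source_mean k (Vl l) (nl l) (fl l) n) \<and>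
          U n = (1 / real s) *\<^sub>R (\<Sum>l=1..s. Ul l n)))"

definition prolongation :: "real \<Rightarrow> nat \<Rightarrow> 'h \<Rightarrow> (nat \<Rightarrow> 'h) \<Rightarrow> real \<Rightarrow> 'h" where
  "prolongation T N u0 W t =
     (if t = 0 then u0
      else W (THE n. n \<in> {1..N} \<and> t \<in> {(real n - 1) * (T / real N)<..real n * (T / real N)}))"

definition converges_Lp ::
  "real \<Rightarrow> real \<Rightarrow> 'a::real_vector set \<Rightarrow> ('a \<Rightarrow> real) \<Rightarrow> (nat \<Rightarrow> real \<Rightarrow> 'a) \<Rightarrow> (real \<Rightarrow> 'a) \<Rightarrow> bool"
  where
  "converges_Lp T p X n W w \<longleftrightarrow>
     (\<forall>N\<ge>1. W N \<in> Lp_space T p X n) \<and> w \<in> Lp_space T p X n \<and>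
     (\<lambda>N. Lp_norm T p n (\<lambda>t. W N t - w t)) \<longlonglongrightarrow> 0"

end

theory Submission
  imports Defs
begin

text \<open>
  Convergence is shown by comparing \<open>U\<^sup>n\<close> with \<open>v(t\<^sub>n)\<close>, where \<open>v(t)\<close> is the mean of the solution \<open>u\<close>
  over a short window near \<open>t\<close>. Unlike \<open>u\<close>, the function \<open>v\<close> has a derivative \<open>w\<close> in \<open>H\<close>, and on
  \<open>V\<close> this derivative is the sum of the window means \<open>G\<^sub>l\<close> of \<open>f\<^sub>l - A\<^sub>l u\<close>. In the energy identity for
  \<open>U\<^sup>n - v(t\<^sub>n)\<close> monotonicity and Young's inequality take care of every term except the functional
  \<open>\<Sum>\<^sub>l (G\<^sub>l - w/s)\<close> applied to the stages \<open>U\<^sub>l\<^sup>n\<close>. That functional cancels when all stages coincide in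
  \<open>V\<close>, so by an Ehrling type inequality it is small up to a multiple of the \<open>H\<close>-distance of the stages,
  which the a priori bound of the scheme controls. This gives uniform convergence at the grid points;
  for \<open>\<eta> > 0\<close> the monotonicity term then bounds the errors of the stages in \<open>L\<^sup>p(0,T;V\<^sub>l)\<close>.
\<close>

section \<open>Norms and duals on a carrier\<close>

text \<open>A stage lies in its own space \<open>Vl l\<close> only, whereas the derivative of
  \<open>u\<close> is a functional on \<open>V\<close> and comes without a splitting into
  functionals on the spaces \<open>Vl l\<close>, so it cannot be tested with the stages. A
  derivative in \<open>H\<close> can, and it splits evenly into \<open>w / s\<close>. The price is
  the mismatch between \<open>w / s\<close> and the means \<open>G\<^sub>l\<close>, which does not
  shrink with the windows; it cancels only in the sum and only on equal arguments. This dictates the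
  order of the choices. The weight in Young's inequality comes first, then the window length, which
  fixes the functionals and with them the Ehrling constant. That constant may be huge, but it is
  fixed before the step size: the squared distances of the stages from the preceding value of the
  scheme have a sum bounded independently of the step size, so their integral over time vanishes
  with the step. Hahn-Banach, weak compactness, Pettis' theorem and the Bochner integral are
  developed on carriers, because the spaces are subsets of one type with different norms.\<close>

context
  fixes X :: "'a::real_vector set" and n :: "'a \<Rightarrow> real"
  assumes normed: "normed_on X n"
begin

lemma carrier_subspace: "subspace X"
  using normed by (simp add: normed_on_def)

lemma carrier_0: "0 \<in> X"
  and carrier_add: "x \<in> X \<Longrightarrow> y \<in> X \<Longrightarrow> x + y \<in> X"
  and carrier_diff: "x \<in> X \<Longrightarrow> y \<in> X \<Longrightarrow> x - y \<in> X"
  and carrier_scale: "x \<in> X \<Longrightarrow> c *\<^sub>R x \<in> X"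
  and carrier_minus: "x \<in> X \<Longrightarrow> - x \<in> X"
  using carrier_subspace
  by (auto intro: subspace_0 subspace_add subspace_diff subspace_scale subspace_neg)

lemma carrier_norm_nonneg: "x \<in> X \<Longrightarrow> 0 \<le> n x"
  and carrier_norm_add: "x \<in> X \<Longrightarrow> y \<in> X \<Longrightarrow> n (x + y) \<le> n x + n y"
  and carrier_norm_scale: "x \<in> X \<Longrightarrow> n (c *\<^sub>R x) = \<bar>c\<bar> * n x"
  and carrier_norm_eq_0: "x \<in> X \<Longrightarrow> n x = 0 \<Longrightarrow> x = 0"
  using normed by (auto simp: normed_on_def seminorm_on_def)

lemma carrier_norm_0: "n 0 = 0"
  using carrier_norm_scale[OF carrier_0, of 0] by simp

lemma carrier_norm_minus: "x \<in> X \<Longrightarrow> n (- x) = n x"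
  using carrier_norm_scale[of x "-1"] by simp

lemma carrier_norm_diff: "x \<in> X \<Longrightarrow> y \<in> X \<Longrightarrow> n (x - y) \<le> n x + n y"
  using carrier_norm_add[of x "- y"] carrier_minus[of y] carrier_norm_minus[of y] by simp

lemma carrier_norm_commute: "x \<in> X \<Longrightarrow> y \<in> X \<Longrightarrow> n (x - y) = n (y - x)"
  using carrier_norm_minus[OF carrier_diff[of x y]] by simp

lemma carrier_norm_triangle:
  "x \<in> X \<Longrightarrow> y \<in> X \<Longrightarrow> z \<in> X \<Longrightarrow> n (x - z) \<le> n (x - y) + n (y - z)"
  using carrier_norm_add[OF carrier_diff[of x y] carrier_diff[of y z]] by simp

lemma carrier_norm_diff_abs: "x \<in> X \<Longrightarrow> y \<in> X \<Longrightarrow> \<bar>n x - n y\<bar> \<le> n (x - y)"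
  using carrier_norm_add[OF carrier_diff[of x y], of y] carrier_norm_add[OF carrier_diff[of y x], of x]
    carrier_norm_commute[of x y] by auto

lemma dual_spaceI:
  assumes "\<And>x y. x \<in> X \<Longrightarrow> y \<in> X \<Longrightarrow> \<phi> (x + y) = \<phi> x + \<phi> y"
    and "\<And>c x. x \<in> X \<Longrightarrow> \<phi> (c *\<^sub>R x) = c * \<phi> x"
    and "\<And>x. x \<in> X \<Longrightarrow> \<bar>\<phi> x\<bar> \<le> C * n x"
    and "\<And>x. x \<notin> X \<Longrightarrow> \<phi> x = 0"
  shows "\<phi> \<in> dual_space X n"
  using assms unfolding dual_space_def by blast

context
  fixes \<phi> :: "'a \<Rightarrow> real"
  assumes dual: "\<phi> \<in> dual_space X n"
begin

lemma dual_add: "x \<in> X \<Longrightarrow> y \<in> X \<Longrightarrow> \<phi> (x + y) = \<phi> x + \<phi> y"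
  and dual_scale: "x \<in> X \<Longrightarrow> \<phi> (c *\<^sub>R x) = c * \<phi> x"
  and dual_outside: "x \<notin> X \<Longrightarrow> \<phi> x = 0"
  using dual by (auto simp: dual_space_def)

lemma dual_minus: "x \<in> X \<Longrightarrow> \<phi> (- x) = - \<phi> x"
  using dual_scale[of x "-1"] by simp

lemma dual_diff: "x \<in> X \<Longrightarrow> y \<in> X \<Longrightarrow> \<phi> (x - y) = \<phi> x - \<phi> y"
  using dual_add[of x "- y"] dual_minus[of y] carrier_minus by simp

lemma dual_bdd: "bdd_above ((\<lambda>x. \<bar>\<phi> x\<bar>) ` {x\<in>X. n x \<le> 1})"
proof -
  obtain C where C: "\<forall>x\<in>X. \<bar>\<phi> x\<bar> \<le> C * n x"
    using dual by (auto simp: dual_space_def)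
  have "\<bar>\<phi> x\<bar> \<le> \<bar>C\<bar>" if "x \<in> X" "n x \<le> 1" for x
  proof -
    have "C * n x \<le> \<bar>C\<bar> * 1"
      using carrier_norm_nonneg[OF that(1)] that by (intro mult_mono) auto
    with C that show ?thesis by force
  qed
  then show ?thesis by (intro bdd_aboveI2[where M="\<bar>C\<bar>"]) auto
qed

lemma dual_bound: assumes x: "x \<in> X" shows "\<bar>\<phi> x\<bar> \<le> dual_norm X n \<phi> * n x"
proof (cases "n x = 0")
  case True
  then have "x = 0" using carrier_norm_eq_0 x by simp
  then have "\<phi> x = 0" using dual_scale[OF carrier_0, of 0] by simp
  then show ?thesis using True by simp
next
  case False
  then have pos: "n x > 0" using carrier_norm_nonneg[OF x] by simp
  let ?y = "(1 / n x) *\<^sub>R x"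
  have "n ?y = 1" using carrier_norm_scale[OF x] pos by simp
  then have "\<bar>\<phi> ?y\<bar> \<le> dual_norm X n \<phi>"
    unfolding dual_norm_def using carrier_scale[OF x]
    by (intro cSUP_upper dual_bdd) auto
  then show ?thesis using dual_scale[OF x] pos by (simp add: abs_mult field_simps)
qed

lemma dual_norm_nonneg: "0 \<le> dual_norm X n \<phi>"
proof -
  have "\<bar>\<phi> 0\<bar> \<le> dual_norm X n \<phi>"
    unfolding dual_norm_def using carrier_0 carrier_norm_0 by (intro cSUP_upper dual_bdd) auto
  then show ?thesis by linarith
qed

end

lemma dual_norm_leI:
  assumes "\<And>x. x \<in> X \<Longrightarrow> \<bar>\<phi> x\<bar> \<le> C * n x" "C \<ge> 0"
  shows "dual_norm X n \<phi> \<le> C"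
  unfolding dual_norm_def
proof (rule cSUP_least)
  show "{x \<in> X. n x \<le> 1} \<noteq> {}" using carrier_0 carrier_norm_0 by auto
next
  fix x assume "x \<in> {x \<in> X. n x \<le> 1}"
  then have x: "x \<in> X" "n x \<le> 1" by auto
  have "C * n x \<le> C * 1" using x assms by (intro mult_left_mono) auto
  then show "\<bar>\<phi> x\<bar> \<le> C" using assms(1)[OF x(1)] by linarith
qed

text \<open>Makes the dual an instance of the same notion, so that the facts on carriers apply to
  functionals, to time-dependent functionals and to the bidual.\<close>

lemma normed_on_dual: "normed_on (dual_space X n) (dual_norm X n)"
proof -
  have add: "\<phi> + \<psi> \<in> dual_space X n" "dual_norm X n (\<phi> + \<psi>) \<le> dual_norm X n \<phi> + dual_norm X n \<psi>"
    if a: "\<phi> \<in> dual_space X n" and b: "\<psi> \<in> dual_space X n" for \<phi> \<psi>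
  proof -
    have bd: "\<bar>(\<phi> + \<psi>) x\<bar> \<le> (dual_norm X n \<phi> + dual_norm X n \<psi>) * n x" if "x \<in> X" for x
      using dual_bound[OF a that] dual_bound[OF b that] by (simp add: distrib_right)
    show "\<phi> + \<psi> \<in> dual_space X n"
      by (rule dual_spaceI[OF _ _ bd])
        (auto simp: dual_add[OF a] dual_add[OF b] dual_scale[OF a] dual_scale[OF b] algebra_simps
          dual_outside[OF a] dual_outside[OF b])
    show "dual_norm X n (\<phi> + \<psi>) \<le> dual_norm X n \<phi> + dual_norm X n \<psi>"
      by (rule dual_norm_leI[OF bd]) (use dual_norm_nonneg[OF a] dual_norm_nonneg[OF b] in linarith)+
  qed
  have scale_le: "c *\<^sub>R \<phi> \<in> dual_space X n" "dual_norm X n (c *\<^sub>R \<phi>) \<le> \<bar>c\<bar> * dual_norm X n \<phi>"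
    if a: "\<phi> \<in> dual_space X n" for c \<phi>
  proof -
    have bd: "\<bar>(c *\<^sub>R \<phi>) x\<bar> \<le> (\<bar>c\<bar> * dual_norm X n \<phi>) * n x" if "x \<in> X" for x
      using mult_left_mono[OF dual_bound[OF a that], of "\<bar>c\<bar>"]
      by (simp add: scaleR_fun_def abs_mult mult.assoc)
    show "c *\<^sub>R \<phi> \<in> dual_space X n"
      by (rule dual_spaceI[OF _ _ bd])
        (auto simp: scaleR_fun_def dual_add[OF a] dual_scale[OF a] algebra_simps dual_outside[OF a])
    show "dual_norm X n (c *\<^sub>R \<phi>) \<le> \<bar>c\<bar> * dual_norm X n \<phi>"
      using dual_norm_leI[OF bd] dual_norm_nonneg[OF a] by simp
  qed
  have zero: "0 \<in> dual_space X n"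
    by (rule dual_spaceI[where C=0]) auto
  have scale: "dual_norm X n (c *\<^sub>R \<phi>) = \<bar>c\<bar> * dual_norm X n \<phi>"
    if a: "\<phi> \<in> dual_space X n" for c \<phi>
  proof (cases "c = 0")
    case True
    then show ?thesis
      using scale_le(2)[OF a, of 0] dual_norm_nonneg[OF scale_le(1)[OF a, of 0]] by simp
  next
    case False
    have "dual_norm X n ((1/c) *\<^sub>R (c *\<^sub>R \<phi>)) \<le> \<bar>1/c\<bar> * dual_norm X n (c *\<^sub>R \<phi>)"
      by (rule scale_le(2)[OF scale_le(1)[OF a]])
    then have "\<bar>c\<bar> * dual_norm X n \<phi> \<le> dual_norm X n (c *\<^sub>R \<phi>)"
      using False by (simp add: field_simps)
    then show ?thesis using scale_le(2)[OF a, of c] by simp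
  qed
  have "\<phi> = 0" if a: "\<phi> \<in> dual_space X n" and z: "dual_norm X n \<phi> = 0" for \<phi>
  proof
    fix x show "\<phi> x = 0 x"
      using dual_bound[OF a, of x] z dual_outside[OF a, of x] by (cases "x \<in> X") auto
  qed
  then show ?thesis
    unfolding normed_on_def seminorm_on_def subspace_def
    by (intro conjI ballI allI impI add scale_le scale zero dual_norm_nonneg)
qed

end

section \<open>The Hahn-Banach theorem and reflexivity\<close>

definition sublinear_on :: "'a::real_vector set \<Rightarrow> ('a \<Rightarrow> real) \<Rightarrow> bool" where
  "sublinear_on X q \<longleftrightarrow> (\<forall>x\<in>X. \<forall>y\<in>X. q (x + y) \<le> q x + q y) \<and>
     (\<forall>c\<ge>0. \<forall>x\<in>X. q (c *\<^sub>R x) = c * q x)"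

lemma sublinear_on_0: "subspace X \<Longrightarrow> sublinear_on X q \<Longrightarrow> q 0 = 0"
  unfolding sublinear_on_def by (metis mult_zero_left order_refl scaleR_zero_left subspace_0)

lemma sublinear_on_lower:
  assumes X: "subspace X" and q: "sublinear_on X q" and x: "x \<in> X"
  shows "- q (- x) \<le> q x"
proof -
  have "q (x + (- x)) \<le> q x + q (- x)"
    using q x subspace_neg[OF X x] unfolding sublinear_on_def by blast
  then show ?thesis using sublinear_on_0[OF X q] by simp
qed

text \<open>The auxiliary function of the classical proof that minimal sublinear functions are
  linear. For sublinear \<open>q\<close> it is sublinear again, lies below \<open>q\<close>, and its
  value at \<open>- y\<close> is at most \<open>- q y\<close>.\<close>

definition ray_inf :: "('a::real_vector \<Rightarrow> real) \<Rightarrow> 'a \<Rightarrow> 'a \<Rightarrow> real" where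
  "ray_inf q y x = (INF t\<in>{0..}. q (x + t *\<^sub>R y) - t * q y)"

text \<open>The last two claims are the parameters \<open>t = 0\<close> and \<open>t = 1\<close> of
  the infimum. With \<open>x = - y\<close> the last one pins down the value in the direction of
  \<open>y\<close>, which is all that Hahn-Banach needs.\<close>

lemma sublinear_ray_inf:
  assumes X: "subspace X" and q: "sublinear_on X q" and y: "y \<in> X"
  shows "sublinear_on X (ray_inf q y)" and "\<And>x. x \<in> X \<Longrightarrow> ray_inf q y x \<le> q x"
    and "\<And>x. x \<in> X \<Longrightarrow> ray_inf q y x \<le> q (x + y) - q y"
proof -
  define r where "r = ray_inf q y"
  note r_def = r_def ray_inf_def
  have q1: "q (x + z) \<le> q x + q z" if "x \<in> X" "z \<in> X" for x z
    using q that unfolding sublinear_on_def by blast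
  have q2: "q (c *\<^sub>R x) = c * q x" if "x \<in> X" "c \<ge> 0" for x c
    using q that unfolding sublinear_on_def by blast
  have mem: "x + t *\<^sub>R y \<in> X" if "x \<in> X" for x t
    using X y that by (simp add: subspace_add subspace_scale)
  \<comment> \<open>A lower bound that does not depend on \<open>t\<close>, so that the infimum is
    finite.\<close>
  have low: "- q (- x) \<le> q (x + t *\<^sub>R y) - t * q y" if "x \<in> X" "t \<ge> 0" for x t
    using q1[OF mem[OF that(1), of t] subspace_neg[OF X that(1)]] q2[OF y that(2)] by simp
  have bdd: "bdd_below ((\<lambda>t. q (x + t *\<^sub>R y) - t * q y) ` {0..})" if "x \<in> X" for x
    using low[OF that] by (intro bdd_belowI2[where m="- q (- x)"]) auto
  have up: "r x \<le> q (x + t *\<^sub>R y) - t * q y" if "x \<in> X" "t \<ge> 0" for x t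
    unfolding r_def using that by (intro cINF_lower bdd) auto
  have ge: "a \<le> r x" if "\<And>t. t \<ge> 0 \<Longrightarrow> a \<le> q (x + t *\<^sub>R y) - t * q y" for a x
    unfolding r_def using that by (intro cINF_greatest) auto
  show "ray_inf q y x \<le> q x" if "x \<in> X" for x unfolding r_def(1)[symmetric] using up[OF that, of 0] by simp
  show "ray_inf q y x \<le> q (x + y) - q y" if "x \<in> X" for x unfolding r_def(1)[symmetric] using up[OF that, of 1] by simp
  have sub: "r (x + z) \<le> r x + r z" if "x \<in> X" "z \<in> X" for x z
  proof -
    have "r (x + z) \<le> (q (x + t *\<^sub>R y) - t * q y) + (q (z + t' *\<^sub>R y) - t' * q y)"
      if "t \<ge> 0" "t' \<ge> 0" for t t'
    proof -
      have "r (x + z) \<le> q (x + z + (t + t') *\<^sub>R y) - (t + t') * q y"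
        using up[of "x + z" "t + t'"] X \<open>x \<in> X\<close> \<open>z \<in> X\<close> that by (simp add: subspace_add)
      moreover have "q (x + z + (t + t') *\<^sub>R y) \<le> q (x + t *\<^sub>R y) + q (z + t' *\<^sub>R y)"
        using q1[OF mem[OF \<open>x \<in> X\<close>, of t] mem[OF \<open>z \<in> X\<close>, of t']] by (simp add: algebra_simps)
      ultimately show ?thesis by (simp add: algebra_simps)
    qed
    note * = this
    have "r (x + z) - (q (x + t *\<^sub>R y) - t * q y) \<le> r z" if t: "t \<ge> 0" for t
    proof (rule ge)
      fix t' :: real assume "0 \<le> t'"
      from *[OF t this] show "r (x + z) - (q (x + t *\<^sub>R y) - t * q y) \<le> q (z + t' *\<^sub>R y) - t' * q y"
        by linarith
    qed
    note ** = this
    have "r (x + z) - r z \<le> r x"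
    proof (rule ge)
      fix t :: real assume "0 \<le> t"
      from **[OF this] show "r (x + z) - r z \<le> q (x + t *\<^sub>R y) - t * q y" by linarith
    qed
    then show ?thesis by simp
  qed
  have r0: "r 0 = 0"
  proof -
    have "r 0 = (INF t\<in>{0::real..}. 0)" unfolding r_def using q2[OF y] by (intro INF_cong) auto
    then show ?thesis by simp
  qed
  \<comment> \<open>Replacing \<open>t\<close> by \<open>t / c\<close> gives one inequality for
    every positive \<open>c\<close>; applied to \<open>c *\<^sub>R x\<close> and
    \<open>1 / c\<close> it gives the converse.\<close>
  have half: "c * r x \<le> r (c *\<^sub>R x)" if "x \<in> X" "c > 0" for x c
  proof (rule ge)
    fix t :: real assume "t \<ge> 0"
    have "c * r x \<le> c * (q (x + (t / c) *\<^sub>R y) - t / c * q y)"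
      using up[OF that(1), of "t / c"] that \<open>t \<ge> 0\<close> by (intro mult_left_mono) auto
    also have "\<dots> = q (c *\<^sub>R (x + (t / c) *\<^sub>R y)) - t * q y"
      using q2[OF mem[OF that(1), of "t / c"], of c] that by (simp add: algebra_simps)
    also have "\<dots> = q (c *\<^sub>R x + t *\<^sub>R y) - t * q y"
      using that by (simp add: scaleR_add_right)
    finally show "c * r x \<le> q (c *\<^sub>R x + t *\<^sub>R y) - t * q y" .
  qed
  have "r (c *\<^sub>R x) = c * r x" if "x \<in> X" "c \<ge> 0" for x c
  proof (cases "c = 0")
    case False
    then have c: "c > 0" using that by simp
    have "(1 / c) * r (c *\<^sub>R x) \<le> r ((1 / c) *\<^sub>R (c *\<^sub>R x))"
      using half[of "c *\<^sub>R x" "1 / c"] c X that by (simp add: subspace_scale)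
    then show ?thesis using half[OF that(1) c] c by (simp add: field_simps)
  qed (simp add: r0)
  then show "sublinear_on X (ray_inf q y)" unfolding r_def(1)[symmetric] using sub unfolding sublinear_on_def by blast
qed

text \<open>Instead of extending a functional dimension by dimension, Zorn's lemma provides a
  minimal sublinear function below \<open>ray_inf P y\<close>, and minimality forces linearity.
  Starting from \<open>ray_inf P y\<close> rather than from \<open>P\<close> forces the value
  \<open>P y\<close> at \<open>y\<close>. The candidates vanish outside \<open>X\<close> because
  they are ordered as functions on the whole type.\<close>

lemma hahn_banach:
  assumes X: "subspace X" and P: "sublinear_on X P" and y: "y \<in> X"
  shows "\<exists>\<Lambda>. (\<forall>x\<in>X. \<forall>z\<in>X. \<Lambda> (x + z) = \<Lambda> x + \<Lambda> z) \<and> (\<forall>c. \<forall>x\<in>X. \<Lambda> (c *\<^sub>R x) = c * \<Lambda> x) \<and>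
    (\<forall>x\<in>X. \<Lambda> x \<le> P x) \<and> \<Lambda> y = P y \<and> (\<forall>x. x \<notin> X \<longrightarrow> \<Lambda> x = (0::real))"
proof -
  define P' where "P' = ray_inf P y"
  note P' = sublinear_ray_inf[OF X P y, folded P'_def]
  define S where "S = {q. sublinear_on X q \<and> (\<forall>x\<in>X. q x \<le> P' x) \<and> (\<forall>x. x \<notin> X \<longrightarrow> q x = (0::real))}"
  define res where "res = (\<lambda>(q::'a\<Rightarrow>real) x. if x \<in> X then q x else 0)"
  have res: "sublinear_on X (res q)" if "sublinear_on X q" for q
    using that X unfolding sublinear_on_def res_def by (auto simp: subspace_add subspace_scale)
  \<comment> \<open>The order is reversed for Zorn's lemma: its maximal element is a minimal
    sublinear function, and a chain is bounded by its pointwise infimum.\<close>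
  have "\<exists>m\<in>S. \<forall>a\<in>S. a \<le> m \<longrightarrow> a = m"
  proof (rule predicate_Zorn)
    show "partial_order_on S (relation_of (\<lambda>a b. b \<le> a) S)"
      by (rule partial_order_on_relation_ofI) auto
  next
    fix C assume C: "C \<in> Chains (relation_of (\<lambda>a b. b \<le> a) S)"
    then have CS: "C \<subseteq> S" and Ch: "\<And>a b. a \<in> C \<Longrightarrow> b \<in> C \<Longrightarrow> a \<le> b \<or> b \<le> a"
      unfolding Chains_def relation_of_def by auto
    show "\<exists>u\<in>S. \<forall>a\<in>C. u \<le> a"
    proof (cases "C = {}")
      case True
      have "res P' \<in> S" using res[OF P'(1)] by (auto simp: S_def res_def)
      then show ?thesis using True by auto
    next
      case False
      define u where "u = (\<lambda>x. INF q\<in>C. q x)"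
      have Cq: "sublinear_on X q" "\<And>x. x \<in> X \<Longrightarrow> q x \<le> P' x" "\<And>x. x \<notin> X \<Longrightarrow> q x = 0" if "q \<in> C" for q
        using CS that unfolding S_def by auto
      have bdd: "bdd_below ((\<lambda>q. q x) ` C)" for x
      proof (cases "x \<in> X")
        case True
        have "- P' (- x) \<le> q x" if "q \<in> C" for q
          using sublinear_on_lower[OF X Cq(1)[OF that] True] Cq(2)[OF that subspace_neg[OF X True]]
          by linarith
        then show ?thesis by (intro bdd_belowI2) auto
      next
        case x: False
        have "0 \<le> q x" if "q \<in> C" for q using Cq(3)[OF that x] by simp
        then show ?thesis by (rule bdd_belowI2)
      qed
      have up: "u x \<le> q x" if "q \<in> C" for q x
        unfolding u_def using that by (intro cINF_lower bdd) auto
      have ge: "a \<le> u x" if "\<And>q. q \<in> C \<Longrightarrow> a \<le> q x" for a x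
        unfolding u_def using that False by (intro cINF_greatest) auto
      have sub: "u (x + z) \<le> u x + u z" if xz: "x \<in> X" "z \<in> X" for x z
      proof -
        have *: "u (x + z) \<le> q x + q' z" if qq: "q \<in> C" "q' \<in> C" for q q'
        proof -
          have *: "u (x + z) \<le> q x + q z" if "q \<in> C" for q
            using up[OF that, of "x + z"] Cq(1)[OF that] xz unfolding sublinear_on_def by fastforce
          \<comment> \<open>Two members of a chain are comparable, so both may be replaced by the
            smaller one, for which subadditivity is available.\<close>
          consider "q x \<le> q' x" "q z \<le> q' z" | "q' x \<le> q x" "q' z \<le> q z"
            using Ch[OF qq] by (auto simp: le_fun_def)
          then show ?thesis using *[OF qq(1)] *[OF qq(2)] by cases linarith+
        qed
        have "u (x + z) - q x \<le> u z" if "q \<in> C" for q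
        proof (rule ge)
          fix q' assume "q' \<in> C"
          from *[OF that this] show "u (x + z) - q x \<le> q' z" by linarith
        qed
        then have "u (x + z) - u z \<le> u x"
          by (intro ge) (simp add: algebra_simps)
        then show ?thesis by simp
      qed
      have half: "c * u x \<le> u (c *\<^sub>R x)" if "x \<in> X" "c \<ge> 0" for x c
      proof (rule ge)
        fix q assume "q \<in> C"
        then show "c * u x \<le> q (c *\<^sub>R x)"
          using up[of q x] Cq(1)[of q] that unfolding sublinear_on_def
          by (auto intro: mult_left_mono)
      qed
      have u0: "u 0 = 0"
      proof -
        have "u 0 = (INF q\<in>C. 0)" unfolding u_def using sublinear_on_0[OF X Cq(1)] by (intro INF_cong) auto
        then show ?thesis using False by simp
      qed
      have "u (c *\<^sub>R x) = c * u x" if "x \<in> X" "c \<ge> 0" for x c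
      proof (cases "c = 0")
        case False
        then have c: "c > 0" using that by simp
        have "(1 / c) * u (c *\<^sub>R x) \<le> u ((1 / c) *\<^sub>R (c *\<^sub>R x))"
          using half[of "c *\<^sub>R x" "1 / c"] c X that by (simp add: subspace_scale)
        then show ?thesis using half[OF that] c by (simp add: field_simps)
      qed (simp add: u0)
      moreover obtain q0 where "q0 \<in> C" using False by auto
      moreover have "u x = 0" if "x \<notin> X" for x
      proof -
        have "u x = (INF q\<in>C. 0)" unfolding u_def using Cq(3)[OF _ that] by (intro INF_cong) auto
        then show ?thesis using False by simp
      qed
      ultimately have "u \<in> S"
        using sub order_trans[OF up[of q0] Cq(2)[of q0]] unfolding S_def sublinear_on_def by auto
      then show ?thesis using up by (auto simp: le_fun_def)
    qed
  qed
  then obtain m where m: "m \<in> S" and min: "\<And>a. a \<in> S \<Longrightarrow> a \<le> m \<Longrightarrow> a = m" by blast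
  have mq: "sublinear_on X m" "\<And>x. x \<in> X \<Longrightarrow> m x \<le> P' x" "\<And>x. x \<notin> X \<Longrightarrow> m x = 0"
    using m unfolding S_def by auto
  have add: "m (x + z) = m x + m z" if "x \<in> X" "z \<in> X" for x z
  proof -
    \<comment> \<open>Restricted to \<open>X\<close>, this function belongs to \<open>S\<close> and
      lies below \<open>m\<close>, so it equals \<open>m\<close>. The value at \<open>t = 1\<close>
      then yields \<open>m x + m z \<le> m (x + z)\<close>, the inequality that subadditivity leaves
      open.\<close>
    define r where "r = ray_inf m z"
    note r = sublinear_ray_inf[OF X mq(1) that(2), folded r_def]
    have "r x \<le> P' x" if "x \<in> X" for x using r(2)[OF that] mq(2)[OF that] by linarith
    then have "res r \<in> S" using res[OF r(1)] by (auto simp: S_def res_def)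
    moreover have "res r \<le> m" using r(2) mq(3) by (simp add: res_def le_fun_def)
    ultimately have "res r = m" by (rule min)
    then have "m x = res r x" by simp
    then have "m x \<le> m (x + z) - m z" using r(3)[OF that(1)] that by (simp add: res_def)
    moreover have "m (x + z) \<le> m x + m z" using mq(1) that unfolding sublinear_on_def by blast
    ultimately show ?thesis by simp
  qed
  have neg: "m (- x) = - m x" if "x \<in> X" for x
    using add[OF that subspace_neg[OF X that]] sublinear_on_0[OF X mq(1)] by simp
  have scale: "m (c *\<^sub>R x) = c * m x" if "x \<in> X" for c x
  proof (cases "c \<ge> 0")
    case True then show ?thesis using mq(1) that unfolding sublinear_on_def by blast
  next
    case False
    then have "m ((- c) *\<^sub>R x) = - c * m x" using mq(1) that unfolding sublinear_on_def
      by (simp del: scaleR_minus_left)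
    then show ?thesis using neg[OF subspace_scale[OF X that, of c]] by simp
  qed
  have "m (- y) \<le> - P y"
    using mq(2)[OF subspace_neg[OF X y]] P'(3)[OF subspace_neg[OF X y]] sublinear_on_0[OF X P] by simp
  moreover have le: "m x \<le> P x" if "x \<in> X" for x using mq(2)[OF that] P'(2)[OF that] by simp
  ultimately have "m y = P y" using neg[OF y] le[OF y] by simp
  then show ?thesis using add scale le mq(3) by (intro exI[of _ m]) simp
qed

text \<open>Hahn-Banach with the norm itself as the dominating function; domination at
  \<open>x\<close> and at \<open>- x\<close> together bounds the absolute value. It later bounds the
  norm of a mean that is known through functionals only.\<close>

lemma norming_functional:
  assumes N: "normed_on X n" and y: "y \<in> X"
  obtains \<phi> where "\<phi> \<in> dual_space X n" "dual_norm X n \<phi> \<le> 1" "\<phi> y = n y"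
proof -
  have "sublinear_on X n"
    using carrier_norm_add[OF N] carrier_norm_scale[OF N] by (auto simp: sublinear_on_def)
  then obtain \<Lambda> where L0: "\<forall>x\<in>X. \<forall>z\<in>X. \<Lambda> (x + z) = \<Lambda> x + \<Lambda> z" "\<forall>c. \<forall>x\<in>X. \<Lambda> (c *\<^sub>R x) = c * \<Lambda> x"
    "\<forall>x\<in>X. \<Lambda> x \<le> n x" "\<Lambda> y = n y" "\<forall>x. x \<notin> X \<longrightarrow> \<Lambda> x = (0::real)"
    using hahn_banach[OF carrier_subspace[OF N] _ y, of n] by blast
  note L = L0(1)[rule_format] L0(2)[rule_format] L0(3)[rule_format] L0(4) L0(5)[rule_format]
  have bd: "\<bar>\<Lambda> x\<bar> \<le> 1 * n x" if "x \<in> X" for x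
    using L(3)[OF that] L(3)[OF carrier_minus[OF N that]] L(2)[OF that, of "-1"]
      carrier_norm_minus[OF N that] by simp
  have "\<Lambda> \<in> dual_space X n" by (rule dual_spaceI[OF N, where \<phi>=\<Lambda> and C=1, OF L(1,2) bd L(5)])
  then show thesis using that dual_norm_leI[OF N bd] L(4) by simp
qed

text \<open>In a reflexive space a weak limit of functionals is a weak-star limit, so it lies in the
  norm closure of every subspace that contains the sequence.\<close>

lemma weak_limit_in_closure:
  assumes N: "normed_on X n" and R: "reflexive_on X n"
    and Y: "subspace Y" "Y \<subseteq> dual_space X n"
    and \<psi>: "\<And>i::nat. \<psi> i \<in> Y" and \<phi>: "\<phi> \<in> dual_space X n"
    and lim: "\<And>x. x \<in> X \<Longrightarrow> (\<lambda>i. \<psi> i x) \<longlonglongrightarrow> \<phi> x" and e: "e > 0"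
  shows "\<exists>\<kappa>\<in>Y. dual_norm X n (\<phi> - \<kappa>) < e"
proof (rule ccontr)
  assume "\<not> ?thesis"
  then have far: "e \<le> dual_norm X n (\<phi> - \<kappa>)" if "\<kappa> \<in> Y" for \<kappa> using that by force
  let ?D = "dual_space X n" and ?N = "dual_norm X n"
  note D = normed_on_dual[OF N]
  \<comment> \<open>Hahn-Banach below the distance to \<open>Y\<close> gives a functional that
    vanishes on \<open>Y\<close> and takes at \<phi> the distance of \<phi>, which is at least
    \<open>e\<close>. Reflexivity turns it into the evaluation at some \<open>x\<close>, where the
    pointwise limit of the members of \<open>Y\<close> is 0.\<close>
  define P where "P = (\<lambda>\<alpha>. INF \<kappa>\<in>Y. ?N (\<alpha> - \<kappa>))"
  have Y0: "0 \<in> Y" using Y(1) by (rule subspace_0)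
  have YD: "\<kappa> \<in> ?D" if "\<kappa> \<in> Y" for \<kappa> using that Y(2) by auto
  have up: "P \<alpha> \<le> ?N (\<alpha> - \<kappa>)" if "\<alpha> \<in> ?D" "\<kappa> \<in> Y" for \<alpha> \<kappa>
    unfolding P_def using that carrier_norm_nonneg[OF D carrier_diff[OF D that(1) YD]]
    by (intro cINF_lower bdd_belowI2[where m=0]) auto
  have ge: "a \<le> P \<alpha>" if "\<And>\<kappa>. \<kappa> \<in> Y \<Longrightarrow> a \<le> ?N (\<alpha> - \<kappa>)" for a \<alpha>
    unfolding P_def using that Y0 by (intro cINF_greatest) auto
  have sub: "P (\<alpha> + \<beta>) \<le> P \<alpha> + P \<beta>" if "\<alpha> \<in> ?D" "\<beta> \<in> ?D" for \<alpha> \<beta>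
  proof -
    have "P (\<alpha> + \<beta>) \<le> ?N (\<alpha> - \<kappa>) + ?N (\<beta> - \<kappa>')" if c: "\<kappa> \<in> Y" "\<kappa>' \<in> Y" for \<kappa> \<kappa>'
    proof -
      have "P (\<alpha> + \<beta>) \<le> ?N (\<alpha> + \<beta> - (\<kappa> + \<kappa>'))"
        using that c \<open>\<alpha> \<in> ?D\<close> \<open>\<beta> \<in> ?D\<close> by (intro up carrier_add[OF D] subspace_add[OF Y(1)])
      also have "\<alpha> + \<beta> - (\<kappa> + \<kappa>') = (\<alpha> - \<kappa>) + (\<beta> - \<kappa>')" by simp
      also have "?N \<dots> \<le> ?N (\<alpha> - \<kappa>) + ?N (\<beta> - \<kappa>')"
        using \<open>\<alpha> \<in> ?D\<close> \<open>\<beta> \<in> ?D\<close> c YD by (intro carrier_norm_add[OF D] carrier_diff[OF D])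
      finally show ?thesis .
    qed
    then have "P (\<alpha> + \<beta>) - ?N (\<alpha> - \<kappa>) \<le> P \<beta>" if "\<kappa> \<in> Y" for \<kappa>
      using that by (intro ge) (simp add: algebra_simps)
    then have "P (\<alpha> + \<beta>) - P \<beta> \<le> P \<alpha>"
      by (intro ge) (simp add: algebra_simps)
    then show ?thesis by simp
  qed
  have half: "c * P \<alpha> \<le> P (c *\<^sub>R \<alpha>)" if "\<alpha> \<in> ?D" "c > 0" for \<alpha> c
  proof (rule ge)
    fix \<kappa> assume c: "\<kappa> \<in> Y"
    then have "(1/c) *\<^sub>R \<kappa> \<in> Y" using Y(1) by (simp add: subspace_scale)
    from up[OF that(1) this] have "c * P \<alpha> \<le> c * ?N (\<alpha> - (1/c) *\<^sub>R \<kappa>)" using that by simp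
    also have "\<dots> = ?N (c *\<^sub>R (\<alpha> - (1/c) *\<^sub>R \<kappa>))"
      using carrier_norm_scale[OF D carrier_diff[OF D that(1) YD[OF \<open>(1/c) *\<^sub>R \<kappa> \<in> Y\<close>]], of c] that by simp
    also have "c *\<^sub>R (\<alpha> - (1/c) *\<^sub>R \<kappa>) = c *\<^sub>R \<alpha> - \<kappa>" using that by (simp add: scaleR_diff_right)
    finally show "c * P \<alpha> \<le> ?N (c *\<^sub>R \<alpha> - \<kappa>)" .
  qed
  have PY: "P \<kappa> = 0" if "\<kappa> \<in> Y" for \<kappa>
    using up[OF YD[OF that] that] carrier_norm_0[OF D]
      ge[of 0 \<kappa>] carrier_norm_nonneg[OF D carrier_diff[OF D YD[OF that] YD]] by force
  have "P (c *\<^sub>R \<alpha>) = c * P \<alpha>" if "\<alpha> \<in> ?D" "c \<ge> 0" for \<alpha> c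
  proof (cases "c = 0")
    case False
    then have c: "c > 0" using that by simp
    have "(1 / c) * P (c *\<^sub>R \<alpha>) \<le> P ((1 / c) *\<^sub>R (c *\<^sub>R \<alpha>))"
      using half[of "c *\<^sub>R \<alpha>" "1 / c"] c that carrier_scale[OF D] by simp
    then show ?thesis using half[OF that(1) c] c by (simp add: field_simps)
  qed (simp add: PY Y0)
  then have "sublinear_on ?D P" using sub unfolding sublinear_on_def by blast
  then obtain \<Lambda> where L0: "\<forall>x\<in>?D. \<forall>z\<in>?D. \<Lambda> (x + z) = \<Lambda> x + \<Lambda> z"
    "\<forall>c. \<forall>x\<in>?D. \<Lambda> (c *\<^sub>R x) = c * \<Lambda> x"
    "\<forall>x\<in>?D. \<Lambda> x \<le> P x" "\<Lambda> \<phi> = P \<phi>" "\<forall>x. x \<notin> ?D \<longrightarrow> \<Lambda> x = (0::real)"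
    using hahn_banach[OF carrier_subspace[OF D] _ \<phi>, of P] by blast
  note L = L0(1)[rule_format] L0(2)[rule_format] L0(3)[rule_format] L0(4) L0(5)[rule_format]
  have PN: "P \<alpha> \<le> ?N \<alpha>" if "\<alpha> \<in> ?D" for \<alpha> using up[OF that Y0] by simp
  have bd: "\<bar>\<Lambda> x\<bar> \<le> 1 * ?N x" if "x \<in> ?D" for x
    using L(3)[OF that] L(3)[OF carrier_minus[OF D that]] L(2)[OF that, of "-1"]
      carrier_norm_minus[OF D that] PN[OF that] PN[OF carrier_minus[OF D that]] by simp
  have "\<Lambda> \<in> dual_space ?D ?N" by (rule dual_spaceI[OF D, where \<phi>=\<Lambda> and C=1, OF L(1,2) bd L(5)])
  then obtain x where x: "x \<in> X" and xL: "\<And>\<alpha>. \<alpha> \<in> ?D \<Longrightarrow> \<Lambda> \<alpha> = \<alpha> x"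
    using bspec[OF R[unfolded reflexive_on_def], of \<Lambda>] by blast
  have "\<Lambda> (\<psi> i) = 0" for i
    using L(3)[OF YD[OF \<psi>[of i]]] L(3)[OF carrier_minus[OF D YD[OF \<psi>[of i]]]]
      L(2)[OF YD[OF \<psi>[of i]], of "-1"] PY[OF \<psi>[of i]] PY[OF subspace_neg[OF Y(1) \<psi>[of i]]] by simp
  then have "\<psi> i x = 0" for i using xL[OF YD[OF \<psi>]] by simp
  then have "(\<lambda>i. \<psi> i x) \<longlonglongrightarrow> 0" by simp
  with lim[OF x] have "\<phi> x = 0" by (rule LIMSEQ_unique)
  moreover have "P \<phi> \<ge> e" using far by (rule ge)
  ultimately show False using L(4) xL[OF \<phi>] e by linarith
qed

text \<open>By Tychonoff's theorem the evaluations of the dual elements along a bounded sequence have a cluster point, and reflexivity represents it by a vector.\<close>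

lemma weak_cluster_point:
  fixes X :: "'i \<Rightarrow> 'a::real_vector set" and w :: "'i \<Rightarrow> nat \<Rightarrow> 'a"
  assumes N: "\<And>l. l \<in> I \<Longrightarrow> normed_on (X l) (n l)" and R: "\<And>l. l \<in> I \<Longrightarrow> reflexive_on (X l) (n l)"
    and w: "\<And>l j. l \<in> I \<Longrightarrow> w l j \<in> X l" and B: "\<And>l j. l \<in> I \<Longrightarrow> n l (w l j) \<le> B"
  obtains G x where "G \<noteq> bot" "G \<le> sequentially" "\<And>l. l \<in> I \<Longrightarrow> x l \<in> X l"
    "\<And>l \<phi>. l \<in> I \<Longrightarrow> \<phi> \<in> dual_space (X l) (n l) \<Longrightarrow> ((\<lambda>j. \<phi> (w l j)) \<longlongrightarrow> \<phi> (x l)) G"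
proof -
  \<comment> \<open>The product runs over all pairs of an index and a function; pairs that are not
    admissible get the factor \<open>{0}\<close>, so that they carry no information.\<close>
  define ok where "ok = (\<lambda>(l, \<phi>). l \<in> I \<and> \<phi> \<in> dual_space (X l) (n l))"
  define c where "c = (\<lambda>(l, \<phi>). if ok (l, \<phi>) then dual_norm (X l) (n l) \<phi> * B else 0)"
  define E where "E = (\<lambda>j (l, \<phi>). if ok (l, \<phi>) then \<phi> (w l j) else 0)"
  define K where "K = (PiE UNIV (\<lambda>i. {- c i .. c i}))"
  have bd: "\<bar>\<phi> (w l j)\<bar> \<le> dual_norm (X l) (n l) \<phi> * B" if "l \<in> I" "\<phi> \<in> dual_space (X l) (n l)" for l \<phi> j
  proof -
    have "\<bar>\<phi> (w l j)\<bar> \<le> dual_norm (X l) (n l) \<phi> * n l (w l j)"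
      using dual_bound[OF N[OF that(1)] that(2) w[OF that(1)]] .
    also have "\<dots> \<le> dual_norm (X l) (n l) \<phi> * B"
      using B[OF that(1)] dual_norm_nonneg[OF N[OF that(1)] that(2)] by (intro mult_left_mono)
    finally show ?thesis .
  qed
  have EK: "E j \<in> K" for j
    using bd by (auto simp: K_def E_def c_def ok_def abs_le_iff minus_le_iff)
  have "compactin (product_topology (\<lambda>_. euclidean) UNIV) K"
    unfolding K_def by (simp add: compactin_PiE)
  then have "compact K" by (simp add: euclidean_product_topology)
  moreover have "filtermap E sequentially \<noteq> bot" by (simp add: filtermap_bot_iff)
  moreover have "\<forall>\<^sub>F x in filtermap E sequentially. x \<in> K"
    using EK by (simp add: eventually_filtermap)
  ultimately have "\<exists>z\<in>K. inf (nhds z) (filtermap E sequentially) \<noteq> bot"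
    by (rule compact_filter[THEN iffD1, rule_format])
  then obtain z where zK: "z \<in> K" and z: "inf (nhds z) (filtermap E sequentially) \<noteq> bot" ..
  \<comment> \<open>The cluster point in the product is pulled back to a filter on the indices along
    which all evaluations, for all components at once, converge. A filter is used because the duals
    need not be separable, so no diagonal subsequence is available from compactness alone.\<close>
  define G where "G = inf (filtercomap E (nhds z)) sequentially"
  have Gb: "G \<noteq> bot"
  proof
    assume "G = bot"
    then have "eventually (\<lambda>_. False) (inf (filtercomap E (nhds z)) sequentially)"
      by (simp add: G_def)
    then obtain P Q where P: "eventually P (filtercomap E (nhds z))" and Q: "eventually Q sequentially"
      and PQ: "\<And>j. P j \<Longrightarrow> Q j \<Longrightarrow> False" unfolding eventually_inf by blast
    obtain P' where P': "eventually P' (nhds z)" "\<And>j. P' (E j) \<Longrightarrow> P j"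
      using P unfolding eventually_filtercomap by blast
    have "eventually (\<lambda>y. \<not> P' y) (filtermap E sequentially)"
      unfolding eventually_filtermap using Q by (rule eventually_mono) (use P'(2) PQ in auto)
    then have "eventually (\<lambda>_. False) (inf (nhds z) (filtermap E sequentially))"
      unfolding eventually_inf using P'(1) by (intro exI[of _ P'] exI[of _ "\<lambda>y. \<not> P' y"]) auto
    then show False using z by (simp add: eventually_False)
  qed
  have Gs: "G \<le> sequentially" unfolding G_def by simp
  have "filterlim E (nhds z) G"
    unfolding G_def using filterlim_filtercomap by (rule filterlim_mono) auto
  then have Ez: "((\<lambda>j. E j i) \<longlongrightarrow> z i) G" for i
  proof -
    have "filterlim (\<lambda>y. y i) (nhds (z i)) (nhds z)"
    proof (rule topological_tendstoI)
      fix S assume "open S" "z i \<in> S"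
      then have "open ((\<lambda>y. y i) -` S)" "z \<in> (\<lambda>y. y i) -` S"
        using open_vimage[OF _ continuous_on_product_coordinates[of i]] by auto
      then show "eventually (\<lambda>y. y i \<in> S) (nhds z)" unfolding eventually_nhds by auto
    qed
    then show ?thesis using \<open>filterlim E (nhds z) G\<close> by (rule filterlim_compose)
  qed
  have lim: "((\<lambda>j. \<phi> (w l j)) \<longlongrightarrow> z (l, \<phi>)) G" if "l \<in> I" "\<phi> \<in> dual_space (X l) (n l)" for l \<phi>
    using Ez[of "(l, \<phi>)"] that by (simp add: E_def ok_def)
  have "\<exists>x\<in>X l. \<forall>\<phi>\<in>dual_space (X l) (n l). z (l, \<phi>) = \<phi> x" if l: "l \<in> I" for l
  proof -
    note D = normed_on_dual[OF N[OF l]]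
    have "(\<lambda>\<phi>. z (l, \<phi>)) \<in> dual_space (dual_space (X l) (n l)) (dual_norm (X l) (n l))"
    proof (rule dual_spaceI[OF D, where C=B])
      fix \<phi> \<psi> assume a: "\<phi> \<in> dual_space (X l) (n l)" "\<psi> \<in> dual_space (X l) (n l)"
      show "z (l, \<phi> + \<psi>) = z (l, \<phi>) + z (l, \<psi>)"
        using tendsto_unique[OF Gb lim[OF l carrier_add[OF D a]]] tendsto_add[OF lim[OF l a(1)] lim[OF l a(2)]]
        by simp
    next
      fix \<phi> and r :: real assume a: "\<phi> \<in> dual_space (X l) (n l)"
      show "z (l, r *\<^sub>R \<phi>) = r * z (l, \<phi>)"
        using tendsto_unique[OF Gb lim[OF l carrier_scale[OF D a, of r]]] tendsto_mult_left[OF lim[OF l a], of r]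
        by (simp add: scaleR_fun_def)
    next
      fix \<phi> assume a: "\<phi> \<in> dual_space (X l) (n l)"
      have "z (l, \<phi>) \<in> {- c (l, \<phi>) .. c (l, \<phi>)}" using zK unfolding K_def PiE_iff by simp
      then show "\<bar>z (l, \<phi>)\<bar> \<le> B * dual_norm (X l) (n l) \<phi>"
        using l a by (simp add: c_def ok_def abs_le_iff mult.commute)
    next
      fix \<phi> assume a: "\<phi> \<notin> dual_space (X l) (n l)"
      have "z (l, \<phi>) \<in> {- c (l, \<phi>) .. c (l, \<phi>)}" using zK unfolding K_def PiE_iff by simp
      then show "z (l, \<phi>) = 0" using a by (simp add: c_def ok_def)
    qed
    from R[OF l, unfolded reflexive_on_def, rule_format, OF this] show ?thesis .
  qed
  then have "\<forall>l\<in>I. \<exists>x. x \<in> X l \<and> (\<forall>\<phi>\<in>dual_space (X l) (n l). z (l, \<phi>) = \<phi> x)" by blast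
  from bchoice[OF this] obtain x where
    x: "\<forall>l\<in>I. x l \<in> X l \<and> (\<forall>\<phi>\<in>dual_space (X l) (n l). z (l, \<phi>) = \<phi> (x l))" ..
  show thesis
  proof (rule that[of G x, OF Gb Gs])
    fix l assume l: "l \<in> I" show "x l \<in> X l" by (rule conjunct1[OF bspec[OF x l]])
  next
    fix l \<phi> assume a: "l \<in> I" "\<phi> \<in> dual_space (X l) (n l)"
    have eq: "z (l, \<phi>) = \<phi> (x l)" using bspec[OF conjunct2[OF bspec[OF x a(1)]] a(2)] .
    show "((\<lambda>j. \<phi> (w l j)) \<longlongrightarrow> \<phi> (x l)) G" using lim[OF a] by (simp only: eq)
  qed
qed

lemma gelfand_emb_dual:
  assumes N: "normed_on X n" and C: "\<And>x. x \<in> X \<Longrightarrow> norm x \<le> C * n x"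
  shows "gelfand_emb X h \<in> dual_space X n" "dual_norm X n (gelfand_emb X h) \<le> norm h * \<bar>C\<bar>"
proof -
  have bd: "\<bar>gelfand_emb X h x\<bar> \<le> (norm h * \<bar>C\<bar>) * n x" if "x \<in> X" for x
  proof -
    have "\<bar>inner h x\<bar> \<le> norm h * norm x" by (rule Cauchy_Schwarz_ineq2)
    also have "C * n x \<le> \<bar>C\<bar> * n x" using carrier_norm_nonneg[OF N that] by (intro mult_right_mono) auto
    with C[OF that] have "norm h * norm x \<le> norm h * (\<bar>C\<bar> * n x)" by (intro mult_left_mono) auto
    finally show ?thesis using that by (simp add: gelfand_emb_def mult.assoc)
  qed
  show "gelfand_emb X h \<in> dual_space X n"
    by (rule dual_spaceI[OF N _ _ bd])
      (auto simp: gelfand_emb_def inner_add_right carrier_add[OF N] carrier_scale[OF N])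
  show "dual_norm X n (gelfand_emb X h) \<le> norm h * \<bar>C\<bar>"
    by (rule dual_norm_leI[OF N bd]) auto
qed

text \<open>By contradiction: the components of a bounded violating sequence have a common weak limit,
  which lies in the intersection of the spaces, where the functionals cancel.\<close>

lemma ehrling_inequality:
  fixes X :: "nat \<Rightarrow> 'h::real_inner set"
  assumes fin: "finite I" and l0: "l0 \<in> I"
    and N: "\<And>l. l \<in> I \<Longrightarrow> normed_on (X l) (n l)" and R: "\<And>l. l \<in> I \<Longrightarrow> reflexive_on (X l) (n l)"
    and C: "\<And>l x. l \<in> I \<Longrightarrow> x \<in> X l \<Longrightarrow> norm x \<le> C l * n l x"
    and \<zeta>: "\<And>l. l \<in> I \<Longrightarrow> \<zeta> l \<in> dual_space (X l) (n l)"
    and cancel: "\<And>x. (\<And>l. l \<in> I \<Longrightarrow> x \<in> X l) \<Longrightarrow> (\<Sum>l\<in>I. \<zeta> l x) = 0"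
    and e: "e > 0"
  shows "\<exists>K\<ge>0. \<forall>w. (\<forall>l\<in>I. w l \<in> X l) \<longrightarrow>
     \<bar>\<Sum>l\<in>I. \<zeta> l (w l)\<bar> \<le> e * (\<Sum>l\<in>I. n l (w l)) + K * (\<Sum>l\<in>I. norm (w l - w l0))"
proof (rule ccontr)
  assume neg: "\<not> ?thesis"
  have "\<forall>j::nat. \<exists>w. (\<forall>l\<in>I. w l \<in> X l) \<and>
     e * (\<Sum>l\<in>I. n l (w l)) + real j * (\<Sum>l\<in>I. norm (w l - w l0)) < \<bar>\<Sum>l\<in>I. \<zeta> l (w l)\<bar>"
    using neg by (meson not_le of_nat_0_le_iff)
  then obtain w0 where w0: "\<And>j l. l \<in> I \<Longrightarrow> w0 j l \<in> X l"
     and w0e: "\<And>j. e * (\<Sum>l\<in>I. n l (w0 j l)) + real j * (\<Sum>l\<in>I. norm (w0 j l - w0 j l0)) < \<bar>\<Sum>l\<in>I. \<zeta> l (w0 j l)\<bar>"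
    by metis
  \<comment> \<open>Both sides of the violated inequality are homogeneous of degree one, so division
    by \<open>S j\<close> keeps the violation and bounds the norms of all components by 1.\<close>
  define S where "S j = (\<Sum>l\<in>I. n l (w0 j l))" for j
  have n0: "0 \<le> n l (w0 j l)" if "l \<in> I" for l j using carrier_norm_nonneg[OF N[OF that] w0[OF that]] .
  define B where "B = (\<Sum>l\<in>I. dual_norm (X l) (n l) (\<zeta> l))"
  have d0: "0 \<le> dual_norm (X l) (n l) (\<zeta> l)" if "l \<in> I" for l using dual_norm_nonneg[OF N[OF that] \<zeta>[OF that]] .
  have Sup: "\<bar>\<Sum>l\<in>I. \<zeta> l (w0 j l)\<bar> \<le> B * S j" for j
  proof -
    have "\<bar>\<Sum>l\<in>I. \<zeta> l (w0 j l)\<bar> \<le> (\<Sum>l\<in>I. \<bar>\<zeta> l (w0 j l)\<bar>)" by (rule sum_abs)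
    also have "\<dots> \<le> (\<Sum>l\<in>I. dual_norm (X l) (n l) (\<zeta> l) * S j)"
    proof (rule sum_mono)
      fix l assume l: "l \<in> I"
      have "n l (w0 j l) \<le> S j" unfolding S_def using fin l n0 by (intro member_le_sum) auto
      then show "\<bar>\<zeta> l (w0 j l)\<bar> \<le> dual_norm (X l) (n l) (\<zeta> l) * S j"
        using dual_bound[OF N[OF l] \<zeta>[OF l] w0[OF l]] d0[OF l] by (meson mult_left_mono order_trans)
    qed
    finally show ?thesis by (simp add: B_def sum_distrib_right)
  qed
  have H0: "0 \<le> (\<Sum>l\<in>I. norm (w0 j l - w0 j l0))" for j by (simp add: sum_nonneg)
  have "S j \<ge> 0" for j unfolding S_def using n0 by (simp add: sum_nonneg)
  moreover have "S j \<noteq> 0" for j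
    using w0e[of j] Sup[of j] H0[of j] by (auto simp flip: S_def) (smt (verit) mult_nonneg_nonneg of_nat_0_le_iff)
  ultimately have Spos: "S j > 0" for j by (metis less_eq_real_def)
  define w where "w l j = (1 / S j) *\<^sub>R w0 j l" for l j
  have w: "w l j \<in> X l" if "l \<in> I" for l j unfolding w_def using carrier_scale[OF N[OF that] w0[OF that]] .
  have wn: "n l (w l j) \<le> 1" if "l \<in> I" for l j
  proof -
    have "n l (w0 j l) \<le> S j" unfolding S_def using fin that n0 by (intro member_le_sum) auto
    then show ?thesis unfolding w_def using carrier_norm_scale[OF N[OF that] w0[OF that]] Spos[of j] by (simp add: field_simps)
  qed
  have \<zeta>w: "(\<Sum>l\<in>I. \<zeta> l (w l j)) = (\<Sum>l\<in>I. \<zeta> l (w0 j l)) / S j" for j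
    unfolding w_def sum_divide_distrib using dual_scale[OF N \<zeta> w0] by (intro sum.cong) auto
  have we: "e < \<bar>\<Sum>l\<in>I. \<zeta> l (w l j)\<bar>" for j
  proof -
    have "e * S j < \<bar>\<Sum>l\<in>I. \<zeta> l (w0 j l)\<bar>"
      using w0e[of j] H0[of j] by (auto simp flip: S_def) (smt (verit) mult_nonneg_nonneg of_nat_0_le_iff)
    then show ?thesis using Spos[of j] by (simp add: \<zeta>w field_simps)
  qed
  \<comment> \<open>A violation with the constant \<open>j\<close> leaves room only for distances in
    \<open>H\<close> of size \<open>B / j\<close>. Hence all components have the same weak limit in
    \<open>H\<close>.\<close>
  have wd: "norm (w l j - w l0 j) * real j \<le> B" if "l \<in> I" for l j
  proof -
    have "norm (w0 j l - w0 j l0) \<le> (\<Sum>l\<in>I. norm (w0 j l - w0 j l0))" using that fin by (intro member_le_sum) auto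
    then have "real j * norm (w0 j l - w0 j l0) \<le> real j * (\<Sum>l\<in>I. norm (w0 j l - w0 j l0))" by (intro mult_left_mono) auto
    also have "\<dots> \<le> B * S j" using w0e[of j] Sup[of j] e Spos[of j] unfolding S_def[symmetric] by (smt (verit) mult_pos_pos)
    finally have "real j * norm (w0 j l - w0 j l0) \<le> B * S j" .
    note A = this
    have eq: "norm (w l j - w l0 j) = norm (w0 j l - w0 j l0) / S j"
      unfolding w_def using Spos[of j] by (simp flip: scaleR_diff_right)
    show ?thesis unfolding eq using A Spos[of j] by (simp add: field_simps)
  qed
  obtain G x where G: "G \<noteq> bot" "G \<le> sequentially" and x: "\<And>l. l \<in> I \<Longrightarrow> x l \<in> X l"
    and lim: "\<And>l \<phi>. l \<in> I \<Longrightarrow> \<phi> \<in> dual_space (X l) (n l) \<Longrightarrow> ((\<lambda>j. \<phi> (w l j)) \<longlongrightarrow> \<phi> (x l)) G"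
    by (rule weak_cluster_point[of I X n w 1]) (use N R w wn in auto)
  have xeq: "x l = x l0" if l: "l \<in> I" for l
  proof -
    have "(\<lambda>j. norm (w l j - w l0 j)) \<longlonglongrightarrow> 0"
    proof (rule tendsto_sandwich[OF _ _ tendsto_const lim_const_over_n[of B]])
      show "\<forall>\<^sub>F j in sequentially. norm (w l j - w l0 j) \<le> B / real j"
        using eventually_gt_at_top[of 0] by eventually_elim (use wd[OF l] in \<open>auto simp: field_simps\<close>)
    qed auto
    then have d: "(\<lambda>j. w l j - w l0 j) \<longlonglongrightarrow> 0" by (rule tendsto_norm_zero_cancel)
    have "inner h (x l) = inner h (x l0)" for h
    proof -
      have "(\<lambda>j. inner h (w l j - w l0 j)) \<longlonglongrightarrow> 0" using tendsto_inner[OF tendsto_const d, of h] by simp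
      then have a: "((\<lambda>j. inner h (w l j - w l0 j)) \<longlongrightarrow> 0) G" using G(2) by (rule tendsto_mono[rotated])
      have "((\<lambda>j. gelfand_emb (X l) h (w l j) - gelfand_emb (X l0) h (w l0 j))
          \<longlongrightarrow> gelfand_emb (X l) h (x l) - gelfand_emb (X l0) h (x l0)) G"
        using l l0 by (intro tendsto_diff lim gelfand_emb_dual[OF N C]) auto
      then have "((\<lambda>j. inner h (w l j - w l0 j)) \<longlongrightarrow> inner h (x l) - inner h (x l0)) G"
        using w[OF l] w[OF l0] x[OF l] x[OF l0] by (simp add: gelfand_emb_def inner_diff_right)
      from tendsto_unique[OF G(1) this a] show ?thesis by linarith
    qed
    then have "inner (x l - x l0) (x l - x l0) = 0" by (simp add: inner_diff_right)
    then show ?thesis by simp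
  qed
  have lim\<zeta>: "((\<lambda>j. \<bar>\<Sum>l\<in>I. \<zeta> l (w l j)\<bar>) \<longlongrightarrow> \<bar>\<Sum>l\<in>I. \<zeta> l (x l)\<bar>) G"
    by (intro tendsto_rabs tendsto_sum lim \<zeta>)
  have "(\<Sum>l\<in>I. \<zeta> l (x l)) = (\<Sum>l\<in>I. \<zeta> l (x l0))"
    by (rule sum.cong[OF refl]) (rule arg_cong[OF xeq])
  also have "\<dots> = 0"
  proof (rule cancel)
    fix l assume l: "l \<in> I"
    show "x l0 \<in> X l" using x[OF l] unfolding xeq[OF l] .
  qed
  finally have z: "\<bar>\<Sum>l\<in>I. \<zeta> l (x l)\<bar> = 0" by simp
  have "e \<le> \<bar>\<Sum>l\<in>I. \<zeta> l (x l)\<bar>"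
    by (rule tendsto_lowerbound[OF lim\<zeta> _ G(1)]) (simp add: less_imp_le[OF we])
  with e z show False by linarith
qed

section \<open>Young's and Jensen's inequalities\<close>

text \<open>Young's inequality for \<open>e powr (1/p) * a\<close> and
  \<open>e powr (-1/p) * b\<close>; the factors \<open>1 / p\<close> and \<open>1 / q\<close> are at
  most 1 and are dropped.\<close>

lemma young_epsilon:
  fixes p q e :: real
  assumes "p > 1" "q > 1" "1 / p + 1 / q = 1" "e > 0"
  obtains C where "C > 0" "\<And>a b. a \<ge> 0 \<Longrightarrow> b \<ge> 0 \<Longrightarrow> a * b \<le> e * a powr p + C * b powr q"
proof
  let ?C = "e powr (- q / p)"
  show "?C > 0" using assms by simp
  fix a b :: real assume ab: "a \<ge> 0" "b \<ge> 0"
  have "a * b = (e powr (1/p) * a) * (e powr (-1/p) * b)"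
    using assms by (simp add: mult.assoc mult.left_commute flip: powr_add)
  also have "\<dots> \<le> (e powr (1/p) * a) powr p / p + (e powr (-1/p) * b) powr q / q"
    using assms ab by (intro Youngs_inequality) auto
  also have "\<dots> = e * a powr p / p + ?C * b powr q / q"
    using assms ab by (simp add: powr_mult powr_powr)
  also have "\<dots> \<le> e * a powr p / 1 + ?C * b powr q / 1"
    using assms by (intro add_mono divide_left_mono) auto
  finally show "a * b \<le> e * a powr p + ?C * b powr q" by simp
qed


section \<open>Strong measurability\<close>

lemma AE_lebesgue_on_iff:
  "S \<in> sets lebesgue \<Longrightarrow> (AE t in lebesgue_on S. P t) \<longleftrightarrow> (AE t in lebesgue. t \<in> S \<longrightarrow> P t)"
  by (simp add: AE_restrict_space_iff)

lemma AE_lebesgue_on_subset: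
  assumes "S \<in> sets lebesgue" "R \<in> sets lebesgue" "R \<subseteq> S" "AE t in lebesgue_on S. P t"
  shows "AE t in lebesgue_on R. P t"
proof -
  have "AE t in lebesgue. t \<in> S \<longrightarrow> P t" using assms by (simp add: AE_lebesgue_on_iff)
  then have "AE t in lebesgue. t \<in> R \<longrightarrow> P t" by eventually_elim (use assms in auto)
  then show ?thesis using assms by (simp add: AE_lebesgue_on_iff)
qed

text \<open>Completeness of Lebesgue measure, carried over to the subset \<open>S\<close> by
  extending the functions by 0.\<close>

lemma borel_measurable_AE_lebesgue_on:
  fixes f g :: "real \<Rightarrow> real"
  assumes S: "S \<in> sets lebesgue" and f: "f \<in> borel_measurable (lebesgue_on S)"
    and eq: "AE t in lebesgue_on S. f t = g t"
  shows "g \<in> borel_measurable (lebesgue_on S)"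
proof -
  have "(\<lambda>t. if t \<in> S then f t else 0) \<in> borel_measurable lebesgue"
    using borel_measurable_if[OF S] f by blast
  moreover have "AE t in lebesgue. (if t \<in> S then f t else 0) = (if t \<in> S then g t else 0)"
    using eq unfolding AE_lebesgue_on_iff[OF S] by eventually_elim auto
  ultimately have "(\<lambda>t. if t \<in> S then g t else 0) \<in> borel_measurable lebesgue"
    by (rule borel_measurable_AE)
  then show ?thesis using borel_measurable_if[OF S] by blast
qed

lemma borel_measurable_AE_limit:
  fixes f :: "nat \<Rightarrow> real \<Rightarrow> real"
  assumes S: "S \<in> sets lebesgue" and f: "\<And>i. f i \<in> borel_measurable (lebesgue_on S)"
    and lim: "AE t in lebesgue_on S. (\<lambda>i. f i t) \<longlonglongrightarrow> g t"
  shows "g \<in> borel_measurable (lebesgue_on S)"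
proof (rule borel_measurable_AE_lebesgue_on[OF S])
  show "(\<lambda>t. lim (\<lambda>i. f i t)) \<in> borel_measurable (lebesgue_on S)"
    using f by (rule borel_measurable_lim_metric)
  show "AE t in lebesgue_on S. lim (\<lambda>i. f i t) = g t"
    using lim by eventually_elim (rule limI)
qed

lemma simple_onD:
  assumes "simple_on M X \<sigma>"
  shows "simple_function M \<sigma>" "\<And>t. t \<in> space M \<Longrightarrow> \<sigma> t \<in> X"
  using assms unfolding simple_on_def by auto

lemma simple_on_compose:
  assumes "simple_on M X \<sigma>" "\<And>x. x \<in> X \<Longrightarrow> h x \<in> Y"
  shows "simple_on M Y (\<lambda>t. h (\<sigma> t))"
  using assms simple_function_compose[of M \<sigma> h] unfolding simple_on_def comp_def by auto

lemma simple_on_borel: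
  fixes h :: "'a \<Rightarrow> real"
  shows "simple_on M X \<sigma> \<Longrightarrow> (\<lambda>t. h (\<sigma> t)) \<in> borel_measurable M"
  using simple_function_compose[of M \<sigma> h] unfolding simple_on_def comp_def
  by (auto intro: borel_measurable_simple_function)

lemma strongly_measurableD:
  assumes "strongly_measurable_on M X n g"
  obtains \<sigma> where "\<And>i::nat. simple_on M X (\<sigma> i)" "AE t in M. g t \<in> X"
    "AE t in M. (\<lambda>i. n (\<sigma> i t - g t)) \<longlonglongrightarrow> 0"
  using assms unfolding strongly_measurable_on_def by auto

lemma strongly_measurableI:
  assumes "\<And>i::nat. simple_on M X (\<sigma> i)" "AE t in M. g t \<in> X"
    "AE t in M. (\<lambda>i. n (\<sigma> i t - g t)) \<longlonglongrightarrow> 0"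
  shows "strongly_measurable_on M X n g"
proof -
  have "AE t in M. g t \<in> X \<and> (\<lambda>i. n (\<sigma> i t - g t)) \<longlonglongrightarrow> 0" using assms(2,3) by eventually_elim auto
  then show ?thesis using assms(1) unfolding strongly_measurable_on_def by blast
qed

text \<open>Any real function of a simple function is measurable, and the Lipschitz bound carries
  this to the limit. Norms, evaluations at a vector and functionals are all of this form, so no
  topology on the carrier is needed.\<close>

lemma strongly_measurable_lipschitz:
  fixes h :: "'a::real_vector \<Rightarrow> real"
  assumes S: "S \<in> sets lebesgue" and g: "strongly_measurable_on (lebesgue_on S) X n g"
    and h: "\<And>x y. x \<in> X \<Longrightarrow> y \<in> X \<Longrightarrow> \<bar>h x - h y\<bar> \<le> C * n (x - y)"
  shows "(\<lambda>t. h (g t)) \<in> borel_measurable (lebesgue_on S)"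
proof -
  obtain \<sigma> where \<sigma>: "\<And>i::nat. simple_on (lebesgue_on S) X (\<sigma> i)" "AE t in lebesgue_on S. g t \<in> X"
    "AE t in lebesgue_on S. (\<lambda>i. n (\<sigma> i t - g t)) \<longlonglongrightarrow> 0" by (rule strongly_measurableD[OF g], rule that)
  show ?thesis
  proof (rule borel_measurable_AE_limit[OF S])
    show "(\<lambda>t. h (\<sigma> i t)) \<in> borel_measurable (lebesgue_on S)" for i by (rule simple_on_borel[OF \<sigma>(1)])
    show "AE t in lebesgue_on S. (\<lambda>i. h (\<sigma> i t)) \<longlonglongrightarrow> h (g t)"
      using \<sigma>(2,3) AE_space
    proof eventually_elim
      fix t assume t: "g t \<in> X" "(\<lambda>i. n (\<sigma> i t - g t)) \<longlonglongrightarrow> 0" "t \<in> space (lebesgue_on S)"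
      have "(\<lambda>i. h (\<sigma> i t) - h (g t)) \<longlonglongrightarrow> 0"
      proof (rule Lim_null_comparison)
        show "\<forall>\<^sub>F i in sequentially. norm (h (\<sigma> i t) - h (g t)) \<le> C * n (\<sigma> i t - g t)"
          using h[OF simple_onD(2)[OF \<sigma>(1) t(3)] t(1)] by simp
        show "(\<lambda>i. C * n (\<sigma> i t - g t)) \<longlonglongrightarrow> 0" using tendsto_mult_right_zero[OF t(2)] .
      qed
      then show "(\<lambda>i. h (\<sigma> i t)) \<longlonglongrightarrow> h (g t)" by (simp add: LIM_zero_iff)
    qed
  qed
qed

lemma strongly_measurable_norm:
  assumes S: "S \<in> sets lebesgue" and N: "normed_on X n" and g: "strongly_measurable_on (lebesgue_on S) X n g"
  shows "(\<lambda>t. n (g t)) \<in> borel_measurable (lebesgue_on S)"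
  by (rule strongly_measurable_lipschitz[OF S g, where C=1]) (simp add: carrier_norm_diff_abs[OF N])

lemma strongly_measurable_map:
  assumes g: "strongly_measurable_on M X n g"
    and mem: "\<And>x. x \<in> X \<Longrightarrow> h x \<in> Y" and m0: "\<And>y. y \<in> Y \<Longrightarrow> 0 \<le> m y" and Y: "normed_on Y m"
    and h: "\<And>x y. x \<in> X \<Longrightarrow> y \<in> X \<Longrightarrow> m (h x - h y) \<le> C * n (x - y)"
  shows "strongly_measurable_on M Y m (\<lambda>t. h (g t))"
proof -
  obtain \<sigma> where \<sigma>: "\<And>i::nat. simple_on M X (\<sigma> i)" "AE t in M. g t \<in> X"
    "AE t in M. (\<lambda>i. n (\<sigma> i t - g t)) \<longlonglongrightarrow> 0" by (rule strongly_measurableD[OF g], rule that)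
  show ?thesis
  proof (rule strongly_measurableI)
    show "simple_on M Y (\<lambda>t. h (\<sigma> i t))" for i by (rule simple_on_compose[OF \<sigma>(1) mem])
    show "AE t in M. h (g t) \<in> Y" using \<sigma>(2) by eventually_elim (rule mem)
    show "AE t in M. (\<lambda>i. m (h (\<sigma> i t) - h (g t))) \<longlonglongrightarrow> 0"
      using \<sigma>(2,3) AE_space
    proof eventually_elim
      fix t assume t: "g t \<in> X" "(\<lambda>i. n (\<sigma> i t - g t)) \<longlonglongrightarrow> 0" "t \<in> space M"
      show "(\<lambda>i. m (h (\<sigma> i t) - h (g t))) \<longlonglongrightarrow> 0"
      proof (rule Lim_null_comparison)
        show "\<forall>\<^sub>F i in sequentially. norm (m (h (\<sigma> i t) - h (g t))) \<le> C * n (\<sigma> i t - g t)"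
          using h[OF simple_onD(2)[OF \<sigma>(1) t(3)] t(1)]
            m0[OF carrier_diff[OF Y mem[OF simple_onD(2)[OF \<sigma>(1) t(3)]] mem[OF t(1)]]] by simp
        show "(\<lambda>i. C * n (\<sigma> i t - g t)) \<longlonglongrightarrow> 0" using tendsto_mult_right_zero[OF t(2)] .
      qed
    qed
  qed
qed

lemma strongly_measurable_diff:
  assumes N: "normed_on X n" and f: "strongly_measurable_on M X n f" and g: "strongly_measurable_on M X n g"
  shows "strongly_measurable_on M X n (\<lambda>t. f t - g t)"
proof -
  obtain \<sigma> where \<sigma>: "\<And>i::nat. simple_on M X (\<sigma> i)" "AE t in M. g t \<in> X"
    "AE t in M. (\<lambda>i. n (\<sigma> i t - g t)) \<longlonglongrightarrow> 0" by (rule strongly_measurableD[OF g], rule that)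
  obtain \<tau> where \<tau>: "\<And>i::nat. simple_on M X (\<tau> i)" "AE t in M. f t \<in> X"
    "AE t in M. (\<lambda>i. n (\<tau> i t - f t)) \<longlonglongrightarrow> 0" by (rule strongly_measurableD[OF f], rule that)
  show ?thesis
  proof (rule strongly_measurableI)
    show "simple_on M X (\<lambda>t. \<tau> i t - \<sigma> i t)" for i
      using simple_function_compose2[OF simple_onD(1)[OF \<tau>(1)] simple_onD(1)[OF \<sigma>(1)], of "(-)" i i]
        simple_onD(2)[OF \<tau>(1)] simple_onD(2)[OF \<sigma>(1)]
      unfolding simple_on_def by (auto intro!: carrier_diff[OF N])
    show "AE t in M. f t - g t \<in> X" using \<sigma>(2) \<tau>(2) by eventually_elim (rule carrier_diff[OF N])
    show "AE t in M. (\<lambda>i. n ((\<tau> i t - \<sigma> i t) - (f t - g t))) \<longlonglongrightarrow> 0"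
      using \<sigma>(2,3) \<tau>(2,3) AE_space
    proof eventually_elim
      fix t assume t: "g t \<in> X" "(\<lambda>i. n (\<sigma> i t - g t)) \<longlonglongrightarrow> 0" 
        "f t \<in> X" "(\<lambda>i. n (\<tau> i t - f t)) \<longlonglongrightarrow> 0" "t \<in> space M"
      have s: "\<sigma> i t - g t \<in> X" "\<tau> i t - f t \<in> X" for i
        using simple_onD(2)[OF \<sigma>(1) t(5)] simple_onD(2)[OF \<tau>(1) t(5)] t by (auto intro: carrier_diff[OF N])
      show "(\<lambda>i. n ((\<tau> i t - \<sigma> i t) - (f t - g t))) \<longlonglongrightarrow> 0"
      proof (rule Lim_null_comparison)
        have "n ((\<tau> i t - \<sigma> i t) - (f t - g t)) \<le> n (\<tau> i t - f t) + n (\<sigma> i t - g t)" for i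
          using carrier_norm_diff[OF N s(2)[of i] s(1)[of i]] by (simp add: algebra_simps)
        moreover have "0 \<le> n ((\<tau> i t - \<sigma> i t) - (f t - g t))" for i
          using carrier_norm_nonneg[OF N carrier_diff[OF N s(2)[of i] s(1)[of i]]] by (simp add: algebra_simps)
        ultimately show "\<forall>\<^sub>F i in sequentially. norm (n ((\<tau> i t - \<sigma> i t) - (f t - g t)))
            \<le> n (\<tau> i t - f t) + n (\<sigma> i t - g t)" by simp
        show "(\<lambda>i. n (\<tau> i t - f t) + n (\<sigma> i t - g t)) \<longlonglongrightarrow> 0" using tendsto_add[OF t(4) t(2)] by simp
      qed
    qed
  qed
qed

lemma strongly_measurable_scale:
  assumes N: "normed_on X n" and a: "a \<in> borel_measurable M" and g: "strongly_measurable_on M X n g"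
  shows "strongly_measurable_on M X n (\<lambda>t. a t *\<^sub>R g t)"
proof -
  obtain \<sigma> where \<sigma>: "\<And>i::nat. simple_on M X (\<sigma> i)" "AE t in M. g t \<in> X"
    "AE t in M. (\<lambda>i. n (\<sigma> i t - g t)) \<longlonglongrightarrow> 0" by (rule strongly_measurableD[OF g], rule that)
  from borel_measurable_implies_sequence_metric[OF a, of 0] obtain b where
    "(\<forall>i::nat. simple_function M (b i)) \<and> (\<forall>t\<in>space M. (\<lambda>i. b i t) \<longlonglongrightarrow> a t) \<and>
     (\<forall>i. \<forall>t\<in>space M. dist (b i t) 0 \<le> 2 * dist (a t) 0)" ..
  then have b: "\<And>i::nat. simple_function M (b i)" "\<And>t. t \<in> space M \<Longrightarrow> (\<lambda>i. b i t) \<longlonglongrightarrow> a t" by auto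
  show ?thesis
  proof (rule strongly_measurableI)
    show "simple_on M X (\<lambda>t. b i t *\<^sub>R \<sigma> i t)" for i
      using simple_function_compose2[OF b(1) simple_onD(1)[OF \<sigma>(1)], of "(*\<^sub>R)" i i]
        simple_onD(2)[OF \<sigma>(1)]
      unfolding simple_on_def by (auto intro!: carrier_scale[OF N])
    show "AE t in M. a t *\<^sub>R g t \<in> X" using \<sigma>(2) by eventually_elim (rule carrier_scale[OF N])
    show "AE t in M. (\<lambda>i. n (b i t *\<^sub>R \<sigma> i t - a t *\<^sub>R g t)) \<longlonglongrightarrow> 0"
      using \<sigma>(2,3) AE_space
    proof eventually_elim
      fix t assume t: "g t \<in> X" "(\<lambda>i. n (\<sigma> i t - g t)) \<longlonglongrightarrow> 0" "t \<in> space M"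
      have s: "\<sigma> i t - g t \<in> X" for i
        using simple_onD(2)[OF \<sigma>(1) t(3)] t by (auto intro: carrier_diff[OF N])
      have eq: "b i t *\<^sub>R \<sigma> i t - a t *\<^sub>R g t = b i t *\<^sub>R (\<sigma> i t - g t) + (b i t - a t) *\<^sub>R g t" for i
        by (simp add: algebra_simps)
      show "(\<lambda>i. n (b i t *\<^sub>R \<sigma> i t - a t *\<^sub>R g t)) \<longlonglongrightarrow> 0"
      proof (rule Lim_null_comparison)
        have "n (b i t *\<^sub>R \<sigma> i t - a t *\<^sub>R g t) \<le> \<bar>b i t\<bar> * n (\<sigma> i t - g t) + \<bar>b i t - a t\<bar> * n (g t)" for i
          unfolding eq using carrier_norm_add[OF N carrier_scale[OF N s[of i], of "b i t"] carrier_scale[OF N t(1), of "b i t - a t"]]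
          by (simp add: carrier_norm_scale[OF N] s t(1))
        moreover have "0 \<le> n (b i t *\<^sub>R \<sigma> i t - a t *\<^sub>R g t)" for i
          unfolding eq by (intro carrier_norm_nonneg[OF N] carrier_add[OF N] carrier_scale[OF N] s t)
        ultimately show "\<forall>\<^sub>F i in sequentially. norm (n (b i t *\<^sub>R \<sigma> i t - a t *\<^sub>R g t))
            \<le> \<bar>b i t\<bar> * n (\<sigma> i t - g t) + \<bar>b i t - a t\<bar> * n (g t)" by simp
        have "(\<lambda>i. \<bar>b i t\<bar> * n (\<sigma> i t - g t) + \<bar>b i t - a t\<bar> * n (g t)) \<longlonglongrightarrow> \<bar>a t\<bar> * 0 + \<bar>a t - a t\<bar> * n (g t)"
          by (intro tendsto_intros b(2) t)
        then show "(\<lambda>i. \<bar>b i t\<bar> * n (\<sigma> i t - g t) + \<bar>b i t - a t\<bar> * n (g t)) \<longlonglongrightarrow> 0" by simp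
      qed
    qed
  qed
qed

lemma strongly_measurable_simple:
  assumes "normed_on X n" "simple_on M X \<sigma>"
  shows "strongly_measurable_on M X n \<sigma>"
  using assms simple_onD[OF assms(2)]
  by (intro strongly_measurableI[where \<sigma>="\<lambda>_. \<sigma>"]) (auto simp: carrier_norm_0)

lemma simple_on_subset:
  assumes "S \<in> sets lebesgue" "R \<in> sets lebesgue" "R \<subseteq> S" "simple_on (lebesgue_on S) X \<sigma>"
  shows "simple_on (lebesgue_on R) X \<sigma>"
proof -
  have s: "simple_function (lebesgue_on S) \<sigma>" "\<sigma> ` S \<subseteq> X" using assms(4) by (auto simp: simple_on_def)
  have "\<sigma> -` {x} \<inter> R \<in> sets (lebesgue_on R)" if "x \<in> \<sigma> ` R" for x
  proof -
    have "\<sigma> -` {x} \<inter> S \<in> sets (lebesgue_on S)" using s(1) that assms(3) unfolding simple_function_def by auto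
    then have "\<sigma> -` {x} \<inter> S \<in> sets lebesgue" using assms(1) by (simp add: sets_restrict_space_iff)
    then have "(\<sigma> -` {x} \<inter> S) \<inter> R \<in> sets lebesgue" using assms(2) by auto
    moreover have "(\<sigma> -` {x} \<inter> S) \<inter> R = \<sigma> -` {x} \<inter> R" using assms(3) by auto
    ultimately show ?thesis using assms(2) by (simp add: sets_restrict_space_iff)
  qed
  moreover have "finite (\<sigma> ` R)"
    using s(1) finite_subset[OF image_mono[OF assms(3)], of \<sigma>] unfolding simple_function_def by simp
  ultimately show ?thesis using s(2) assms(3) unfolding simple_on_def simple_function_def by auto
qed

lemma strongly_measurable_subset:
  assumes "S \<in> sets lebesgue" "R \<in> sets lebesgue" "R \<subseteq> S" "strongly_measurable_on (lebesgue_on S) X n g"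
  shows "strongly_measurable_on (lebesgue_on R) X n g"
proof -
  obtain \<sigma> where \<sigma>: "\<And>i::nat. simple_on (lebesgue_on S) X (\<sigma> i)" "AE t in lebesgue_on S. g t \<in> X"
    "AE t in lebesgue_on S. (\<lambda>i. n (\<sigma> i t - g t)) \<longlonglongrightarrow> 0" by (rule strongly_measurableD[OF assms(4)], rule that)
  show ?thesis
    by (rule strongly_measurableI[where \<sigma>=\<sigma>])
      (use \<sigma> assms simple_on_subset AE_lebesgue_on_subset in blast)+
qed

section \<open>Simple approximation and the Bochner integral in a dual space\<close>

lemma powr_add_le:
  fixes a b r :: real
  assumes "a \<ge> 0" "b \<ge> 0" "r > 0"
  shows "(a + b) powr r \<le> 2 powr r * (a powr r + b powr r)"
proof -
  have "(a + b) powr r \<le> (2 * max a b) powr r" using assms by (intro powr_mono2) auto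
  also have "\<dots> = 2 powr r * max a b powr r" using assms by (simp add: powr_mult)
  also have "max a b powr r \<le> a powr r + b powr r" by (auto simp: max_def)
  finally show ?thesis by simp
qed

text \<open>Plays the role of Minkowski's inequality; the factor \<open>2 powr r\<close> does no
  harm, because only integrability and smallness matter.\<close>

lemma integrable_powr_bound:
  fixes a b c :: "'t \<Rightarrow> real"
  assumes c: "c \<in> borel_measurable M" and le: "AE t in M. 0 \<le> c t \<and> c t \<le> a t + b t \<and> 0 \<le> a t \<and> 0 \<le> b t"
    and a: "integrable M (\<lambda>t. a t powr r)" and b: "integrable M (\<lambda>t. b t powr r)" and r: "r > 0"
  shows "integrable M (\<lambda>t. c t powr r)"
    "(\<integral>t. c t powr r \<partial>M) \<le> 2 powr r * ((\<integral>t. a t powr r \<partial>M) + (\<integral>t. b t powr r \<partial>M))"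
proof -
  have int: "integrable M (\<lambda>t. 2 powr r * (a t powr r + b t powr r))" using a b by simp
  have bd: "AE t in M. c t powr r \<le> 2 powr r * (a t powr r + b t powr r)"
    using le
  proof eventually_elim
    fix t assume t: "0 \<le> c t \<and> c t \<le> a t + b t \<and> 0 \<le> a t \<and> 0 \<le> b t"
    then have "c t powr r \<le> (a t + b t) powr r" using r by (intro powr_mono2) auto
    also have "\<dots> \<le> 2 powr r * (a t powr r + b t powr r)" using t r by (intro powr_add_le) auto
    finally show "c t powr r \<le> 2 powr r * (a t powr r + b t powr r)" .
  qed
  show i: "integrable M (\<lambda>t. c t powr r)"
  proof (rule Bochner_Integration.integrable_bound[OF int])
    show "(\<lambda>t. c t powr r) \<in> borel_measurable M" using c by measurable
    show "AE t in M. norm (c t powr r) \<le> norm (2 powr r * (a t powr r + b t powr r))"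
      using bd by eventually_elim simp
  qed
  have "(\<integral>t. c t powr r \<partial>M) \<le> (\<integral>t. 2 powr r * (a t powr r + b t powr r) \<partial>M)"
    by (rule integral_mono_AE[OF i int bd])
  also have "\<dots> = 2 powr r * ((\<integral>t. a t powr r \<partial>M) + (\<integral>t. b t powr r \<partial>M))" using a b by simp
  finally show "(\<integral>t. c t powr r \<partial>M) \<le> 2 powr r * ((\<integral>t. a t powr r \<partial>M) + (\<integral>t. b t powr r \<partial>M))" .
qed

text \<open>The approximating simple functions are cut off where they exceed twice the norm of \<open>g\<close>, so
  that dominated convergence applies.\<close>

lemma simple_approximation:
  assumes S: "S \<in> lmeasurable" and N: "normed_on X n"
    and g: "strongly_measurable_on (lebesgue_on S) X n g"
    and int: "integrable (lebesgue_on S) (\<lambda>t. n (g t) powr r)" and r: "r > 0" and e: "e > 0"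
  obtains \<tau> where "simple_on (lebesgue_on S) X \<tau>" "integrable (lebesgue_on S) (\<lambda>t. n (g t - \<tau> t) powr r)"
    "(\<integral>t. n (g t - \<tau> t) powr r \<partial>lebesgue_on S) < e"
proof -
  let ?M = "lebesgue_on S"
  have Sl: "S \<in> sets lebesgue" using S by (simp add: fmeasurable_def)
  interpret finite_measure ?M by (rule finite_measure_lebesgue_on[OF S])
  obtain \<sigma> where \<sigma>: "\<And>i::nat. simple_on ?M X (\<sigma> i)" "AE t in ?M. g t \<in> X"
    "AE t in ?M. (\<lambda>i. n (\<sigma> i t - g t)) \<longlonglongrightarrow> 0" by (rule strongly_measurableD[OF g], rule that)
  have gm [measurable]: "(\<lambda>t. n (g t)) \<in> borel_measurable ?M" by (rule strongly_measurable_norm[OF Sl N g])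
  have \<sigma>m [measurable]: "(\<lambda>t. n (\<sigma> i t)) \<in> borel_measurable ?M" for i by (rule simple_on_borel[OF \<sigma>(1)])
  \<comment> \<open>The summand 1 switches the cut-off off in the limit even where
    \<open>g t\<close> has norm 0; the finite measure of \<open>S\<close> keeps the resulting bound
    \<open>3 * n (g t) + 1\<close> integrable to the power \<open>r\<close>.\<close>
  define A where "A i = {t \<in> space ?M. n (\<sigma> i t) \<le> 2 * n (g t) + 1}" for i
  have A [measurable]: "A i \<in> sets ?M" for i unfolding A_def by measurable
  define \<tau> where "\<tau> i t = (if t \<in> A i then \<sigma> i t else 0)" for i t
  have \<tau>: "simple_on ?M X (\<tau> i)" for i
  proof -
    have "simple_function ?M (\<tau> i)" unfolding \<tau>_def
      using simple_onD(1)[OF \<sigma>(1)] A sets.sets_into_space[OF A]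
      by (intro simple_function_If_set) (auto simp: Int_absorb2)
    then show ?thesis using simple_onD(2)[OF \<sigma>(1)] carrier_0[OF N] unfolding simple_on_def \<tau>_def by auto
  qed
  have w: "integrable ?M (\<lambda>t. (3 * n (g t) + 1) powr r)"
  proof (rule integrable_powr_bound(1)[where a="\<lambda>t. 3 * n (g t)" and b="\<lambda>t. 1"])
    show "AE t in ?M. 0 \<le> 3 * n (g t) + 1 \<and> 3 * n (g t) + 1 \<le> 3 * n (g t) + 1 \<and> 0 \<le> 3 * n (g t) \<and> (0::real) \<le> 1"
      using \<sigma>(2) by eventually_elim (use carrier_norm_nonneg[OF N] in auto)
    have "AE t in ?M. (3 * n (g t)) powr r = 3 powr r * n (g t) powr r"
      using \<sigma>(2) by eventually_elim (use carrier_norm_nonneg[OF N] in \<open>auto simp: powr_mult\<close>)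
    then show "integrable ?M (\<lambda>t. (3 * n (g t)) powr r)"
      using int by (subst integrable_cong_AE[where g="\<lambda>t. 3 powr r * n (g t) powr r"]) auto
  qed (use r in auto)
  have mem: "\<tau> i t \<in> X" if "t \<in> space ?M" for i t using simple_onD(2)[OF \<tau> that] .
  have dm: "(\<lambda>t. n (g t - \<tau> i t)) \<in> borel_measurable ?M" for i
    by (intro strongly_measurable_norm[OF Sl N] strongly_measurable_diff[OF N] g strongly_measurable_simple[OF N] \<tau>)
  have bd: "AE t in ?M. norm (n (g t - \<tau> i t) powr r) \<le> (3 * n (g t) + 1) powr r" for i
    using \<sigma>(2) AE_space
  proof eventually_elim
    fix t assume t: "g t \<in> X" "t \<in> space ?M"
    have "n (\<tau> i t) \<le> 2 * n (g t) + 1"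
      using carrier_norm_nonneg[OF N t(1)] t(2) by (auto simp: \<tau>_def A_def carrier_norm_0[OF N])
    then have "n (g t - \<tau> i t) \<le> 3 * n (g t) + 1"
      using carrier_norm_diff[OF N t(1) mem[OF t(2)], of i] by linarith
    then show "norm (n (g t - \<tau> i t) powr r) \<le> (3 * n (g t) + 1) powr r"
      using carrier_norm_nonneg[OF N carrier_diff[OF N t(1) mem[OF t(2)]]] r by (auto intro: powr_mono2)
  qed
  have lim: "AE t in ?M. (\<lambda>i. n (g t - \<tau> i t) powr r) \<longlonglongrightarrow> 0"
    using \<sigma>(2,3) AE_space
  proof eventually_elim
    fix t assume t: "g t \<in> X" "(\<lambda>i. n (\<sigma> i t - g t)) \<longlonglongrightarrow> 0" "t \<in> space ?M"
    have st: "\<sigma> i t \<in> X" for i using simple_onD(2)[OF \<sigma>(1) t(3)] .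
    have "n (g t) \<ge> 0" by (rule carrier_norm_nonneg[OF N t(1)])
    have "\<forall>\<^sub>F i in sequentially. n (\<sigma> i t - g t) < 1" using t(2) by (rule order_tendstoD) simp
    then have "\<forall>\<^sub>F i in sequentially. n (\<sigma> i t - g t) = n (g t - \<tau> i t)"
    proof eventually_elim
      fix i assume "n (\<sigma> i t - g t) < 1"
      then have "n (\<sigma> i t) \<le> 2 * n (g t) + 1"
        using carrier_norm_diff_abs[OF N st[of i] t(1)] \<open>n (g t) \<ge> 0\<close> by linarith
      then show "n (\<sigma> i t - g t) = n (g t - \<tau> i t)"
        using t(3) carrier_norm_commute[OF N st[of i] t(1)] by (auto simp: \<tau>_def A_def)
    qed
    with t(2) have "(\<lambda>i. n (g t - \<tau> i t)) \<longlonglongrightarrow> 0" by (rule Lim_transform_eventually)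
    then show "(\<lambda>i. n (g t - \<tau> i t) powr r) \<longlonglongrightarrow> 0"
      using r carrier_norm_nonneg[OF N carrier_diff[OF N t(1) mem[OF t(3)]]]
      by (intro tendsto_zero_powrI[where b=r]) auto
  qed
  have m: "(\<lambda>t. n (g t - \<tau> i t) powr r) \<in> borel_measurable ?M" for i using dm by measurable
  have "(\<lambda>i. \<integral>t. n (g t - \<tau> i t) powr r \<partial>?M) \<longlonglongrightarrow> (\<integral>t. 0 \<partial>?M)"
    by (rule integral_dominated_convergence[OF _ m w lim bd]) auto
  then have "\<forall>\<^sub>F i in sequentially. (\<integral>t. n (g t - \<tau> i t) powr r \<partial>?M) < e"
    using e by (intro order_tendstoD(2)) auto
  then obtain i where "(\<integral>t. n (g t - \<tau> i t) powr r \<partial>?M) < e" by (auto simp: eventually_sequentially)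
  moreover have "integrable ?M (\<lambda>t. n (g t - \<tau> i t) powr r)"
    by (rule Bochner_Integration.integrable_bound[OF w m], use bd[of i] in eventually_elim) auto
  ultimately show thesis using that \<tau> by blast
qed

lemma linear_eval: "linear (\<lambda>\<phi>::'a \<Rightarrow> real. \<phi> y)"
  by (rule linearI) (auto simp: scaleR_fun_def)

text \<open>Evaluation at \<open>y\<close> is linear, so it passes through the finite sum that
  defines the integral of a simple function. This is the link from vector-valued to scalar
  integrals.\<close>

lemma simple_integral_eval:
  fixes \<sigma> :: "real \<Rightarrow> 'a \<Rightarrow> real"
  assumes M: "finite_measure M" and s: "simple_function M \<sigma>"
  shows "Bochner_Integration.simple_bochner_integral M \<sigma> y = (\<integral>t. \<sigma> t y \<partial>M)" "integrable M (\<lambda>t. \<sigma> t y)"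
proof -
  interpret finite_measure M by fact
  have i: "Bochner_Integration.simple_bochner_integrable M \<sigma>" by (rule simple_bochner_integrable.intros[OF s]) simp
  have s': "simple_function M (\<lambda>t. \<sigma> t y)" using simple_function_compose[OF s, of "\<lambda>\<phi>. \<phi> y"] by (simp add: comp_def)
  have i': "Bochner_Integration.simple_bochner_integrable M (\<lambda>t. \<sigma> t y)" by (rule simple_bochner_integrable.intros[OF s']) simp
  show "Bochner_Integration.simple_bochner_integral M \<sigma> y = (\<integral>t. \<sigma> t y \<partial>M)"
    using simple_bochner_integral_linear[OF linear_eval i, of y] simple_bochner_integrable_eq_integral[OF i'] by simp
  show "integrable M (\<lambda>t. \<sigma> t y)"
    using has_bochner_integral_simple_bochner_integrable[OF i'] by (auto simp: integrable.simps)
qed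

context
  fixes S :: "real set" and Y :: "'a::real_vector set" and n :: "'a \<Rightarrow> real" and g :: "real \<Rightarrow> 'a \<Rightarrow> real"
  assumes S: "S \<in> lmeasurable" and N: "normed_on Y n"
    and g: "strongly_measurable_on (lebesgue_on S) (dual_space Y n) (dual_norm Y n) g"
    and int: "integrable (lebesgue_on S) (\<lambda>t. dual_norm Y n (g t))"
begin

lemma dual_AE: "AE t in lebesgue_on S. g t \<in> dual_space Y n"
  using g unfolding strongly_measurable_on_def by (auto elim: eventually_mono)

lemma dual_eval_measurable: "y \<in> Y \<Longrightarrow> (\<lambda>t. g t y) \<in> borel_measurable (lebesgue_on S)"
proof (rule strongly_measurable_lipschitz[OF _ g, where C="n y"])
  fix \<phi> \<psi> assume y: "y \<in> Y" and "\<phi> \<in> dual_space Y n" "\<psi> \<in> dual_space Y n"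
  then show "\<bar>\<phi> y - \<psi> y\<bar> \<le> n y * dual_norm Y n (\<phi> - \<psi>)"
    using dual_bound[OF N carrier_diff[OF normed_on_dual[OF N]] y, of \<phi> \<psi>] by (simp add: mult.commute)
qed (use S in \<open>simp add: fmeasurable_def\<close>)

lemma dual_eval_integrable: assumes y: "y \<in> Y" shows "integrable (lebesgue_on S) (\<lambda>t. g t y)"
proof (rule Bochner_Integration.integrable_bound[of _ "\<lambda>t. dual_norm Y n (g t) * n y"])
  show "AE t in lebesgue_on S. norm (g t y) \<le> norm (dual_norm Y n (g t) * n y)"
    using dual_AE by eventually_elim (use dual_bound[OF N _ y] in force)
qed (use int dual_eval_measurable[OF y] in auto)

text \<open>The integral in the weak-star sense, set to 0 outside \<open>Y\<close> to be an element
  of the dual in the sense used here.\<close>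

definition "dual_integral y = (if y \<in> Y then \<integral>t. g t y \<partial>lebesgue_on S else 0)"

lemma dual_integral_mem: "dual_integral \<in> dual_space Y n"
proof (rule dual_spaceI[OF N, where C="\<integral>t. dual_norm Y n (g t) \<partial>lebesgue_on S"])
  fix x y assume xy: "x \<in> Y" "y \<in> Y"
  have "(\<integral>t. g t (x + y) \<partial>lebesgue_on S) = (\<integral>t. g t x + g t y \<partial>lebesgue_on S)"
    using dual_AE by (intro integral_cong_AE borel_measurable_add dual_eval_measurable carrier_add[OF N] xy)
      (auto elim!: eventually_mono simp: dual_add[OF N _ xy])
  then show "dual_integral (x + y) = dual_integral x + dual_integral y"
    using xy carrier_add[OF N xy] dual_eval_integrable by (simp add: dual_integral_def)
next
  fix c x assume x: "x \<in> Y"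
  have "(\<integral>t. g t (c *\<^sub>R x) \<partial>lebesgue_on S) = (\<integral>t. c * g t x \<partial>lebesgue_on S)"
    using dual_AE by (intro integral_cong_AE borel_measurable_times borel_measurable_const dual_eval_measurable carrier_scale[OF N] x)
      (auto elim!: eventually_mono simp: dual_scale[OF N _ x])
  then show "dual_integral (c *\<^sub>R x) = c * dual_integral x"
    using x carrier_scale[OF N x] by (simp add: dual_integral_def)
next
  fix x assume x: "x \<in> Y"
  have "\<bar>\<integral>t. g t x \<partial>lebesgue_on S\<bar> \<le> (\<integral>t. \<bar>g t x\<bar> \<partial>lebesgue_on S)" by (rule integral_abs_bound)
  also have "\<dots> \<le> (\<integral>t. dual_norm Y n (g t) * n x \<partial>lebesgue_on S)"
  proof (rule integral_mono_AE)
    show "AE t in lebesgue_on S. \<bar>g t x\<bar> \<le> dual_norm Y n (g t) * n x"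
      using dual_AE by eventually_elim (rule dual_bound[OF N _ x])
  qed (use dual_eval_integrable[OF x] int in auto)
  also have "\<dots> = (\<integral>t. dual_norm Y n (g t) \<partial>lebesgue_on S) * n x" by simp
  finally show "\<bar>dual_integral x\<bar> \<le> (\<integral>t. dual_norm Y n (g t) \<partial>lebesgue_on S) * n x"
    using x by (simp add: dual_integral_def)
qed (simp add: dual_integral_def)

text \<open>Turns every Bochner integral of functionals, in the weak derivative as well as in the
  scheme, into scalar integrals. Existence follows from approximation in \<open>L\<^sup>1\<close>,
  where the estimate at each vector \<open>y\<close> bounds the dual norm; uniqueness holds because
  the evaluations of any candidate are limits of the same scalar integrals.\<close>

lemma bochner_dual: "bochner_integral_on (lebesgue_on S) (dual_space Y n) (dual_norm Y n) g = dual_integral"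
proof -
  let ?M = "lebesgue_on S" and ?D = "dual_space Y n" and ?N = "dual_norm Y n"
  note D = normed_on_dual[OF N]
  have fm: "finite_measure ?M" by (rule finite_measure_lebesgue_on[OF S])
  have Sl: "S \<in> sets lebesgue" using S by (simp add: fmeasurable_def)
  \<comment> \<open>Stated in the extended nonnegative reals, because the integrals of the errors of
    a candidate's sequence may be infinite for some indices.\<close>
  have key: "ennreal \<bar>Bochner_Integration.simple_bochner_integral ?M \<sigma> y - dual_integral y\<bar> \<le> (\<integral>\<^sup>+t. ennreal (?N (g t - \<sigma> t)) \<partial>?M) * ennreal (n y)"
    if \<sigma>: "simple_on ?M ?D \<sigma>" and y: "y \<in> Y" for \<sigma> y
  proof -
    have m: "(\<lambda>t. ?N (g t - \<sigma> t)) \<in> borel_measurable ?M"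
      by (intro strongly_measurable_norm[OF Sl D] strongly_measurable_diff[OF D] g strongly_measurable_simple[OF D] \<sigma>)
    have "Bochner_Integration.simple_bochner_integral ?M \<sigma> y - dual_integral y = (\<integral>t. \<sigma> t y - g t y \<partial>?M)"
      using simple_integral_eval[OF fm simple_onD(1)[OF \<sigma>]] dual_eval_integrable[OF y] y by (simp add: dual_integral_def)
    then have "ennreal \<bar>Bochner_Integration.simple_bochner_integral ?M \<sigma> y - dual_integral y\<bar> \<le> (\<integral>\<^sup>+t. ennreal (norm (\<sigma> t y - g t y)) \<partial>?M)"
      using integral_norm_bound_ennreal[of ?M "\<lambda>t. \<sigma> t y - g t y"]
        simple_integral_eval(2)[OF fm simple_onD(1)[OF \<sigma>], of y] dual_eval_integrable[OF y] by simp
    also have "\<dots> \<le> (\<integral>\<^sup>+t. ennreal (?N (g t - \<sigma> t)) * ennreal (n y) \<partial>?M)"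
    proof (rule nn_integral_mono_AE)
      show "AE t in ?M. ennreal (norm (\<sigma> t y - g t y)) \<le> ennreal (?N (g t - \<sigma> t)) * ennreal (n y)"
        using dual_AE AE_space
      proof eventually_elim
        fix t assume t: "g t \<in> ?D" "t \<in> space ?M"
        have d: "g t - \<sigma> t \<in> ?D" using carrier_diff[OF D t(1) simple_onD(2)[OF \<sigma> t(2)]] .
        have "norm (\<sigma> t y - g t y) \<le> ?N (g t - \<sigma> t) * n y"
          using dual_bound[OF N d y] by (simp add: abs_minus_commute)
        then show "ennreal (norm (\<sigma> t y - g t y)) \<le> ennreal (?N (g t - \<sigma> t)) * ennreal (n y)"
          using dual_norm_nonneg[OF N d] carrier_norm_nonneg[OF N y] by (simp flip: ennreal_mult)
      qed
    qed
    also have "\<dots> = (\<integral>\<^sup>+t. ennreal (?N (g t - \<sigma> t)) \<partial>?M) * ennreal (n y)"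
      using m by (intro nn_integral_multc) measurable
    finally show ?thesis .
  qed
  have "has_bochner_integral_on ?M ?D ?N g dual_integral"
  proof -
    have int1: "integrable ?M (\<lambda>t. ?N (g t) powr 1)"
    proof (rule Bochner_Integration.integrable_bound[OF int])
      show "(\<lambda>t. ?N (g t) powr 1) \<in> borel_measurable ?M" using int by measurable
    qed auto
    have "\<exists>\<tau>. simple_on ?M ?D \<tau> \<and> integrable ?M (\<lambda>t. ?N (g t - \<tau> t) powr 1) \<and> (\<integral>t. ?N (g t - \<tau> t) powr 1 \<partial>?M) < 1 / Suc i" for i
      by (rule simple_approximation[where e="1 / Suc i" and r=1 and n="?N", OF S D g int1]) auto
    then have "\<forall>i. \<exists>\<tau>. simple_on ?M ?D \<tau> \<and> integrable ?M (\<lambda>t. ?N (g t - \<tau> t) powr 1) \<and> (\<integral>t. ?N (g t - \<tau> t) powr 1 \<partial>?M) < 1 / Suc i" by blast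
    from choice[OF this] obtain \<tau> where \<tau>0: "\<forall>i. simple_on ?M ?D (\<tau> i) \<and> integrable ?M (\<lambda>t. ?N (g t - \<tau> i t) powr 1) \<and>
      (\<integral>t. ?N (g t - \<tau> i t) powr 1 \<partial>?M) < 1 / Suc i" ..
    then have \<tau>: "\<And>i. simple_on ?M ?D (\<tau> i)" "\<And>i. integrable ?M (\<lambda>t. ?N (g t - \<tau> i t) powr 1)"
      "\<And>i. (\<integral>t. ?N (g t - \<tau> i t) powr 1 \<partial>?M) < 1 / Suc i" by auto
    have pos: "AE t in ?M. 0 \<le> ?N (g t - \<tau> i t)" for i
      using dual_AE AE_space
      by eventually_elim (intro dual_norm_nonneg[OF N] carrier_diff[OF D] simple_onD(2)[OF \<tau>(1)])
    have nn: "(\<integral>\<^sup>+t. ennreal (?N (g t - \<tau> i t)) \<partial>?M) = ennreal (\<integral>t. ?N (g t - \<tau> i t) powr 1 \<partial>?M)" for i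
    proof -
      have "(\<integral>\<^sup>+t. ennreal (?N (g t - \<tau> i t)) \<partial>?M) = (\<integral>\<^sup>+t. ennreal (?N (g t - \<tau> i t) powr 1) \<partial>?M)"
        using pos[of i] by (intro nn_integral_cong_AE) (auto elim!: eventually_mono)
      also have "\<dots> = ennreal (\<integral>t. ?N (g t - \<tau> i t) powr 1 \<partial>?M)" using \<tau>(2) by (intro nn_integral_eq_integral) auto
      finally show ?thesis .
    qed
    have l0: "(\<lambda>i. \<integral>t. ?N (g t - \<tau> i t) powr 1 \<partial>?M) \<longlonglongrightarrow> 0"
      by (rule tendsto_sandwich[OF _ _ tendsto_const LIMSEQ_inverse_real_of_nat])
        (use \<tau>(3) in \<open>auto simp: inverse_eq_divide less_imp_le\<close>)
    then have l1: "(\<lambda>i. \<integral>\<^sup>+t. ennreal (?N (g t - \<tau> i t)) \<partial>?M) \<longlonglongrightarrow> 0"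
      unfolding nn using tendsto_ennrealI[OF l0] by simp
    have "?N (Bochner_Integration.simple_bochner_integral ?M (\<tau> i) - dual_integral) \<le> (\<integral>t. ?N (g t - \<tau> i t) powr 1 \<partial>?M)" for i
    proof (rule dual_norm_leI[OF N])
      fix y assume y: "y \<in> Y"
      show "\<bar>(Bochner_Integration.simple_bochner_integral ?M (\<tau> i) - dual_integral) y\<bar> \<le> (\<integral>t. ?N (g t - \<tau> i t) powr 1 \<partial>?M) * n y"
        using key[OF \<tau>(1)[of i] y] carrier_norm_nonneg[OF N y] unfolding nn
        by (simp flip: ennreal_mult add: ennreal_le_iff)
    qed simp
    moreover have "0 \<le> ?N (Bochner_Integration.simple_bochner_integral ?M (\<tau> i) - dual_integral)" for i
    proof (intro dual_norm_nonneg[OF N] carrier_diff[OF D] dual_integral_mem)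
      show "Bochner_Integration.simple_bochner_integral ?M (\<tau> i) \<in> ?D"
        unfolding simple_bochner_integral_def using simple_onD(2)[OF \<tau>(1)]
        by (intro subspace_sum carrier_subspace[OF D] carrier_scale[OF D]) auto
    qed
    ultimately have "(\<lambda>i. ?N (Bochner_Integration.simple_bochner_integral ?M (\<tau> i) - dual_integral)) \<longlonglongrightarrow> 0"
      by (intro tendsto_sandwich[OF _ _ tendsto_const l0]) auto
    then show ?thesis
      unfolding has_bochner_integral_on_def using dual_integral_mem g l1 \<tau>(1) by blast
  qed
  moreover have "I = dual_integral" if I: "has_bochner_integral_on ?M ?D ?N g I" for I
  proof
    fix y
    obtain \<sigma> where \<sigma>: "\<And>i::nat. simple_on ?M ?D (\<sigma> i)"
      "(\<lambda>i. \<integral>\<^sup>+t. ennreal (?N (g t - \<sigma> i t)) \<partial>?M) \<longlonglongrightarrow> 0"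
      "(\<lambda>i. ?N (Bochner_Integration.simple_bochner_integral ?M (\<sigma> i) - I)) \<longlonglongrightarrow> 0" and ID: "I \<in> ?D"
      using I unfolding has_bochner_integral_on_def by blast
    show "I y = dual_integral y"
    proof (cases "y \<in> Y")
      case False
      then show ?thesis using dual_outside[OF N ID] dual_outside[OF N dual_integral_mem] by simp
    next
      case y: True
      have "(\<lambda>i. (\<integral>\<^sup>+t. ennreal (?N (g t - \<sigma> i t)) \<partial>?M) * ennreal (n y)) \<longlonglongrightarrow> 0"
        using ennreal_tendsto_cmult[OF _ \<sigma>(2), of "ennreal (n y)"] by (simp add: mult.commute)
      from tendsto_sandwich[OF _ _ tendsto_const this, of "\<lambda>i. ennreal \<bar>Bochner_Integration.simple_bochner_integral ?M (\<sigma> i) y - dual_integral y\<bar>"]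
      have "(\<lambda>i. ennreal \<bar>Bochner_Integration.simple_bochner_integral ?M (\<sigma> i) y - dual_integral y\<bar>) \<longlonglongrightarrow> ennreal 0"
        using key[OF \<sigma>(1) y] by simp
      then have a: "(\<lambda>i. \<bar>Bochner_Integration.simple_bochner_integral ?M (\<sigma> i) y - dual_integral y\<bar>) \<longlonglongrightarrow> 0"
        by (rule tendsto_ennrealD) auto
      have sD: "Bochner_Integration.simple_bochner_integral ?M (\<sigma> i) \<in> ?D" for i
        unfolding simple_bochner_integral_def using simple_onD(2)[OF \<sigma>(1)]
        by (intro subspace_sum carrier_subspace[OF D] carrier_scale[OF D]) auto
      have b: "(\<lambda>i. \<bar>Bochner_Integration.simple_bochner_integral ?M (\<sigma> i) y - I y\<bar>) \<longlonglongrightarrow> 0"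
      proof (rule tendsto_sandwich[OF _ _ tendsto_const tendsto_mult_left_zero[OF \<sigma>(3)]])
        show "\<forall>\<^sub>F i in sequentially. \<bar>Bochner_Integration.simple_bochner_integral ?M (\<sigma> i) y - I y\<bar> \<le> ?N (Bochner_Integration.simple_bochner_integral ?M (\<sigma> i) - I) * n y"
          using dual_bound[OF N carrier_diff[OF D sD ID] y] by simp
      qed auto
      have "(\<lambda>i. Bochner_Integration.simple_bochner_integral ?M (\<sigma> i) y) \<longlonglongrightarrow> dual_integral y"
        using a by (simp add: tendsto_rabs_zero_iff LIM_zero_iff)
      moreover have "(\<lambda>i. Bochner_Integration.simple_bochner_integral ?M (\<sigma> i) y) \<longlonglongrightarrow> I y"
        using b by (simp add: tendsto_rabs_zero_iff LIM_zero_iff)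
      ultimately show ?thesis using LIMSEQ_unique by blast
    qed
  qed
  ultimately show ?thesis unfolding bochner_integral_on_def by (rule the_equality)
qed

end


section \<open>Grids and averages\<close>

lemma integrable_lebesgue_on_subset:
  fixes F :: "real \<Rightarrow> real"
  assumes "integrable (lebesgue_on S) F" "S \<in> sets lebesgue" "R \<in> sets lebesgue" "R \<subseteq> S"
  shows "integrable (lebesgue_on R) F"
proof -
  have "integrable lebesgue (\<lambda>x. indicator S x *\<^sub>R F x)"
    using assms by (simp add: integrable_restrict_space)
  then have "integrable lebesgue (\<lambda>x. indicator R x *\<^sub>R (indicator S x *\<^sub>R F x))"
    by (rule integrable_mult_indicator[OF assms(3)])
  moreover have "(\<lambda>x. indicator R x *\<^sub>R (indicator S x *\<^sub>R F x)) = (\<lambda>x. indicator R x *\<^sub>R F x)"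
    using assms(4) by (auto simp: indicator_def fun_eq_iff)
  ultimately show ?thesis using assms by (simp add: integrable_restrict_space)
qed

text \<open>Passes to the integral over a closed interval, for which splitting at a point and
  continuity in the upper limit are at hand.\<close>

lemma lebesgue_open_interval:
  fixes F :: "real \<Rightarrow> real"
  assumes "integrable (lebesgue_on {a<..<b}) F"
  shows "F integrable_on {a..b}" "(\<integral>t. F t \<partial>lebesgue_on {a<..<b}) = integral {a..b} F"
  using integrable_on_lebesgue_on[OF assms] lebesgue_integral_eq_integral[OF assms]
  by (auto simp: integrable_on_open_interval_real integral_open_interval_real)

lemma integral_open_combine:
  fixes F :: "real \<Rightarrow> real"
  assumes F: "integrable (lebesgue_on {a<..<b}) F" and c: "a \<le> c" "c \<le> b"
  shows "(\<integral>t. F t \<partial>lebesgue_on {a<..<b}) = (\<integral>t. F t \<partial>lebesgue_on {a<..<c}) + (\<integral>t. F t \<partial>lebesgue_on {c<..<b})"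
proof -
  have "integrable (lebesgue_on {a<..<c}) F" "integrable (lebesgue_on {c<..<b}) F"
    by (rule integrable_lebesgue_on_subset[OF F]; use c in auto)+
  then show ?thesis
    using lebesgue_open_interval F Henstock_Kurzweil_Integration.integral_combine[OF c, of F] by simp
qed

lemma open_interval_lmeasurable: "{a<..<b::real} \<in> lmeasurable" "{a<..<b::real} \<in> sets lebesgue"
  by auto

lemma finite_measure_open_interval: "finite_measure (lebesgue_on {a<..<b::real})"
  by (rule finite_measure_lebesgue_on) auto

lemma integral_const_open_interval: "a \<le> b \<Longrightarrow> (\<integral>t. c \<partial>lebesgue_on {a<..<b}) = (b - a) * (c::real)"
  by (simp add: measure_restrict_space)

text \<open>Rounding up puts a grid point into the cell on its left, which matches the half-open
  cells of the prolongation. For \<open>t \<le> 0\<close> the value is 0, which is no cell.\<close>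

definition step_index :: "real \<Rightarrow> nat \<Rightarrow> real \<Rightarrow> nat" where
  "step_index T N t = nat \<lceil>t / (T / real N)\<rceil>"

lemma step_index_eq:
  assumes "T > 0" "N \<ge> 1" "m \<ge> 1"
  shows "step_index T N t = m \<longleftrightarrow> (real m - 1) * (T / real N) < t \<and> t \<le> real m * (T / real N)"
proof -
  have k: "T / real N > 0" using assms by simp
  have "step_index T N t = m \<longleftrightarrow> \<lceil>t / (T / real N)\<rceil> = int m" unfolding step_index_def using assms(3) by linarith
  also have "\<dots> \<longleftrightarrow> real m - 1 < t / (T / real N) \<and> t / (T / real N) \<le> real m" by (simp add: ceiling_eq_iff)
  also have "\<dots> \<longleftrightarrow> (real m - 1) * (T / real N) < t \<and> t \<le> real m * (T / real N)"
    using k by (simp only: pos_less_divide_eq pos_divide_le_eq)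
  finally show ?thesis .
qed

lemma step_index_range:
  assumes "T > 0" "N \<ge> 1" "0 < t" "t \<le> T"
  shows "step_index T N t \<in> {1..N}"
    "(real (step_index T N t) - 1) * (T / real N) < t" "t \<le> real (step_index T N t) * (T / real N)"
proof -
  have k: "T / real N > 0" using assms by simp
  have "0 < t / (T / real N)" using assms k by simp
  then have a: "1 \<le> step_index T N t" unfolding step_index_def by linarith
  have "t / (T / real N) \<le> real N" using assms by (simp add: pos_divide_le_eq)
  then have "step_index T N t \<le> N" unfolding step_index_def by (simp add: nat_le_iff ceiling_le_iff)
  with a show "step_index T N t \<in> {1..N}" by simp
  show "(real (step_index T N t) - 1) * (T / real N) < t" "t \<le> real (step_index T N t) * (T / real N)"
    using step_index_eq[OF assms(1,2) a, of t] by auto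
qed

lemma prolongation_eq:
  assumes "T > 0" "N \<ge> 1" "0 < t" "t \<le> T"
  shows "prolongation T N u0 W t = W (step_index T N t)"
proof -
  note r = step_index_range[OF assms]
  have "(THE n. n \<in> {1..N} \<and> t \<in> {(real n - 1) * (T / real N)<..real n * (T / real N)}) = step_index T N t"
  proof (rule the_equality)
    show "step_index T N t \<in> {1..N} \<and> t \<in> {(real (step_index T N t) - 1) * (T / real N)<..real (step_index T N t) * (T / real N)}"
      using r by auto
    fix n assume "n \<in> {1..N} \<and> t \<in> {(real n - 1) * (T / real N)<..real n * (T / real N)}"
    then show "n = step_index T N t" using step_index_eq[OF assms(1,2), of n t] by auto
  qed
  then show ?thesis using assms(3) by (simp add: prolongation_def)
qed

lemma step_simple_on:
  assumes "T > 0" "N \<ge> 1" "\<And>m. m \<in> {1..N} \<Longrightarrow> W m \<in> X"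
  shows "simple_on (lebesgue_on {0<..<T}) X (\<lambda>t. W (step_index T N t))"
proof -
  let ?M = "lebesgue_on {0<..<T}"
  have r: "step_index T N t \<in> {1..N}" if "0 < t" "t < T" for t using step_index_range(1)[OF assms(1,2) that(1)] that by auto
  have "simple_function ?M (step_index T N)"
    unfolding simple_function_def
  proof (intro conjI ballI)
    have "step_index T N ` space ?M \<subseteq> {1..N}" using r by auto
    then show "finite (step_index T N ` space ?M)" by (rule finite_subset) simp
    fix m assume "m \<in> step_index T N ` space ?M"
    then have "m \<ge> 1" using r by auto
    note eq = step_index_eq[OF assms(1,2) this]
    have "step_index T N -` {m} \<inter> space ?M = {(real m - 1) * (T / real N)<..real m * (T / real N)} \<inter> {0<..<T}"
      by (rule set_eqI) (simp only: Int_iff vimage_singleton_eq greaterThanAtMost_iff eq space_lebesgue_on)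
    also have "\<dots> \<in> sets ?M" by (subst sets_restrict_space_iff) auto
    finally show "step_index T N -` {m} \<inter> space ?M \<in> sets ?M" .
  qed
  from simple_function_compose[OF this, of W] show ?thesis
    using r assms(3) unfolding simple_on_def by (auto simp: comp_def)
qed

lemma step_measurable [measurable]:
  assumes "T > 0" "N \<ge> 1"
  shows "(\<lambda>t. W (step_index T N t) :: real) \<in> borel_measurable (lebesgue_on {0<..<T})"
  using simple_on_borel[OF step_simple_on[OF assms, where X=UNIV and W=W], of "\<lambda>x. x"] by simp

lemma step_integrable:
  assumes "T > 0" "N \<ge> 1"
  shows "integrable (lebesgue_on {0<..<T}) (\<lambda>t. W (step_index T N t) :: real)"
proof -
  interpret finite_measure "lebesgue_on {0<..<T}" by (rule finite_measure_open_interval)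
  show ?thesis
  proof (rule integrable_const_bound[where B="\<Sum>m=1..N. \<bar>W m\<bar>"])
    show "AE t in lebesgue_on {0<..<T}. norm (W (step_index T N t)) \<le> (\<Sum>m=1..N. \<bar>W m\<bar>)"
    proof (rule AE_I2)
      fix t assume "t \<in> space (lebesgue_on {0<..<T})"
      then have "step_index T N t \<in> {1..N}" using step_index_range(1)[OF assms, of t] by auto
      then show "norm (W (step_index T N t)) \<le> (\<Sum>m=1..N. \<bar>W m\<bar>)"
        using member_le_sum[of "step_index T N t" "{1..N}" "\<lambda>m. \<bar>W m\<bar>"] by simp
    qed
  qed (rule step_measurable[OF assms])
qed

lemma integral_split_grid:
  fixes F :: "real \<Rightarrow> real"
  assumes "T > 0" "N \<ge> 1" and F: "integrable (lebesgue_on {0<..<T}) F" and j: "j \<le> N"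
  shows "(\<integral>t. F t \<partial>lebesgue_on {0<..<real j * (T / real N)}) =
    (\<Sum>m=1..j. \<integral>t. F t \<partial>lebesgue_on {(real m - 1) * (T / real N)<..<real m * (T / real N)})"
  using j
proof (induction j)
  case (Suc j)
  have le: "real (Suc j) * (T / real N) \<le> T"
  proof -
    have "real (Suc j) * (T / real N) \<le> real N * (T / real N)"
      using Suc.prems assms by (intro mult_right_mono) auto
    then show ?thesis using assms(2) by simp
  qed
  have "(\<integral>t. F t \<partial>lebesgue_on {0<..<real (Suc j) * (T / real N)}) =
     (\<integral>t. F t \<partial>lebesgue_on {0<..<real j * (T / real N)}) +
     (\<integral>t. F t \<partial>lebesgue_on {real j * (T / real N)<..<real (Suc j) * (T / real N)})"
  proof (rule integral_open_combine[OF integrable_lebesgue_on_subset[OF F]])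
    show "{0<..<real (Suc j) * (T / real N)} \<subseteq> {0<..<T}" using le by (auto simp del: of_nat_Suc)
    show "real j * (T / real N) \<le> real (Suc j) * (T / real N)" using assms by (intro mult_right_mono) auto
  qed (use assms in auto)
  then show ?case using Suc by simp
qed simp

lemma step_integral:
  assumes "T > 0" "N \<ge> 1"
  shows "(\<integral>t. W (step_index T N t) \<partial>lebesgue_on {0<..<T}) = (T / real N) * (\<Sum>m=1..N. W m :: real)"
proof -
  have "(\<integral>t. W (step_index T N t) \<partial>lebesgue_on {0<..<T}) =
    (\<Sum>m=1..N. \<integral>t. W (step_index T N t) \<partial>lebesgue_on {(real m - 1) * (T / real N)<..<real m * (T / real N)})"
    using integral_split_grid[OF assms step_integrable[OF assms], of N W] assms by simp
  also have "\<dots> = (\<Sum>m=1..N. (T / real N) * W m)"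
  proof (rule sum.cong[OF refl])
    fix m assume m: "m \<in> {1..N}"
    have "(\<integral>t. W (step_index T N t) \<partial>lebesgue_on {(real m - 1) * (T / real N)<..<real m * (T / real N)})
      = (\<integral>t. W m \<partial>lebesgue_on {(real m - 1) * (T / real N)<..<real m * (T / real N)})"
    proof (rule Bochner_Integration.integral_cong[OF refl])
      fix t assume t: "t \<in> space (lebesgue_on {(real m - 1) * (T / real N)<..<real m * (T / real N)})"
      have "step_index T N t = m"
        using m t by (subst step_index_eq[OF assms]) (auto simp only: space_lebesgue_on greaterThanLessThan_iff atLeastAtMost_iff)
      then show "W (step_index T N t) = W m" by simp
    qed
    also have "\<dots> = (real m * (T / real N) - (real m - 1) * (T / real N)) * W m"
      using assms by (intro integral_const_open_interval mult_right_mono) auto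
    also have "real m * (T / real N) - (real m - 1) * (T / real N) = T / real N"
      by (simp only: left_diff_distrib mult_1 diff_diff_eq2 add_diff_cancel_left')
    finally show "(\<integral>t. W (step_index T N t) \<partial>lebesgue_on {(real m - 1) * (T / real N)<..<real m * (T / real N)}) = (T / real N) * W m" .
  qed
  finally show ?thesis by (simp add: sum_distrib_left)
qed

lemma integrable_from_powr:
  fixes F :: "real \<Rightarrow> real"
  assumes "finite_measure M" "F \<in> borel_measurable M" "integrable M (\<lambda>t. F t powr r)" "AE t in M. 0 \<le> F t" "r \<ge> 1"
  shows "integrable M F"
proof -
  interpret finite_measure M by fact
  show ?thesis
  proof (rule Bochner_Integration.integrable_bound[of M "\<lambda>t. 1 + F t powr r"])
    show "AE t in M. norm (F t) \<le> norm (1 + F t powr r)"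
      using assms(4)
    proof eventually_elim
      fix t assume t: "0 \<le> F t"
      have "F t \<le> 1 + F t powr r"
      proof (cases "F t \<le> 1")
        case False
        then have "F t powr 1 \<le> F t powr r" using assms(5) by (intro powr_mono) auto
        then show ?thesis using t by simp
      qed (simp add: add_increasing2)
      then show "norm (F t) \<le> norm (1 + F t powr r)" using t by simp
    qed
  qed (use assms in auto)
qed

text \<open>Follows from Young's inequality for \<open>F t\<close> and \<open>D powr (r - 1)\<close>
  with the mean \<open>D\<close>: the conjugate exponent \<open>r'\<close> satisfies
  \<open>(r - 1) * r' = r\<close>, so integration leaves \<open>D powr r\<close> on both sides, once
  with the factor \<open>1 / r'\<close>.\<close>

lemma jensen_powr:
  fixes F :: "real \<Rightarrow> real"
  assumes ab: "a < b" and F: "F \<in> borel_measurable (lebesgue_on {a<..<b})" and pos: "AE t in lebesgue_on {a<..<b}. 0 \<le> F t"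
    and int: "integrable (lebesgue_on {a<..<b}) (\<lambda>t. F t powr r)" and r: "r > 1"
  shows "((1 / (b - a)) * (\<integral>t. F t \<partial>lebesgue_on {a<..<b})) powr r \<le> (1 / (b - a)) * (\<integral>t. F t powr r \<partial>lebesgue_on {a<..<b})"
proof -
  let ?M = "lebesgue_on {a<..<b}"
  define D where "D = (1 / (b - a)) * (\<integral>t. F t \<partial>?M)"
  have i: "integrable ?M F" by (rule integrable_from_powr[OF finite_measure_open_interval F int pos]) (use r in simp)
  have D0: "D \<ge> 0" unfolding D_def using ab pos by (intro mult_nonneg_nonneg integral_nonneg_AE) auto
  define r' where "r' = r / (r - 1)"
  have r': "r' > 1" "1 / r + 1 / r' = 1" "(r - 1) * r' = r" using r by (auto simp: r'_def field_simps)
  interpret finite_measure ?M by (rule finite_measure_open_interval)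
  have "(\<integral>t. F t * D powr (r - 1) \<partial>?M) \<le> (\<integral>t. F t powr r / r + D powr r / r' \<partial>?M)"
  proof (rule integral_mono_AE)
    show "AE t in ?M. F t * D powr (r - 1) \<le> F t powr r / r + D powr r / r'"
      using pos
    proof eventually_elim
      fix t assume "0 \<le> F t"
      then have "F t * D powr (r - 1) \<le> F t powr r / r + (D powr (r - 1)) powr r' / r'"
        using r r' by (intro Youngs_inequality) auto
      then show "F t * D powr (r - 1) \<le> F t powr r / r + D powr r / r'" by (simp add: powr_powr r'(3))
    qed
  qed (use i int in auto)
  moreover have "(\<integral>t. F t * D powr (r - 1) \<partial>?M) = (b - a) * D * D powr (r - 1)" using ab by (simp add: D_def)
  moreover have "D * D powr (r - 1) = D powr r"
    using D0 r by (cases "D = 0") (auto simp: powr_mult_base)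
  moreover have "(\<integral>t. F t powr r / r + D powr r / r' \<partial>?M) = (\<integral>t. F t powr r \<partial>?M) / r + (b - a) * (D powr r / r')"
    using int integral_const_open_interval[of a b "D powr r / r'"] ab by simp
  ultimately have "(b - a) * D powr r \<le> (\<integral>t. F t powr r \<partial>?M) / r + (b - a) * (D powr r / r')"
    by (simp add: mult.assoc)
  moreover have "D powr r / r' = D powr r - D powr r / r"
  proof -
    have "1 / r' = 1 - 1 / r" using r'(2) by simp
    then have "D powr r * (1 / r') = D powr r * (1 - 1 / r)" by simp
    then show ?thesis by (simp add: algebra_simps)
  qed
  ultimately have "(b - a) * (D powr r / r) \<le> (\<integral>t. F t powr r \<partial>?M) / r" by (simp add: algebra_simps)
  then have "(b - a) * D powr r \<le> (\<integral>t. F t powr r \<partial>?M)" using r by (simp add: divide_le_cancel)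
  then show ?thesis unfolding D_def[symmetric] using ab by (simp add: field_simps)
qed

text \<open>Used to count the windows that cover a given time; rounding at the two ends costs the
  summand 1.\<close>

lemma card_multiples_le:
  fixes a b c :: real
  assumes "c > 0" "a \<le> b"
  shows "real (card {m\<in>{1..N}. a < real m * c \<and> real m * c < b}) \<le> (b - a) / c + 1"
proof -
  let ?S = "{m\<in>{1..N}. a < real m * c \<and> real m * c < b}"
  have "int ` ?S \<subseteq> {\<lfloor>a / c\<rfloor> + 1 .. \<lceil>b / c\<rceil> - 1}"
  proof
    fix i assume "i \<in> int ` ?S"
    then obtain m where m: "i = int m" "a < real m * c" "real m * c < b" by auto
    then have "a / c < real m" "real m < b / c" using assms by (auto simp: field_simps)
    then show "i \<in> {\<lfloor>a / c\<rfloor> + 1 .. \<lceil>b / c\<rceil> - 1}" unfolding m(1) by (auto simp: le_floor_iff) linarith+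
  qed
  then have "card (int ` ?S) \<le> card {\<lfloor>a / c\<rfloor> + 1 .. \<lceil>b / c\<rceil> - 1}" by (intro card_mono) auto
  moreover have "card (int ` ?S) = card ?S" by (intro card_image) auto
  ultimately have "card ?S \<le> nat (\<lceil>b / c\<rceil> - 1 - \<lfloor>a / c\<rfloor>)" by simp
  moreover have "a / c \<le> b / c" using assms by (intro divide_right_mono) auto
  then have "\<lfloor>a / c\<rfloor> \<le> \<lceil>b / c\<rceil>" by linarith
  moreover have "real_of_int (\<lceil>b / c\<rceil> - 1 - \<lfloor>a / c\<rfloor>) \<le> b / c - a / c + 1" by linarith
  ultimately have "real (card ?S) \<le> b / c - a / c + 1"
    using \<open>a / c \<le> b / c\<close> by linarith
  then show ?thesis by (simp add: diff_divide_distrib)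
qed

text \<open>Multiplication by \<open>1 - \<delta> / T\<close> maps \<open>[0,T]\<close> onto
  \<open>[0,T - \<delta>]\<close>, so a window of length \<delta> to the right of a contracted grid
  point still fits.\<close>

lemma window_subset:
  assumes T: "T > 0" "N \<ge> 1" and d: "0 < \<delta>" "\<delta> < T" and m: "m \<in> {1..N}"
  defines "\<tau> \<equiv> (1 - \<delta> / T) * (real m * (T / real N))"
  shows "{\<tau><..<\<tau> + \<delta>} \<subseteq> {0<..<T}"
proof -
  have "real m * (T / real N) \<le> real N * (T / real N)" using T m by (intro mult_right_mono) auto
  then have le: "real m * (T / real N) \<le> T" using T by simp
  have th: "1 - \<delta> / T > 0" using d T by (simp add: field_simps)
  have "0 \<le> \<tau>" unfolding \<tau>_def using th T by (intro mult_nonneg_nonneg) auto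
  moreover have "\<tau> \<le> (1 - \<delta> / T) * T" unfolding \<tau>_def using th le by (intro mult_left_mono) auto
  moreover have "(1 - \<delta> / T) * T = T - \<delta>" using T by (simp add: left_diff_distrib)
  ultimately have "\<tau> + \<delta> \<le> T" "0 \<le> \<tau>" by linarith+
  then show ?thesis by auto
qed

text \<open>With \<open>k = T / N\<close> and \<theta> as in the proof, a given time lies in at most
  \<open>\<delta> / (\<theta> * k) + 1\<close> windows; multiplied by the weight
  \<open>k / \<delta>\<close> this is the factor on the right. It stays bounded once
  \<open>k \<le> \<delta>\<close> and \<open>\<delta> \<le> T / 2\<close>.\<close>

lemma sum_window_integrals:
  fixes \<phi> :: "real \<Rightarrow> real"
  assumes T: "T > 0" "N \<ge> 1" and d: "0 < \<delta>" "\<delta> < T"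
    and int: "integrable (lebesgue_on {0<..<T}) \<phi>" and pos: "AE t in lebesgue_on {0<..<T}. 0 \<le> \<phi> t"
  shows "(\<Sum>m=1..N. (T / real N) * ((1 / \<delta>) * (\<integral>t. \<phi> t \<partial>lebesgue_on {(1 - \<delta> / T) * (real m * (T / real N))<..<(1 - \<delta> / T) * (real m * (T / real N)) + \<delta>})))
     \<le> (1 / (1 - \<delta> / T) + (T / real N) / \<delta>) * (\<integral>t. \<phi> t \<partial>lebesgue_on {0<..<T})"
proof -
  let ?M = "lebesgue_on {0<..<T}" and ?k = "T / real N"
  define \<theta> where "\<theta> = 1 - \<delta> / T"
  define W where "W m = {\<theta> * (real m * ?k)<..<\<theta> * (real m * ?k) + \<delta>}" for m :: nat
  have th: "\<theta> > 0" unfolding \<theta>_def using d T by (simp add: field_simps)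
  have k: "?k > 0" using T by simp
  have WT: "W m \<subseteq> {0<..<T}" if "m \<in> {1..N}" for m
    using window_subset[OF T d that] by (simp add: W_def \<theta>_def)
  have Wi: "(\<integral>t. \<phi> t \<partial>lebesgue_on (W m)) = (\<integral>t. indicator (W m) t * \<phi> t \<partial>?M)" if "m \<in> {1..N}" for m
  proof -
    have "(\<integral>t. indicator (W m) t * \<phi> t \<partial>?M) = (\<integral>t. (if t \<in> W m then \<phi> t else 0) \<partial>?M)"
      by (intro Bochner_Integration.integral_cong) (auto simp: indicator_def)
    also have "\<dots> = (\<integral>t. \<phi> t \<partial>lebesgue_on (W m \<inter> {0<..<T}))"
      by (rule Lebesgue_Measure.integral_restrict_Int) (auto simp: W_def)
    also have "W m \<inter> {0<..<T} = W m" using WT[OF that] by auto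
    finally show ?thesis by simp
  qed
  have ii: "integrable ?M (\<lambda>t. indicator (W m) t * \<phi> t)" for m
  proof -
    have "W m \<inter> {0<..<T} \<in> sets ?M" by (subst sets_restrict_space_iff) (auto simp: W_def)
    then have "integrable ?M (\<lambda>t. indicator (W m \<inter> {0<..<T}) t *\<^sub>R \<phi> t)" using int by (rule integrable_mult_indicator)
    then show ?thesis by (rule Bochner_Integration.integrable_cong[THEN iffD1, rotated -1]) (auto simp: indicator_def)
  qed
  have "(\<Sum>m=1..N. (\<integral>t. \<phi> t \<partial>lebesgue_on (W m))) = (\<integral>t. (\<Sum>m=1..N. indicator (W m) t * \<phi> t) \<partial>?M)"
    using Wi by (subst Bochner_Integration.integral_sum[OF ii]) (rule sum.cong[OF refl])
  also have "\<dots> \<le> (\<integral>t. (\<delta> / (\<theta> * ?k) + 1) * \<phi> t \<partial>?M)"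
  proof (rule integral_mono_AE)
    show "AE t in ?M. (\<Sum>m=1..N. indicator (W m) t * \<phi> t) \<le> (\<delta> / (\<theta> * ?k) + 1) * \<phi> t"
      using pos
    proof eventually_elim
      fix t assume p: "0 \<le> \<phi> t"
      have "(\<Sum>m=1..N. indicator (W m) t) = real (card {m\<in>{1..N}. t \<in> W m})"
        by (simp add: indicator_def sum.If_cases Int_def)
      also have "{m\<in>{1..N}. t \<in> W m} = {m\<in>{1..N}. t - \<delta> < real m * (\<theta> * ?k) \<and> real m * (\<theta> * ?k) < t}"
        by (auto simp: W_def mult.left_commute mult.commute)
      also have "real (card \<dots>) \<le> (t - (t - \<delta>)) / (\<theta> * ?k) + 1"
        using th k d by (intro card_multiples_le mult_pos_pos) auto
      finally have "(\<Sum>m=1..N. indicator (W m) t) \<le> \<delta> / (\<theta> * ?k) + 1" by simp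
      from mult_right_mono[OF this p] show "(\<Sum>m=1..N. indicator (W m) t * \<phi> t) \<le> (\<delta> / (\<theta> * ?k) + 1) * \<phi> t"
        by (simp add: sum_distrib_right)
    qed
    show "integrable ?M (\<lambda>t. \<Sum>m=1..N. indicator (W m) t * \<phi> t)" by (rule Bochner_Integration.integrable_sum, rule ii)
    show "integrable ?M (\<lambda>t. (\<delta> / (\<theta> * ?k) + 1) * \<phi> t)" by (rule integrable_mult_right, rule int)
  qed
  also have "\<dots> = (\<delta> / (\<theta> * ?k) + 1) * (\<integral>t. \<phi> t \<partial>?M)" by simp
  finally have *: "(\<Sum>m=1..N. (\<integral>t. \<phi> t \<partial>lebesgue_on (W m))) \<le> (\<delta> / (\<theta> * ?k) + 1) * (\<integral>t. \<phi> t \<partial>?M)" .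
  have "(\<Sum>m=1..N. ?k * ((1 / \<delta>) * (\<integral>t. \<phi> t \<partial>lebesgue_on (W m)))) = (?k / \<delta>) * (\<Sum>m=1..N. (\<integral>t. \<phi> t \<partial>lebesgue_on (W m)))"
    by (simp add: sum_distrib_left)
  also have "\<dots> \<le> (?k / \<delta>) * ((\<delta> / (\<theta> * ?k) + 1) * (\<integral>t. \<phi> t \<partial>?M))"
    using * k d by (intro mult_left_mono) auto
  also have "\<dots> = ((?k / \<delta>) * (\<delta> / (\<theta> * ?k) + 1)) * (\<integral>t. \<phi> t \<partial>?M)" by (simp only: mult.assoc)
  also have "(?k / \<delta>) * (\<delta> / (\<theta> * ?k) + 1) = 1 / \<theta> + ?k / \<delta>"
    using k d th T(2) by (simp add: distrib_left)
  finally show ?thesis unfolding W_def \<theta>_def .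
qed

text \<open>Regularity of Lebesgue measure encloses \<open>E\<close> between a closed and an open
  set that differ little from it; a Urysohn function for the two deviates from the indicator only
  between them.\<close>

lemma indicator_continuous_approximation:
  assumes E: "E \<in> sets lebesgue" and e: "e > 0"
  obtains \<psi> :: "real \<Rightarrow> real" where "continuous_on UNIV \<psi>" "\<And>t. 0 \<le> \<psi> t" "\<And>t. \<psi> t \<le> 1"
    "(\<integral>t. \<bar>indicator E t - \<psi> t\<bar> \<partial>lebesgue_on {0<..<T}) \<le> e"
proof -
  obtain U where U: "open U" "E \<subseteq> U" "U - E \<in> lmeasurable" "emeasure lebesgue (U - E) < ennreal (e / 2)"
    using sets_lebesgue_outer_open[OF E, of "e / 2"] e by auto
  obtain K where K: "closed K" "K \<subseteq> E" "E - K \<in> lmeasurable" "emeasure lebesgue (E - K) < ennreal (e / 2)"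
    using sets_lebesgue_inner_closed[OF E, of "e / 2"] e by auto
  have "closed (- U)" "K \<inter> - U = {}" using U K by auto
  from Urysohn[OF K(1) this, where a="1::real" and b=0] obtain \<psi> where
    \<psi>: "continuous_on UNIV \<psi>" "\<And>x. \<psi> x \<in> closed_segment (1::real) 0" "\<And>x. x \<in> K \<Longrightarrow> \<psi> x = 1" "\<And>x. x \<in> - U \<Longrightarrow> \<psi> x = 0"
    by blast
  have r: "0 \<le> \<psi> t" "\<psi> t \<le> 1" for t using \<psi>(2)[of t] by (auto simp: closed_segment_eq_real_ivl)
  let ?M = "lebesgue_on {0<..<T}"
  interpret finite_measure ?M by (rule finite_measure_open_interval)
  have m1: "emeasure lebesgue (U - E) = ennreal (measure lebesgue (U - E))" using U(3) by (simp add: emeasure_eq_measure2)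
  have m2: "emeasure lebesgue (E - K) = ennreal (measure lebesgue (E - K))" using K(3) by (simp add: emeasure_eq_measure2)
  have ib: "integrable lebesgue (\<lambda>t. indicator (U - E) t + indicator (E - K) t :: real)"
    using U(3) K(3) by (intro Bochner_Integration.integrable_add integrable_real_indicator) (auto simp: fmeasurable_def)
  have ib': "integrable ?M (\<lambda>t. indicator (U - E) t + indicator (E - K) t :: real)"
    using integrable_lebesgue_on_subset[of UNIV "\<lambda>t. indicator (U - E) t + indicator (E - K) t :: real" "{0<..<T}"] ib
    by (simp add: lebesgue_on_UNIV_eq)
  have \<psi>m: "\<psi> \<in> borel_measurable ?M"
    by (rule measurable_restrict_space1, rule measurable_completion) (use borel_measurable_continuous_onI[OF \<psi>(1)] in simp)
  have Em: "indicator E \<in> borel_measurable ?M"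
    using E by (intro measurable_restrict_space1 borel_measurable_indicator) 
  have bd: "\<bar>indicator E t - \<psi> t\<bar> \<le> indicator (U - E) t + indicator (E - K) t" for t
    using r[of t] \<psi>(3)[of t] \<psi>(4)[of t] U(2) K(2) by (auto simp: indicator_def)
  have "(\<integral>t. \<bar>indicator E t - \<psi> t\<bar> \<partial>?M) \<le> (\<integral>t. indicator (U - E) t + indicator (E - K) t \<partial>?M)"
  proof (rule integral_mono[OF _ ib'])
    show "integrable ?M (\<lambda>t. \<bar>indicator E t - \<psi> t\<bar>)"
      by (rule Bochner_Integration.integrable_bound[OF ib' borel_measurable_abs[OF borel_measurable_diff[OF Em \<psi>m]]])
        (auto intro!: order_trans[OF bd])
  qed (rule bd)
  also have "\<dots> = (\<integral>t. indicator {0<..<T} t *\<^sub>R (indicator (U - E) t + indicator (E - K) t) \<partial>lebesgue)"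
    by (rule integral_restrict_space) auto
  also have "\<dots> \<le> (\<integral>t. indicator (U - E) t + indicator (E - K) t \<partial>lebesgue)"
  proof (rule integral_mono[OF _ ib])
    show "integrable lebesgue (\<lambda>t. indicator {0<..<T} t *\<^sub>R (indicator (U - E) t + indicator (E - K) t) :: real)"
      using ib by (intro integrable_mult_indicator) auto
  qed (auto simp: indicator_def)
  also have "\<dots> = measure lebesgue (U - E) + measure lebesgue (E - K)"
    using U(3) K(3) by (subst Bochner_Integration.integral_add) (auto simp: fmeasurable_def intro!: integrable_real_indicator)
  also have "\<dots> \<le> e" using U(4) K(4) e unfolding m1 m2 by (simp add: ennreal_less_iff)
  finally show thesis using that[OF \<psi>(1) r] by blast
qed

text \<open>A simple function approximates \<open>g\<close>, and the indicators of its finitely many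
  level sets are then replaced by continuous scalar functions. Continuity with values in the carrier
  is thus reduced to scalar continuity with finitely many fixed vectors.\<close>

lemma continuous_approximation:
  assumes T: "T > 0" and N: "normed_on X n" and g: "g \<in> Lp_space T r X n" and r: "r \<ge> 1" and e: "e > 0"
  obtains G where "\<And>t. G t \<in> X"
    "\<And>\<kappa>. \<kappa> > 0 \<Longrightarrow> \<exists>d>0. \<forall>t\<in>{0..T}. \<forall>t'\<in>{0..T}. \<bar>t - t'\<bar> < d \<longrightarrow> n (G t - G t') \<le> \<kappa>"
    "(\<lambda>t. n (g t - G t)) \<in> borel_measurable (lebesgue_on {0<..<T})"
    "integrable (lebesgue_on {0<..<T}) (\<lambda>t. n (g t - G t) powr r)"
    "(\<integral>t. n (g t - G t) powr r \<partial>lebesgue_on {0<..<T}) \<le> e"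
proof -
  let ?M = "lebesgue_on {0<..<T}"
  interpret finite_measure ?M by (rule finite_measure_open_interval)
  have gs: "strongly_measurable_on ?M X n g" and gi: "integrable ?M (\<lambda>t. n (g t) powr r)"
    using g by (auto simp: Lp_space_def)
  have gX: "AE t in ?M. g t \<in> X" using gs unfolding strongly_measurable_on_def by (auto elim: eventually_mono)
  define e1 where "e1 = e / (2 * 2 powr r)"
  have e1: "e1 > 0" using e by (simp add: e1_def)
  obtain \<sigma> where \<sigma>: "simple_on ?M X \<sigma>" "integrable ?M (\<lambda>t. n (g t - \<sigma> t) powr r)"
    "(\<integral>t. n (g t - \<sigma> t) powr r \<partial>?M) < e1"
    by (rule simple_approximation[OF open_interval_lmeasurable(1) N gs gi _ e1], use r in simp, rule that)
  define V where "V = \<sigma> ` space ?M"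
  have finV: "finite V" using simple_onD(1)[OF \<sigma>(1)] unfolding V_def simple_function_def by simp
  have VX: "x \<in> X" if "x \<in> V" for x using that simple_onD(2)[OF \<sigma>(1)] unfolding V_def by auto
  define E where "E x = {t\<in>{0<..<T}. \<sigma> t = x}" for x
  have E: "E x \<in> sets lebesgue" if "x \<in> V" for x
  proof -
    have "\<sigma> -` {x} \<inter> space ?M \<in> sets ?M" using simple_onD(1)[OF \<sigma>(1)] that unfolding V_def simple_function_def by auto
    moreover have "\<sigma> -` {x} \<inter> space ?M = E x" by (auto simp: E_def)
    ultimately show ?thesis by (auto simp: sets_restrict_space_iff)
  qed
  define K where "K = (\<Sum>x\<in>V. n x) + 1"
  have n0: "0 \<le> n x" if "x \<in> V" for x using carrier_norm_nonneg[OF N VX[OF that]] .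
  have K: "K > 0" "\<And>x. x \<in> V \<Longrightarrow> n x \<le> K"
    using n0 finV by (auto simp: K_def sum_nonneg add_nonneg_pos add_increasing2 member_le_sum intro!: order_trans[OF member_le_sum[of _ V n]])
  define c where "c = real (card V) + 1"
  have c: "c \<ge> 1" by (simp add: c_def)
  \<comment> \<open>Chosen so that \<open>K powr r * c powr r * c * e2\<close> equals
    \<open>e1\<close>. The factors come from the norms of the vectors, from the bound
    \<open>Dr\<close> and from the number of level sets.\<close>
  define e2 where "e2 = e1 / (K powr r * c powr r * c)"
  have e2: "e2 > 0" using e1 K c by (simp add: e2_def)
  have "\<exists>\<psi>::real\<Rightarrow>real. continuous_on UNIV \<psi> \<and> (\<forall>t. 0 \<le> \<psi> t \<and> \<psi> t \<le> 1) \<and>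
    (\<integral>t. \<bar>indicator (E x) t - \<psi> t\<bar> \<partial>?M) \<le> e2" if "x \<in> V" for x
    by (rule indicator_continuous_approximation[OF E[OF that] e2, of T]) blast
  then have "\<forall>x\<in>V. \<exists>\<psi>::real\<Rightarrow>real. continuous_on UNIV \<psi> \<and> (\<forall>t. 0 \<le> \<psi> t \<and> \<psi> t \<le> 1) \<and>
    (\<integral>t. \<bar>indicator (E x) t - \<psi> t\<bar> \<partial>?M) \<le> e2" by blast
  from bchoice[OF this] obtain \<psi> :: "'a \<Rightarrow> real \<Rightarrow> real" where \<psi>0: "\<forall>x\<in>V. continuous_on UNIV (\<psi> x) \<and> (\<forall>t. 0 \<le> \<psi> x t \<and> \<psi> x t \<le> 1) \<and>
    (\<integral>t. \<bar>indicator (E x) t - \<psi> x t\<bar> \<partial>?M) \<le> e2" ..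
  then have \<psi>: "continuous_on UNIV (\<psi> x)" "0 \<le> \<psi> x t" "\<psi> x t \<le> 1" "(\<integral>t. \<bar>indicator (E x) t - \<psi> x t\<bar> \<partial>?M) \<le> e2"
    if "x \<in> V" for x t using that by auto
  define G where "G t = (\<Sum>x\<in>V. \<psi> x t *\<^sub>R x)" for t
  have GX: "G t \<in> X" for t
    unfolding G_def using VX by (intro subspace_sum carrier_subspace[OF N] carrier_scale[OF N])
  have nsum: "n (\<Sum>x\<in>V. a x *\<^sub>R x) \<le> (\<Sum>x\<in>V. \<bar>a x\<bar> * n x)" for a
    using finV VX
  proof (induction V rule: finite_induct)
    case (insert x F)
    have "n (a x *\<^sub>R x + (\<Sum>x\<in>F. a x *\<^sub>R x)) \<le> n (a x *\<^sub>R x) + n (\<Sum>x\<in>F. a x *\<^sub>R x)"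
      using insert.prems by (intro carrier_norm_add[OF N] carrier_scale[OF N] subspace_sum carrier_subspace[OF N]) auto
    then show ?case using insert carrier_norm_scale[OF N insert.prems[of x], of "a x"] by simp
  qed (simp add: carrier_norm_0[OF N])
  have nsumK: "n (\<Sum>x\<in>V. a x *\<^sub>R x) \<le> K * (\<Sum>x\<in>V. \<bar>a x\<bar>)" for a
  proof -
    have "(\<Sum>x\<in>V. \<bar>a x\<bar> * n x) \<le> (\<Sum>x\<in>V. \<bar>a x\<bar> * K)" using K(2) by (intro sum_mono mult_left_mono) auto
    with nsum[of a] show ?thesis by (simp add: sum_distrib_left mult.commute)
  qed
  have uc: "\<exists>d>0. \<forall>t\<in>{0..T}. \<forall>t'\<in>{0..T}. \<bar>t - t'\<bar> < d \<longrightarrow> n (G t - G t') \<le> \<kappa>" if k: "\<kappa> > 0" for \<kappa>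
  proof -
    have "\<exists>d>0. \<forall>t\<in>{0..T}. \<forall>t'\<in>{0..T}. \<bar>t - t'\<bar> < d \<longrightarrow> \<bar>\<psi> x t - \<psi> x t'\<bar> \<le> \<kappa> / (K * c)" if "x \<in> V" for x
    proof -
      have "uniformly_continuous_on {0..T} (\<psi> x)"
        by (rule compact_uniformly_continuous[OF continuous_on_subset[OF \<psi>(1)[OF that]]]) auto
      moreover have "\<kappa> / (K * c) > 0" using k K c by simp
      ultimately obtain d where "d > 0" "\<forall>t\<in>{0..T}. \<forall>t'\<in>{0..T}. dist t' t < d \<longrightarrow> dist (\<psi> x t') (\<psi> x t) < \<kappa> / (K * c)"
        unfolding uniformly_continuous_on_def by blast
      then show ?thesis by (intro exI[of _ d]) (auto simp: dist_real_def abs_minus_commute less_imp_le)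
    qed
    then have "\<forall>x\<in>V. \<exists>d>0. \<forall>t\<in>{0..T}. \<forall>t'\<in>{0..T}. \<bar>t - t'\<bar> < d \<longrightarrow> \<bar>\<psi> x t - \<psi> x t'\<bar> \<le> \<kappa> / (K * c)" by blast
    from bchoice[OF this] obtain d where d: "\<forall>x\<in>V. d x > 0 \<and> (\<forall>t\<in>{0..T}. \<forall>t'\<in>{0..T}. \<bar>t - t'\<bar> < d x \<longrightarrow> \<bar>\<psi> x t - \<psi> x t'\<bar> \<le> \<kappa> / (K * c))" ..
    define d0 where "d0 = Min (insert 1 (d ` V))"
    have d0: "d0 > 0" "\<And>x. x \<in> V \<Longrightarrow> d0 \<le> d x" unfolding d0_def using finV d by auto
    have "n (G t - G t') \<le> \<kappa>" if tt: "t \<in> {0..T}" "t' \<in> {0..T}" "\<bar>t - t'\<bar> < d0" for t t'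
    proof -
      have "G t - G t' = (\<Sum>x\<in>V. (\<psi> x t - \<psi> x t') *\<^sub>R x)" unfolding G_def by (simp add: sum_subtractf scaleR_diff_left)
      then have "n (G t - G t') \<le> K * (\<Sum>x\<in>V. \<bar>\<psi> x t - \<psi> x t'\<bar>)" using nsumK by simp
      also have "(\<Sum>x\<in>V. \<bar>\<psi> x t - \<psi> x t'\<bar>) \<le> (\<Sum>x\<in>V. \<kappa> / (K * c))"
        using d tt d0(2) by (intro sum_mono) force
      also have "\<dots> = real (card V) * (\<kappa> / (K * c))" by simp
      also have "\<dots> \<le> c * (\<kappa> / (K * c))" using k K c by (intro mult_right_mono) (auto simp: c_def)
      finally show ?thesis using K c by (simp add: mult_left_mono)
    qed
    then show ?thesis using d0(1) by blast
  qed
  define D where "D t = (\<Sum>x\<in>V. \<bar>indicator (E x) t - \<psi> x t\<bar>)" for t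
  have im: "(\<lambda>t. \<bar>indicator (E x) t - \<psi> x t\<bar>) \<in> borel_measurable ?M" if "x \<in> V" for x
  proof -
    have "\<psi> x \<in> borel_measurable ?M"
      by (rule measurable_restrict_space1, rule measurable_completion) (use borel_measurable_continuous_onI[OF \<psi>(1)[OF that]] in simp)
    moreover have "indicator (E x) \<in> borel_measurable ?M"
      using E[OF that] by (intro measurable_restrict_space1 borel_measurable_indicator)
    ultimately show ?thesis by (intro borel_measurable_abs borel_measurable_diff)
  qed
  have ii: "integrable ?M (\<lambda>t. \<bar>indicator (E x) t - \<psi> x t\<bar>)" if "x \<in> V" for x
  proof (rule integrable_const_bound[where B=1, OF _ im[OF that]], rule AE_I2)
    fix t show "norm \<bar>indicator (E x) t - \<psi> x t\<bar> \<le> 1"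
      using \<psi>(2,3)[OF that, of t] by (simp add: indicator_def abs_le_iff)
  qed
  have Di: "integrable ?M D" unfolding D_def using ii by (intro Bochner_Integration.integrable_sum)
  have Dle: "(\<integral>t. D t \<partial>?M) \<le> c * e2"
  proof -
    have "(\<integral>t. D t \<partial>?M) = (\<Sum>x\<in>V. \<integral>t. \<bar>indicator (E x) t - \<psi> x t\<bar> \<partial>?M)" unfolding D_def using ii by (intro Bochner_Integration.integral_sum)
    also have "\<dots> \<le> (\<Sum>x\<in>V. e2)" using \<psi>(4) by (intro sum_mono)
    also have "\<dots> \<le> c * e2" using e2 by (simp add: c_def)
    finally show ?thesis .
  qed
  have D0: "0 \<le> D t" for t unfolding D_def by (intro sum_nonneg) auto
  have Dc: "D t \<le> c" for t
  proof -
    have "\<bar>indicator (E x) t - \<psi> x t\<bar> \<le> 1" if "x \<in> V" for x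
      using \<psi>(2,3)[OF that, of t] by (simp add: indicator_def abs_le_iff)
    then have "D t \<le> (\<Sum>x\<in>V. 1)" unfolding D_def by (rule sum_mono)
    then show ?thesis by (simp add: c_def)
  qed
  \<comment> \<open>Since \<open>D\<close> never exceeds \<open>c\<close>, its \<open>r\<close>-th
    power is controlled by \<open>D\<close> itself, and smallness of the indicator errors in
    \<open>L\<^sup>1\<close> is enough.\<close>
  have Dr: "D t powr r \<le> c powr r * D t" for t
  proof -
    have 1: "D t / c \<le> 1" "0 \<le> D t / c" using Dc[of t] D0[of t] c by auto
    have "(D t / c) powr r \<le> (D t / c) powr 1" using 1 r by (intro powr_mono') auto
    also have "\<dots> \<le> D t" using mult_left_mono[OF c D0[of t]] c 1 D0[of t] by (simp add: pos_divide_le_eq)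
    finally have "(D t / c) powr r \<le> D t" by simp
    moreover have "(D t / c) powr r = D t powr r / c powr r" using D0[of t] c by (simp add: powr_divide)
    ultimately show ?thesis using c by (simp add: field_simps)
  qed
  have \<sigma>G: "n (\<sigma> t - G t) \<le> K * D t" if t: "t \<in> space ?M" for t
  proof -
    have sV: "\<sigma> t \<in> V" using t by (auto simp: V_def)
    have "\<sigma> t = (\<Sum>x\<in>V. (if x = \<sigma> t then x else 0))" using finV sV by (simp add: sum.delta)
    also have "\<dots> = (\<Sum>x\<in>V. indicator (E x) t *\<^sub>R x)" using t by (intro sum.cong) (auto simp: E_def indicator_def)
    finally have "\<sigma> t - G t = (\<Sum>x\<in>V. (indicator (E x) t - \<psi> x t) *\<^sub>R x)"
      unfolding G_def by (simp add: sum_subtractf scaleR_diff_left)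
    then show ?thesis using nsumK unfolding D_def by simp
  qed
  have Ki: "integrable ?M (\<lambda>t. (K * D t) powr r)" and Kle: "(\<integral>t. (K * D t) powr r \<partial>?M) \<le> e1"
  proof -
    have bd: "(K * D t) powr r \<le> K powr r * (c powr r * D t)" for t
      using Dr[of t] D0[of t] K by (simp add: powr_mult mult_left_mono)
    show i: "integrable ?M (\<lambda>t. (K * D t) powr r)"
    proof (rule Bochner_Integration.integrable_bound)
      show "integrable ?M (\<lambda>t. K powr r * (c powr r * D t))" using Di by simp
      show "(\<lambda>t. (K * D t) powr r) \<in> borel_measurable ?M" using Di by measurable
      show "AE t in ?M. norm ((K * D t) powr r) \<le> norm (K powr r * (c powr r * D t))" using bd D0 by (auto intro!: order_trans[OF bd])
    qed
    have "(\<integral>t. (K * D t) powr r \<partial>?M) \<le> (\<integral>t. K powr r * (c powr r * D t) \<partial>?M)"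
      by (rule integral_mono[OF i]) (use Di bd in auto)
    also have "\<dots> = K powr r * (c powr r * (\<integral>t. D t \<partial>?M))" by simp
    also have "\<dots> \<le> K powr r * (c powr r * (c * e2))" using Dle by (intro mult_left_mono) auto
    also have "\<dots> = e1" using K c by (simp add: e2_def)
    finally show "(\<integral>t. (K * D t) powr r \<partial>?M) \<le> e1" .
  qed
  have Gm: "strongly_measurable_on ?M X n G"
  proof -
    have s: "strongly_measurable_on ?M X n (\<lambda>t. \<psi> x t *\<^sub>R x)" if "x \<in> V" for x
    proof (rule strongly_measurable_scale[OF N])
      show "\<psi> x \<in> borel_measurable ?M"
        by (rule measurable_restrict_space1, rule measurable_completion) (use borel_measurable_continuous_onI[OF \<psi>(1)[OF that]] in simp)
      show "strongly_measurable_on ?M X n (\<lambda>t. x)"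
        by (rule strongly_measurable_simple[OF N]) (use VX[OF that] in \<open>auto simp: simple_on_def\<close>)
    qed
    have "strongly_measurable_on ?M X n (\<lambda>t. \<Sum>x\<in>F. \<psi> x t *\<^sub>R x)" if "F \<subseteq> V" for F
      using finite_subset[OF that finV] that
    proof (induction F rule: finite_induct)
      case empty
      show ?case by (simp, rule strongly_measurable_simple[OF N]) (use carrier_0[OF N] in \<open>auto simp: simple_on_def\<close>)
    next
      case (insert x F)
      have "strongly_measurable_on ?M X n (\<lambda>t. \<psi> x t *\<^sub>R x - ((-1) *\<^sub>R (\<Sum>x\<in>F. \<psi> x t *\<^sub>R x)))"
        using insert by (intro strongly_measurable_diff[OF N] s strongly_measurable_scale[OF N]) auto
      then show ?case using insert by simp
    qed
    then show ?thesis unfolding G_def by blast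
  qed
  have dm: "(\<lambda>t. n (g t - G t)) \<in> borel_measurable ?M"
    by (intro strongly_measurable_norm[OF _ N] strongly_measurable_diff[OF N] gs Gm) auto
  have le: "AE t in ?M. 0 \<le> n (g t - G t) \<and> n (g t - G t) \<le> n (g t - \<sigma> t) + K * D t \<and> 0 \<le> n (g t - \<sigma> t) \<and> 0 \<le> K * D t"
    using gX AE_space
  proof eventually_elim
    fix t assume t: "g t \<in> X" "t \<in> space ?M"
    have s: "\<sigma> t \<in> X" using simple_onD(2)[OF \<sigma>(1) t(2)] .
    show "0 \<le> n (g t - G t) \<and> n (g t - G t) \<le> n (g t - \<sigma> t) + K * D t \<and> 0 \<le> n (g t - \<sigma> t) \<and> 0 \<le> K * D t"
      using carrier_norm_triangle[OF N t(1) s GX[of t]] \<sigma>G[OF t(2)] K(1) D0[of t]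
        carrier_norm_nonneg[OF N carrier_diff[OF N t(1) GX]] carrier_norm_nonneg[OF N carrier_diff[OF N t(1) s]]
      by auto
  qed
  note ib = integrable_powr_bound[OF dm le \<sigma>(2) Ki]
  have r0: "r > 0" using r by simp
  have "(\<integral>t. n (g t - G t) powr r \<partial>?M) \<le> 2 powr r * (e1 + e1)"
    using ib(2)[OF r0] \<sigma>(3) Kle by (smt (verit) mult_left_mono powr_ge_zero)
  also have "\<dots> = e" by (simp add: e1_def)
  finally show thesis using that[OF GX uc dm ib(1)[OF r0]] by blast
qed

text \<open>The factor \<open>1 - \<delta> / T\<close> keeps the windows inside \<open>(0,T)\<close>.\<close>

lemma window_average_approximation:
  assumes T: "T > 0" and N: "normed_on X n" and g: "g \<in> Lp_space T r X n" and r: "r > 1" and e: "e > 0"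
  obtains \<delta>0 where "\<delta>0 > 0" "\<And>\<delta>. 0 < \<delta> \<Longrightarrow> \<delta> < \<delta>0 \<Longrightarrow> \<exists>N0\<ge>1. \<forall>N\<ge>N0. \<forall>h.
     (\<forall>m\<in>{1..N}. h m \<in> X \<and> (\<forall>x\<in>X. n (h m - x) \<le> (1 / \<delta>) * (\<integral>t. n (g t - x)
        \<partial>lebesgue_on {(1 - \<delta> / T) * (real m * (T / real N))<..<(1 - \<delta> / T) * (real m * (T / real N)) + \<delta>}))) \<longrightarrow>
     integrable (lebesgue_on {0<..<T}) (\<lambda>t. n (g t - h (step_index T N t)) powr r) \<and>
     (\<integral>t. n (g t - h (step_index T N t)) powr r \<partial>lebesgue_on {0<..<T}) \<le> e"
proof -
  let ?M = "lebesgue_on {0<..<T}"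
  interpret finite_measure ?M by (rule finite_measure_open_interval)
  have gs: "strongly_measurable_on ?M X n g" and gi: "integrable ?M (\<lambda>t. n (g t) powr r)"
    using g by (auto simp: Lp_space_def)
  have gX: "AE t in ?M. g t \<in> X" using gs unfolding strongly_measurable_on_def by (auto elim: eventually_mono)
  have r0: "r > 0" "r \<ge> 1" using r by auto
  \<comment> \<open>The final estimate contains \<open>4 powr r * e1\<close> at most four times,
    which gives \<open>e / 2\<close>, and \<open>4 powr r * (T * \<kappa> powr r)\<close> once,
    which gives the other half of \<open>e\<close>.\<close>
  define e1 where "e1 = e / (8 * 4 powr r)"
  have e1: "e1 > 0" using e by (simp add: e1_def)
  define \<kappa> where "\<kappa> = (e / (2 * 4 powr r * T)) powr (1 / r)"
  have \<kappa>: "\<kappa> > 0" "\<kappa> powr r = e / (2 * 4 powr r * T)" using e T r by (auto simp: \<kappa>_def powr_powr)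
  obtain G where GX: "\<And>t. G t \<in> X"
    and uc: "\<And>\<kappa>. \<kappa> > 0 \<Longrightarrow> \<exists>d>0. \<forall>t\<in>{0..T}. \<forall>t'\<in>{0..T}. \<bar>t - t'\<bar> < d \<longrightarrow> n (G t - G t') \<le> \<kappa>"
    and Fm: "(\<lambda>t. n (g t - G t)) \<in> borel_measurable ?M"
    and Fi: "integrable ?M (\<lambda>t. n (g t - G t) powr r)"
    and Fe: "(\<integral>t. n (g t - G t) powr r \<partial>?M) \<le> e1"
    by (rule continuous_approximation[OF T N g r0(2) e1], rule that)
  define F where "F t = n (g t - G t)" for t
  have F0: "AE t in ?M. 0 \<le> F t" unfolding F_def
    using gX by eventually_elim (intro carrier_norm_nonneg[OF N] carrier_diff[OF N] GX)
  have Fint: "integrable ?M F" by (rule integrable_from_powr[OF finite_measure_open_interval _ _ F0 r0(2)]) (use Fm Fi in \<open>auto simp: F_def\<close>)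
  obtain d where d: "d > 0" "\<And>t t'. t \<in> {0..T} \<Longrightarrow> t' \<in> {0..T} \<Longrightarrow> \<bar>t - t'\<bar> < d \<Longrightarrow> n (G t - G t') \<le> \<kappa>"
    using uc[OF \<kappa>(1)] by blast
  \<comment> \<open>A point of the window that belongs to the cell of \<open>t\<close> is less than
    \<open>2 * \<delta>\<close> away from \<open>t\<close> when the step is at most \<delta>; hence
    \<open>d / 2\<close>. The bound \<open>T / 2\<close> keeps \<open>1 / (1 - \<delta> / T)\<close>
    below 2.\<close>
  define \<delta>0 where "\<delta>0 = min (d / 2) (T / 2)"
  have "\<delta>0 > 0" using d T by (simp add: \<delta>0_def)
  moreover have "\<exists>N0\<ge>1. \<forall>N\<ge>N0. \<forall>h.
     (\<forall>m\<in>{1..N}. h m \<in> X \<and> (\<forall>x\<in>X. n (h m - x) \<le> (1 / \<delta>) * (\<integral>t. n (g t - x)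
        \<partial>lebesgue_on {(1 - \<delta> / T) * (real m * (T / real N))<..<(1 - \<delta> / T) * (real m * (T / real N)) + \<delta>}))) \<longrightarrow>
     integrable ?M (\<lambda>t. n (g t - h (step_index T N t)) powr r) \<and>
     (\<integral>t. n (g t - h (step_index T N t)) powr r \<partial>?M) \<le> e" if \<delta>: "0 < \<delta>" "\<delta> < \<delta>0" for \<delta>
  proof -
    have \<delta>': "\<delta> < d / 2" "\<delta> < T / 2" "\<delta> < T" using \<delta> T by (auto simp: \<delta>0_def)
    define N0 where "N0 = nat \<lceil>T / \<delta>\<rceil> + 1"
    have kN: "T / real N \<le> \<delta>" "N \<ge> 1" if "N \<ge> N0" for N
    proof -
      have "T / \<delta> \<le> real N" using that unfolding N0_def by linarith
      moreover show "N \<ge> 1" using that by (simp add: N0_def)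
      ultimately show "T / real N \<le> \<delta>" using \<delta> by (simp add: field_simps)
    qed
    have "integrable ?M (\<lambda>t. n (g t - h (step_index T N t)) powr r) \<and>
     (\<integral>t. n (g t - h (step_index T N t)) powr r \<partial>?M) \<le> e"
      if NN: "N \<ge> N0" and h: "\<forall>m\<in>{1..N}. h m \<in> X \<and> (\<forall>x\<in>X. n (h m - x) \<le> (1 / \<delta>) * (\<integral>t. n (g t - x)
        \<partial>lebesgue_on {(1 - \<delta> / T) * (real m * (T / real N))<..<(1 - \<delta> / T) * (real m * (T / real N)) + \<delta>}))" for N h
    proof -
      note N1 = kN(2)[OF NN]
      let ?k = "T / real N"
      define \<theta> where "\<theta> = 1 - \<delta> / T"
      define W where "W m = {\<theta> * (real m * ?k)<..<\<theta> * (real m * ?k) + \<delta>}" for m :: nat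
      have WT: "W m \<subseteq> {0<..<T}" if "m \<in> {1..N}" for m
        using window_subset[OF T N1 \<delta>(1) \<delta>'(3) that] by (simp add: W_def \<theta>_def)
      have Wl: "W m \<in> sets lebesgue" for m by (simp add: W_def)
      have hX: "h m \<in> X" if "m \<in> {1..N}" for m using h that by blast
      have hm: "n (h m - x) \<le> (1 / \<delta>) * (\<integral>t. n (g t - x) \<partial>lebesgue_on (W m))" if "m \<in> {1..N}" "x \<in> X" for m x
        using h that unfolding W_def \<theta>_def by blast
      define D where "D m = (1 / \<delta>) * (\<integral>t. F t \<partial>lebesgue_on (W m))" for m
      have FW: "integrable (lebesgue_on (W m)) F" "integrable (lebesgue_on (W m)) (\<lambda>t. F t powr r)" "AE t in lebesgue_on (W m). 0 \<le> F t" "AE t in lebesgue_on (W m). g t \<in> X" if "m \<in> {1..N}" for m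
        using integrable_lebesgue_on_subset[OF _ _ Wl WT[OF that]] AE_lebesgue_on_subset[OF _ Wl WT[OF that]] Fint Fi F0 gX
        by (auto simp: F_def)
      have D0: "0 \<le> D m" if "m \<in> {1..N}" for m
        unfolding D_def using FW(3)[OF that] \<delta> by (intro mult_nonneg_nonneg integral_nonneg_AE) auto
      have Dr: "D m powr r \<le> (1 / \<delta>) * (\<integral>t. F t powr r \<partial>lebesgue_on (W m))" if "m \<in> {1..N}" for m
        using jensen_powr[of "\<theta> * (real m * ?k)" "\<theta> * (real m * ?k) + \<delta>" F r] FW[OF that] \<delta> r
        unfolding D_def W_def by simp
      have sumD: "?k * (\<Sum>m=1..N. D m powr r) \<le> 3 * e1"
      proof -
        have "?k * (\<Sum>m=1..N. D m powr r) \<le> ?k * (\<Sum>m=1..N. (1 / \<delta>) * (\<integral>t. F t powr r \<partial>lebesgue_on (W m)))"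
          using T by (intro mult_left_mono sum_mono Dr) auto
        also have "\<dots> = (\<Sum>m=1..N. ?k * ((1 / \<delta>) * (\<integral>t. F t powr r \<partial>lebesgue_on (W m))))" by (simp add: sum_distrib_left)
        also have "\<dots> \<le> (1 / (1 - \<delta> / T) + ?k / \<delta>) * (\<integral>t. F t powr r \<partial>?M)"
          unfolding W_def \<theta>_def by (rule sum_window_integrals[OF T N1 \<delta>(1) \<delta>'(3)]) (use Fi in \<open>auto simp: F_def\<close>)
        also have "\<dots> \<le> 3 * e1"
        proof (rule mult_mono)
          have "\<delta> / T \<le> 1 / 2" using \<delta>' T by (simp add: field_simps)
          moreover have "0 < 1 - y \<and> 1 \<le> 2 * (1 - y)" if "y \<le> 1 / 2" for y :: real using that by simp
          ultimately have *: "0 < 1 - \<delta> / T" "1 \<le> 2 * (1 - \<delta> / T)" by blast+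
          then have "1 / (1 - \<delta> / T) \<le> 2" by (simp only: pos_divide_le_eq)
          moreover have "?k / \<delta> \<le> \<delta> / \<delta>" using kN(1)[OF NN] \<delta> by (intro divide_right_mono) auto
          then have "?k / \<delta> \<le> 1" using \<delta> by simp
          ultimately show "1 / (1 - \<delta> / T) + ?k / \<delta> \<le> 3" by linarith
        qed (use Fe in \<open>auto simp: F_def intro!: integral_nonneg_AE\<close>)
        finally show ?thesis .
      qed
      define b where "b t = D (step_index T N t) + \<kappa>" for t
      have si: "step_index T N t \<in> {1..N}" if "t \<in> space ?M" for t
        using step_index_range(1)[OF T N1, of t] that by auto
      have bi: "integrable ?M (\<lambda>t. b t powr r)" unfolding b_def by (rule step_integrable[OF T N1])
      have bb: "(\<integral>t. b t powr r \<partial>?M) \<le> 2 powr r * ((\<integral>t. D (step_index T N t) powr r \<partial>?M) + (\<integral>t. \<kappa> powr r \<partial>?M))"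
      proof (rule integrable_powr_bound(2)[where r=r])
        show "b \<in> borel_measurable ?M" unfolding b_def by (rule step_measurable[OF T N1])
        show "AE t in ?M. 0 \<le> b t \<and> b t \<le> D (step_index T N t) + \<kappa> \<and> 0 \<le> D (step_index T N t) \<and> 0 \<le> \<kappa>"
          using AE_space by eventually_elim (use D0 si \<kappa> in \<open>auto simp: b_def\<close>)
      qed (use step_integrable[OF T N1] r0 in auto)
      have bb': "(\<integral>t. b t powr r \<partial>?M) \<le> 2 powr r * (3 * e1 + T * \<kappa> powr r)"
      proof -
        have "(\<integral>t. D (step_index T N t) powr r \<partial>?M) \<le> 3 * e1"
          using sumD step_integral[OF T N1, of "\<lambda>m. D m powr r"] by simp
        moreover have "(\<integral>t. \<kappa> powr r \<partial>?M) = T * \<kappa> powr r" using integral_const_open_interval[of 0 T "\<kappa> powr r"] T by simp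
        ultimately show ?thesis using bb by (smt (verit) mult_left_mono powr_ge_zero)
      qed
      \<comment> \<open>The hypothesis on \<open>h m\<close> compares it with constants only, so the
        constant \<open>G t\<close> is inserted. On the window, \<open>g r - G t\<close> is split
        into \<open>F r\<close> and an oscillation of \<open>G\<close> that is at most
        \<kappa>.\<close>
      have main: "n (g t - h (step_index T N t)) \<le> F t + b t" if t: "t \<in> space ?M" "g t \<in> X" for t
      proof -
        define m where "m = step_index T N t"
        have m: "m \<in> {1..N}" using si[OF t(1)] by (simp add: m_def)
        have tT: "0 < t" "t < T" using t by auto
        have tm: "(real m - 1) * ?k < t" "t \<le> real m * ?k" using step_index_range(2,3)[OF T N1 tT(1)] tT by (auto simp: m_def)
        interpret W: finite_measure "lebesgue_on (W m)" unfolding W_def by (rule finite_measure_open_interval)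
        have "n (h m - G t) \<le> (1 / \<delta>) * (\<integral>r. n (g r - G t) \<partial>lebesgue_on (W m))" by (rule hm[OF m GX])
        also have "(\<integral>r. n (g r - G t) \<partial>lebesgue_on (W m)) \<le> (\<integral>r. F r + \<kappa> \<partial>lebesgue_on (W m))"
        proof (rule integral_mono_AE')
          show "integrable (lebesgue_on (W m)) (\<lambda>r. F r + \<kappa>)" using FW(1)[OF m] by simp
          show "AE r in lebesgue_on (W m). n (g r - G t) \<le> F r + \<kappa>"
            using FW(4)[OF m] AE_space
          proof eventually_elim
            fix r assume r: "g r \<in> X" "r \<in> space (lebesgue_on (W m))"
            have rW: "\<theta> * (real m * ?k) < r" "r < \<theta> * (real m * ?k) + \<delta>" using r(2) by (auto simp: W_def)
            have mk: "0 \<le> real m * ?k" "real m * ?k \<le> T"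
            proof -
              have "real m * ?k \<le> real N * ?k" using m T by (intro mult_right_mono) auto
              then show "real m * ?k \<le> T" using N1 by simp
            qed (use T in auto)
            have "(1 - \<delta> / T) * x = x - \<delta> * (x / T)" for x by (simp add: left_diff_distrib)
            then have "\<theta> * (real m * ?k) = real m * ?k - \<delta> * (real m * ?k / T)" unfolding \<theta>_def .
            moreover have "x / T \<le> 1 \<and> 0 \<le> x / T" if "0 \<le> x" "x \<le> T" for x using that T by simp
            then have "real m * ?k / T \<le> 1" "0 \<le> real m * ?k / T" using mk by blast+
            then have "\<delta> * (real m * ?k / T) \<le> \<delta> * 1" "0 \<le> \<delta> * (real m * ?k / T)"
              using \<delta> by (intro mult_left_mono mult_nonneg_nonneg; linarith)+
            moreover have "a * k - t < \<delta>" if "(a - 1) * k < t" "k \<le> \<delta>" for a k :: real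
              using that by (simp add: left_diff_distrib)
            then have "real m * ?k - t < \<delta>" using tm(1) kN(1)[OF NN] by blast
            ultimately have "\<bar>r - t\<bar> < d"
            proof -
              have "\<bar>r - t\<bar> < d" if "w = \<tau> - x" "w < r" "r < w + \<delta>" "x \<le> \<delta> * 1" "0 \<le> x" "\<tau> - t < \<delta>" "t \<le> \<tau>" for w \<tau> x
                using that \<delta>'(1) by linarith
              then show "\<theta> * (real m * ?k) = real m * ?k - \<delta> * (real m * ?k / T) \<Longrightarrow>
                \<delta> * (real m * ?k / T) \<le> \<delta> * 1 \<Longrightarrow> 0 \<le> \<delta> * (real m * ?k / T) \<Longrightarrow> real m * ?k - t < \<delta> \<Longrightarrow> \<bar>r - t\<bar> < d"
                using rW tm(2) by blast
            qed
            then have "n (G r - G t) \<le> \<kappa>" using r(2) WT[OF m] tT by (intro d(2)) auto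
            moreover have "n (g r - G t) \<le> n (g r - G r) + n (G r - G t)" by (rule carrier_norm_triangle[OF N r(1) GX GX])
            ultimately show "n (g r - G t) \<le> F r + \<kappa>" by (simp add: F_def)
          qed
          show "AE r in lebesgue_on (W m). 0 \<le> F r + \<kappa>"
            using FW(3)[OF m] by eventually_elim (use \<kappa> in auto)
        qed
        also have "(\<integral>r. F r + \<kappa> \<partial>lebesgue_on (W m)) = (\<integral>r. F r \<partial>lebesgue_on (W m)) + \<delta> * \<kappa>"
        proof -
          have "(\<integral>r. F r + \<kappa> \<partial>lebesgue_on (W m)) = (\<integral>r. F r \<partial>lebesgue_on (W m)) + (\<integral>r. \<kappa> \<partial>lebesgue_on (W m))"
            by (rule Bochner_Integration.integral_add[OF FW(1)[OF m] W.integrable_const])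
          also have "(\<integral>r. \<kappa> \<partial>lebesgue_on (W m)) = (\<theta> * (real m * ?k) + \<delta> - \<theta> * (real m * ?k)) * \<kappa>"
            unfolding W_def using \<delta> by (intro integral_const_open_interval) simp
          finally show ?thesis by simp
        qed
        finally have "n (h m - G t) \<le> (1 / \<delta>) * ((\<integral>r. F r \<partial>lebesgue_on (W m)) + \<delta> * \<kappa>)"
          using \<delta> by (simp add: divide_right_mono)
        then have "n (h m - G t) \<le> b t" using \<delta> by (simp add: D_def b_def m_def add_divide_distrib)
        then show ?thesis
          using carrier_norm_triangle[OF N t(2) GX[of t] hX[OF m]] carrier_norm_commute[OF N GX[of t] hX[OF m]]
          by (simp add: F_def m_def)
      qed
      have le: "AE t in ?M. 0 \<le> n (g t - h (step_index T N t)) \<and> n (g t - h (step_index T N t)) \<le> F t + b t \<and> 0 \<le> F t \<and> 0 \<le> b t"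
        using gX F0 AE_space
      proof eventually_elim
        fix t assume t: "g t \<in> X" "0 \<le> F t" "t \<in> space ?M"
        then show "0 \<le> n (g t - h (step_index T N t)) \<and> n (g t - h (step_index T N t)) \<le> F t + b t \<and> 0 \<le> F t \<and> 0 \<le> b t"
          using main[OF t(3,1)] D0[OF si[OF t(3)]] \<kappa>(1) carrier_norm_nonneg[OF N carrier_diff[OF N t(1) hX[OF si[OF t(3)]]]]
          by (auto simp: b_def)
      qed
      have m: "(\<lambda>t. n (g t - h (step_index T N t))) \<in> borel_measurable ?M"
        by (intro strongly_measurable_norm[OF _ N] strongly_measurable_diff[OF N] gs
            strongly_measurable_simple[OF N] step_simple_on[OF T N1 hX]) auto
      have Fi': "integrable ?M (\<lambda>t. F t powr r)" using Fi by (simp add: F_def)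
      note ib = integrable_powr_bound[OF m le Fi' bi r0(1)]
      have Fe': "(\<integral>t. F t powr r \<partial>?M) \<le> e1" using Fe by (simp add: F_def)
      have "(\<integral>t. n (g t - h (step_index T N t)) powr r \<partial>?M) \<le> 2 powr r * (e1 + 2 powr r * (3 * e1 + T * \<kappa> powr r))"
        using ib(2) Fe' bb' by (smt (verit) mult_left_mono powr_ge_zero)
      also have "\<dots> \<le> e"
      proof -
        have 4: "2 powr r * 2 powr r = (4::real) powr r" by (simp flip: powr_mult)
        have "(2::real) powr r \<le> 4 powr r" using r0 by (intro powr_mono2) auto
        then have "2 powr r * e1 \<le> 4 powr r * e1" using e1 by (intro mult_right_mono) auto
        moreover have "4 powr r * e1 = e / 8" by (simp add: e1_def)
        moreover have "4 powr r * (T * \<kappa> powr r) = e / 2" using T by (simp add: \<kappa>(2))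
        moreover have "2 powr r * (e1 + 2 powr r * (3 * e1 + T * \<kappa> powr r)) = 2 powr r * e1 + 3 * ((2 powr r * 2 powr r) * e1) + (2 powr r * 2 powr r) * (T * \<kappa> powr r)"
          by (simp add: algebra_simps)
        ultimately show ?thesis unfolding 4 using e by linarith
      qed
      finally show ?thesis using ib(1) by blast
    qed
    then show ?thesis by (intro exI[of _ N0]) (auto simp: N0_def)
  qed
  ultimately show thesis using that by blast
qed


section \<open>Measurability of the Nemytskii operators\<close>

lemma real_squeeze_0:
  fixes f g :: "nat \<Rightarrow> real"
  assumes "\<And>i. 0 \<le> f i \<and> f i \<le> g i" "g \<longlonglongrightarrow> 0"
  shows "f \<longlonglongrightarrow> 0"
  by (rule tendsto_sandwich[OF _ _ tendsto_const assms(2)]) (use assms(1) in auto)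

context
  fixes T p \<beta> \<eta> lam \<mu> :: real and X :: "'h::real_inner set" and n sn :: "'h \<Rightarrow> real"
    and A :: "real \<Rightarrow> 'h \<Rightarrow> 'h \<Rightarrow> real"
  assumes N: "normed_on X n" and fam: "operator_family T p \<beta> \<eta> lam \<mu> X n sn A"
    and p: "p > 1" and eta: "\<eta> \<ge> 0" and beta: "\<beta> > 0"
begin

lemma operator_dual: "t \<in> {0..T} \<Longrightarrow> v \<in> X \<Longrightarrow> A t v \<in> dual_space X n"
  and operator_continuous: "v \<in> X \<Longrightarrow> t \<in> {0..T} \<Longrightarrow>
    ((\<lambda>r. dual_norm X n (A r v - A t v)) \<longlongrightarrow> 0) (at t within {0..T})"
  and operator_hemicontinuous: "t \<in> {0..T} \<Longrightarrow> x \<in> X \<Longrightarrow> v \<in> X \<Longrightarrow> w \<in> X \<Longrightarrow>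
    continuous_on {0..1} (\<lambda>\<tau>::real. A t (x + \<tau> *\<^sub>R v) w)"
  and operator_monotone: "t \<in> {0..T} \<Longrightarrow> v \<in> X \<Longrightarrow> w \<in> X \<Longrightarrow>
    (A t v - A t w) (v - w) \<ge> \<eta> * sn (v - w) powr p"
  and operator_growth: "t \<in> {0..T} \<Longrightarrow> v \<in> X \<Longrightarrow> dual_norm X n (A t v) \<le> \<beta> * (1 + n v powr (p - 1))"
  and operator_coercive: "t \<in> {0..T} \<Longrightarrow> v \<in> X \<Longrightarrow> A t v v + lam \<ge> \<mu> * sn v powr p"
  using fam unfolding operator_family_def by blast+

text \<open>Minty's argument. Monotonicity is applied at \<open>x i\<close> and at the shifted point
  \<open>y + \<tau> *\<^sub>R w\<close>; division by \<tau> bounds \<open>A t (x i) w\<close> by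
  \<open>A t (y + \<tau> *\<^sub>R w) w\<close> plus a multiple of \<open>n (x i - y)\<close>,
  because growth bounds the functionals \<open>A t (x i)\<close>. Hemicontinuity makes the shift
  negligible, with \<tau> fixed before \<open>i\<close> grows.\<close>

lemma demicontinuous_upper:
  assumes t: "t \<in> {0..T}" and x: "\<And>i::nat. x i \<in> X" "y \<in> X" and lim: "(\<lambda>i. n (x i - y)) \<longlonglongrightarrow> 0"
    and w: "w \<in> X" and e: "e > 0"
  shows "\<forall>\<^sub>F i in sequentially. A t (x i) w \<le> A t y w + e"
proof -
  have dX: "x i - y \<in> X" for i using carrier_diff[OF N x(1) x(2)] .
  define f where "f \<tau> = A t (y + \<tau> *\<^sub>R w) w" for \<tau> :: real
  have "continuous_on {0..1} f" unfolding f_def by (rule operator_hemicontinuous[OF t x(2) w w])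
  then have "\<exists>d>0. \<forall>\<tau>\<in>{0..1}. dist \<tau> 0 < d \<longrightarrow> dist (f \<tau>) (f 0) < e / 2"
    using e unfolding continuous_on_iff by (meson atLeastAtMost_iff half_gt_zero order_refl zero_le_one)
  then obtain d where d: "d > 0" "\<And>\<tau>. \<tau> \<in> {0..1} \<Longrightarrow> \<bar>\<tau>\<bar> < d \<Longrightarrow> \<bar>f \<tau> - f 0\<bar> < e / 2"
    by (auto simp: dist_real_def)
  define \<tau> where "\<tau> = min 1 (d / 2)"
  have \<tau>: "0 < \<tau>" "\<tau> \<le> 1" "\<bar>\<tau>\<bar> < d" using d(1) by (auto simp: \<tau>_def)
  have "\<bar>f \<tau> - f 0\<bar> < e / 2" using d(2)[of \<tau>] \<tau> by simp
  moreover have "f 0 = A t y w" by (simp add: f_def)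
  ultimately have f\<tau>: "f \<tau> \<le> A t y w + e / 2" by linarith
  let ?z = "y + \<tau> *\<^sub>R w"
  have z: "?z \<in> X" using carrier_add[OF N x(2) carrier_scale[OF N w]] .
  define B where "B = \<beta> * (1 + (n y + 1) powr (p - 1)) + dual_norm X n (A t ?z)"
  have n0: "0 \<le> n y" by (rule carrier_norm_nonneg[OF N x(2)])
  have B: "B > 0" unfolding B_def using beta dual_norm_nonneg[OF N operator_dual[OF t z]]
    by (intro add_pos_nonneg mult_pos_pos add_pos_nonneg) auto
  have "\<forall>\<^sub>F i in sequentially. n (x i - y) < min 1 (\<tau> * e / (2 * B))"
    using lim \<tau> e B by (intro order_tendstoD(2)[OF lim]) auto
  then show ?thesis
  proof eventually_elim
    fix i assume i: "n (x i - y) < min 1 (\<tau> * e / (2 * B))"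
    have d0: "0 \<le> n (x i - y)" by (rule carrier_norm_nonneg[OF N dX])
    have "n (x i) \<le> n y + 1" using carrier_norm_diff_abs[OF N x(1)[of i] x(2)] i by auto
    then have "n (x i) powr (p - 1) \<le> (n y + 1) powr (p - 1)"
      using carrier_norm_nonneg[OF N x(1)] p by (intro powr_mono2) auto
    then have "dual_norm X n (A t (x i)) \<le> \<beta> * (1 + (n y + 1) powr (p - 1))"
      using operator_growth[OF t x(1)[of i]] beta by (smt (verit) mult_left_mono)
    then have b1: "A t (x i) (x i - y) \<le> \<beta> * (1 + (n y + 1) powr (p - 1)) * n (x i - y)"
      using dual_bound[OF N operator_dual[OF t x(1)[of i]] dX[of i]] d0 mult_right_mono by fastforce
    have b2: "- A t ?z (x i - y) \<le> dual_norm X n (A t ?z) * n (x i - y)"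
      using dual_bound[OF N operator_dual[OF t z] dX[of i]] by linarith
    have "0 \<le> \<eta> * sn (x i - ?z) powr p" using eta by simp
    also have "\<dots> \<le> (A t (x i) - A t ?z) (x i - ?z)" by (rule operator_monotone[OF t x(1) z])
    also have "x i - ?z = (x i - y) - \<tau> *\<^sub>R w" by simp
    also have "(A t (x i) - A t ?z) \<dots> = A t (x i) (x i - y) - \<tau> * A t (x i) w - A t ?z (x i - y) + \<tau> * A t ?z w"
      using dual_diff[OF N operator_dual[OF t x(1)[of i]] dX[of i] carrier_scale[OF N w]]
        dual_diff[OF N operator_dual[OF t z] dX[of i] carrier_scale[OF N w]]
        dual_scale[OF N operator_dual[OF t x(1)[of i]] w] dual_scale[OF N operator_dual[OF t z] w]
      by simp
    finally have "\<tau> * A t (x i) w \<le> B * n (x i - y) + \<tau> * A t ?z w"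
      using b1 b2 by (simp add: B_def algebra_simps)
    also have "B * n (x i - y) \<le> \<tau> * (e / 2)" using i B by (simp add: field_simps)
    also have "\<tau> * A t ?z w \<le> \<tau> * (A t y w + e / 2)" using f\<tau> \<tau> by (intro mult_left_mono) (auto simp: f_def)
    finally have "\<tau> * A t (x i) w \<le> \<tau> * (A t y w + e)" by (simp add: algebra_simps)
    then show "A t (x i) w \<le> A t y w + e" using \<tau> by simp
  qed
qed

text \<open>The one-sided bound is used for \<open>w\<close> and for \<open>- w\<close>.\<close>

lemma demicontinuous:
  assumes t: "t \<in> {0..T}" and x: "\<And>i::nat. x i \<in> X" "y \<in> X" and lim: "(\<lambda>i. n (x i - y)) \<longlonglongrightarrow> 0"
    and w: "w \<in> X"
  shows "(\<lambda>i. A t (x i) w) \<longlonglongrightarrow> A t y w"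
proof (rule LIMSEQ_I)
  fix e :: real assume e: "e > 0"
  have "\<forall>\<^sub>F i in sequentially. A t (x i) w \<le> A t y w + e / 2"
    by (rule demicontinuous_upper[OF t x lim w]) (use e in simp)
  moreover have "\<forall>\<^sub>F i in sequentially. A t (x i) (- w) \<le> A t y (- w) + e / 2"
    by (rule demicontinuous_upper[OF t x lim carrier_minus[OF N w]]) (use e in simp)
  ultimately have "\<forall>\<^sub>F i in sequentially. norm (A t (x i) w - A t y w) < e"
  proof eventually_elim
    fix i assume "A t (x i) w \<le> A t y w + e / 2" "A t (x i) (- w) \<le> A t y (- w) + e / 2"
    then show "norm (A t (x i) w - A t y w) < e"
      using e dual_minus[OF N operator_dual[OF t x(1)[of i]] w] dual_minus[OF N operator_dual[OF t x(2)] w]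
      by (simp add: abs_less_iff)
  qed
  then show "\<exists>no. \<forall>i\<ge>no. norm (A t (x i) w - A t y w) < e" by (simp add: eventually_sequentially)
qed

end

text \<open>Pettis' theorem: a countable family of test vectors that norms the differences of the \<open>y j\<close>
  also norms the functions \<open>g - y j\<close>.\<close>

lemma pettis_dual:
  fixes y :: "nat \<Rightarrow> 'a::real_vector \<Rightarrow> real"
  assumes S: "S \<in> sets lebesgue" and N: "normed_on X n" and y: "\<And>j. y j \<in> dual_space X n"
    and weak: "\<And>x. x \<in> X \<Longrightarrow> (\<lambda>t. g t x) \<in> borel_measurable (lebesgue_on S)"
    and g: "AE t in lebesgue_on S. g t \<in> dual_space X n \<and> (\<forall>e>0. \<exists>j. dual_norm X n (g t - y j) < e)"
  shows "strongly_measurable_on (lebesgue_on S) (dual_space X n) (dual_norm X n) g"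
proof -
  let ?D = "dual_space X n" and ?N = "dual_norm X n" and ?M = "lebesgue_on S"
  note D = normed_on_dual[OF N]
  have "\<exists>x\<in>X. n x \<le> 1 \<and> ?N z - e < \<bar>z x\<bar>" if z: "z \<in> ?D" and e: "e > 0" for z and e :: real
  proof -
    have "?N z - e < (SUP x\<in>{x\<in>X. n x \<le> 1}. \<bar>z x\<bar>)" using e unfolding dual_norm_def by simp
    then obtain x where "x \<in> {x\<in>X. n x \<le> 1}" "?N z - e < \<bar>z x\<bar>"
      using less_cSUP_iff[OF _ dual_bdd[OF N z]] carrier_0[OF N] carrier_norm_0[OF N] by (metis (mono_tags, lifting) empty_iff mem_Collect_eq zero_le_one)
    then show ?thesis by auto
  qed
  then have "\<forall>i j m. \<exists>x. x \<in> X \<and> n x \<le> 1 \<and> ?N (y i - y j) - 1 / Suc m < \<bar>(y i - y j) x\<bar>"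
    using carrier_diff[OF D y y] by (metis of_nat_0_less_iff zero_less_Suc zero_less_divide_1_iff)
  then obtain x where x: "\<And>i j m. x i j m \<in> X" "\<And>i j m. n (x i j m) \<le> 1"
    "\<And>i j m. ?N (y i - y j) - 1 / Suc m < \<bar>(y i - y j) (x i j m)\<bar>" by metis
  \<comment> \<open>Measurable, being given by countably many evaluations. By \<open>Qeq\<close> it
    is, up to a null set, the set where \<open>g t\<close> has distance at most \<open>r\<close>
    from \<open>y j\<close>: \<open>g t\<close> is close to some \<open>y i\<close>, and the vectors
    \<open>x i j m\<close> norm \<open>y i - y j\<close>.\<close>
  define Q where "Q j r = {t \<in> space ?M. \<forall>i m. \<bar>g t (x i j m) - y j (x i j m)\<bar> \<le> r}" for j and r :: real
  have Q: "Q j r \<in> sets ?M" for j r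
  proof -
    have m: "(\<lambda>t. g t (x i j m)) \<in> borel_measurable ?M" for i m by (rule weak[OF x(1)])
    show ?thesis unfolding Q_def using m by measurable
  qed
  have Qeq: "t \<in> Q j r \<longleftrightarrow> ?N (g t - y j) \<le> r"
    if t: "t \<in> space ?M" "g t \<in> ?D" "\<forall>e>0. \<exists>j. ?N (g t - y j) < e" for t j r
  proof
    have d: "g t - y j \<in> ?D" by (rule carrier_diff[OF D t(2) y])
    assume "?N (g t - y j) \<le> r"
    moreover have "\<bar>(g t - y j) (x i j m)\<bar> \<le> ?N (g t - y j) * 1" for i m
      using dual_bound[OF N d x(1)[of i j m]] mult_left_mono[OF x(2)[of i j m] dual_norm_nonneg[OF N d]] by linarith
    ultimately show "t \<in> Q j r" unfolding Q_def using t(1) by (simp, meson order_trans)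
  next
    assume tQ: "t \<in> Q j r"
    show "?N (g t - y j) \<le> r"
    proof (rule field_le_epsilon)
      fix e :: real assume e: "e > 0"
      obtain i where i: "?N (g t - y i) < e / 3" using t(3) e by (metis divide_pos_pos zero_less_numeral)
      obtain m where m: "1 / Suc m < e / 3" using nat_approx_posE[of "e / 3"] e by auto
      have d: "g t - y i \<in> ?D" by (rule carrier_diff[OF D t(2) y])
      have "\<bar>(y i - y j) (x i j m)\<bar> \<le> \<bar>(g t - y i) (x i j m)\<bar> + \<bar>g t (x i j m) - y j (x i j m)\<bar>" by simp
      also have "\<bar>(g t - y i) (x i j m)\<bar> \<le> ?N (g t - y i) * 1"
        using dual_bound[OF N d x(1)[of i j m]] mult_left_mono[OF x(2)[of i j m] dual_norm_nonneg[OF N d]] by linarith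
      also have "\<bar>g t (x i j m) - y j (x i j m)\<bar> \<le> r" using tQ unfolding Q_def by blast
      finally have "?N (y i - y j) \<le> r + 2 * e / 3" using x(3)[of i j m] i m by linarith
      then show "?N (g t - y j) \<le> r + e" using carrier_norm_triangle[OF D t(2) y[of i] y[of j]] i by linarith
    qed
  qed
  \<comment> \<open>The pairs \<open>(j, m)\<close> up to \<open>k\<close> for which
    \<open>y j\<close> is known to be within \<open>1 / Suc m\<close> of \<open>g t\<close>. The
    choice \<open>best\<close> takes the largest \<open>m\<close>, so \<sigma> improves with
    \<open>k\<close>; it depends on \<open>t\<close> only through a subset of a finite set, which
    makes it simple. If no pair qualifies, the choice is arbitrary but still a member of the
    sequence \<open>y\<close>.\<close>
  define P where "P k t = {jm \<in> {..k} \<times> {..k}. t \<in> Q (fst jm) (1 / Suc (snd jm))}" for k t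
  define best where "best R = (SOME jm. jm \<in> R \<and> (\<forall>jm'\<in>R. snd jm' \<le> (snd jm :: nat)))" for R :: "(nat \<times> nat) set"
  define \<sigma> where "\<sigma> k t = y (fst (best (P k t)))" for k t
  have best: "best R \<in> R" "\<And>jm'. jm' \<in> R \<Longrightarrow> snd jm' \<le> snd (best R)" if "finite R" "R \<noteq> {}" for R
  proof -
    have "Max (snd ` R) \<in> snd ` R" using that by simp
    then obtain jm where "jm \<in> R" "snd jm = Max (snd ` R)" by (metis imageE)
    then have "jm \<in> R \<and> (\<forall>jm'\<in>R. snd jm' \<le> snd jm)" using that(1) by auto
    from someI[of "\<lambda>jm. jm \<in> R \<and> (\<forall>jm'\<in>R. snd jm' \<le> snd jm)", OF this]
    show "best R \<in> R" "\<And>jm'. jm' \<in> R \<Longrightarrow> snd jm' \<le> snd (best R)" unfolding best_def by auto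
  qed
  have \<sigma>s: "simple_on ?M ?D (\<sigma> k)" for k
  proof -
    have "simple_function ?M (P k)"
      unfolding simple_function_def
    proof (intro conjI ballI)
      have "P k ` space ?M \<subseteq> Pow ({..k} \<times> {..k})" unfolding P_def by auto
      then show "finite (P k ` space ?M)" by (rule finite_subset) simp
      fix R assume "R \<in> P k ` space ?M"
      then have R: "R \<subseteq> {..k} \<times> {..k}" unfolding P_def by auto
      have "P k -` {R} \<inter> space ?M = {t \<in> space ?M. \<forall>jm\<in>{..k} \<times> {..k}. (t \<in> Q (fst jm) (1 / Suc (snd jm))) = (jm \<in> R)}"
        using R unfolding P_def by blast
      also have "\<dots> \<in> sets ?M"
      proof (rule sets.sets_Collect_finite_All)
        fix jm assume "jm \<in> {..k} \<times> {..k}"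
        have "Q j r \<subseteq> space ?M" for j r unfolding Q_def by auto
        then have "{t \<in> space ?M. (t \<in> Q j r) = b} = (if b then Q j r else space ?M - Q j r)" for j r b by auto
        then show "{t \<in> space ?M. (t \<in> Q (fst jm) (1 / Suc (snd jm))) = (jm \<in> R)} \<in> sets ?M"
          using Q by auto
      qed auto
      finally show "P k -` {R} \<inter> space ?M \<in> sets ?M" .
    qed
    from simple_function_compose[OF this, of "\<lambda>R. y (fst (best R))"] show ?thesis
      using y unfolding simple_on_def \<sigma>_def by (auto simp: comp_def)
  qed
  show ?thesis
  proof (rule strongly_measurableI[OF \<sigma>s])
    show "AE t in ?M. g t \<in> ?D" using g by eventually_elim simp
    show "AE t in ?M. (\<lambda>k. ?N (\<sigma> k t - g t)) \<longlonglongrightarrow> 0"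
      using g AE_space
    proof eventually_elim
      fix t assume t: "g t \<in> ?D \<and> (\<forall>e>0. \<exists>j. ?N (g t - y j) < e)" "t \<in> space ?M"
      show "(\<lambda>k. ?N (\<sigma> k t - g t)) \<longlonglongrightarrow> 0"
      proof (rule LIMSEQ_I)
        fix e :: real assume e: "e > 0"
        obtain m where m: "1 / Suc m < e" using nat_approx_posE[OF e] by auto
        obtain j where "?N (g t - y j) < 1 / Suc m" using t(1) by (metis of_nat_0_less_iff zero_less_Suc zero_less_divide_1_iff)
        then have jm: "t \<in> Q j (1 / Suc m)" using Qeq[of t j "1 / Suc m"] t by simp
        have "norm (?N (\<sigma> k t - g t) - 0) < e" if k: "k \<ge> max j m" for k
        proof -
          have in1: "(j, m) \<in> P k t" using jm k unfolding P_def by simp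
          have fin: "finite (P k t)" "P k t \<noteq> {}" using in1 unfolding P_def by (auto intro: finite_subset[of _ "{..k} \<times> {..k}"])
          obtain j' m' where b: "best (P k t) = (j', m')" by fastforce
          have "m \<le> m'" using best(2)[OF fin in1] by (simp add: b)
          have "(j', m') \<in> P k t" using best(1)[OF fin] unfolding b .
          then have "t \<in> Q j' (1 / Suc m')" unfolding P_def by simp
          then have "?N (g t - y j') \<le> 1 / Suc m'" using Qeq[of t j' "1 / Suc m'"] t by simp
          also have "\<dots> \<le> 1 / Suc m" using \<open>m \<le> m'\<close> by (simp add: field_simps)
          finally have "?N (g t - y j') < e" using m by linarith
          moreover have "?N (\<sigma> k t - g t) = ?N (g t - y j')"
            using carrier_norm_commute[OF D _ y, of "g t" j'] t(1) by (simp add: \<sigma>_def b)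
          moreover have "0 \<le> ?N (g t - y j')" using t(1) by (intro dual_norm_nonneg[OF N] carrier_diff[OF D] y) simp
          ultimately show ?thesis by simp
        qed
        then show "\<exists>no. \<forall>k\<ge>no. norm (?N (\<sigma> k t - g t) - 0) < e" by blast
      qed
    qed
  qed
qed

text \<open>Rational linear combinations, coded as finite lists of a coefficient and an index and
  enumerated through this code.\<close>

lemma countable_dense_in_span:
  fixes c :: "nat \<Rightarrow> 'a::real_vector"
  assumes N: "normed_on D m" and c: "range c \<subseteq> D"
  shows "\<exists>y :: nat \<Rightarrow> 'a. (\<forall>j. y j \<in> D) \<and> (\<forall>z\<in>span (range c). \<forall>e>0. \<exists>j. m (z - y j) < e)"
proof -
  define ev where "ev l = (\<Sum>(q, i)\<leftarrow>l. real_of_rat q *\<^sub>R c i)" for l :: "(rat \<times> nat) list"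
  have evD: "ev l \<in> D" for l
    by (induction l) (use c in \<open>auto simp: ev_def carrier_0[OF N] intro!: carrier_add[OF N] carrier_scale[OF N]\<close>)
  have dense: "z \<in> D \<and> (\<forall>e>0. \<exists>l. m (z - ev l) < e)" if "z \<in> span (range c)" for z
    using that
  proof (induction rule: span_induct_alt)
    case base
    have "m (0 - ev []) = 0" by (simp add: ev_def carrier_norm_0[OF N])
    then show ?case using carrier_0[OF N] by metis
  next
    case (step a x z)
    then obtain i where i: "x = c i" by auto
    have xD: "x \<in> D" using i c by auto
    have zD: "z \<in> D" using step by blast
    show ?case
    proof (intro conjI allI impI)
      show "a *\<^sub>R x + z \<in> D" by (rule carrier_add[OF N carrier_scale[OF N xD] zD])
      fix e :: real assume e: "e > 0"
      obtain l where l: "m (z - ev l) < e / 2" using step e half_gt_zero by blast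
      have m0: "0 \<le> m x" by (rule carrier_norm_nonneg[OF N xD])
      have "a < a + e / (2 * (m x + 1))" using e m0 by (simp add: add_pos_nonneg)
      then obtain q where q: "a < real_of_rat q" "real_of_rat q < a + e / (2 * (m x + 1))" using of_rat_dense by blast
      have eq: "a *\<^sub>R x + z - ev ((q, i) # l) = (a - real_of_rat q) *\<^sub>R x + (z - ev l)"
        by (simp add: ev_def i algebra_simps)
      have "m (a *\<^sub>R x + z - ev ((q, i) # l)) \<le> \<bar>a - real_of_rat q\<bar> * m x + m (z - ev l)"
        unfolding eq carrier_norm_scale[OF N xD, symmetric]
        by (rule carrier_norm_add[OF N carrier_scale[OF N xD] carrier_diff[OF N zD evD]])
      also have "\<bar>a - real_of_rat q\<bar> * m x \<le> (e / (2 * (m x + 1))) * (m x + 1)"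
        using q m0 by (intro mult_mono) auto
      also have "\<dots> = e / 2" using m0 by (simp add: field_simps)
      finally show "\<exists>l. m (a *\<^sub>R x + z - ev l) < e" using l by (intro exI[of _ "(q, i) # l"]) linarith
    qed
  qed
  then have "\<exists>j. m (z - ev (from_nat j)) < e" if "z \<in> span (range c)" "e > 0" for z e
    using dense[OF that(1)] that(2) by (metis from_nat_to_nat)
  then show ?thesis using evD by (intro exI[of _ "\<lambda>j. ev (from_nat j)"] conjI ballI allI impI) auto
qed

text \<open>The space \<open>X\<close> is not assumed separable, so Pettis' theorem needs a
  separable range. The values lie in the closed span of the countably many functionals
  \<open>A r (d j)\<close> with rational \<open>r\<close> and a sequence \<open>d\<close> dense in
  \<open>V\<close>: with respect to time by continuity in the dual norm, with respect to the vector
  by demicontinuity, which yields pointwise limits only and is upgraded to approximation in norm by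
  reflexivity. The general time argument \<rho> covers the identity as well as the grid
  times.\<close>

lemma nemytskii_strongly_measurable:
  fixes X V :: "'h::real_inner set"
  assumes N: "normed_on X n" and R: "reflexive_on X n"
    and fam: "operator_family T p \<beta> \<eta> lam \<mu> X n sn A" and p: "p > 1" and eta: "\<eta> \<ge> 0" and beta: "\<beta> > 0" and T: "T > 0"
    and V: "normed_on V nV" "separable_on V nV" "V \<subseteq> X" "\<And>v. v \<in> V \<Longrightarrow> n v \<le> C * nV v"
    and S: "S \<in> sets lebesgue" and u: "strongly_measurable_on (lebesgue_on S) V nV u"
    and \<rho>: "\<rho> \<in> borel_measurable (lebesgue_on S)" "\<And>t. t \<in> S \<Longrightarrow> \<rho> t \<in> {0..T}"
  shows "strongly_measurable_on (lebesgue_on S) (dual_space X n) (dual_norm X n) (\<lambda>t. A (\<rho> t) (u t))"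
proof -
  let ?D = "dual_space X n" and ?N = "dual_norm X n" and ?M = "lebesgue_on S"
  note D = normed_on_dual[OF N]
  note dual = operator_dual[OF N fam p eta beta] and cont = operator_continuous[OF N fam p eta beta]
    and demi = demicontinuous[OF N fam p eta beta]
  obtain E where E: "E \<subseteq> V" "countable E" "\<And>x e. x \<in> V \<Longrightarrow> e > 0 \<Longrightarrow> \<exists>d\<in>E. nV (x - d) < e"
    using V(2) unfolding separable_on_def by blast
  have "E \<noteq> {}" using E(3)[OF carrier_0[OF V(1)], of 1] by auto
  define d where "d = from_nat_into E"
  have d: "range d = E" unfolding d_def using \<open>E \<noteq> {}\<close> E(2) by (rule range_from_nat_into)
  \<comment> \<open>Rational times outside \<open>[0,T]\<close> are moved into it, so that every
    member of the enumeration \<open>c\<close> lies in the dual; the same map extends the scalar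
    functions of time continuously to the whole line.\<close>
  define clamp where "clamp r = max 0 (min T r)" for r :: real
  have clamp: "clamp r \<in> {0..T}" for r using T by (simp add: clamp_def)
  have clamp_eq: "clamp r = r" if "r \<in> {0..T}" for r using that by (simp add: clamp_def)
  define c where "c i = A (clamp (real_of_rat (fst (from_nat i :: rat \<times> nat)))) (d (snd (from_nat i :: rat \<times> nat)))" for i :: nat
  have dX: "d j \<in> X" "d j \<in> V" for j using d E(1) V(3) by auto
  have cD: "range c \<subseteq> ?D" unfolding c_def using dual[OF clamp dX(1)] by auto
  define Y where "Y = span (range c)"
  have YD: "Y \<subseteq> ?D" unfolding Y_def by (rule span_minimal[OF cD carrier_subspace[OF D]])
  have cY: "A r (d j) \<in> Y" if "r \<in> {0..T}" "r = real_of_rat a" for r a j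
  proof -
    have "A r (d j) = c (to_nat (a, j))" unfolding c_def using that clamp_eq by simp
    then show ?thesis unfolding Y_def by (simp add: span_base)
  qed
  have near1: "\<exists>z\<in>Y. ?N (A t (d j) - z) < e" if t: "t \<in> {0..T}" and e: "e > 0" for t j e
  proof -
    have "\<forall>\<^sub>F r in at t within {0..T}. ?N (A r (d j) - A t (d j)) < e"
      using cont[OF dX(1) t] e by (intro order_tendstoD(2)) auto
    then obtain \<epsilon> where \<epsilon>: "\<epsilon> > 0" "\<And>r. r \<in> {0..T} \<Longrightarrow> r \<noteq> t \<Longrightarrow> dist r t < \<epsilon> \<Longrightarrow> ?N (A r (d j) - A t (d j)) < e"
      unfolding eventually_at by blast
    have "max 0 (t - \<epsilon>) < min T (t + \<epsilon>)" using t T \<epsilon>(1) by auto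
    then obtain q where q: "max 0 (t - \<epsilon>) < real_of_rat q" "real_of_rat q < min T (t + \<epsilon>)" using of_rat_dense by blast
    then have r: "real_of_rat q \<in> {0..T}" "dist (real_of_rat q) t < \<epsilon>" by (auto simp: dist_real_def)
    have "?N (A t (d j) - A (real_of_rat q) (d j)) < e"
      using \<epsilon>(2)[OF r(1) _ r(2)] carrier_norm_commute[OF D dual[OF t dX(1)] dual[OF r(1) dX(1)], of j j] carrier_norm_0[OF D] e
      by (cases "real_of_rat q = t") auto
    then show ?thesis using cY[OF r(1) refl] by blast
  qed
  have near: "\<exists>z\<in>Y. ?N (A t v - z) < e" if t: "t \<in> {0..T}" and v: "v \<in> V" and e: "e > 0" for t v e
  proof -
    have "\<forall>i. \<exists>j. nV (v - d j) < 1 / Suc i"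
      using E(3)[OF v] d by (metis of_nat_0_less_iff rangeE zero_less_Suc zero_less_divide_1_iff)
    then obtain j where j: "\<And>i. nV (v - d (j i)) < 1 / Suc i" by metis
    have "\<forall>i. \<exists>z. z \<in> Y \<and> ?N (A t (d (j i)) - z) < 1 / Suc i"
      using near1[OF t] by (metis of_nat_0_less_iff zero_less_Suc zero_less_divide_1_iff)
    then obtain \<psi> where \<psi>: "\<And>i. \<psi> i \<in> Y" "\<And>i. ?N (A t (d (j i)) - \<psi> i) < 1 / Suc i" by metis
    have vX: "v \<in> X" using v V(3) by auto
    have inv: "(\<lambda>i. 1 / real (Suc i)) \<longlonglongrightarrow> 0" using LIMSEQ_inverse_real_of_nat by (simp add: inverse_eq_divide)
    have "(\<lambda>i. nV (v - d (j i))) \<longlonglongrightarrow> 0"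
      by (rule tendsto_sandwich[OF _ _ tendsto_const inv])
        (auto intro!: always_eventually less_imp_le[OF j] carrier_norm_nonneg[OF V(1) carrier_diff[OF V(1) v dX(2)]] simp del: of_nat_Suc)
    then have "(\<lambda>i. C * nV (v - d (j i))) \<longlonglongrightarrow> 0" by (rule tendsto_mult_right_zero)
    moreover have "0 \<le> n (d (j i) - v) \<and> n (d (j i) - v) \<le> C * nV (v - d (j i))" for i
      using carrier_norm_commute[OF N dX(1)[of "j i"] vX] V(4)[OF carrier_diff[OF V(1) v dX(2)[of "j i"]]]
        carrier_norm_nonneg[OF N carrier_diff[OF N vX dX(1)[of "j i"]]] by simp
    ultimately have "(\<lambda>i. n (d (j i) - v)) \<longlonglongrightarrow> 0" by (rule real_squeeze_0[rotated])
    from demi[OF t dX(1) vX this] have l1: "(\<lambda>i. A t (d (j i)) x) \<longlonglongrightarrow> A t v x" if "x \<in> X" for x using that by blast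
    have l2: "(\<lambda>i. \<psi> i x) \<longlonglongrightarrow> A t v x" if x: "x \<in> X" for x
    proof -
      have "(\<lambda>i. A t (d (j i)) x - \<psi> i x) \<longlonglongrightarrow> 0"
      proof (rule Lim_null_comparison)
        show "\<forall>\<^sub>F i in sequentially. norm (A t (d (j i)) x - \<psi> i x) \<le> 1 / real (Suc i) * n x"
        proof (rule always_eventually, rule allI)
          fix i
          have "norm (A t (d (j i)) x - \<psi> i x) \<le> ?N (A t (d (j i)) - \<psi> i) * n x"
            using dual_bound[OF N carrier_diff[OF D dual[OF t dX(1)[of "j i"]] subsetD[OF YD \<psi>(1)[of i]]] x] by simp
          also have "\<dots> \<le> 1 / real (Suc i) * n x" using \<psi>(2)[of i] carrier_norm_nonneg[OF N x] by (intro mult_right_mono) auto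
          finally show "norm (A t (d (j i)) x - \<psi> i x) \<le> 1 / real (Suc i) * n x" .
        qed
        show "(\<lambda>i. 1 / real (Suc i) * n x) \<longlonglongrightarrow> 0" using tendsto_mult_left_zero[OF inv] .
      qed
      from tendsto_diff[OF l1[OF x] this] show ?thesis by simp
    qed
    have sY: "subspace Y" unfolding Y_def by (rule subspace_span)
    show ?thesis by (rule weak_limit_in_closure[OF N R sY YD \<psi>(1) dual[OF t vX] l2 e])
  qed
  from countable_dense_in_span[OF D cD, folded Y_def] obtain y where
    "(\<forall>j::nat. y j \<in> ?D) \<and> (\<forall>z\<in>Y. \<forall>e>0. \<exists>j. ?N (z - y j) < e)" ..
  then have y: "\<And>j. y j \<in> ?D" "\<And>z e. z \<in> Y \<Longrightarrow> e > 0 \<Longrightarrow> \<exists>j. ?N (z - y j) < e" by auto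
  obtain \<sigma> where \<sigma>: "\<And>i::nat. simple_on ?M V (\<sigma> i)" "AE t in ?M. u t \<in> V"
    "AE t in ?M. (\<lambda>i. nV (\<sigma> i t - u t)) \<longlonglongrightarrow> 0" by (rule strongly_measurableD[OF u], rule that)
  show ?thesis
  proof (rule pettis_dual[OF S N y(1)])
    show "AE t in ?M. A (\<rho> t) (u t) \<in> ?D \<and> (\<forall>e>0. \<exists>j. ?N (A (\<rho> t) (u t) - y j) < e)"
      using \<sigma>(2) AE_space
    proof eventually_elim
      fix t assume t: "u t \<in> V" "t \<in> space ?M"
      have \<rho>t: "\<rho> t \<in> {0..T}" using \<rho>(2) t(2) by simp
      have AD: "A (\<rho> t) (u t) \<in> ?D" using dual[OF \<rho>t] t(1) V(3) by auto
      moreover have "\<exists>j. ?N (A (\<rho> t) (u t) - y j) < e" if e: "e > 0" for e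
      proof -
        obtain z where z: "z \<in> Y" "?N (A (\<rho> t) (u t) - z) < e / 2" using near[OF \<rho>t t(1), of "e / 2"] e by auto
        obtain j where "?N (z - y j) < e / 2" using y(2)[OF z(1), of "e / 2"] e by auto
        then show ?thesis using z(2) carrier_norm_triangle[OF D AD subsetD[OF YD z(1)] y(1)[of j]] by (intro exI[of _ j]) linarith
      qed
      ultimately show "A (\<rho> t) (u t) \<in> ?D \<and> (\<forall>e>0. \<exists>j. ?N (A (\<rho> t) (u t) - y j) < e)" by blast
    qed
  next
    fix x assume x: "x \<in> X"
    have vm: "(\<lambda>t. A (\<rho> t) v x) \<in> borel_measurable ?M" if v: "v \<in> X" for v
    proof -
      have "continuous_on {0..T} (\<lambda>r. A r v x)"
        unfolding continuous_on_def
      proof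
        fix t assume t: "t \<in> {0..T}"
        have "((\<lambda>r. A r v x - A t v x) \<longlongrightarrow> 0) (at t within {0..T})"
        proof (rule Lim_null_comparison)
          show "\<forall>\<^sub>F r in at t within {0..T}. norm (A r v x - A t v x) \<le> ?N (A r v - A t v) * n x"
            unfolding eventually_at_filter
            using dual_bound[OF N carrier_diff[OF D dual[OF _ v] dual[OF t v]] x] by (intro always_eventually) auto
          show "((\<lambda>r. ?N (A r v - A t v) * n x) \<longlongrightarrow> 0) (at t within {0..T})"
            by (rule tendsto_mult_left_zero[OF cont[OF v t]])
        qed
        then show "((\<lambda>r. A r v x) \<longlongrightarrow> A t v x) (at t within {0..T})" by (simp add: LIM_zero_iff)
      qed
      then have "continuous_on UNIV (\<lambda>r. A (clamp r) v x)"
        using clamp by (intro continuous_on_compose2[of "{0..T}" "\<lambda>r. A r v x" UNIV clamp])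
          (auto simp: clamp_def intro!: continuous_intros)
      then have "(\<lambda>t. A (clamp (\<rho> t)) v x) \<in> borel_measurable ?M"
        using measurable_compose[OF \<rho>(1) borel_measurable_continuous_onI] by blast
      then show ?thesis by (rule measurable_cong[THEN iffD1, rotated]) (use \<rho>(2) clamp_eq in auto)
    qed
    show "(\<lambda>t. A (\<rho> t) (u t) x) \<in> borel_measurable ?M"
    proof (rule borel_measurable_AE_limit[OF S])
      fix i
      let ?I = "\<sigma> i ` space ?M"
      have fin: "finite ?I" using simple_onD(1)[OF \<sigma>(1)] unfolding simple_function_def by blast
      have IV: "v \<in> X" if "v \<in> ?I" for v using that simple_onD(2)[OF \<sigma>(1)] V(3) by auto
      have "\<sigma> i \<in> measurable ?M (count_space ?I)"
        using simple_onD(1)[OF \<sigma>(1)[of i]] fin unfolding simple_function_def by (auto simp: measurable_count_space_eq2)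
      from measurable_compose_countable'[OF vm[OF IV] this countable_finite[OF fin]]
      show "(\<lambda>t. A (\<rho> t) (\<sigma> i t) x) \<in> borel_measurable ?M" by simp
    next
      show "AE t in ?M. (\<lambda>i. A (\<rho> t) (\<sigma> i t) x) \<longlonglongrightarrow> A (\<rho> t) (u t) x"
        using \<sigma>(2,3) AE_space
      proof eventually_elim
        fix t assume t: "u t \<in> V" "(\<lambda>i. nV (\<sigma> i t - u t)) \<longlonglongrightarrow> 0" "t \<in> space ?M"
        have sV: "\<sigma> i t \<in> V" for i using simple_onD(2)[OF \<sigma>(1) t(3)] .
        have uX: "u t \<in> X" and sX: "\<sigma> i t \<in> X" for i using t(1) sV V(3) by auto
        have "(\<lambda>i. C * nV (\<sigma> i t - u t)) \<longlonglongrightarrow> 0" using t(2) by (rule tendsto_mult_right_zero)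
        moreover have "0 \<le> n (\<sigma> i t - u t) \<and> n (\<sigma> i t - u t) \<le> C * nV (\<sigma> i t - u t)" for i
          using V(4)[OF carrier_diff[OF V(1) sV[of i] t(1)]] carrier_norm_nonneg[OF N carrier_diff[OF N sX[of i] uX]] by simp
        ultimately have "(\<lambda>i. n (\<sigma> i t - u t)) \<longlonglongrightarrow> 0" by (rule real_squeeze_0[rotated])
        then show "(\<lambda>i. A (\<rho> t) (\<sigma> i t) x) \<longlonglongrightarrow> A (\<rho> t) (u t) x"
          using demi[OF _ sX uX _ x] \<rho>(2) t(3) by simp
      qed
    qed
  qed
qed


section \<open>Smooth test functions and the weak derivative\<close>

text \<open>The power of \<open>1 / x\<close> makes the family closed under differentiation up to
  linear combinations, as the next facts show; \<open>m = 0\<close> is the usual flat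
  function.\<close>

definition flat_exp :: "nat \<Rightarrow> real \<Rightarrow> real" where
  "flat_exp m x = (if x > 0 then (1 / x) ^ m * exp (- (1 / x)) else 0)"

lemma flat_exp_at_right_0: "((\<lambda>x. flat_exp m x) \<longlongrightarrow> 0) (at_right 0)"
proof -
  have "((\<lambda>x. x ^ m / exp x) \<longlongrightarrow> (0::real)) at_top" by (rule tendsto_power_div_exp_0)
  from filterlim_compose[OF this filterlim_inverse_at_top_right]
  have "((\<lambda>x. inverse x ^ m / exp (inverse x)) \<longlongrightarrow> (0::real)) (at_right 0)" .
  then show ?thesis
  proof (rule Lim_transform_eventually)
    show "\<forall>\<^sub>F x in at_right 0. inverse x ^ m / exp (inverse x) = flat_exp m x"
      using eventually_at_right_less[of "0::real"]
      by eventually_elim (simp add: flat_exp_def exp_minus inverse_eq_divide)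
  qed
qed

text \<open>At 0 the difference quotient from the right is the next member of the family, which
  tends to 0 there; away from 0 it is the chain rule.\<close>

lemma flat_exp_deriv:
  "(flat_exp m has_real_derivative (- real m * flat_exp (Suc m) x + flat_exp (Suc (Suc m)) x)) (at x)"
proof -
  consider "x > 0" | "x < 0" | "x = 0" by linarith
  then show ?thesis
  proof cases
    case 1
    have outer: "((\<lambda>z. z ^ m * exp (- z)) has_real_derivative (real m * z ^ (m - 1) * exp (- z) - z ^ m * exp (- z))) (at z)" for z :: real
      by (auto intro!: derivative_eq_intros)
    have inner: "((\<lambda>x. 1 / x) has_real_derivative - ((1 / x) * (1 / x))) (at x)"
      using 1 by (auto intro!: derivative_eq_intros simp: field_simps)
    have "(real m * z ^ (m - 1) * exp (- z) - z ^ m * exp (- z)) * - (z * z) =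
      - real m * (z ^ Suc m * exp (- z)) + z ^ Suc (Suc m) * exp (- z)" for z :: real
      by (cases m) (simp_all add: algebra_simps)
    from this[of "1 / x"]
    have "((\<lambda>x. (1 / x) ^ m * exp (- (1 / x))) has_real_derivative
      (- real m * flat_exp (Suc m) x + flat_exp (Suc (Suc m)) x)) (at x)"
      using DERIV_chain2[OF outer inner] 1 unfolding flat_exp_def by simp
    then show ?thesis
    proof (rule DERIV_cong_ev[THEN iffD2, rotated -1])
      show "\<forall>\<^sub>F y in nhds x. flat_exp m y = (1 / y) ^ m * exp (- (1 / y))"
        using eventually_nhds_in_open[of "{0<..}" x] 1 by (auto elim!: eventually_mono simp: flat_exp_def)
    qed auto
  next
    case 2
    have "((\<lambda>x. 0::real) has_real_derivative 0) (at x)" by simp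
    then have "(flat_exp m has_real_derivative 0) (at x)"
    proof (rule DERIV_cong_ev[THEN iffD2, rotated -1])
      show "\<forall>\<^sub>F y in nhds x. flat_exp m y = 0"
        using eventually_nhds_in_open[of "{..<0}" x] 2 by (auto elim!: eventually_mono simp: flat_exp_def)
    qed auto
    then show ?thesis using 2 by (simp add: flat_exp_def)
  next
    case 3
    have "((\<lambda>h. (flat_exp m (0 + h) - flat_exp m 0) / h) \<longlongrightarrow> 0) (at 0)"
      unfolding filterlim_at_split
    proof
      have "((\<lambda>h. 0) \<longlongrightarrow> (0::real)) (at_left 0)" by simp
      then show "((\<lambda>h. (flat_exp m (0 + h) - flat_exp m 0) / h) \<longlongrightarrow> 0) (at_left 0)"
      proof (rule Lim_transform_eventually)
        show "\<forall>\<^sub>F h in at_left 0. 0 = (flat_exp m (0 + h) - flat_exp m 0) / h"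
          unfolding eventually_at_filter by (auto simp: flat_exp_def intro!: always_eventually)
      qed
      show "((\<lambda>h. (flat_exp m (0 + h) - flat_exp m 0) / h) \<longlongrightarrow> 0) (at_right 0)"
        using flat_exp_at_right_0[of "Suc m"]
      proof (rule Lim_transform_eventually)
        show "\<forall>\<^sub>F h in at_right 0. flat_exp (Suc m) h = (flat_exp m (0 + h) - flat_exp m 0) / h"
          using eventually_at_right_less[of "0::real"]
          by eventually_elim (simp add: flat_exp_def)
      qed
    qed
    then have "(flat_exp m has_real_derivative 0) (at 0)" unfolding DERIV_def .
    then show ?thesis using 3 by (simp add: flat_exp_def)
  qed
qed

text \<open>A space of functions stable under differentiation, so that smoothness of all orders
  follows by induction without formulas for higher derivatives.\<close>

inductive_set bumps :: "(real \<Rightarrow> real) set" where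
  base: "(\<lambda>x. flat_exp i (a * x + b) * flat_exp j (1 - (a * x + b))) \<in> bumps"
| add: "f \<in> bumps \<Longrightarrow> g \<in> bumps \<Longrightarrow> (\<lambda>x. f x + g x) \<in> bumps"
| scale: "f \<in> bumps \<Longrightarrow> (\<lambda>x. c * f x) \<in> bumps"

lemma bumps_deriv: "f \<in> bumps \<Longrightarrow> \<exists>f'\<in>bumps. \<forall>x. (f has_real_derivative f' x) (at x)"
proof (induction rule: bumps.induct)
  case (base i a b j)
  define B where "B i j = (\<lambda>x. flat_exp i (a * x + b) * flat_exp j (1 - (a * x + b)))" for i j
  have B: "B i j \<in> bumps" for i j unfolding B_def by (rule bumps.base)
  define f' where "f' x = a * (- real i * B (Suc i) j x + B (Suc (Suc i)) j x) +
      (- a) * (- real j * B i (Suc j) x + B i (Suc (Suc j)) x)" for x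
  have "f' \<in> bumps" unfolding f'_def by (intro bumps.add bumps.scale B)
  moreover have "(B i j has_real_derivative f' x) (at x)" for x
  proof -
    have l1: "((\<lambda>x. a * x + b) has_real_derivative a) (at x)" by (auto intro!: derivative_eq_intros)
    have l2: "((\<lambda>x. 1 - (a * x + b)) has_real_derivative - a) (at x)" by (auto intro!: derivative_eq_intros)
    show ?thesis unfolding B_def
      by (rule DERIV_cong[OF DERIV_mult[OF DERIV_chain2[OF flat_exp_deriv l1] DERIV_chain2[OF flat_exp_deriv l2]]])
        (simp add: f'_def B_def algebra_simps)
  qed
  ultimately show ?case unfolding B_def[symmetric] by blast
next
  case (add f g)
  then obtain f' g' where "f' \<in> bumps" "\<forall>x. (f has_real_derivative f' x) (at x)"
    "g' \<in> bumps" "\<forall>x. (g has_real_derivative g' x) (at x)" by blast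
  then show ?case by (intro bexI[of _ "\<lambda>x. f' x + g' x"]) (auto intro!: DERIV_add bumps.add)
next
  case (scale f c)
  then obtain f' where "f' \<in> bumps" "\<forall>x. (f has_real_derivative f' x) (at x)" by blast
  then show ?case by (intro bexI[of _ "\<lambda>x. c * f' x"]) (auto intro!: DERIV_cmult bumps.scale)
qed

lemma bumps_higher_deriv: "f \<in> bumps \<Longrightarrow> (deriv ^^ m) f \<in> bumps"
proof (induction m)
  case (Suc m)
  then obtain g where g: "g \<in> bumps" "\<And>x. ((deriv ^^ m) f has_real_derivative g x) (at x)"
    using bumps_deriv by blast
  have "deriv ((deriv ^^ m) f) = g" using DERIV_imp_deriv[OF g(2)] by (rule ext)
  then show ?case using g(1) by simp
qed simp

text \<open>The cut-offs used as test functions are not bumps themselves, but all their derivatives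
  of positive order are.\<close>

lemma antiderivative_of_bump_smooth:
  assumes "f \<in> bumps" "\<And>x. (F has_real_derivative f x) (at x)"
  shows "((deriv ^^ m) F) differentiable (at x)"
proof (cases m)
  case 0
  then show ?thesis using assms(2) by (auto simp: real_differentiable_def)
next
  case (Suc j)
  have "deriv F = f" using DERIV_imp_deriv[OF assms(2)] by (rule ext)
  then have "(deriv ^^ m) F = (deriv ^^ j) f" by (simp add: Suc funpow_Suc_right del: funpow.simps)
  moreover obtain g where "((deriv ^^ j) f has_real_derivative g x) (at x)"
    using bumps_deriv[OF bumps_higher_deriv[OF assms(1)]] by blast
  ultimately show ?thesis by (auto simp: real_differentiable_def)
qed

text \<open>A bump with integral 1 and its primitive. Affine substitutions are part of the claim
  because the cut-offs are rescaled copies of \<open>S\<close>.\<close>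

lemma smooth_step:
  "\<exists>b S :: real \<Rightarrow> real. (\<forall>\<alpha> \<gamma>. (\<lambda>x. b (\<alpha> * x + \<gamma>)) \<in> bumps) \<and> (\<forall>x. b x \<ge> 0) \<and>
    (\<forall>x. x \<le> 0 \<or> x \<ge> 1 \<longrightarrow> b x = 0) \<and> (\<forall>x. (S has_real_derivative b x) (at x)) \<and>
    (\<forall>x\<le>0. S x = 0) \<and> (\<forall>x\<ge>1. S x = 1) \<and> (\<forall>x. 0 \<le> S x) \<and> (\<forall>x. S x \<le> 1)"
proof -
  define b0 where "b0 x = flat_exp 0 x * flat_exp 0 (1 - x)" for x
  have b00: "b0 x \<ge> 0" for x by (simp add: b0_def flat_exp_def)
  have b0z: "b0 x = 0" if "x \<le> 0 \<or> x \<ge> 1" for x using that by (auto simp: b0_def flat_exp_def)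
  have b0b: "(\<lambda>x. b0 (\<alpha> * x + \<gamma>)) \<in> bumps" for \<alpha> \<gamma> unfolding b0_def by (rule bumps.base)
  have cont: "continuous_on A b0" for A
  proof -
    obtain b' where "\<And>x. (b0 has_real_derivative b' x) (at x)" using bumps_deriv[OF b0b[of 1 0]] by auto
    then show ?thesis by (meson DERIV_isCont continuous_at_imp_continuous_on)
  qed
  define c where "c = integral {-1..1} b0"
  have "c \<noteq> 0"
  proof
    assume "c = 0"
    then have "\<forall>x\<in>cbox (-1) 1. b0 x = 0"
      using integral_eq_0_iff[of "-1" 1 b0] cont b00 unfolding c_def by auto
    then have "b0 (1/2) = 0" by auto
    then show False by (simp add: b0_def flat_exp_def)
  qed
  moreover have "c \<ge> 0" unfolding c_def using b00 by (intro Henstock_Kurzweil_Integration.integral_nonneg integrable_continuous_real cont) auto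
  ultimately have c: "c > 0" by simp
  \<comment> \<open>Starting at \<open>-1\<close>, to the left of the support, makes 0 an interior
    point of the domain where the fundamental theorem applies.\<close>
  define I where "I x = integral {-1..x} b0" for x
  have Ineg: "I x = 0" if "x \<le> 0" for x
  proof -
    have "I x = integral {-1..x} (\<lambda>x. 0)" unfolding I_def by (rule Henstock_Kurzweil_Integration.integral_cong) (use that b0z in auto)
    then show ?thesis by simp
  qed
  have Ideriv: "(I has_real_derivative b0 x) (at x)" for x
  proof (cases "x < 0")
    case True
    have "((\<lambda>x. 0::real) has_real_derivative 0) (at x)" by simp
    then have "(I has_real_derivative 0) (at x)"
    proof (rule DERIV_cong_ev[THEN iffD2, rotated -1])
      show "\<forall>\<^sub>F y in nhds x. I y = 0"
        using eventually_nhds_in_open[of "{..<0}" x] True by (auto elim!: eventually_mono simp: Ineg)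
    qed auto
    then show ?thesis using True b0z by simp
  next
    case False
    have "(I has_real_derivative b0 x) (at x within {-1..x+1})"
      unfolding I_def by (rule integral_has_real_derivative[OF cont]) (use False in auto)
    moreover have "at x within {-1..x+1} = at x" by (rule at_within_interior) (use False in auto)
    ultimately show ?thesis by simp
  qed
  have Imono: "I x \<le> I y" if "x \<le> y" for x y
    by (rule DERIV_nonneg_imp_nondecreasing[OF that]) (use Ideriv b00 in blast)
  have I1: "I x = c" if "x \<ge> 1" for x
  proof -
    have "integral {-1..1} b0 + integral {1..x} b0 = integral {-1..x} b0"
      by (rule Henstock_Kurzweil_Integration.integral_combine) (use that cont integrable_continuous_real in auto)
    moreover have "integral {1..x} b0 = integral {1..x} (\<lambda>x. 0)"
      by (rule Henstock_Kurzweil_Integration.integral_cong) (use b0z in auto)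
    ultimately show ?thesis by (simp add: I_def c_def)
  qed
  show ?thesis
  proof (rule exI[of _ "\<lambda>x. (1 / c) * b0 x"], rule exI[of _ "\<lambda>x. (1 / c) * I x"], intro conjI allI impI)
    show "(\<lambda>x. (1 / c) * b0 (\<alpha> * x + \<gamma>)) \<in> bumps" for \<alpha> \<gamma> by (rule bumps.scale[OF b0b])
    show "(1 / c) * b0 x \<ge> 0" for x using c b00 by simp
    show "(1 / c) * b0 x = 0" if "x \<le> 0 \<or> x \<ge> 1" for x using b0z[OF that] by simp
    show "((\<lambda>x. (1 / c) * I x) has_real_derivative (1 / c) * b0 x) (at x)" for x by (rule DERIV_cmult[OF Ideriv])
    show "(1 / c) * I x = 0" if "x \<le> 0" for x using Ineg[OF that] by simp
    show "(1 / c) * I x = 1" if "x \<ge> 1" for x using I1[OF that] c by simp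
    show "0 \<le> (1 / c) * I x" for x using Imono[of "min 0 x" x] Ineg[of "min 0 x"] c by simp
    show "(1 / c) * I x \<le> 1" for x using Imono[of x "max 1 x"] I1[of "max 1 x"] c by simp
  qed
qed

text \<open>The test function \<phi> with parameter \<epsilon> rises from 0 to 1 on
  \<open>[a + \<epsilon>, a + 2 * \<epsilon>]\<close> and falls back on
  \<open>[b - 2 * \<epsilon>, b - \<epsilon>]\<close>. As \<epsilon> tends to 0 it tends to the
  indicator of the interval, while its derivative is the difference of two approximate identities,
  at \<open>a\<close> and at \<open>b\<close>; continuity of \<open>y\<close> yields the values
  there.\<close>

lemma increment_from_test_functions:
  fixes y z :: "real \<Rightarrow> real"
  assumes T: "T > 0" and y: "continuous_on {0..T} y" and z: "integrable (lebesgue_on {0<..<T}) z"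
    and weak: "\<And>\<phi>. \<phi> \<in> test_functions T \<Longrightarrow>
      (\<integral>t. deriv \<phi> t * y t \<partial>lebesgue_on {0<..<T}) = - (\<integral>t. \<phi> t * z t \<partial>lebesgue_on {0<..<T})"
    and ab: "0 \<le> a" "a < b" "b \<le> T"
  shows "y b - y a = (\<integral>t. z t \<partial>lebesgue_on {a<..<b})"
proof -
  let ?M = "lebesgue_on {0<..<T}"
  obtain \<beta> S :: "real \<Rightarrow> real" where
    \<beta>: "\<And>\<alpha> \<gamma>. (\<lambda>x. \<beta> (\<alpha> * x + \<gamma>)) \<in> bumps" "\<And>x. \<beta> x \<ge> 0" "\<And>x. x \<le> 0 \<or> x \<ge> 1 \<Longrightarrow> \<beta> x = 0"
    and S: "\<And>x. (S has_real_derivative \<beta> x) (at x)" "\<And>x. x \<le> 0 \<Longrightarrow> S x = 0" "\<And>x. x \<ge> 1 \<Longrightarrow> S x = 1"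
    "\<And>x. 0 \<le> S x" "\<And>x. S x \<le> 1"
  proof -
    from smooth_step obtain b S :: "real \<Rightarrow> real" where "(\<forall>\<alpha> \<gamma>. (\<lambda>x. b (\<alpha> * x + \<gamma>)) \<in> bumps) \<and> (\<forall>x. b x \<ge> 0) \<and>
      (\<forall>x. x \<le> 0 \<or> x \<ge> 1 \<longrightarrow> b x = 0) \<and> (\<forall>x. (S has_real_derivative b x) (at x)) \<and>
      (\<forall>x\<le>0. S x = 0) \<and> (\<forall>x\<ge>1. S x = 1) \<and> (\<forall>x. 0 \<le> S x) \<and> (\<forall>x. S x \<le> 1)" by (elim exE)
    then show thesis by (intro that[of b S]) auto
  qed
  have \<beta>c: "continuous_on A \<beta>" for A
  proof -
    obtain b' where "\<And>x. (\<beta> has_real_derivative b' x) (at x)" using bumps_deriv[OF \<beta>(1)[of 1 0]] by auto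
    then show ?thesis by (meson DERIV_isCont continuous_at_imp_continuous_on)
  qed
  have Sc: "continuous_on A S" for A using S(1) by (meson DERIV_isCont continuous_at_imp_continuous_on)
  define r where "r e d t = (1 / e) * \<beta> ((1 / e) * t + d)" for e d t
  define \<phi> where "\<phi> e t = S ((1 / e) * t + (- a / e - 1)) - S ((1 / e) * t + (2 - b / e))" for e t
  define \<phi>' where "\<phi>' e t = r e (- a / e - 1) t + (-1) * r e (2 - b / e) t" for e t
  have d\<phi>: "(\<phi> e has_real_derivative \<phi>' e t) (at t)" for e t
  proof -
    have l: "((\<lambda>t. (1 / e) * t + d) has_real_derivative 1 / e) (at t)" for d
      by (rule DERIV_cong[OF DERIV_add[OF DERIV_cmult[OF DERIV_ident] DERIV_const]]) simp
    show ?thesis unfolding \<phi>_def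
      by (rule DERIV_cong[OF DERIV_diff[OF DERIV_chain2[OF S(1) l] DERIV_chain2[OF S(1) l]]])
        (simp add: \<phi>'_def r_def)
  qed
  have b\<phi>': "\<phi>' e \<in> bumps" for e unfolding \<phi>'_def r_def by (intro bumps.add bumps.scale \<beta>(1))
  have arg1: "((1 / e) * t + (- a / e - 1) \<le> 0 \<longleftrightarrow> t \<le> a + e) \<and> (1 \<le> (1 / e) * t + (- a / e - 1) \<longleftrightarrow> a + 2 * e \<le> t)"
    and arg2: "((1 / e) * t + (2 - b / e) \<le> 0 \<longleftrightarrow> t \<le> b - 2 * e) \<and> (1 \<le> (1 / e) * t + (2 - b / e) \<longleftrightarrow> b - e \<le> t)"
    if "e > 0" for e t using that by (auto simp: field_simps)
  have \<phi>test: "\<phi> e \<in> test_functions T" if e: "e > 0" "4 * e < b - a" for e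
  proof -
    have sub: "{t. \<phi> e t \<noteq> 0} \<subseteq> {a + e..b - e}"
    proof
      fix t assume t: "t \<in> {t. \<phi> e t \<noteq> 0}"
      have "\<not> t \<le> a + e"
      proof
        assume "t \<le> a + e"
        then have "\<phi> e t = 0" unfolding \<phi>_def using arg1[OF e(1), of t] arg2[OF e(1), of t] e S(2) by simp
        then show False using t by simp
      qed
      moreover have "\<not> t \<ge> b - e"
      proof
        assume "t \<ge> b - e"
        then have "\<phi> e t = 0" unfolding \<phi>_def using arg1[OF e(1), of t] arg2[OF e(1), of t] e S(3) by simp
        then show False using t by simp
      qed
      ultimately show "t \<in> {a + e..b - e}" by simp
    qed
    then have cl: "closure {t. \<phi> e t \<noteq> 0} \<subseteq> {a + e..b - e}" by (simp add: closure_minimal)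
    have "compact (closure {t. \<phi> e t \<noteq> 0})"
      using bounded_subset[OF bounded_closed_interval cl] by (simp add: compact_eq_bounded_closed)
    moreover have "closure {t. \<phi> e t \<noteq> 0} \<subseteq> {0<..<T}" using cl e ab by (force intro: order_trans)
    ultimately show ?thesis unfolding test_functions_def
      using antiderivative_of_bump_smooth[OF b\<phi>' d\<phi>] by blast
  qed
  have \<phi>deriv: "deriv (\<phi> e) t = \<phi>' e t" for e t using DERIV_imp_deriv[OF d\<phi>] .
  \<comment> \<open>A denominator of at least 5 keeps \<open>4 * \<epsilon> i\<close> below
    \<open>b - a\<close>, so that rise and fall do not overlap.\<close>
  define \<epsilon> where "\<epsilon> i = (b - a) / (5 + real i)" for i :: nat
  have \<epsilon>: "\<epsilon> i > 0" "4 * \<epsilon> i < b - a" for i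
  proof -
    show "\<epsilon> i > 0" using ab by (simp add: \<epsilon>_def)
    have "(b - a) * 4 < (b - a) * (5 + real i)" using ab by (intro mult_strict_left_mono) auto
    then show "4 * \<epsilon> i < b - a" unfolding \<epsilon>_def by (simp add: pos_divide_less_eq mult.commute)
  qed
  have \<epsilon>0: "\<epsilon> \<longlonglongrightarrow> 0"
  proof (rule real_squeeze_0)
    show "0 \<le> \<epsilon> i \<and> \<epsilon> i \<le> (b - a) * (1 / real (Suc i))" for i
    proof
      show "0 \<le> \<epsilon> i" using \<epsilon>(1)[of i] by simp
      have "(b - a) / (5 + real i) \<le> (b - a) / real (Suc i)" using ab by (intro divide_left_mono) auto
      then show "\<epsilon> i \<le> (b - a) * (1 / real (Suc i))" by (simp add: \<epsilon>_def)
    qed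
    show "(\<lambda>i. (b - a) * (1 / real (Suc i))) \<longlonglongrightarrow> 0"
      using tendsto_mult_right_zero[OF LIMSEQ_inverse_real_of_nat, of "b - a"] by (simp add: inverse_eq_divide)
  qed
  have L1: "(\<lambda>i. \<integral>t. \<phi> (\<epsilon> i) t * z t \<partial>?M) \<longlonglongrightarrow> (\<integral>t. indicator {a<..<b} t * z t \<partial>?M)"
  proof (rule integral_dominated_convergence[where w="\<lambda>t. \<bar>z t\<bar>"])
    have ab': "{a<..<b} \<inter> {0<..<T} \<in> sets ?M" by (subst sets_restrict_space_iff) auto
    have "(\<lambda>t. indicator {a<..<b} t :: real) \<in> borel_measurable ?M"
      by (intro measurable_restrict_space1 borel_measurable_indicator) auto
    then show "(\<lambda>t. indicator {a<..<b} t * z t) \<in> borel_measurable ?M" using z by measurable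
    show "(\<lambda>t. \<phi> (\<epsilon> i) t * z t) \<in> borel_measurable ?M" for i
    proof -
      have "continuous_on UNIV (\<phi> (\<epsilon> i))" using d\<phi> by (meson DERIV_isCont continuous_at_imp_continuous_on)
      then have "\<phi> (\<epsilon> i) \<in> borel_measurable ?M"
        by (intro measurable_restrict_space1 measurable_completion) (simp add: borel_measurable_continuous_onI)
      then show ?thesis using z by measurable
    qed
    show "integrable ?M (\<lambda>t. \<bar>z t\<bar>)" using z by simp
    show "AE t in ?M. norm (\<phi> (\<epsilon> i) t * z t) \<le> \<bar>z t\<bar>" for i
    proof (rule AE_I2)
      fix t
      have "\<bar>\<phi> (\<epsilon> i) t\<bar> \<le> 1" unfolding \<phi>_def
        using S(4,5)[of "(1 / \<epsilon> i) * t + (- a / \<epsilon> i - 1)"] S(4,5)[of "(1 / \<epsilon> i) * t + (2 - b / \<epsilon> i)"] by linarith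
      then show "norm (\<phi> (\<epsilon> i) t * z t) \<le> \<bar>z t\<bar>" by (simp add: abs_mult mult_left_le_one_le)
    qed
    show "AE t in ?M. (\<lambda>i. \<phi> (\<epsilon> i) t * z t) \<longlonglongrightarrow> indicator {a<..<b} t * z t"
    proof (rule AE_I2)
      fix t
      have "\<forall>\<^sub>F i in sequentially. \<phi> (\<epsilon> i) t = indicator {a<..<b} t"
      proof (cases "t \<in> {a<..<b}")
        case True
        then have "\<forall>\<^sub>F i in sequentially. \<epsilon> i < min ((t - a) / 2) ((b - t) / 2)"
          using \<epsilon>0 by (intro order_tendstoD(2)) auto
        then show ?thesis
        proof eventually_elim
          fix i assume "\<epsilon> i < min ((t - a) / 2) ((b - t) / 2)"
          then have "a + 2 * \<epsilon> i \<le> t" "t \<le> b - 2 * \<epsilon> i" by auto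
          then show "\<phi> (\<epsilon> i) t = indicator {a<..<b} t"
            unfolding \<phi>_def using arg1[OF \<epsilon>(1)[of i], of t] arg2[OF \<epsilon>(1)[of i], of t] S(2,3) True by simp
        qed
      next
        case False
        have "\<phi> (\<epsilon> i) t = 0" for i
        proof (cases "t \<le> a")
          case True
          then have "t \<le> a + \<epsilon> i" "t \<le> b - 2 * \<epsilon> i" using \<epsilon>[of i] by auto
          then show ?thesis unfolding \<phi>_def using arg1[OF \<epsilon>(1)[of i], of t] arg2[OF \<epsilon>(1)[of i], of t] S(2) by simp
        next
          case F: False
          then have "a + 2 * \<epsilon> i \<le> t" "b - \<epsilon> i \<le> t" using \<epsilon>[of i] False by auto
          then show ?thesis unfolding \<phi>_def using arg1[OF \<epsilon>(1)[of i], of t] arg2[OF \<epsilon>(1)[of i], of t] S(3) by simp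
        qed
        then show ?thesis using False by simp
      qed
      then have "\<forall>\<^sub>F i in sequentially. indicator {a<..<b} t * z t = \<phi> (\<epsilon> i) t * z t" by eventually_elim simp
      then show "(\<lambda>i. \<phi> (\<epsilon> i) t * z t) \<longlonglongrightarrow> indicator {a<..<b} t * z t"
        by (rule Lim_transform_eventually[OF tendsto_const])
    qed
  qed
  have indz: "(\<integral>t. indicator {a<..<b} t * z t \<partial>?M) = (\<integral>t. z t \<partial>lebesgue_on {a<..<b})"
  proof -
    have "(\<integral>t. indicator {a<..<b} t * z t \<partial>?M) = (\<integral>t. (if t \<in> {a<..<b} then z t else 0) \<partial>?M)"
      by (intro Bochner_Integration.integral_cong) (auto simp: indicator_def)
    also have "\<dots> = (\<integral>t. z t \<partial>lebesgue_on ({a<..<b} \<inter> {0<..<T}))" by (rule Lebesgue_Measure.integral_restrict_Int) auto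
    also have "{a<..<b} \<inter> {0<..<T} = {a<..<b}" using ab by auto
    finally show ?thesis .
  qed
  have rc: "continuous_on A (r e d)" for A e d
    unfolding r_def by (intro continuous_intros continuous_on_compose2[OF \<beta>c[of UNIV]]) auto
  \<comment> \<open>The approximate identity for both endpoints at once: \<open>r\<close> is
    nonnegative, lives within \<open>2 * \<epsilon> i\<close> of \<open>x\<close>, and has integral
    1 over \<open>[0,T]\<close> because its primitive passes from 0 to 1 there.\<close>
  have L2: "(\<lambda>i. integral {0..T} (\<lambda>t. r (\<epsilon> i) (d i) t * y t)) \<longlonglongrightarrow> y x"
    if x: "x \<in> {0..T}"
      and S0: "\<And>i. S ((1 / \<epsilon> i) * 0 + d i) = 0" "\<And>i. S ((1 / \<epsilon> i) * T + d i) = 1"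
      and supp: "\<And>i t. r (\<epsilon> i) (d i) t \<noteq> 0 \<Longrightarrow> \<bar>t - x\<bar> \<le> 2 * \<epsilon> i" for x d
  proof (rule LIMSEQ_I)
    fix \<kappa> :: real assume \<kappa>: "\<kappa> > 0"
    obtain \<delta> where \<delta>: "\<delta> > 0" "\<And>t. t \<in> {0..T} \<Longrightarrow> dist t x < \<delta> \<Longrightarrow> dist (y t) (y x) < \<kappa> / 2"
      using y x \<kappa> unfolding continuous_on_iff by (meson half_gt_zero)
    have "\<forall>\<^sub>F i in sequentially. \<epsilon> i < \<delta> / 2" using \<epsilon>0 \<delta>(1) by (intro order_tendstoD(2)) auto
    then have "\<forall>\<^sub>F i in sequentially. norm (integral {0..T} (\<lambda>t. r (\<epsilon> i) (d i) t * y t) - y x) < \<kappa>"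
    proof eventually_elim
      fix i assume i: "\<epsilon> i < \<delta> / 2"
      have one: "(r (\<epsilon> i) (d i) has_integral 1) {0..T}"
      proof -
        have "(r (\<epsilon> i) (d i) has_integral (S ((1 / \<epsilon> i) * T + d i) - S ((1 / \<epsilon> i) * 0 + d i))) {0..T}"
        proof (rule fundamental_theorem_of_calculus)
          fix t
          have l: "((\<lambda>t. (1 / \<epsilon> i) * t + d i) has_real_derivative 1 / \<epsilon> i) (at t)"
            by (rule DERIV_cong[OF DERIV_add[OF DERIV_cmult[OF DERIV_ident] DERIV_const]]) simp
          have "((\<lambda>t. S ((1 / \<epsilon> i) * t + d i)) has_real_derivative r (\<epsilon> i) (d i) t) (at t)"
            by (rule DERIV_cong[OF DERIV_chain2[OF S(1) l]]) (simp add: r_def)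
          then show "((\<lambda>t. S ((1 / \<epsilon> i) * t + d i)) has_vector_derivative r (\<epsilon> i) (d i) t) (at t within {0..T})"
            by (meson has_field_derivative_at_within has_real_derivative_iff_has_vector_derivative)
        qed (use T in simp)
        then show ?thesis using S0 by simp
      qed
      have i1: "(\<lambda>t. r (\<epsilon> i) (d i) t * y t) integrable_on {0..T}"
        by (intro integrable_continuous_real continuous_on_mult rc y)
      have i2: "(\<lambda>t. r (\<epsilon> i) (d i) t * y x) integrable_on {0..T}"
        by (intro integrable_continuous_real continuous_on_mult rc continuous_on_const)
      have "integral {0..T} (\<lambda>t. r (\<epsilon> i) (d i) t * y t) - y x
        = integral {0..T} (\<lambda>t. r (\<epsilon> i) (d i) t * y t) - integral {0..T} (\<lambda>t. r (\<epsilon> i) (d i) t * y x)"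
        using integral_unique[OF has_integral_mult_left[OF one, of "y x"]] by simp
      also have "\<dots> = integral {0..T} (\<lambda>t. r (\<epsilon> i) (d i) t * y t - r (\<epsilon> i) (d i) t * y x)"
        by (rule Henstock_Kurzweil_Integration.integral_diff[symmetric, OF i1 i2])
      also have "norm \<dots> \<le> integral {0..T} (\<lambda>t. r (\<epsilon> i) (d i) t * (\<kappa> / 2))"
      proof (rule Henstock_Kurzweil_Integration.integral_norm_bound_integral)
        show "(\<lambda>t. r (\<epsilon> i) (d i) t * y t - r (\<epsilon> i) (d i) t * y x) integrable_on {0..T}"
          by (rule Henstock_Kurzweil_Integration.integrable_diff[OF i1 i2])
        show "(\<lambda>t. r (\<epsilon> i) (d i) t * (\<kappa> / 2)) integrable_on {0..T}"
          by (intro integrable_continuous_real continuous_on_mult rc continuous_on_const)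
        fix t assume t: "t \<in> {0..T}"
        have r0: "0 \<le> r (\<epsilon> i) (d i) t" unfolding r_def using \<beta>(2) \<epsilon>(1)[of i] by simp
        show "norm (r (\<epsilon> i) (d i) t * y t - r (\<epsilon> i) (d i) t * y x) \<le> r (\<epsilon> i) (d i) t * (\<kappa> / 2)"
        proof (cases "r (\<epsilon> i) (d i) t = 0")
          case False
          have "\<bar>t - x\<bar> < \<delta>" using supp[OF False] i by linarith
          then have "\<bar>y t - y x\<bar> \<le> \<kappa> / 2" using \<delta>(2)[OF t] by (simp add: dist_real_def less_imp_le)
          then have "r (\<epsilon> i) (d i) t * \<bar>y t - y x\<bar> \<le> r (\<epsilon> i) (d i) t * (\<kappa> / 2)" using r0 by (intro mult_left_mono) auto
          moreover have "norm (r (\<epsilon> i) (d i) t * y t - r (\<epsilon> i) (d i) t * y x) = r (\<epsilon> i) (d i) t * \<bar>y t - y x\<bar>"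
            using r0 by (simp add: abs_mult flip: right_diff_distrib)
          ultimately show ?thesis by simp
        qed simp
      qed
      also have "\<dots> = \<kappa> / 2" using integral_unique[OF has_integral_mult_left[OF one, of "\<kappa> / 2"]] by simp
      also have "\<dots> < \<kappa>" using \<kappa> by simp
      finally show "norm (integral {0..T} (\<lambda>t. r (\<epsilon> i) (d i) t * y t) - y x) < \<kappa>" .
    qed
    then show "\<exists>no. \<forall>i\<ge>no. norm (integral {0..T} (\<lambda>t. r (\<epsilon> i) (d i) t * y t) - y x) < \<kappa>" by (simp add: eventually_sequentially)
  qed
  have A: "(\<lambda>i. integral {0..T} (\<lambda>t. r (\<epsilon> i) (- a / \<epsilon> i - 1) t * y t)) \<longlonglongrightarrow> y a"
  proof (rule L2)
    fix i t
    show "S ((1 / \<epsilon> i) * 0 + (- a / \<epsilon> i - 1)) = 0" using arg1[OF \<epsilon>(1)[of i], of 0] \<epsilon>[of i] ab S(2) by simp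
    have "a + 2 * \<epsilon> i \<le> T" using \<epsilon>[of i] ab by linarith
    then show "S ((1 / \<epsilon> i) * T + (- a / \<epsilon> i - 1)) = 1" using arg1[OF \<epsilon>(1)[of i], of T] S(3) by simp
    assume "r (\<epsilon> i) (- a / \<epsilon> i - 1) t \<noteq> 0"
    then have "\<not> ((1 / \<epsilon> i) * t + (- a / \<epsilon> i - 1) \<le> 0 \<or> (1 / \<epsilon> i) * t + (- a / \<epsilon> i - 1) \<ge> 1)" using \<beta>(3) unfolding r_def by force
    then show "\<bar>t - a\<bar> \<le> 2 * \<epsilon> i" using arg1[OF \<epsilon>(1)[of i], of t] \<epsilon>(1)[of i] by linarith
  qed (use ab in auto)
  have B: "(\<lambda>i. integral {0..T} (\<lambda>t. r (\<epsilon> i) (2 - b / \<epsilon> i) t * y t)) \<longlonglongrightarrow> y b"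
  proof (rule L2)
    fix i t
    have "0 \<le> b - 2 * \<epsilon> i" using \<epsilon>[of i] ab by linarith
    then show "S ((1 / \<epsilon> i) * 0 + (2 - b / \<epsilon> i)) = 0" using arg2[OF \<epsilon>(1)[of i], of 0] S(2) by simp
    have "b - \<epsilon> i \<le> T" using \<epsilon>[of i] ab by linarith
    then show "S ((1 / \<epsilon> i) * T + (2 - b / \<epsilon> i)) = 1" using arg2[OF \<epsilon>(1)[of i], of T] S(3) by simp
    assume "r (\<epsilon> i) (2 - b / \<epsilon> i) t \<noteq> 0"
    then have "\<not> ((1 / \<epsilon> i) * t + (2 - b / \<epsilon> i) \<le> 0 \<or> (1 / \<epsilon> i) * t + (2 - b / \<epsilon> i) \<ge> 1)" using \<beta>(3) unfolding r_def by force
    then show "\<bar>t - b\<bar> \<le> 2 * \<epsilon> i" using arg2[OF \<epsilon>(1)[of i], of t] \<epsilon>(1)[of i] by linarith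
  qed (use ab in auto)
  have eq: "(\<integral>t. deriv (\<phi> (\<epsilon> i)) t * y t \<partial>?M) =
    integral {0..T} (\<lambda>t. r (\<epsilon> i) (- a / \<epsilon> i - 1) t * y t) - integral {0..T} (\<lambda>t. r (\<epsilon> i) (2 - b / \<epsilon> i) t * y t)" for i
  proof -
    have c: "continuous_on {0..T} (\<lambda>t. \<phi>' (\<epsilon> i) t * y t)"
      unfolding \<phi>'_def by (intro continuous_on_mult continuous_on_add rc y continuous_on_const)
    have "integrable (lebesgue_on {0..T}) (\<lambda>t. \<phi>' (\<epsilon> i) t * y t)"
      by (rule continuous_imp_integrable_real[OF c])
    then have "integrable ?M (\<lambda>t. \<phi>' (\<epsilon> i) t * y t)"
      by (rule integrable_lebesgue_on_subset) auto
    then have "(\<integral>t. deriv (\<phi> (\<epsilon> i)) t * y t \<partial>?M) = integral {0..T} (\<lambda>t. \<phi>' (\<epsilon> i) t * y t)"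
      unfolding \<phi>deriv by (rule lebesgue_open_interval)
    also have "\<dots> = integral {0..T} (\<lambda>t. r (\<epsilon> i) (- a / \<epsilon> i - 1) t * y t - r (\<epsilon> i) (2 - b / \<epsilon> i) t * y t)"
      by (rule arg_cong[where f="integral {0..T}"]) (auto simp: \<phi>'_def algebra_simps fun_eq_iff)
    also have "\<dots> = integral {0..T} (\<lambda>t. r (\<epsilon> i) (- a / \<epsilon> i - 1) t * y t) - integral {0..T} (\<lambda>t. r (\<epsilon> i) (2 - b / \<epsilon> i) t * y t)"
      by (intro Henstock_Kurzweil_Integration.integral_diff integrable_continuous_real continuous_on_mult rc y)
    finally show ?thesis .
  qed
  have "(\<lambda>i. \<integral>t. deriv (\<phi> (\<epsilon> i)) t * y t \<partial>?M) \<longlonglongrightarrow> y a - y b"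
    unfolding eq by (rule tendsto_diff[OF A B])
  moreover have "(\<lambda>i. \<integral>t. deriv (\<phi> (\<epsilon> i)) t * y t \<partial>?M) \<longlonglongrightarrow> - (\<integral>t. z t \<partial>lebesgue_on {a<..<b})"
    unfolding weak[OF \<phi>test[OF \<epsilon>]] using tendsto_minus[OF L1] unfolding indz .
  ultimately have "y a - y b = - (\<integral>t. z t \<partial>lebesgue_on {a<..<b})" by (rule LIMSEQ_unique)
  then show ?thesis by simp
qed

text \<open>Evaluation at one vector \<open>w\<close> of \<open>V\<close> turns the identity between
  Bochner integrals into the scalar one treated above. Most of the proof checks the integrability
  that \<open>bochner_dual\<close> requires.\<close>

lemma weak_derivative_increment:
  fixes V :: "'h::real_inner set"
  assumes T: "T > 0" and N: "normed_on V nV" and C: "\<And>x. x \<in> V \<Longrightarrow> norm x \<le> C * nV x"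
    and u: "u \<in> Lp_space T p V nV" "p \<ge> 1" and v: "v \<in> Lp_space T q (dual_space V nV) (dual_norm V nV)" "q \<ge> 1"
    and weak: "weak_derivative T V nV u v" and cont: "continuous_on {0..T} u"
    and ab: "0 \<le> a" "a \<le> b" "b \<le> T" and w: "w \<in> V"
  shows "inner (u b) w - inner (u a) w = (\<integral>t. v t w \<partial>lebesgue_on {a<..<b})"
proof (cases "a = b")
  case False
  let ?M = "lebesgue_on {0<..<T}" and ?D = "dual_space V nV" and ?N = "dual_norm V nV"
  note D = normed_on_dual[OF N]
  have lm: "{0<..<T} \<in> lmeasurable" and ls: "{0<..<T} \<in> sets lebesgue" by auto
  have us: "strongly_measurable_on ?M V nV u" "integrable ?M (\<lambda>t. nV (u t) powr p)"
    and vs: "strongly_measurable_on ?M ?D ?N v" "integrable ?M (\<lambda>t. ?N (v t) powr q)"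
    using u v by (auto simp: Lp_space_def)
  have uX: "AE t in ?M. u t \<in> V" and vX: "AE t in ?M. v t \<in> ?D"
    using us(1) vs(1) unfolding strongly_measurable_on_def by (auto elim: eventually_mono)
  have ui: "integrable ?M (\<lambda>t. nV (u t))"
    by (rule integrable_from_powr[OF finite_measure_open_interval strongly_measurable_norm[OF ls N us(1)] us(2) _ u(2)])
      (use uX in eventually_elim, rule carrier_norm_nonneg[OF N])
  have vi: "integrable ?M (\<lambda>t. ?N (v t))"
    by (rule integrable_from_powr[OF finite_measure_open_interval strongly_measurable_norm[OF ls D vs(1)] vs(2) _ v(2)])
      (use vX in eventually_elim, rule carrier_norm_nonneg[OF D])
  note emb = gelfand_emb_dual[OF N C]
  have es: "strongly_measurable_on ?M ?D ?N (\<lambda>t. gelfand_emb V (u t))"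
  proof (rule strongly_measurable_map[OF us(1)])
    show "gelfand_emb V x \<in> ?D" for x by (rule emb)
    show "0 \<le> ?N y" if "y \<in> ?D" for y by (rule dual_norm_nonneg[OF N that])
    show "normed_on ?D ?N" by (rule D)
    show "?N (gelfand_emb V x - gelfand_emb V y) \<le> (\<bar>C\<bar> * \<bar>C\<bar>) * nV (x - y)" if "x \<in> V" "y \<in> V" for x y
    proof -
      have "gelfand_emb V x - gelfand_emb V y = gelfand_emb V (x - y)"
        by (auto simp: gelfand_emb_def fun_eq_iff inner_diff_left)
      then have "?N (gelfand_emb V x - gelfand_emb V y) \<le> norm (x - y) * \<bar>C\<bar>" using emb(2) by simp
      also have "norm (x - y) \<le> \<bar>C\<bar> * nV (x - y)"
        using C[OF carrier_diff[OF N that]] carrier_norm_nonneg[OF N carrier_diff[OF N that]]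
        by (meson abs_ge_self mult_right_mono order_trans)
      then have "norm (x - y) * \<bar>C\<bar> \<le> (\<bar>C\<bar> * nV (x - y)) * \<bar>C\<bar>" by (intro mult_right_mono) auto
      finally show ?thesis by (simp add: mult.assoc mult.commute mult.left_commute)
    qed
  qed
  have key: "(\<integral>t. deriv \<phi> t * inner (u t) w \<partial>?M) = - (\<integral>t. \<phi> t * v t w \<partial>?M)" if \<phi>: "\<phi> \<in> test_functions T" for \<phi>
  proof -
    have diff: "((deriv ^^ m) \<phi>) differentiable (at x)" for m x using \<phi> unfolding test_functions_def by blast
    have c0: "continuous_on A \<phi>" for A
      using differentiable_imp_continuous_within[OF diff[of 0]] by (simp add: continuous_at_imp_continuous_on)
    have c1: "continuous_on A (deriv \<phi>)" for A
      using differentiable_imp_continuous_within[OF diff[of 1]] by (simp add: continuous_at_imp_continuous_on)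
    have gen: "strongly_measurable_on ?M ?D ?N (\<lambda>t. \<psi> t *\<^sub>R G t)" "integrable ?M (\<lambda>t. ?N (\<psi> t *\<^sub>R G t))"
      if \<psi>: "continuous_on UNIV \<psi>" and G: "strongly_measurable_on ?M ?D ?N G" and Gi: "integrable ?M (\<lambda>t. B * nn t)"
        and le: "AE t in ?M. ?N (G t) \<le> B * nn t" for \<psi> G B and nn :: "real \<Rightarrow> real"
    proof -
      have pm: "\<psi> \<in> borel_measurable ?M"
        by (intro measurable_restrict_space1 measurable_completion) (simp add: borel_measurable_continuous_onI[OF \<psi>])
      show sm: "strongly_measurable_on ?M ?D ?N (\<lambda>t. \<psi> t *\<^sub>R G t)" by (rule strongly_measurable_scale[OF D pm G])
      have "compact (\<psi> ` {0..T})" by (rule compact_continuous_image[OF continuous_on_subset[OF \<psi>]]) auto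
      then obtain K where K: "\<And>t. t \<in> {0..T} \<Longrightarrow> \<bar>\<psi> t\<bar> \<le> K" by (meson compact_imp_bounded bounded_real imageI)
      have GX: "AE t in ?M. G t \<in> ?D" using G unfolding strongly_measurable_on_def by (auto elim: eventually_mono)
      show "integrable ?M (\<lambda>t. ?N (\<psi> t *\<^sub>R G t))"
      proof (rule Bochner_Integration.integrable_bound)
        show "integrable ?M (\<lambda>t. K * (B * nn t))" using Gi by (rule integrable_mult_right)
        show "(\<lambda>t. ?N (\<psi> t *\<^sub>R G t)) \<in> borel_measurable ?M" by (rule strongly_measurable_norm[OF ls D sm])
        show "AE t in ?M. norm (?N (\<psi> t *\<^sub>R G t)) \<le> norm (K * (B * nn t))"
          using GX le AE_space
        proof eventually_elim
          fix t assume t: "G t \<in> ?D" "?N (G t) \<le> B * nn t" "t \<in> space ?M"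
          have "\<bar>\<psi> t\<bar> * ?N (G t) \<le> K * (B * nn t)"
            using K[of t] t dual_norm_nonneg[OF N t(1)] by (intro mult_mono) auto
          then show "norm (?N (\<psi> t *\<^sub>R G t)) \<le> norm (K * (B * nn t))"
            using carrier_norm_scale[OF D t(1), of "\<psi> t"] dual_norm_nonneg[OF N t(1)] by simp
        qed
      qed
    qed
    have le1: "AE t in ?M. ?N (gelfand_emb V (u t)) \<le> (\<bar>C\<bar> * \<bar>C\<bar>) * nV (u t)"
      using uX
    proof eventually_elim
      fix t assume t: "u t \<in> V"
      have "norm (u t) \<le> \<bar>C\<bar> * nV (u t)"
        using C[OF t] carrier_norm_nonneg[OF N t] by (meson abs_ge_self mult_right_mono order_trans)
      then have "norm (u t) * \<bar>C\<bar> \<le> (\<bar>C\<bar> * nV (u t)) * \<bar>C\<bar>" by (intro mult_right_mono) auto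
      then show "?N (gelfand_emb V (u t)) \<le> (\<bar>C\<bar> * \<bar>C\<bar>) * nV (u t)"
        using emb(2)[of "u t"] by (simp add: mult.assoc mult.commute mult.left_commute)
    qed
    note g1 = gen[OF c1 es integrable_mult_right[OF ui] le1]
    note g2 = gen[OF c0 vs(1), of 1 "\<lambda>t. ?N (v t)"]
    have g2': "strongly_measurable_on ?M ?D ?N (\<lambda>t. \<phi> t *\<^sub>R v t)" "integrable ?M (\<lambda>t. ?N (\<phi> t *\<^sub>R v t))"
      using g2 vi by auto
    have "bochner_integral_on ?M ?D ?N (\<lambda>t. deriv \<phi> t *\<^sub>R gelfand_emb V (u t)) w =
      (- bochner_integral_on ?M ?D ?N (\<lambda>t. \<phi> t *\<^sub>R v t)) w"
      using weak \<phi> unfolding weak_derivative_def by simp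
    moreover have "bochner_integral_on ?M ?D ?N (\<lambda>t. deriv \<phi> t *\<^sub>R gelfand_emb V (u t)) w = (\<integral>t. deriv \<phi> t * inner (u t) w \<partial>?M)"
      unfolding bochner_dual[OF lm N g1] dual_integral_def[OF lm N g1] using w by (simp add: scaleR_fun_def gelfand_emb_def)
    moreover have "bochner_integral_on ?M ?D ?N (\<lambda>t. \<phi> t *\<^sub>R v t) w = (\<integral>t. \<phi> t * v t w \<partial>?M)"
      unfolding bochner_dual[OF lm N g2'] dual_integral_def[OF lm N g2'] using w by (simp add: scaleR_fun_def)
    ultimately show ?thesis by simp
  qed
  show ?thesis
  proof (rule increment_from_test_functions[OF T, where y="\<lambda>t. inner (u t) w" and z="\<lambda>t. v t w"])
    show "continuous_on {0..T} (\<lambda>t. inner (u t) w)" by (intro continuous_intros cont)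
    show "integrable ?M (\<lambda>t. v t w)" by (rule dual_eval_integrable[OF lm N vs(1) vi w])
  qed (use key ab False in auto)
qed simp


section \<open>Means over an interval\<close>

text \<open>Averaging the evaluations defines an element of the bidual, and reflexivity returns a
  vector. A norming functional of \<open>v - x\<close> then gives the bound on the norm.\<close>

lemma interval_mean_reflexive:
  fixes u :: "real \<Rightarrow> 'a::real_vector"
  assumes N: "normed_on X n" and R: "reflexive_on X n" and ab: "a < b"
    and u: "strongly_measurable_on (lebesgue_on {a<..<b}) X n u" and int: "integrable (lebesgue_on {a<..<b}) (\<lambda>t. n (u t))"
  shows "\<exists>v\<in>X. (\<forall>\<phi>\<in>dual_space X n. \<phi> v = (1 / (b - a)) * (\<integral>t. \<phi> (u t) \<partial>lebesgue_on {a<..<b})) \<and>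
    (\<forall>x\<in>X. n (v - x) \<le> (1 / (b - a)) * (\<integral>t. n (u t - x) \<partial>lebesgue_on {a<..<b}))"
proof -
  let ?M = "lebesgue_on {a<..<b}" and ?D = "dual_space X n" and ?N = "dual_norm X n"
  note D = normed_on_dual[OF N]
  interpret finite_measure ?M by (rule finite_measure_open_interval)
  have uX: "AE t in ?M. u t \<in> X" using u unfolding strongly_measurable_on_def by (auto elim: eventually_mono)
  have m: "(\<lambda>t. \<phi> (u t)) \<in> borel_measurable ?M" if "\<phi> \<in> ?D" for \<phi>
  proof (rule strongly_measurable_lipschitz[OF _ u])
    fix x y assume "x \<in> X" "y \<in> X"
    then show "\<bar>\<phi> x - \<phi> y\<bar> \<le> ?N \<phi> * n (x - y)"
      using dual_bound[OF N that carrier_diff[OF N, of x y]] dual_diff[OF N that, of x y] by simp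
  qed auto
  have bd: "AE t in ?M. \<bar>\<phi> (u t)\<bar> \<le> ?N \<phi> * n (u t)" if "\<phi> \<in> ?D" for \<phi>
    using uX by eventually_elim (rule dual_bound[OF N that])
  have i: "integrable ?M (\<lambda>t. \<phi> (u t))" if "\<phi> \<in> ?D" for \<phi>
  proof (rule Bochner_Integration.integrable_bound[OF integrable_mult_right[OF int, of "?N \<phi>"] m[OF that]])
    show "AE t in ?M. norm (\<phi> (u t)) \<le> norm (?N \<phi> * n (u t))" using bd[OF that] by eventually_elim auto
  qed
  define \<Phi> where "\<Phi> \<phi> = (if \<phi> \<in> ?D then (1 / (b - a)) * (\<integral>t. \<phi> (u t) \<partial>?M) else 0)" for \<phi>
  have "\<Phi> \<in> dual_space ?D ?N"
  proof (rule dual_spaceI[OF D, where C="(1 / (b - a)) * (\<integral>t. n (u t) \<partial>?M)"])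
    fix \<phi> \<psi> assume a: "\<phi> \<in> ?D" "\<psi> \<in> ?D"
    then show "\<Phi> (\<phi> + \<psi>) = \<Phi> \<phi> + \<Phi> \<psi>" using i carrier_add[OF D a] by (simp add: \<Phi>_def distrib_left)
  next
    fix c :: real and \<phi> assume a: "\<phi> \<in> ?D"
    then show "\<Phi> (c *\<^sub>R \<phi>) = c * \<Phi> \<phi>" using carrier_scale[OF D a] by (simp add: \<Phi>_def scaleR_fun_def)
  next
    fix \<phi> assume a: "\<phi> \<in> ?D"
    have "\<bar>\<integral>t. \<phi> (u t) \<partial>?M\<bar> \<le> (\<integral>t. \<bar>\<phi> (u t)\<bar> \<partial>?M)" by (rule integral_abs_bound)
    also have "\<dots> \<le> (\<integral>t. ?N \<phi> * n (u t) \<partial>?M)"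
      by (rule integral_mono_AE[OF _ _ bd[OF a]]) (use i[OF a] int in auto)
    finally have "(1 / (b - a)) * \<bar>\<integral>t. \<phi> (u t) \<partial>?M\<bar> \<le> (1 / (b - a)) * (?N \<phi> * (\<integral>t. n (u t) \<partial>?M))"
      using ab by (intro mult_left_mono) auto
    then show "\<bar>\<Phi> \<phi>\<bar> \<le> (1 / (b - a)) * (\<integral>t. n (u t) \<partial>?M) * ?N \<phi>"
      using a ab by (simp add: \<Phi>_def abs_mult mult.commute mult.left_commute)
  qed (simp add: \<Phi>_def)
  from R[unfolded reflexive_on_def, rule_format, OF this]
  obtain v where v: "v \<in> X" "\<forall>\<phi>\<in>?D. \<Phi> \<phi> = \<phi> v" ..
  have v2: "\<phi> v = (1 / (b - a)) * (\<integral>t. \<phi> (u t) \<partial>?M)" if "\<phi> \<in> ?D" for \<phi>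
    using bspec[OF v(2) that] that by (simp add: \<Phi>_def)
  have "n (v - x) \<le> (1 / (b - a)) * (\<integral>t. n (u t - x) \<partial>?M)" if x: "x \<in> X" for x
  proof -
    obtain \<phi> where \<phi>: "\<phi> \<in> ?D" "?N \<phi> \<le> 1" "\<phi> (v - x) = n (v - x)"
      using norming_functional[OF N carrier_diff[OF N v(1) x]] by blast
    have nm: "(\<lambda>t. n (u t - x)) \<in> borel_measurable ?M"
      by (intro strongly_measurable_norm[OF _ N] strongly_measurable_diff[OF N] u strongly_measurable_simple[OF N])
        (use x in \<open>auto simp: simple_on_def\<close>)
    have ni: "integrable ?M (\<lambda>t. n (u t - x))"
    proof (rule Bochner_Integration.integrable_bound[OF _ nm])
      show "integrable ?M (\<lambda>t. n (u t) + n x)" using int by simp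
      show "AE t in ?M. norm (n (u t - x)) \<le> norm (n (u t) + n x)"
        using uX by eventually_elim
          (use carrier_norm_diff[OF N _ x] carrier_norm_nonneg[OF N carrier_diff[OF N _ x]] in fastforce)
    qed
    have "n (v - x) = (1 / (b - a)) * (\<integral>t. \<phi> (u t) \<partial>?M) - \<phi> x"
      using dual_diff[OF N \<phi>(1) v(1) x] v2[OF \<phi>(1)] \<phi>(3) by simp
    also have "\<phi> x = (1 / (b - a)) * (\<integral>t. \<phi> x \<partial>?M)" using ab by (subst integral_const_open_interval) auto
    also have "(1 / (b - a)) * (\<integral>t. \<phi> (u t) \<partial>?M) - (1 / (b - a)) * (\<integral>t. \<phi> x \<partial>?M) = (1 / (b - a)) * (\<integral>t. \<phi> (u t) - \<phi> x \<partial>?M)"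
      using i[OF \<phi>(1)] by (simp add: right_diff_distrib)
    also have "\<dots> \<le> (1 / (b - a)) * (\<integral>t. n (u t - x) \<partial>?M)"
    proof (intro mult_left_mono integral_mono_AE ni)
      show "AE t in ?M. \<phi> (u t) - \<phi> x \<le> n (u t - x)"
        using uX
      proof eventually_elim
        fix t assume t: "u t \<in> X"
        have "\<phi> (u t - x) \<le> ?N \<phi> * n (u t - x)" using dual_bound[OF N \<phi>(1) carrier_diff[OF N t x]] by simp
        also have "\<dots> \<le> 1 * n (u t - x)" using \<phi>(2) carrier_norm_nonneg[OF N carrier_diff[OF N t x]] by (intro mult_right_mono)
        finally show "\<phi> (u t) - \<phi> x \<le> n (u t - x)" using dual_diff[OF N \<phi>(1) t x] by simp
      qed
    qed (use i[OF \<phi>(1)] ab in auto)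
    finally show ?thesis .
  qed
  then show ?thesis using v(1) v2 by blast
qed

text \<open>For functionals the mean can be written down vector by vector, so reflexivity is not
  called upon here.\<close>

lemma interval_mean_dual:
  assumes N: "normed_on Y n" and ab: "a < b"
    and g: "strongly_measurable_on (lebesgue_on {a<..<b}) (dual_space Y n) (dual_norm Y n) g"
    and int: "integrable (lebesgue_on {a<..<b}) (\<lambda>t. dual_norm Y n (g t))"
  defines "h \<equiv> (\<lambda>y. if y \<in> Y then (1 / (b - a)) * (\<integral>t. g t y \<partial>lebesgue_on {a<..<b}) else 0)"
  shows "h \<in> dual_space Y n"
    and "\<And>\<phi>. \<phi> \<in> dual_space Y n \<Longrightarrow> dual_norm Y n (h - \<phi>) \<le> (1 / (b - a)) * (\<integral>t. dual_norm Y n (g t - \<phi>) \<partial>lebesgue_on {a<..<b})"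
proof -
  let ?M = "lebesgue_on {a<..<b}" and ?D = "dual_space Y n" and ?N = "dual_norm Y n"
  note D = normed_on_dual[OF N]
  have lm: "{a<..<b} \<in> lmeasurable" by simp
  have "h = (1 / (b - a)) *\<^sub>R dual_integral {a<..<b} Y g"
    by (auto simp: h_def fun_eq_iff scaleR_fun_def dual_integral_def[OF lm N g int])
  then show hD: "h \<in> ?D" using carrier_scale[OF D dual_integral_mem[OF lm N g int]] by simp
  have gD: "AE t in ?M. g t \<in> ?D" by (rule dual_AE[OF lm N g int])
  interpret finite_measure ?M by (rule finite_measure_open_interval)
  fix \<phi> assume \<phi>: "\<phi> \<in> ?D"
  have nm: "(\<lambda>t. ?N (g t - \<phi>)) \<in> borel_measurable ?M"
    by (intro strongly_measurable_norm[OF _ D] strongly_measurable_diff[OF D] g strongly_measurable_simple[OF D])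
      (use \<phi> in \<open>auto simp: simple_on_def\<close>)
  have ni: "integrable ?M (\<lambda>t. ?N (g t - \<phi>))"
  proof (rule Bochner_Integration.integrable_bound[OF _ nm])
    show "integrable ?M (\<lambda>t. ?N (g t) + ?N \<phi>)" using int by simp
    show "AE t in ?M. norm (?N (g t - \<phi>)) \<le> norm (?N (g t) + ?N \<phi>)"
      using gD by eventually_elim
        (use carrier_norm_diff[OF D _ \<phi>] carrier_norm_nonneg[OF D carrier_diff[OF D _ \<phi>]] in fastforce)
  qed
  have n0: "AE t in ?M. 0 \<le> ?N (g t - \<phi>)" using gD by eventually_elim (intro carrier_norm_nonneg[OF D] carrier_diff[OF D] \<phi>)
  show "?N (h - \<phi>) \<le> (1 / (b - a)) * (\<integral>t. ?N (g t - \<phi>) \<partial>?M)"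
  proof (rule dual_norm_leI[OF N])
    fix y assume y: "y \<in> Y"
    note i = dual_eval_integrable[OF lm N g int y]
    have "\<phi> y = (1 / (b - a)) * (\<integral>t. \<phi> y \<partial>?M)" using ab by (subst integral_const_open_interval) auto
    then have "(h - \<phi>) y = (1 / (b - a)) * (\<integral>t. g t y - \<phi> y \<partial>?M)"
      using y i by (simp add: h_def right_diff_distrib)
    also have "\<bar>\<dots>\<bar> = (1 / (b - a)) * \<bar>\<integral>t. g t y - \<phi> y \<partial>?M\<bar>" using ab by (simp add: abs_mult)
    also have "\<bar>\<integral>t. g t y - \<phi> y \<partial>?M\<bar> \<le> (\<integral>t. \<bar>g t y - \<phi> y\<bar> \<partial>?M)" by (rule integral_abs_bound)
    also have "\<dots> \<le> (\<integral>t. ?N (g t - \<phi>) * n y \<partial>?M)"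
    proof (rule integral_mono_AE)
      show "AE t in ?M. \<bar>g t y - \<phi> y\<bar> \<le> ?N (g t - \<phi>) * n y"
        using gD by eventually_elim (use dual_bound[OF N carrier_diff[OF D _ \<phi>] y] in force)
    qed (use i ni in auto)
    also have "\<dots> = (\<integral>t. ?N (g t - \<phi>) \<partial>?M) * n y" by simp
    finally show "\<bar>(h - \<phi>) y\<bar> \<le> (1 / (b - a)) * (\<integral>t. ?N (g t - \<phi>) \<partial>?M) * n y"
      using ab by (simp add: mult_left_mono mult.assoc divide_right_mono)
  qed (use ab n0 in \<open>auto intro!: divide_nonneg_nonneg integral_nonneg_AE\<close>)
qed

section \<open>A discrete energy estimate\<close>

lemma le_of_quadratic_le:
  fixes x :: real
  assumes "x\<^sup>2 \<le> a + b * x" "a \<ge> 0" "b \<ge> 0"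
  shows "x \<le> a + b + 1"
proof (rule ccontr)
  assume "\<not> x \<le> a + b + 1"
  then have x: "x > a + b + 1" by simp
  then have "x * x > (a + b + 1) * x" using assms by (intro mult_strict_right_mono) auto
  moreover have "a * 1 \<le> a * x" using x assms by (intro mult_left_mono) auto
  then have "a + b * x \<le> (a + b + 1) * x" using x assms by (simp add: distrib_right)
  ultimately have "a + b * x < x * x" by linarith
  then show False using assms(1) by (simp add: power2_eq_square)
qed

text \<open>In the application \<open>a\<close> is the mean square of the stages and
  \<open>b\<close> the square of their mean, so \<open>ba\<close> lets the inequality telescope. The
  data enter linearly in \<open>sqrt (a n)\<close>; bounding all these roots by their maximum
  \<open>X\<close> produces a quadratic inequality for \<open>X\<close>, and no Gronwall argument
  with exponential constants is needed.\<close>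

lemma discrete_energy:
  fixes a b d \<phi> \<psi> :: "nat \<Rightarrow> real"
  assumes step: "\<And>n. n \<in> {1..N} \<Longrightarrow> a n + d n \<le> b (n - 1) + \<psi> n + \<phi> n * sqrt (a n)"
    and ba: "\<And>n. n \<in> {1..N} \<Longrightarrow> b n \<le> a n" and a0: "\<And>n. 0 \<le> a n" and d0: "\<And>n. 0 \<le> d n"
    and \<phi>0: "\<And>n. n \<in> {1..N} \<Longrightarrow> 0 \<le> \<phi> n" and \<psi>0: "\<And>n. n \<in> {1..N} \<Longrightarrow> 0 \<le> \<psi> n"
    and K: "0 \<le> b 0" "b 0 + (\<Sum>n=1..N. \<psi> n) \<le> K1" "(\<Sum>n=1..N. \<phi> n) \<le> K2"
  shows "\<And>n. n \<in> {1..N} \<Longrightarrow> a n \<le> (K1 + K2 + 1)\<^sup>2" "(\<Sum>n=1..N. d n) \<le> K1 + K2 * (K1 + K2 + 1)"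
proof -
  define X where "X = Max (insert 0 ((\<lambda>n. sqrt (a n)) ` {1..N}))"
  have X: "sqrt (a n) \<le> X" if "n \<in> {1..N}" for n unfolding X_def using that by (intro Max_ge) auto
  have X0: "X \<ge> 0" unfolding X_def by (intro Max_ge) auto
  have K10: "K1 \<ge> 0" using K \<psi>0 by (smt (verit) sum_nonneg)
  have K20: "K2 \<ge> 0" using K \<phi>0 by (smt (verit) sum_nonneg)
  have tel: "b j + (\<Sum>n=1..j. d n) \<le> b 0 + (\<Sum>n=1..j. \<psi> n) + (\<Sum>n=1..j. \<phi> n) * X" if "j \<le> N" for j
    using that
  proof (induction j)
    case (Suc j)
    have m: "Suc j \<in> {1..N}" using Suc.prems by simp
    have "\<phi> (Suc j) * sqrt (a (Suc j)) \<le> \<phi> (Suc j) * X" using X[OF m] \<phi>0[OF m] by (intro mult_left_mono)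
    then show ?case using Suc step[OF m] ba[OF m] by (simp add: distrib_right)
  qed simp
  have part: "b 0 + (\<Sum>n=1..j. \<psi> n) + (\<Sum>n=1..j. \<phi> n) * X \<le> K1 + K2 * X" if "j \<le> N" for j
  proof -
    have "(\<Sum>n=1..j. \<psi> n) \<le> (\<Sum>n=1..N. \<psi> n)" using that \<psi>0 by (intro sum_mono2) auto
    moreover have "(\<Sum>n=1..j. \<phi> n) \<le> (\<Sum>n=1..N. \<phi> n)" using that \<phi>0 by (intro sum_mono2) auto
    then have "(\<Sum>n=1..j. \<phi> n) * X \<le> K2 * X" using K X0 by (intro mult_right_mono) auto
    ultimately show ?thesis using K by linarith
  qed
  have aj: "a j \<le> K1 + K2 * X" if j: "j \<in> {1..N}" for j
  proof -
    obtain i where i: "j = Suc i" using j by (cases j) auto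
    have "\<phi> j * sqrt (a j) \<le> \<phi> j * X" using X[OF j] \<phi>0[OF j] by (intro mult_left_mono)
    moreover have "0 \<le> (\<Sum>n=1..i. d n)" using d0 by (simp add: sum_nonneg)
    ultimately have "a j \<le> b 0 + (\<Sum>n=1..j. \<psi> n) + (\<Sum>n=1..j. \<phi> n) * X"
      using tel[of i] step[OF j] d0[of j] j unfolding i by (simp add: distrib_right)
    then show ?thesis using part[of j] j by simp
  qed
  have "X\<^sup>2 \<le> K1 + K2 * X"
  proof -
    have "X \<in> insert 0 ((\<lambda>n. sqrt (a n)) ` {1..N})" unfolding X_def by (intro Max_in) auto
    then show ?thesis
    proof
      assume "X = 0" then show ?thesis using K10 by simp
    next
      assume "X \<in> (\<lambda>n. sqrt (a n)) ` {1..N}"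
      then obtain n where n: "n \<in> {1..N}" "X = sqrt (a n)" by auto
      then have "X\<^sup>2 = a n" using a0 by simp
      then show ?thesis using aj[OF n(1)] by simp
    qed
  qed
  then have XK: "X \<le> K1 + K2 + 1" by (rule le_of_quadratic_le[OF _ K10 K20])
  show "a n \<le> (K1 + K2 + 1)\<^sup>2" if "n \<in> {1..N}" for n
  proof -
    have "sqrt (a n) \<le> K1 + K2 + 1" using X[OF that] XK by simp
    then have "(sqrt (a n))\<^sup>2 \<le> (K1 + K2 + 1)\<^sup>2" using a0 by (intro power_mono) auto
    then show ?thesis using a0 by simp
  qed
  show "(\<Sum>n=1..N. d n) \<le> K1 + K2 * (K1 + K2 + 1)"
  proof (cases N)
    case 0
    then show ?thesis using K10 K20 by simp
  next
    case (Suc i)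
    have m: "N \<in> {1..N}" using Suc by simp
    have "\<phi> N * sqrt (a N) \<le> \<phi> N * X" using X[OF m] \<phi>0[OF m] by (intro mult_left_mono)
    then have "(\<Sum>n=1..N. d n) \<le> b 0 + (\<Sum>n=1..N. \<psi> n) + (\<Sum>n=1..N. \<phi> n) * X"
      using tel[of i] step[OF m] a0[of N] unfolding Suc by (simp add: distrib_right)
    also have "\<dots> \<le> K1 + K2 * X" using part[of N] by simp
    also have "\<dots> \<le> K1 + K2 * (K1 + K2 + 1)" using XK K20 by (simp add: mult_left_mono)
    finally show ?thesis .
  qed
qed

text \<open>The variance identity. Dropping the nonnegative left-hand side bounds the square of the
  mean by the mean of the squares.\<close>

lemma norm_mean_sq_le:
  fixes x :: "nat \<Rightarrow> 'h::real_inner"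
  assumes s: "s \<ge> 1" and m: "m = (1 / real s) *\<^sub>R (\<Sum>l=1..s. x l)"
  shows "(1 / real s) * (\<Sum>l=1..s. (norm (x l - m))\<^sup>2) = (1 / real s) * (\<Sum>l=1..s. (norm (x l))\<^sup>2) - (norm m)\<^sup>2"
proof -
  have sm: "(\<Sum>l=1..s. x l) = real s *\<^sub>R m" using s m by simp
  have "(\<Sum>l=1..s. (norm (x l - m))\<^sup>2) = (\<Sum>l=1..s. (norm (x l))\<^sup>2 - 2 * inner (x l) m + (norm m)\<^sup>2)"
    by (intro sum.cong refl) (simp add: power2_norm_eq_inner inner_diff_left inner_diff_right inner_commute)
  also have "\<dots> = (\<Sum>l=1..s. (norm (x l))\<^sup>2) - 2 * inner (\<Sum>l=1..s. x l) m + real s * (norm m)\<^sup>2"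
    by (simp add: sum.distrib sum_subtractf inner_sum_left sum_distrib_left)
  also have "inner (\<Sum>l=1..s. x l) m = real s * (norm m)\<^sup>2" unfolding sm by (simp add: power2_norm_eq_inner)
  finally show ?thesis using s by (simp add: field_simps)
qed

section \<open>The scheme and its a priori bounds\<close>

locale splitting =
  fixes T p q :: real and s :: nat
    and V :: "'h::{real_inner, banach, second_countable_topology} set"
    and nV sV :: "'h \<Rightarrow> real"
    and Vl :: "nat \<Rightarrow> 'h set" and nl sl :: "nat \<Rightarrow> 'h \<Rightarrow> real"
    and A :: "real \<Rightarrow> 'h \<Rightarrow> 'h \<Rightarrow> real" and Al :: "nat \<Rightarrow> real \<Rightarrow> 'h \<Rightarrow> 'h \<Rightarrow> real"
    and \<beta> \<eta> lam \<mu> :: real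
    and f :: "real \<Rightarrow> 'h \<Rightarrow> real" and fl :: "nat \<Rightarrow> real \<Rightarrow> 'h \<Rightarrow> real"
    and u0 :: 'h and u :: "real \<Rightarrow> 'h"
    and U :: "nat \<Rightarrow> nat \<Rightarrow> 'h" and Ul :: "nat \<Rightarrow> nat \<Rightarrow> nat \<Rightarrow> 'h"
  assumes T: "T > 0" and p: "p > 1" and q_def: "q = p / (p - 1)" and s: "s \<ge> 1"
    and spaces: "space_decomposition s V nV sV Vl nl sl"
    and beta: "\<beta> > 0" and eta: "\<eta> \<ge> 0" and lam: "lam \<ge> 0" and mu: "\<mu> > 0"
    and fam: "\<And>l. l \<in> {1..s} \<Longrightarrow> operator_family T p \<beta> \<eta> lam \<mu> (Vl l) (nl l) (sl l) (Al l)"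
    and opdec: "operator_decomposition s T V A Al"
    and source: "source_decomposition s T q V nV Vl nl f fl"
    and sol: "evolution_solution T p V nV A f u0 u"
    and scheme: "\<And>N. N \<ge> 1 \<Longrightarrow> sum_splitting s T N Vl nl Al fl u0 (U N) (Ul N)"
begin

abbreviation "M \<equiv> lebesgue_on {0<..<T}"
abbreviation "L \<equiv> {1..s}"
abbreviation "Dl l \<equiv> dual_space (Vl l) (nl l)"
abbreviation "dl l \<equiv> dual_norm (Vl l) (nl l)"
abbreviation "idx N t \<equiv> real (step_index T N t) * (T / real N)"

section \<open>Constants and embeddings common to all components\<close>

lemma q: "q > 1" "1 / p + 1 / q = 1" "1 / q + 1 / p = 1" "(p - 1) * q = p"
  using p by (auto simp: q_def field_simps)

lemma V: "normed_on V nV" "separable_on V nV" "reflexive_on V nV"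
  using spaces unfolding space_decomposition_def gelfand_space_def banach_on_def by auto

lemma Vl: "l \<in> L \<Longrightarrow> normed_on (Vl l) (nl l)" "l \<in> L \<Longrightarrow> reflexive_on (Vl l) (nl l)"
  using spaces unfolding space_decomposition_def gelfand_space_def banach_on_def by auto

lemma Dl: "l \<in> L \<Longrightarrow> normed_on (Dl l) (dl l)"
  using normed_on_dual[OF Vl(1)] .

lemma V_Inter: "(\<And>l. l \<in> L \<Longrightarrow> x \<in> Vl l) \<Longrightarrow> x \<in> V" and V_subset: "l \<in> L \<Longrightarrow> V \<subseteq> Vl l"
  using spaces unfolding space_decomposition_def by blast+

lemma sl_nonneg: "l \<in> L \<Longrightarrow> x \<in> Vl l \<Longrightarrow> 0 \<le> sl l x"
  using spaces unfolding space_decomposition_def gelfand_space_def seminorm_on_def by blast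

text \<open>Properties that survive enlarging the constant hold for all components with the sum of
  the individual constants.\<close>

lemma finite_constant:
  fixes P :: "nat \<Rightarrow> real \<Rightarrow> bool"
  assumes "\<And>l. l \<in> L \<Longrightarrow> \<exists>c. P l c" "\<And>l c c'. l \<in> L \<Longrightarrow> P l c \<Longrightarrow> c \<le> c' \<Longrightarrow> P l c'"
  shows "\<exists>c>0. \<forall>l\<in>L. P l c"
proof -
  obtain c where c: "\<forall>l\<in>L. P l (c l)" using bchoice[of L P] assms(1) by blast
  have "P l (1 + (\<Sum>l\<in>L. \<bar>c l\<bar>))" if "l \<in> L" for l
  proof (rule assms(2)[OF that])
    show "P l (c l)" using c that by blast
    have "\<bar>c l\<bar> \<le> (\<Sum>l\<in>L. \<bar>c l\<bar>)" using that by (intro member_le_sum) auto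
    then show "c l \<le> 1 + (\<Sum>l\<in>L. \<bar>c l\<bar>)" by linarith
  qed
  moreover have "1 + (\<Sum>l\<in>L. \<bar>c l\<bar>) > 0" by (simp add: add_pos_nonneg sum_nonneg)
  ultimately show ?thesis by blast
qed

lemma ex_CH: "\<exists>c>0. \<forall>l\<in>L. \<forall>x\<in>Vl l. norm x \<le> c * nl l x"
proof (rule finite_constant)
  fix l assume "l \<in> L"
  then show "\<exists>c. \<forall>x\<in>Vl l. norm x \<le> c * nl l x"
    using spaces unfolding space_decomposition_def gelfand_space_def by blast
next
  fix l c c' assume l: "l \<in> L" and c: "\<forall>x\<in>Vl l. norm x \<le> c * nl l x" "c \<le> (c'::real)"
  show "\<forall>x\<in>Vl l. norm x \<le> c' * nl l x"
  proof
    fix x assume x: "x \<in> Vl l"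
    have "c * nl l x \<le> c' * nl l x" using carrier_norm_nonneg[OF Vl(1)[OF l] x] c(2) by (rule mult_right_mono[rotated])
    then show "norm x \<le> c' * nl l x" using c(1) x by force
  qed
qed

definition "CH = (SOME c. c > 0 \<and> (\<forall>l\<in>L. \<forall>x\<in>Vl l. norm x \<le> c * nl l x))"

lemma CH: "CH > 0" "l \<in> L \<Longrightarrow> x \<in> Vl l \<Longrightarrow> norm x \<le> CH * nl l x"
  using someI_ex[of "\<lambda>c. c > 0 \<and> (\<forall>l\<in>L. \<forall>x\<in>Vl l. norm x \<le> c * nl l x)"] ex_CH unfolding CH_def[symmetric] by blast+

lemma ex_cN: "\<exists>c>0. \<forall>l\<in>L. \<forall>x\<in>Vl l. nl l x \<le> c * (norm x + sl l x)"
proof (rule finite_constant)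
  fix l assume "l \<in> L"
  then show "\<exists>c. \<forall>x\<in>Vl l. nl l x \<le> c * (norm x + sl l x)"
    using spaces unfolding space_decomposition_def gelfand_space_def by blast
next
  fix l c c' assume l: "l \<in> L" and c: "\<forall>x\<in>Vl l. nl l x \<le> c * (norm x + sl l x)" "c \<le> (c'::real)"
  show "\<forall>x\<in>Vl l. nl l x \<le> c' * (norm x + sl l x)"
  proof
    fix x assume x: "x \<in> Vl l"
    have "c * (norm x + sl l x) \<le> c' * (norm x + sl l x)" using sl_nonneg[OF l x] c(2) by (intro mult_right_mono) auto
    then show "nl l x \<le> c' * (norm x + sl l x)" using c(1) x by force
  qed
qed

definition "cN = (SOME c. c > 0 \<and> (\<forall>l\<in>L. \<forall>x\<in>Vl l. nl l x \<le> c * (norm x + sl l x)))"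

lemma cN: "cN > 0" "l \<in> L \<Longrightarrow> x \<in> Vl l \<Longrightarrow> nl l x \<le> cN * (norm x + sl l x)"
  using someI_ex[of "\<lambda>c. c > 0 \<and> (\<forall>l\<in>L. \<forall>x\<in>Vl l. nl l x \<le> c * (norm x + sl l x))"] ex_cN unfolding cN_def[symmetric] by blast+

lemma ex_CV: "\<exists>c>0. \<forall>l\<in>L. \<forall>x\<in>V. nl l x \<le> c * nV x"
proof -
  obtain c where c: "c > 0" "\<And>x. x \<in> V \<Longrightarrow> c * (\<Sum>l=1..s. nl l x) \<le> nV x"
    using spaces unfolding space_decomposition_def equivalent_on_def by blast
  have "nl l x \<le> (1 / c) * nV x" if l: "l \<in> L" and x: "x \<in> V" for l x
  proof -
    have "nl l x \<le> (\<Sum>l=1..s. nl l x)"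
      using l carrier_norm_nonneg[OF Vl(1)] V_subset x by (intro member_le_sum) auto
    then have "c * nl l x \<le> c * (\<Sum>l=1..s. nl l x)" using c(1) by (intro mult_left_mono) auto
    then have "c * nl l x \<le> nV x" using c(2)[OF x] by linarith
    then show ?thesis using c(1) by (simp add: field_simps)
  qed
  then show ?thesis using c(1) by (intro exI[of _ "1 / c"]) auto
qed

definition "CV = (SOME c. c > 0 \<and> (\<forall>l\<in>L. \<forall>x\<in>V. nl l x \<le> c * nV x))"

lemma CV: "CV > 0" "l \<in> L \<Longrightarrow> x \<in> V \<Longrightarrow> nl l x \<le> CV * nV x"
  using someI_ex[of "\<lambda>c. c > 0 \<and> (\<forall>l\<in>L. \<forall>x\<in>V. nl l x \<le> c * nV x)"] ex_CV unfolding CV_def[symmetric] by blast+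

lemma embV: "x \<in> V \<Longrightarrow> norm x \<le> (CH * CV) * nV x"
proof -
  assume x: "x \<in> V"
  have l: "1 \<in> L" using s by simp
  have "norm x \<le> CH * nl 1 x" using CH(2)[OF l] V_subset[OF l] x by auto
  also have "\<dots> \<le> CH * (CV * nV x)" using CV(2)[OF l x] CH(1) by (intro mult_left_mono) auto
  finally show ?thesis by (simp add: mult.assoc)
qed

lemmas Al_dual = operator_dual[OF Vl(1) fam p eta beta]
  and Al_cont = operator_continuous[OF Vl(1) fam p eta beta]
  and Al_mono = operator_monotone[OF Vl(1) fam p eta beta]
  and Al_growth = operator_growth[OF Vl(1) fam p eta beta]
  and Al_coercive = operator_coercive[OF Vl(1) fam p eta beta]

lemma u_Lp: "u \<in> Lp_space T p V nV"
  using sol unfolding evolution_solution_def Wp_space_def by blast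

lemma u_cont: "continuous_on {0..T} u" and u_0: "u 0 = u0"
  using sol unfolding evolution_solution_def by blast+

lemma u_strong: "strongly_measurable_on M V nV u" and u_powr: "integrable M (\<lambda>t. nV (u t) powr p)"
  using u_Lp by (auto simp: Lp_space_def)

lemma u_AE: "AE t in M. u t \<in> V"
  using u_strong unfolding strongly_measurable_on_def by (auto elim: eventually_mono)

lemma fl_strong: "l \<in> L \<Longrightarrow> strongly_measurable_on M (Dl l) (dl l) (fl l)"
  and fl_powr: "l \<in> L \<Longrightarrow> integrable M (\<lambda>t. dl l (fl l t) powr q)"
  using source unfolding source_decomposition_def Lp_space_def by blast+

lemma fl_AE: "l \<in> L \<Longrightarrow> AE t in M. fl l t \<in> Dl l"
  using fl_strong unfolding strongly_measurable_on_def by (auto elim: eventually_mono)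

lemma fl_nonneg_AE: "l \<in> L \<Longrightarrow> AE t in M. 0 \<le> dl l (fl l t)"
  using fl_AE[of l] by (auto elim!: eventually_mono intro: dual_norm_nonneg[OF Vl(1)])

lemma fl_int: "l \<in> L \<Longrightarrow> integrable M (\<lambda>t. dl l (fl l t))"
  using q(1)
  by (intro integrable_from_powr[OF finite_measure_open_interval strongly_measurable_norm[OF _ Dl fl_strong] fl_powr fl_nonneg_AE]) auto

lemma u_l_strong: "l \<in> L \<Longrightarrow> strongly_measurable_on M (Vl l) (nl l) u"
proof (rule strongly_measurable_map[OF u_strong, where h="\<lambda>x. x" and C=CV])
  assume l: "l \<in> L"
  show "x \<in> Vl l" if "x \<in> V" for x using V_subset[OF l] that by auto
  show "0 \<le> nl l y" if "y \<in> Vl l" for y by (rule carrier_norm_nonneg[OF Vl(1)[OF l] that])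
  show "normed_on (Vl l) (nl l)" by (rule Vl(1)[OF l])
  show "nl l (x - y) \<le> CV * nV (x - y)" if "x \<in> V" "y \<in> V" for x y
    by (rule CV(2)[OF l carrier_diff[OF V(1) that]])
qed

lemma u_l_powr: assumes l: "l \<in> L" shows "integrable M (\<lambda>t. nl l (u t) powr p)"
proof (rule Bochner_Integration.integrable_bound[OF integrable_mult_right[OF u_powr, of "CV powr p"]])
  show "(\<lambda>t. nl l (u t) powr p) \<in> borel_measurable M"
    using strongly_measurable_norm[OF _ Vl(1)[OF l] u_l_strong[OF l]] by simp
  show "AE t in M. norm (nl l (u t) powr p) \<le> norm (CV powr p * nV (u t) powr p)"
    using u_AE
  proof eventually_elim
    fix t assume t: "u t \<in> V"
    have "nl l (u t) powr p \<le> (CV * nV (u t)) powr p"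
      using CV(2)[OF l t] carrier_norm_nonneg[OF Vl(1)[OF l], of "u t"] V_subset[OF l] t p by (intro powr_mono2) auto
    then show "norm (nl l (u t) powr p) \<le> norm (CV powr p * nV (u t) powr p)"
      using CV(1) carrier_norm_nonneg[OF V(1) t] by (simp add: powr_mult)
  qed
qed

section \<open>Integrals over grid cells\<close>

abbreviation "cell N n \<equiv> lebesgue_on {(real n - 1) * (T / real N)<..<real n * (T / real N)}"

lemma cell_subset:
  assumes "N \<ge> 1" "n \<in> {1..N}"
  shows "{(real n - 1) * (T / real N)<..<real n * (T / real N)} \<subseteq> {0<..<T}"
proof -
  have "0 \<le> (real n - 1) * (T / real N)" using assms T by auto
  moreover have "real n * (T / real N) \<le> real N * (T / real N)" using assms T by (intro mult_right_mono) auto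
  then have "real n * (T / real N) \<le> T" using assms by simp
  ultimately show ?thesis by auto
qed

lemma node: "N \<ge> 1 \<Longrightarrow> n \<le> N \<Longrightarrow> real n * (T / real N) \<in> {0..T}"
proof -
  assume N: "N \<ge> 1" "n \<le> N"
  have "real n * (T / real N) \<le> real N * (T / real N)" using N T by (intro mult_right_mono) auto
  then show ?thesis using N T by simp
qed

lemma cell_AE: "N \<ge> 1 \<Longrightarrow> n \<in> {1..N} \<Longrightarrow> AE t in M. P t \<Longrightarrow> AE t in cell N n. P t"
  by (rule AE_lebesgue_on_subset[OF _ _ cell_subset]) auto

lemma cell_integrable: "N \<ge> 1 \<Longrightarrow> n \<in> {1..N} \<Longrightarrow> integrable M F \<Longrightarrow> integrable (cell N n) (F :: real \<Rightarrow> real)"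
  by (rule integrable_lebesgue_on_subset[OF _ _ _ cell_subset]) auto

lemma cell_const: "N \<ge> 1 \<Longrightarrow> (\<integral>t. c \<partial>cell N n) = (T / real N) * (c::real)"
proof -
  assume N: "N \<ge> 1"
  have "(real n - 1) * (T / real N) \<le> real n * (T / real N)" using T by (intro mult_right_mono) auto
  moreover have "real n * (T / real N) - (real n - 1) * (T / real N) = T / real N"
    by (simp only: left_diff_distrib mult_1 diff_diff_eq2 add_diff_cancel_left')
  ultimately show ?thesis by (simp only: integral_const_open_interval)
qed

lemma cell_sum:
  fixes F :: "real \<Rightarrow> real"
  assumes N: "N \<ge> 1" and F: "integrable M F" and F0: "AE t in M. 0 \<le> F t" and j: "j \<le> N"
  shows "(\<Sum>n=1..j. \<integral>t. F t \<partial>cell N n) \<le> (\<integral>t. F t \<partial>M)"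
proof -
  have "(\<Sum>n=1..N. \<integral>t. F t \<partial>cell N n) = (\<integral>t. F t \<partial>M)"
    using integral_split_grid[OF T N F, of N] N by simp
  moreover have "(\<Sum>n=1..j. \<integral>t. F t \<partial>cell N n) \<le> (\<Sum>n=1..N. \<integral>t. F t \<partial>cell N n)"
    using j by (intro sum_mono2 integral_nonneg_AE cell_AE[OF N _ F0]) auto
  ultimately show ?thesis by simp
qed

section \<open>The scheme in weak form and its a priori bounds\<close>

lemma scheme_U0: "N \<ge> 1 \<Longrightarrow> U N 0 = u0"
  and Ul_mem: "N \<ge> 1 \<Longrightarrow> n \<in> {1..N} \<Longrightarrow> l \<in> L \<Longrightarrow> Ul N l n \<in> Vl l"
  and U_mean: "N \<ge> 1 \<Longrightarrow> n \<in> {1..N} \<Longrightarrow> U N n = (1 / real s) *\<^sub>R (\<Sum>l=1..s. Ul N l n)"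
  using scheme[of N] unfolding sum_splitting_def Let_def by blast+

text \<open>The equation of a stage multiplied by \<open>k / s\<close> with
  \<open>k = T / real N\<close>, which turns the mean of the source into an integral over the cell.
  All energy arguments start from here.\<close>

lemma scheme_weak:
  assumes N: "N \<ge> 1" and n: "n \<in> {1..N}" and l: "l \<in> L" and x: "x \<in> Vl l"
  shows "(1 / real s) * inner (Ul N l n - U N (n - 1)) x + (T / real N) * Al l (real n * (T / real N)) (Ul N l n) x
    = (\<integral>t. fl l t x \<partial>cell N n)"
proof -
  let ?k = "T / real N"
  have k: "?k > 0" using T N by simp
  have sm: "strongly_measurable_on (cell N n) (Dl l) (dl l) (fl l)"
    by (rule strongly_measurable_subset[OF _ _ cell_subset[OF N n] fl_strong[OF l]]) auto
  have i: "integrable (cell N n) (\<lambda>t. dl l (fl l t))" by (rule cell_integrable[OF N n fl_int[OF l]])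
  have lm: "{(real n - 1) * ?k<..<real n * ?k} \<in> lmeasurable" by simp
  have "source_mean ?k (Vl l) (nl l) (fl l) n x = (1 / ?k) * (\<integral>t. fl l t x \<partial>cell N n)"
    unfolding source_mean_def bochner_dual[OF lm Vl(1)[OF l] sm i] dual_integral_def[OF lm Vl(1)[OF l] sm i] scaleR_fun_def
    using x by simp
  moreover have "gelfand_emb (Vl l) ((1 / ?k) *\<^sub>R (Ul N l n - U N (n - 1))) + real s *\<^sub>R Al l (real n * ?k) (Ul N l n)
    = real s *\<^sub>R source_mean ?k (Vl l) (nl l) (fl l) n"
    using scheme[OF N] n l unfolding sum_splitting_def Let_def by blast
  from fun_cong[OF this, of x]
  have "(1 / ?k) * inner (Ul N l n - U N (n - 1)) x + real s * Al l (real n * ?k) (Ul N l n) x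
    = real s * source_mean ?k (Vl l) (nl l) (fl l) n x"
    using x by (simp add: gelfand_emb_def scaleR_fun_def)
  ultimately have "(1 / ?k) * inner (Ul N l n - U N (n - 1)) x + real s * Al l (real n * ?k) (Ul N l n) x
    = real s * ((1 / ?k) * (\<integral>t. fl l t x \<partial>cell N n))" by simp
  moreover have "(1 / r) * I + k * B = F" if "(1 / k) * I + r * B = r * ((1 / k) * F)" "k > 0" "r > 0" for I B F k r :: real
    using that by (simp add: field_simps)
  ultimately show ?thesis using k s by (meson of_nat_0_less_iff less_le_trans zero_less_one)
qed

text \<open>Each stage is tested with itself. Coercivity controls only the seminorm, so the source
  is split along \<open>nl l x \<le> cN * (norm x + sl l x)\<close>: the seminorm part is absorbed
  with the weight \<open>\<mu> / 2\<close> by Young's inequality, the \<open>H\<close> part is the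
  linear term of \<open>discrete_energy\<close>. The second bound carries no factor of the step
  size, and this is what later drives the stages together.\<close>

lemma a_priori:
  "\<exists>K>0. \<forall>N\<ge>1. (\<forall>n\<in>{1..N}. \<forall>l\<in>L. norm (Ul N l n) \<le> K) \<and>
     (\<Sum>n=1..N. \<Sum>l=1..s. (norm (Ul N l n - U N (n - 1)))\<^sup>2) \<le> K \<and>
     (T / real N) * (\<Sum>n=1..N. \<Sum>l=1..s. nl l (Ul N l n) powr p) \<le> K"
proof -
  obtain C0 where C0: "C0 > 0" "\<And>a b. a \<ge> 0 \<Longrightarrow> b \<ge> 0 \<Longrightarrow> a * b \<le> (\<mu> / 2) * a powr p + C0 * b powr q"
    using young_epsilon[OF p q(1,2), of "\<mu> / 2"] mu by auto
  define F1 where "F1 = (\<integral>t. (\<Sum>l=1..s. dl l (fl l t)) \<partial>M)"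
  define F2 where "F2 = (\<integral>t. (\<Sum>l=1..s. dl l (fl l t) powr q) \<partial>M)"
  \<comment> \<open>Upper bounds for the totals of \<psi> and \<phi> in
    \<open>discrete_energy\<close>; the initial value is part of \<open>K1\<close>.\<close>
  define K1 where "K1 = (norm u0)\<^sup>2 + 2 * (real s * lam * T + C0 * cN powr q * F2)"
  define K2 where "K2 = 2 * cN * real s * F1"
  define KK where "KK = (K1 + K2 + 1)\<^sup>2"
  define KS where "KS = K1 + K2 * (K1 + K2 + 1)"
  have F10: "F1 \<ge> 0" unfolding F1_def
  proof (rule integral_nonneg_AE)
    have "AE t in M. \<forall>l\<in>L. 0 \<le> dl l (fl l t)" by (rule AE_finite_allI) (use fl_nonneg_AE in auto)
    then show "AE t in M. 0 \<le> (\<Sum>l=1..s. dl l (fl l t))" by eventually_elim (auto intro: sum_nonneg)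
  qed
  have F20: "F2 \<ge> 0" unfolding F2_def by (rule integral_nonneg_AE, rule AE_I2, rule sum_nonneg) simp
  have K10: "K1 \<ge> 0" "K2 \<ge> 0" unfolding K1_def K2_def using F10 F20 lam T C0(1) cN(1) by auto
  have KS0: "KS \<ge> 0" unfolding KS_def using K10 by auto
  have main: "(\<forall>n\<in>{1..N}. (1 / real s) * (\<Sum>l=1..s. (norm (Ul N l n))\<^sup>2) \<le> KK) \<and>
     (\<Sum>n=1..N. (1 / real s) * (\<Sum>l=1..s. (norm (Ul N l n - U N (n - 1)))\<^sup>2) + (T / real N) * \<mu> * (\<Sum>l=1..s. sl l (Ul N l n) powr p)) \<le> KS"
    if N: "N \<ge> 1" for N
  proof -
    let ?k = "T / real N"
    have k: "?k > 0" using T N by simp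
    define a where "a n = (1 / real s) * (\<Sum>l=1..s. (norm (Ul N l n))\<^sup>2)" for n
    define b where "b n = (norm (U N n))\<^sup>2" for n
    define d where "d n = (1 / real s) * (\<Sum>l=1..s. (norm (Ul N l n - U N (n - 1)))\<^sup>2) + ?k * \<mu> * (\<Sum>l=1..s. sl l (Ul N l n) powr p)" for n
    define \<psi> where "\<psi> n = 2 * (?k * real s * lam + C0 * cN powr q * (\<integral>t. (\<Sum>l=1..s. dl l (fl l t) powr q) \<partial>cell N n))" for n
    define \<phi> where "\<phi> n = 2 * cN * real s * (\<integral>t. (\<Sum>l=1..s. dl l (fl l t)) \<partial>cell N n)" for n
    have a0: "0 \<le> a n" for n unfolding a_def by (auto intro!: divide_nonneg_nonneg sum_nonneg)
    have d0: "0 \<le> d n" for n unfolding d_def using k mu T by (auto intro!: add_nonneg_nonneg divide_nonneg_nonneg mult_nonneg_nonneg sum_nonneg)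
    have iF1: "integrable M (\<lambda>t. \<Sum>l=1..s. dl l (fl l t))" and iF2: "integrable M (\<lambda>t. \<Sum>l=1..s. dl l (fl l t) powr q)"
      using fl_int fl_powr by (auto intro!: Bochner_Integration.integrable_sum)
    have pos1: "AE t in M. 0 \<le> (\<Sum>l=1..s. dl l (fl l t))"
    proof -
      have "AE t in M. \<forall>l\<in>L. 0 \<le> dl l (fl l t)" by (rule AE_finite_allI) (use fl_nonneg_AE in auto)
      then show ?thesis by eventually_elim (auto intro: sum_nonneg)
    qed
    have pos2: "AE t in M. 0 \<le> (\<Sum>l=1..s. dl l (fl l t) powr q)" by (rule AE_I2, rule sum_nonneg) simp
    have step: "a n + d n \<le> b (n - 1) + \<psi> n + \<phi> n * sqrt (a n)" if n: "n \<in> {1..N}" for n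
    proof -
      define X where "X = sqrt (a n)"
      have X0: "0 \<le> X" unfolding X_def using a0 by simp
      have UX: "norm (Ul N l n) \<le> real s * X" if l: "l \<in> L" for l
      proof -
        have "(norm (Ul N l n))\<^sup>2 \<le> (\<Sum>l=1..s. (norm (Ul N l n))\<^sup>2)" using l by (intro member_le_sum) auto
        also have "\<dots> = real s * a n" using s by (simp add: a_def)
        also have "\<dots> \<le> real s * (real s * a n)"
        proof (rule mult_left_mono)
          show "a n \<le> real s * a n" using mult_right_mono[of 1 "real s" "a n"] s a0[of n] by simp
        qed simp
        also have "\<dots> = (real s * X)\<^sup>2" using a0[of n] by (simp add: X_def power_mult_distrib power2_eq_square)
        finally have "(norm (Ul N l n))\<^sup>2 \<le> (real s * X)\<^sup>2" .
        then show ?thesis by (rule power2_le_imp_le) (use X0 in simp)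
      qed
      have each: "(1 / real s) * inner (Ul N l n - U N (n - 1)) (Ul N l n) + ?k * (\<mu> / 2 * sl l (Ul N l n) powr p)
         \<le> ?k * lam + C0 * cN powr q * (\<integral>t. dl l (fl l t) powr q \<partial>cell N n) + cN * real s * X * (\<integral>t. dl l (fl l t) \<partial>cell N n)"
        if l: "l \<in> L" for l
      proof -
        let ?x = "Ul N l n"
        have x: "?x \<in> Vl l" by (rule Ul_mem[OF N n l])
        have co: "\<mu> * sl l ?x powr p - lam \<le> Al l (real n * ?k) ?x ?x"
        proof -
          have "n \<le> N" using n by simp
          from Al_coercive[OF l l node[OF N this] x] show ?thesis by linarith
        qed
        note i1 = integrable_mult_right[OF cell_integrable[OF N n fl_powr[OF l]], of "C0 * cN powr q"]
        note i2 = integrable_mult_right[OF cell_integrable[OF N n fl_int[OF l]], of "cN * real s * X"]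
        have i3: "integrable (cell N n) (\<lambda>t. \<mu> / 2 * sl l ?x powr p)"
          by (rule finite_measure.integrable_const[OF finite_measure_open_interval])
        have "(\<integral>t. fl l t ?x \<partial>cell N n) \<le> (\<integral>t. (C0 * cN powr q) * dl l (fl l t) powr q + (cN * real s * X) * dl l (fl l t) + \<mu> / 2 * sl l ?x powr p \<partial>cell N n)"
        proof (rule integral_mono_AE)
          show "integrable (cell N n) (\<lambda>t. fl l t ?x)"
            by (rule dual_eval_integrable[OF _ Vl(1)[OF l] strongly_measurable_subset[OF _ _ cell_subset[OF N n] fl_strong[OF l]] cell_integrable[OF N n fl_int[OF l]] x]) auto
          show "integrable (cell N n) (\<lambda>t. (C0 * cN powr q) * dl l (fl l t) powr q + (cN * real s * X) * dl l (fl l t) + \<mu> / 2 * sl l ?x powr p)"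
            by (rule Bochner_Integration.integrable_add[OF Bochner_Integration.integrable_add[OF i1 i2] i3])
          show "AE t in cell N n. fl l t ?x \<le> (C0 * cN powr q) * dl l (fl l t) powr q + (cN * real s * X) * dl l (fl l t) + \<mu> / 2 * sl l ?x powr p"
            using cell_AE[OF N n fl_AE[OF l]]
          proof eventually_elim
            fix t assume t: "fl l t \<in> Dl l"
            let ?g = "dl l (fl l t)"
            have g0: "0 \<le> ?g" by (rule dual_norm_nonneg[OF Vl(1)[OF l] t])
            have "fl l t ?x \<le> ?g * nl l ?x" using dual_bound[OF Vl(1)[OF l] t x] by simp
            also have "\<dots> \<le> ?g * (cN * (norm ?x + sl l ?x))" using cN(2)[OF l x] g0 by (intro mult_left_mono)
            also have "\<dots> = cN * ?g * norm ?x + sl l ?x * (cN * ?g)" by (simp add: algebra_simps)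
            also have "cN * ?g * norm ?x \<le> cN * ?g * (real s * X)" using UX[OF l] g0 cN(1) by (intro mult_left_mono) auto
            also have "sl l ?x * (cN * ?g) \<le> \<mu> / 2 * sl l ?x powr p + C0 * (cN * ?g) powr q"
              using C0(2) sl_nonneg[OF l x] g0 cN(1) by simp
            also have "(cN * ?g) powr q = cN powr q * ?g powr q" using cN(1) g0 by (simp add: powr_mult)
            finally show "fl l t ?x \<le> (C0 * cN powr q) * ?g powr q + (cN * real s * X) * ?g + \<mu> / 2 * sl l ?x powr p"
              by (simp add: mult.assoc mult.left_commute mult.commute)
          qed
        qed
        also have "\<dots> = (C0 * cN powr q) * (\<integral>t. dl l (fl l t) powr q \<partial>cell N n) + (cN * real s * X) * (\<integral>t. dl l (fl l t) \<partial>cell N n) + ?k * (\<mu> / 2 * sl l ?x powr p)"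
          by (simp only: Bochner_Integration.integral_add[OF Bochner_Integration.integrable_add[OF i1 i2] i3]
              Bochner_Integration.integral_add[OF i1 i2] integral_mult_right_zero[of "cell N n" "C0 * cN powr q"] integral_mult_right_zero[of "cell N n" "cN * real s * X"] cell_const[OF N])
        finally have "(\<integral>t. fl l t ?x \<partial>cell N n) \<le> \<dots>" .
        moreover have "?k * (\<mu> * sl l ?x powr p - lam) \<le> ?k * Al l (real n * ?k) ?x ?x" using co k by (intro mult_left_mono) auto
        moreover have "?k * (\<mu> * sl l ?x powr p - lam) = 2 * (?k * (\<mu> / 2 * sl l ?x powr p)) - ?k * lam"
          by (simp only: right_diff_distrib) simp
        ultimately show ?thesis using scheme_weak[OF N n l x] by linarith
      qed
      have inner_id: "inner (x - y) x = ((norm x)\<^sup>2 - (norm y)\<^sup>2 + (norm (x - y))\<^sup>2) / 2" for x y :: 'h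
        by (simp add: power2_norm_eq_inner inner_diff_left inner_diff_right inner_commute)
      have "(\<Sum>l=1..s. (1 / real s) * inner (Ul N l n - U N (n - 1)) (Ul N l n) + ?k * (\<mu> / 2 * sl l (Ul N l n) powr p))
        \<le> (\<Sum>l=1..s. ?k * lam + C0 * cN powr q * (\<integral>t. dl l (fl l t) powr q \<partial>cell N n) + cN * real s * X * (\<integral>t. dl l (fl l t) \<partial>cell N n))"
        by (rule sum_mono) (rule each)
      also have "\<dots> = (\<psi> n + \<phi> n * X) / 2"
      proof -
        have e1: "(\<integral>t. (\<Sum>l=1..s. dl l (fl l t)) \<partial>cell N n) = (\<Sum>l=1..s. \<integral>t. dl l (fl l t) \<partial>cell N n)"
          by (rule Bochner_Integration.integral_sum) (rule cell_integrable[OF N n fl_int])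
        have e2: "(\<integral>t. (\<Sum>l=1..s. dl l (fl l t) powr q) \<partial>cell N n) = (\<Sum>l=1..s. \<integral>t. dl l (fl l t) powr q \<partial>cell N n)"
          by (rule Bochner_Integration.integral_sum) (rule cell_integrable[OF N n fl_powr])
        show ?thesis unfolding \<psi>_def \<phi>_def e1 e2 sum.distrib sum_distrib_left[symmetric]
          by simp
      qed
      finally have 1: "(\<Sum>l=1..s. (1 / real s) * inner (Ul N l n - U N (n - 1)) (Ul N l n) + ?k * (\<mu> / 2 * sl l (Ul N l n) powr p)) \<le> (\<psi> n + \<phi> n * X) / 2" .
      have 2: "(\<Sum>l=1..s. (1 / real s) * inner (Ul N l n - U N (n - 1)) (Ul N l n) + ?k * (\<mu> / 2 * sl l (Ul N l n) powr p))
        = (a n + d n - b (n - 1)) / 2"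
      proof -
        have "(\<Sum>l=1..s. inner (Ul N l n - U N (n - 1)) (Ul N l n)) =
          ((\<Sum>l=1..s. (norm (Ul N l n))\<^sup>2) - real s * (norm (U N (n - 1)))\<^sup>2 + (\<Sum>l=1..s. (norm (Ul N l n - U N (n - 1)))\<^sup>2)) / 2"
          unfolding inner_id by (simp add: sum.distrib sum_subtractf flip: sum_divide_distrib)
        then have "(1 / real s) * (\<Sum>l=1..s. inner (Ul N l n - U N (n - 1)) (Ul N l n)) =
          (a n - b (n - 1) + (1 / real s) * (\<Sum>l=1..s. (norm (Ul N l n - U N (n - 1)))\<^sup>2)) / 2"
          using s by (simp add: a_def b_def field_simps)
        moreover have "(\<Sum>l=1..s. ?k * (\<mu> / 2 * sl l (Ul N l n) powr p)) = ?k * \<mu> * (\<Sum>l=1..s. sl l (Ul N l n) powr p) / 2"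
          by (simp add: sum_distrib_left sum_divide_distrib mult.assoc)
        ultimately show ?thesis unfolding d_def sum.distrib sum_distrib_left[symmetric] by (simp add: algebra_simps)
      qed
      from 1[unfolded 2] show ?thesis unfolding X_def[symmetric] by simp
    qed
    have ba: "b n \<le> a n" if n: "n \<in> {1..N}" for n
    proof -
      have "0 \<le> (1 / real s) * (\<Sum>l=1..s. (norm (Ul N l n - U N n))\<^sup>2)" by (auto intro!: divide_nonneg_nonneg sum_nonneg)
      then show ?thesis using norm_mean_sq_le[OF s U_mean[OF N n]] unfolding a_def b_def by linarith
    qed
    have \<phi>0: "0 \<le> \<phi> n" if "n \<in> {1..N}" for n
      unfolding \<phi>_def using cN(1) by (intro mult_nonneg_nonneg integral_nonneg_AE cell_AE[OF N that pos1]) auto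
    have \<psi>0: "0 \<le> \<psi> n" if "n \<in> {1..N}" for n
      unfolding \<psi>_def using k lam C0(1) by (intro mult_nonneg_nonneg add_nonneg_nonneg integral_nonneg_AE cell_AE[OF N that pos2]) auto
    have S1: "b 0 + (\<Sum>n=1..N. \<psi> n) \<le> K1"
    proof -
      have c2: "(\<Sum>n=1..N. (\<integral>t. (\<Sum>l=1..s. dl l (fl l t) powr q) \<partial>cell N n)) \<le> F2" unfolding F2_def by (rule cell_sum[OF N iF2 pos2]) simp
      have "(\<Sum>n=1..N. \<psi> n) = 2 * (real N * (?k * real s * lam) + C0 * cN powr q * (\<Sum>n=1..N. (\<integral>t. (\<Sum>l=1..s. dl l (fl l t) powr q) \<partial>cell N n)))"
        unfolding \<psi>_def by (simp add: sum.distrib flip: sum_distrib_left)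
      also have "real N * (?k * real s * lam) = real s * lam * T" using N by simp
      also have "C0 * cN powr q * (\<Sum>n=1..N. (\<integral>t. (\<Sum>l=1..s. dl l (fl l t) powr q) \<partial>cell N n)) \<le> C0 * cN powr q * F2"
        using c2 C0(1) by (intro mult_left_mono) auto
      finally show ?thesis unfolding K1_def b_def using scheme_U0[OF N] by simp
    qed
    have S2: "(\<Sum>n=1..N. \<phi> n) \<le> K2"
    proof -
      have c2: "(\<Sum>n=1..N. (\<integral>t. (\<Sum>l=1..s. dl l (fl l t)) \<partial>cell N n)) \<le> F1" unfolding F1_def by (rule cell_sum[OF N iF1 pos1]) simp
      have "(\<Sum>n=1..N. \<phi> n) = 2 * cN * real s * (\<Sum>n=1..N. (\<integral>t. (\<Sum>l=1..s. dl l (fl l t)) \<partial>cell N n))"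
        unfolding \<phi>_def by (simp add: sum_distrib_left)
      also have "\<dots> \<le> K2" unfolding K2_def using c2 cN(1) by (intro mult_left_mono) auto
      finally show ?thesis .
    qed
    have b0: "0 \<le> b 0" by (simp add: b_def)
    note E = discrete_energy[where a=a and b=b and d=d and \<phi>=\<phi> and \<psi>=\<psi> and N=N, OF step ba a0 d0 \<phi>0 \<psi>0 b0 S1 S2]
    show ?thesis using E unfolding KK_def KS_def a_def d_def by blast
  qed
  \<comment> \<open>\<open>KK\<close> bounds the mean of the squared norms of the stages, so
    \<open>real s * KK\<close> bounds each of the squares; \<open>K\<close> adds up what the three
    claims require.\<close>
  define KU where "KU = sqrt (real s * KK)"
  define K where "K = 1 + KU + real s * KS + 2 powr p * cN powr p * (T * (real s * KU powr p) + KS / \<mu>)"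
  have KK0: "KK \<ge> 0" unfolding KK_def by simp
  have KU0: "KU \<ge> 0" unfolding KU_def using KK0 by simp
  have last0: "0 \<le> 2 powr p * cN powr p * (T * (real s * KU powr p) + KS / \<mu>)" using T KS0 mu by auto
  have Kge: "KU \<le> K" "real s * KS \<le> K" "2 powr p * cN powr p * (T * (real s * KU powr p) + KS / \<mu>) \<le> K"
    unfolding K_def using KU0 last0 KS0 mult_nonneg_nonneg[of "real s" KS] by linarith+
  have "K > 0" unfolding K_def using KU0 last0 KS0 mult_nonneg_nonneg[of "real s" KS] by linarith
  moreover have "(\<forall>n\<in>{1..N}. \<forall>l\<in>L. norm (Ul N l n) \<le> K) \<and>
     (\<Sum>n=1..N. \<Sum>l=1..s. (norm (Ul N l n - U N (n - 1)))\<^sup>2) \<le> K \<and>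
     (T / real N) * (\<Sum>n=1..N. \<Sum>l=1..s. nl l (Ul N l n) powr p) \<le> K" if N: "N \<ge> 1" for N
  proof -
    let ?k = "T / real N"
    have k: "?k > 0" using T N by simp
    have UK: "norm (Ul N l n) \<le> KU" if n: "n \<in> {1..N}" and l: "l \<in> L" for n l
    proof -
      have "(norm (Ul N l n))\<^sup>2 \<le> (\<Sum>l=1..s. (norm (Ul N l n))\<^sup>2)" using l by (intro member_le_sum) auto
      also have "\<dots> = real s * ((1 / real s) * (\<Sum>l=1..s. (norm (Ul N l n))\<^sup>2))" using s by simp
      also have "\<dots> \<le> real s * KK" using main[OF N] n by (intro mult_left_mono) auto
      finally show ?thesis unfolding KU_def by (rule real_le_rsqrt)
    qed
    define dd where "dd = (\<Sum>n=1..N. \<Sum>l=1..s. (norm (Ul N l n - U N (n - 1)))\<^sup>2)"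
    define ss where "ss = (\<Sum>n=1..N. \<Sum>l=1..s. sl l (Ul N l n) powr p)"
    have m2: "(1 / real s) * dd + ?k * \<mu> * ss \<le> KS"
      using main[OF N] unfolding dd_def ss_def by (simp add: sum.distrib sum_distrib_left sum_divide_distrib)
    have dd0: "dd \<ge> 0" unfolding dd_def by (auto intro!: sum_nonneg)
    have ss0: "ss \<ge> 0" unfolding ss_def by (auto intro!: sum_nonneg)
    have "0 \<le> ?k * \<mu> * ss" using k mu ss0 by (intro mult_nonneg_nonneg) auto
    then have "(1 / real s) * dd \<le> KS" using m2 by linarith
    then have ddK: "dd \<le> real s * KS" using s by (simp add: field_simps)
    have "0 \<le> (1 / real s) * dd" using dd0 by (intro mult_nonneg_nonneg) auto
    then have "?k * \<mu> * ss \<le> KS" using m2 by linarith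
    then have "(?k * ss) * \<mu> \<le> KS" by (simp only: mult_ac)
    then have ssK: "?k * ss \<le> KS / \<mu>" using mu by (simp only: pos_le_divide_eq)
    have each: "nl l (Ul N l n) powr p \<le> 2 powr p * cN powr p * (KU powr p + sl l (Ul N l n) powr p)" if n: "n \<in> {1..N}" and l: "l \<in> L" for n l
    proof -
      let ?x = "Ul N l n"
      have x: "?x \<in> Vl l" by (rule Ul_mem[OF N n l])
      have "nl l ?x \<le> cN * (KU + sl l ?x)" using cN(2)[OF l x] UK[OF n l] cN(1) by (smt (verit) mult_left_mono)
      then have "nl l ?x powr p \<le> (cN * (KU + sl l ?x)) powr p" using carrier_norm_nonneg[OF Vl(1)[OF l] x] p by (intro powr_mono2) auto
      also have "\<dots> = cN powr p * (KU + sl l ?x) powr p" using cN(1) KU0 sl_nonneg[OF l x] by (simp add: powr_mult)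
      also have "\<dots> \<le> cN powr p * (2 powr p * (KU powr p + sl l ?x powr p))"
        using powr_add_le[OF KU0 sl_nonneg[OF l x]] p by (intro mult_left_mono) auto
      finally show ?thesis by (simp add: mult.commute mult.left_commute)
    qed
    have "?k * (\<Sum>n=1..N. \<Sum>l=1..s. nl l (Ul N l n) powr p) \<le> ?k * (\<Sum>n=1..N. \<Sum>l=1..s. 2 powr p * cN powr p * (KU powr p + sl l (Ul N l n) powr p))"
      using k each by (intro mult_left_mono sum_mono) auto
    also have "\<dots> = 2 powr p * cN powr p * (?k * (real N * (real s * KU powr p)) + ?k * ss)"
      unfolding ss_def by (simp add: sum.distrib distrib_left mult.left_commute flip: sum_distrib_left)
    also have "?k * (real N * (real s * KU powr p)) = T * (real s * KU powr p)" using N by simp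
    also have "2 powr p * cN powr p * (T * (real s * KU powr p) + ?k * ss) \<le> 2 powr p * cN powr p * (T * (real s * KU powr p) + KS / \<mu>)"
      using ssK by (intro mult_left_mono) auto
    finally have n3: "?k * (\<Sum>n=1..N. \<Sum>l=1..s. nl l (Ul N l n) powr p) \<le> 2 powr p * cN powr p * (T * (real s * KU powr p) + KS / \<mu>)" .
    show ?thesis
    proof (intro conjI ballI)
      show "norm (Ul N l n) \<le> K" if "n \<in> {1..N}" "l \<in> L" for n l using UK[OF that] Kge(1) by (rule order_trans)
      show "(\<Sum>n=1..N. \<Sum>l=1..s. (norm (Ul N l n - U N (n - 1)))\<^sup>2) \<le> K" using ddK Kge(2) unfolding dd_def by (rule order_trans)
      show "?k * (\<Sum>n=1..N. \<Sum>l=1..s. nl l (Ul N l n) powr p) \<le> K" using n3 Kge(3) by (rule order_trans)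
    qed
  qed
  ultimately show ?thesis by blast
qed

end


section \<open>Regularisation of the solution\<close>

lemma norm_le_by_inner:
  fixes z :: "'a::real_inner"
  assumes "\<And>h. inner h z \<le> norm h * e" "e \<ge> 0"
  shows "norm z \<le> e"
proof (cases "z = 0")
  case False
  have "norm z * norm z \<le> norm z * e" using assms(1)[of z] by (simp add: power2_norm_eq_inner flip: power2_eq_square)
  then show ?thesis using False by (simp add: mult_le_cancel_left)
qed (use assms in simp)

lemma continuous_oscillation:
  fixes u :: "real \<Rightarrow> 'a::metric_space"
  assumes "continuous_on {0..T} u" "\<kappa> > 0"
  obtains d where "d > 0" "\<forall>t\<in>{0..T}. \<forall>t'\<in>{0..T}. \<bar>t - t'\<bar> < d \<longrightarrow> dist (u t) (u t') \<le> \<kappa>"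
proof -
  have "uniformly_continuous_on {0..T} u" by (rule compact_uniformly_continuous[OF assms(1)]) auto
  then obtain d where "d > 0" "\<forall>t\<in>{0..T}. \<forall>t'\<in>{0..T}. dist t' t < d \<longrightarrow> dist (u t') (u t) < \<kappa>"
    unfolding uniformly_continuous_on_def using assms(2) by blast
  then have "\<forall>t\<in>{0..T}. \<forall>t'\<in>{0..T}. \<bar>t - t'\<bar> < d \<longrightarrow> dist (u t) (u t') \<le> \<kappa>"
    by (auto simp: dist_real_def less_imp_le)
  with \<open>d > 0\<close> show thesis by (rule that)
qed

context splitting
begin

text \<open>On vectors of \<open>V\<close> these functionals add up, for almost every time, to the
  derivative of \<open>u\<close>.\<close>

definition "gl l t = fl l t - Al l t (u t)"

section \<open>The operators along the solution\<close>

lemma nodes_measurable: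
  assumes "N \<ge> 1"
  shows "(\<lambda>t. idx N t) \<in> borel_measurable M"
    "t \<in> {0<..<T} \<Longrightarrow> idx N t \<in> {0..T}"
proof -
  show "(\<lambda>t. idx N t) \<in> borel_measurable M"
    by (rule step_measurable[OF T assms, where W="\<lambda>m. real m * (T / real N)"])
  assume "t \<in> {0<..<T}"
  then have "step_index T N t \<le> N" using step_index_range(1)[OF T assms, of t] by auto
  then show "idx N t \<in> {0..T}" by (rule node[OF assms])
qed

lemma Al_u_strong:
  assumes l: "l \<in> L" and \<rho>: "\<rho> \<in> borel_measurable M" "\<And>t. t \<in> {0<..<T} \<Longrightarrow> \<rho> t \<in> {0..T}"
  shows "strongly_measurable_on M (Dl l) (dl l) (\<lambda>t. Al l (\<rho> t) (u t))"
  by (rule nemytskii_strongly_measurable[OF Vl(1)[OF l] Vl(2)[OF l] fam[OF l] p eta beta T V(1,2) V_subset[OF l] CV(2)[OF l] _ u_strong \<rho>]) auto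

text \<open>The constant of the growth condition raised to the power \<open>q\<close>, where
  \<open>(p - 1) * q = p\<close> turns the right-hand side into a \<open>p\<close>-th power.\<close>

definition "Cg = 2 powr q * \<beta> powr q"

lemma Cg: "Cg > 0" using beta by (simp add: Cg_def)

lemma growth_powr:
  assumes "l \<in> L" "t \<in> {0..T}" "x \<in> Vl l"
  shows "dl l (Al l t x) powr q \<le> Cg * (1 + nl l x powr p)"
proof -
  let ?y = "nl l x"
  have y0: "0 \<le> ?y" by (rule carrier_norm_nonneg[OF Vl(1)[OF assms(1)] assms(3)])
  have "dl l (Al l t x) powr q \<le> (\<beta> * (1 + ?y powr (p - 1))) powr q"
    using Al_growth[OF assms(1,1,2,3)] dual_norm_nonneg[OF Vl(1)[OF assms(1)] Al_dual[OF assms(1,1,2,3)]] q(1)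
    by (intro powr_mono2) auto
  also have "\<dots> = \<beta> powr q * (1 + ?y powr (p - 1)) powr q" using beta by (simp add: powr_mult)
  also have "\<dots> \<le> \<beta> powr q * (2 powr q * (1 powr q + (?y powr (p - 1)) powr q))"
    using q(1) by (intro mult_left_mono powr_add_le) auto
  also have "(?y powr (p - 1)) powr q = ?y powr p" by (simp add: powr_powr q(4))
  finally show ?thesis by (simp add: Cg_def mult.commute mult.left_commute)
qed

lemma Al_u_powr:
  assumes l: "l \<in> L" and \<rho>: "\<rho> \<in> borel_measurable M" "\<And>t. t \<in> {0<..<T} \<Longrightarrow> \<rho> t \<in> {0..T}"
  shows "integrable M (\<lambda>t. dl l (Al l (\<rho> t) (u t)) powr q)"
proof (rule Bochner_Integration.integrable_bound[of M "\<lambda>t. Cg * (1 + nl l (u t) powr p)"])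
  show "integrable M (\<lambda>t. Cg * (1 + nl l (u t) powr p))"
    using u_l_powr[OF l] finite_measure.integrable_const[OF finite_measure_open_interval]
    by (intro integrable_mult_right Bochner_Integration.integrable_add)
  show "(\<lambda>t. dl l (Al l (\<rho> t) (u t)) powr q) \<in> borel_measurable M"
    using strongly_measurable_norm[OF _ Dl[OF l] Al_u_strong[OF l \<rho>]] by simp
  show "AE t in M. norm (dl l (Al l (\<rho> t) (u t)) powr q) \<le> norm (Cg * (1 + nl l (u t) powr p))"
    using u_AE AE_space
  proof eventually_elim
    fix t assume t: "u t \<in> V" "t \<in> space M"
    have "dl l (Al l (\<rho> t) (u t)) powr q \<le> Cg * (1 + nl l (u t) powr p)"
      using growth_powr[OF l \<rho>(2)] t V_subset[OF l] by auto
    then show "norm (dl l (Al l (\<rho> t) (u t)) powr q) \<le> norm (Cg * (1 + nl l (u t) powr p))" by simp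
  qed
qed

lemma id_nodes: "(\<lambda>t. t) \<in> borel_measurable M" "t \<in> {0<..<T} \<Longrightarrow> t \<in> {0..T}"
  using id_borel_measurable_lebesgue_on[of "{0<..<T}"] by (auto simp: id_def)

lemmas Al_u_id_strong = Al_u_strong[OF _ id_nodes] and Al_u_id_powr = Al_u_powr[OF _ id_nodes]

lemma Al_u_AE: "l \<in> L \<Longrightarrow> AE t in M. Al l t (u t) \<in> Dl l"
  using Al_u_id_strong[of l] unfolding strongly_measurable_on_def by (auto elim: eventually_mono)

lemma gl_strong: "l \<in> L \<Longrightarrow> strongly_measurable_on M (Dl l) (dl l) (gl l)"
  unfolding gl_def by (rule strongly_measurable_diff[OF Dl fl_strong Al_u_id_strong])

lemma gl_Lp: assumes l: "l \<in> L" shows "gl l \<in> Lp_space T q (Dl l) (dl l)"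
proof -
  have "integrable M (\<lambda>t. dl l (gl l t) powr q)"
  proof (rule integrable_powr_bound(1)[OF _ _ fl_powr[OF l] Al_u_id_powr[OF l]])
    show "(\<lambda>t. dl l (gl l t)) \<in> borel_measurable M" by (rule strongly_measurable_norm[OF _ Dl[OF l] gl_strong[OF l]]) simp
    show "AE t in M. 0 \<le> dl l (gl l t) \<and> dl l (gl l t) \<le> dl l (fl l t) + dl l (Al l t (u t)) \<and> 0 \<le> dl l (fl l t) \<and> 0 \<le> dl l (Al l t (u t))"
      using fl_AE[OF l] Al_u_AE[OF l]
    proof eventually_elim
      fix t assume t: "fl l t \<in> Dl l" "Al l t (u t) \<in> Dl l"
      show "0 \<le> dl l (gl l t) \<and> dl l (gl l t) \<le> dl l (fl l t) + dl l (Al l t (u t)) \<and> 0 \<le> dl l (fl l t) \<and> 0 \<le> dl l (Al l t (u t))"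
        unfolding gl_def using carrier_norm_diff[OF Dl[OF l] t] carrier_norm_nonneg[OF Dl[OF l]] t carrier_diff[OF Dl[OF l] t] by auto
    qed
  qed (use q(1) in \<open>(simp; fail) | linarith\<close>)+
  then show ?thesis using gl_strong[OF l] by (simp add: Lp_space_def)
qed

lemma gl_AE: "l \<in> L \<Longrightarrow> AE t in M. gl l t \<in> Dl l"
  using gl_strong unfolding strongly_measurable_on_def by (auto elim: eventually_mono)

lemma gl_int: assumes l: "l \<in> L" shows "integrable M (\<lambda>t. dl l (gl l t))"
proof (rule integrable_from_powr[OF finite_measure_open_interval strongly_measurable_norm[OF _ Dl[OF l] gl_strong[OF l]]])
  show "integrable M (\<lambda>t. dl l (gl l t) powr q)" using gl_Lp[OF l] by (simp add: Lp_space_def)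
  show "AE t in M. 0 \<le> dl l (gl l t)" using gl_AE[OF l] by eventually_elim (rule dual_norm_nonneg[OF Vl(1)[OF l]])
qed (use q(1) in \<open>auto intro: less_imp_le\<close>)

lemma u_int: "integrable M (\<lambda>t. nV (u t))"
proof (rule integrable_from_powr[OF finite_measure_open_interval strongly_measurable_norm[OF _ V(1) u_strong] u_powr])
  show "AE t in M. 0 \<le> nV (u t)" using u_AE by eventually_elim (rule carrier_norm_nonneg[OF V(1)])
qed (use p in auto)

lemma gl_eval_int: "l \<in> L \<Longrightarrow> x \<in> Vl l \<Longrightarrow> integrable M (\<lambda>t. gl l t x)"
  by (rule dual_eval_integrable[OF _ Vl(1) gl_strong gl_int]) auto

lemma subinterval:
  assumes "0 \<le> a" "b \<le> T"
  shows "integrable M F \<Longrightarrow> integrable (lebesgue_on {a<..<b}) (F :: real \<Rightarrow> real)"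
    "strongly_measurable_on M X n g \<Longrightarrow> strongly_measurable_on (lebesgue_on {a<..<b}) X n g"
    "AE t in M. P t \<Longrightarrow> AE t in lebesgue_on {a<..<b}. P t"
proof -
  have sub: "{a<..<b} \<subseteq> {0<..<T}" using assms by auto
  have m: "{a<..<b} \<in> sets lebesgue" "{0<..<T} \<in> sets lebesgue" by auto
  show "integrable M F \<Longrightarrow> integrable (lebesgue_on {a<..<b}) F" by (rule integrable_lebesgue_on_subset[OF _ _ _ sub]) auto
  show "strongly_measurable_on M X n g \<Longrightarrow> strongly_measurable_on (lebesgue_on {a<..<b}) X n g" by (rule strongly_measurable_subset[OF _ _ sub]) auto
  show "AE t in M. P t \<Longrightarrow> AE t in lebesgue_on {a<..<b}. P t" by (rule AE_lebesgue_on_subset[OF _ _ sub]) auto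
qed

text \<open>The evolution equation in integrated form. Only vectors of \<open>V\<close> can be
  inserted, since \<open>V\<close> is the common domain of the functionals
  \<open>gl l\<close>.\<close>

lemma u_increment:
  assumes ab: "0 \<le> a" "a \<le> b" "b \<le> T" and w: "w \<in> V"
  shows "inner (u b - u a) w = (\<Sum>l=1..s. \<integral>t. gl l t w \<partial>lebesgue_on {a<..<b})"
proof -
  obtain u' where u': "u' \<in> Lp_space T q (dual_space V nV) (dual_norm V nV)" "weak_derivative T V nV u u'"
    "AE t in M. u' t + A t (u t) = f t"
    using sol unfolding evolution_solution_def q_def by blast
  have "inner (u b) w - inner (u a) w = (\<integral>t. u' t w \<partial>lebesgue_on {a<..<b})"
    by (rule weak_derivative_increment[OF T V(1) embV u_Lp _ u'(1) _ u'(2) u_cont ab w]) (use p q in auto)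
  also have "\<dots> = (\<integral>t. (\<Sum>l=1..s. gl l t w) \<partial>lebesgue_on {a<..<b})"
  proof (rule integral_cong_AE)
    have "strongly_measurable_on M (dual_space V nV) (dual_norm V nV) u'" using u'(1) by (simp add: Lp_space_def)
    then have sm: "strongly_measurable_on (lebesgue_on {a<..<b}) (dual_space V nV) (dual_norm V nV) u'" by (rule subinterval(2)[OF ab(1,3)])
    show "(\<lambda>t. u' t w) \<in> borel_measurable (lebesgue_on {a<..<b})"
    proof (rule strongly_measurable_lipschitz[OF _ sm, where C="nV w"])
      fix \<phi> \<psi> assume "\<phi> \<in> dual_space V nV" "\<psi> \<in> dual_space V nV"
      then show "\<bar>\<phi> w - \<psi> w\<bar> \<le> nV w * dual_norm V nV (\<phi> - \<psi>)"
        using dual_bound[OF V(1) carrier_diff[OF normed_on_dual[OF V(1)]] w, of \<phi> \<psi>] by (simp add: mult.commute)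
    qed auto
    show "(\<lambda>t. \<Sum>l=1..s. gl l t w) \<in> borel_measurable (lebesgue_on {a<..<b})"
      using subinterval(1)[OF ab(1,3) gl_eval_int] V_subset w by (intro borel_measurable_sum borel_measurable_integrable) blast
    have src: "AE t in M. (\<forall>w\<in>V. (\<Sum>l=1..s. fl l t w) = f t w)"
      using source unfolding source_decomposition_def by (auto elim: eventually_mono)
    have "AE t in M. u' t w = (\<Sum>l=1..s. gl l t w)"
      using u'(3) src u_AE AE_space
    proof eventually_elim
      fix t assume t: "u' t + A t (u t) = f t" "\<forall>w\<in>V. (\<Sum>l=1..s. fl l t w) = f t w" "u t \<in> V" "t \<in> space M"
      have "u' t w + A t (u t) w = (\<Sum>l=1..s. fl l t w)" using fun_cong[OF t(1), of w] t(2) w by simp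
      moreover have "A t (u t) w = (\<Sum>l=1..s. Al l t (u t) w)"
        using opdec t(3,4) w unfolding operator_decomposition_def by simp
      ultimately show "u' t w = (\<Sum>l=1..s. gl l t w)" by (simp add: gl_def sum_subtractf)
    qed
    then show "AE t in lebesgue_on {a<..<b}. u' t w = (\<Sum>l=1..s. gl l t w)" by (rule subinterval(3)[OF ab(1,3)])
  qed
  also have "\<dots> = (\<Sum>l=1..s. \<integral>t. gl l t w \<partial>lebesgue_on {a<..<b})"
    using subinterval(1)[OF ab(1,3) gl_eval_int] V_subset w by (intro Bochner_Integration.integral_sum) blast
  finally show ?thesis by (simp add: inner_diff_left)
qed

section \<open>Window means and difference quotients\<close>

lemma window_range:
  assumes "0 < \<delta>" "\<delta> < T" "t \<in> {0..T}"
  shows "0 \<le> (1 - \<delta> / T) * t" "(1 - \<delta> / T) * t + \<delta> \<le> T"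
    "t - \<delta> \<le> (1 - \<delta> / T) * t" "(1 - \<delta> / T) * t \<le> t"
proof -
  have 1: "0 \<le> \<delta> * (t / T)" using assms T by auto
  have 2: "\<delta> * (t / T) \<le> \<delta>" using assms T by (simp add: pos_divide_le_eq mult_left_le)
  have eq: "(1 - \<delta> / T) * t = t - \<delta> * (t / T)" by (simp add: left_diff_distrib)
  have "0 \<le> 1 - \<delta> / T" using assms T by simp
  then show "0 \<le> (1 - \<delta> / T) * t" using assms by (intro mult_nonneg_nonneg) auto
  show "t - \<delta> \<le> (1 - \<delta> / T) * t" "(1 - \<delta> / T) * t \<le> t" unfolding eq using 1 2 by linarith+
  have "(1 - \<delta> / T) * t \<le> (1 - \<delta> / T) * T" using \<open>0 \<le> 1 - \<delta> / T\<close> assms by (intro mult_left_mono) auto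
  also have "(1 - \<delta> / T) * T = T - \<delta>" using T by (simp add: left_diff_distrib)
  finally show "(1 - \<delta> / T) * t + \<delta> \<le> T" by simp
qed

text \<open>A measure rather than a set: Lebesgue measure on the window that belongs to the time
  \<open>t\<close>.\<close>

definition "win \<delta> t = lebesgue_on {(1 - \<delta> / T) * t<..<(1 - \<delta> / T) * t + \<delta>}"

text \<open>Chosen through the two properties of a mean that are used later;
  \<open>interval_mean_reflexive\<close> shows that such a vector exists for the times
  considered.\<close>

definition "u_window \<delta> t = (SOME v. v \<in> V \<and> (\<forall>\<phi>\<in>dual_space V nV. \<phi> v = (1 / \<delta>) * (\<integral>r. \<phi> (u r) \<partial>win \<delta> t)) \<and>
    (\<forall>x\<in>V. nV (v - x) \<le> (1 / \<delta>) * (\<integral>r. nV (u r - x) \<partial>win \<delta> t)))"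

text \<open>The mean of the derivative of \<open>u\<close> over the window. The windows move with
  speed \<open>1 - \<delta> / T\<close>, so the derivative of \<open>u_window\<close> is this vector
  times that speed; the discrepancy is an error term below.\<close>

definition "u_slope \<delta> t = (1 / \<delta>) *\<^sub>R (u ((1 - \<delta> / T) * t + \<delta>) - u ((1 - \<delta> / T) * t))"

definition "gl_window \<delta> l t = (\<lambda>x. if x \<in> Vl l then (1 / \<delta>) * (\<integral>r. gl l r x \<partial>win \<delta> t) else 0)"

context
  fixes \<delta> :: real
  assumes \<delta>: "0 < \<delta>" "\<delta> < T"
begin

lemma u_window:
  assumes t: "t \<in> {0..T}"
  shows "u_window \<delta> t \<in> V" "\<And>\<phi>. \<phi> \<in> dual_space V nV \<Longrightarrow> \<phi> (u_window \<delta> t) = (1 / \<delta>) * (\<integral>r. \<phi> (u r) \<partial>win \<delta> t)"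
    "\<And>x. x \<in> V \<Longrightarrow> nV (u_window \<delta> t - x) \<le> (1 / \<delta>) * (\<integral>r. nV (u r - x) \<partial>win \<delta> t)"
proof -
  note r = window_range(1,2)[OF \<delta> t]
  have "\<exists>v\<in>V. (\<forall>\<phi>\<in>dual_space V nV. \<phi> v = (1 / ((1 - \<delta> / T) * t + \<delta> - (1 - \<delta> / T) * t)) * (\<integral>r. \<phi> (u r) \<partial>win \<delta> t)) \<and>
    (\<forall>x\<in>V. nV (v - x) \<le> (1 / ((1 - \<delta> / T) * t + \<delta> - (1 - \<delta> / T) * t)) * (\<integral>r. nV (u r - x) \<partial>win \<delta> t))"
    unfolding win_def
    by (rule interval_mean_reflexive[OF V(1,3) _ subinterval(2)[OF r u_strong] subinterval(1)[OF r u_int]]) (use \<delta> in simp)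
  then have "\<exists>v. v \<in> V \<and> (\<forall>\<phi>\<in>dual_space V nV. \<phi> v = (1 / \<delta>) * (\<integral>r. \<phi> (u r) \<partial>win \<delta> t)) \<and>
    (\<forall>x\<in>V. nV (v - x) \<le> (1 / \<delta>) * (\<integral>r. nV (u r - x) \<partial>win \<delta> t))" by auto
  from someI_ex[OF this] have *: "u_window \<delta> t \<in> V \<and> (\<forall>\<phi>\<in>dual_space V nV. \<phi> (u_window \<delta> t) = (1 / \<delta>) * (\<integral>r. \<phi> (u r) \<partial>win \<delta> t)) \<and>
    (\<forall>x\<in>V. nV (u_window \<delta> t - x) \<le> (1 / \<delta>) * (\<integral>r. nV (u r - x) \<partial>win \<delta> t))"
    unfolding u_window_def[symmetric] .
  show "u_window \<delta> t \<in> V" by (rule conjunct1[OF *])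
  show "\<phi> (u_window \<delta> t) = (1 / \<delta>) * (\<integral>r. \<phi> (u r) \<partial>win \<delta> t)" if "\<phi> \<in> dual_space V nV" for \<phi>
    by (rule bspec[OF conjunct1[OF conjunct2[OF *]] that])
  show "nV (u_window \<delta> t - x) \<le> (1 / \<delta>) * (\<integral>r. nV (u r - x) \<partial>win \<delta> t)" if "x \<in> V" for x
    by (rule bspec[OF conjunct2[OF conjunct2[OF *]] that])
qed

lemma gl_window:
  assumes t: "t \<in> {0..T}" and l: "l \<in> L"
  shows "gl_window \<delta> l t \<in> Dl l"
    "\<And>\<phi>. \<phi> \<in> Dl l \<Longrightarrow> dl l (gl_window \<delta> l t - \<phi>) \<le> (1 / \<delta>) * (\<integral>r. dl l (gl l r - \<phi>) \<partial>win \<delta> t)"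
proof -
  note r = window_range(1,2)[OF \<delta> t]
  have lt: "(1 - \<delta> / T) * t < (1 - \<delta> / T) * t + \<delta>" using \<delta> by simp
  note * = interval_mean_dual[OF Vl(1)[OF l] lt subinterval(2)[OF r gl_strong[OF l]] subinterval(1)[OF r gl_int[OF l]]]
  show "gl_window \<delta> l t \<in> Dl l" using *(1) unfolding gl_window_def win_def add_diff_cancel_left' .
  show "dl l (gl_window \<delta> l t - \<phi>) \<le> (1 / \<delta>) * (\<integral>r. dl l (gl l r - \<phi>) \<partial>win \<delta> t)" if "\<phi> \<in> Dl l" for \<phi>
    using *(2)[OF that] unfolding gl_window_def win_def add_diff_cancel_left' .
qed

lemma gl_window_sum:
  assumes t: "t \<in> {0..T}" and x: "x \<in> V"
  shows "(\<Sum>l=1..s. gl_window \<delta> l t x) = inner (u_slope \<delta> t) x"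
proof -
  note r = window_range(1,2)[OF \<delta> t]
  have "(\<Sum>l=1..s. gl_window \<delta> l t x) = (\<Sum>l=1..s. (1 / \<delta>) * (\<integral>r. gl l r x \<partial>win \<delta> t))"
    using V_subset x by (intro sum.cong refl) (auto simp: gl_window_def)
  also have "\<dots> = (1 / \<delta>) * (\<Sum>l=1..s. \<integral>r. gl l r x \<partial>win \<delta> t)" by (simp add: sum_distrib_left)
  also have "(\<Sum>l=1..s. \<integral>r. gl l r x \<partial>win \<delta> t) = inner (u ((1 - \<delta> / T) * t + \<delta>) - u ((1 - \<delta> / T) * t)) x"
    unfolding win_def by (rule u_increment[OF r(1) _ r(2) x, symmetric]) (use \<delta> in simp)
  finally show ?thesis by (simp add: u_slope_def)
qed

lemma inner_u_int: assumes "0 \<le> a" "b \<le> T"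
  shows "integrable (lebesgue_on {a<..<b}) (\<lambda>r. inner h (u r))"
proof -
  have "integrable (lebesgue_on {0..T}) (\<lambda>r. inner h (u r))"
    by (rule continuous_imp_integrable_real) (intro continuous_intros u_cont)
  then show ?thesis by (rule integrable_lebesgue_on_subset) (use assms in auto)
qed

text \<open>The mean was formed in \<open>V\<close>. Testing with embedded vectors identifies it
  with the mean in \<open>H\<close>, where the continuity of \<open>u\<close> can be used.\<close>

lemma u_window_inner:
  assumes t: "t \<in> {0..T}"
  shows "inner h (u_window \<delta> t) = (1 / \<delta>) * (\<integral>r. inner h (u r) \<partial>win \<delta> t)"
proof -
  note r = window_range(1,2)[OF \<delta> t]
  have "gelfand_emb V h (u_window \<delta> t) = (1 / \<delta>) * (\<integral>r. gelfand_emb V h (u r) \<partial>win \<delta> t)"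
    by (rule u_window(2)[OF t gelfand_emb_dual(1)[OF V(1) embV]])
  also have "(\<integral>r. gelfand_emb V h (u r) \<partial>win \<delta> t) = (\<integral>r. inner h (u r) \<partial>win \<delta> t)"
  proof (rule integral_cong_AE)
    show im: "(\<lambda>r. inner h (u r)) \<in> borel_measurable (win \<delta> t)"
      using inner_u_int[OF r] unfolding win_def by (rule borel_measurable_integrable)
    have ae: "AE r in win \<delta> t. u r \<in> V" unfolding win_def by (rule subinterval(3)[OF r u_AE])
    then show "AE r in win \<delta> t. gelfand_emb V h (u r) = inner h (u r)" by eventually_elim (simp add: gelfand_emb_def)
    show "(\<lambda>r. gelfand_emb V h (u r)) \<in> borel_measurable (win \<delta> t)"
      unfolding win_def
    proof (rule borel_measurable_AE_lebesgue_on)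
      show "(\<lambda>r. inner h (u r)) \<in> borel_measurable (lebesgue_on {(1 - \<delta> / T) * t<..<(1 - \<delta> / T) * t + \<delta>})" using im unfolding win_def .
      show "AE r in lebesgue_on {(1 - \<delta> / T) * t<..<(1 - \<delta> / T) * t + \<delta>}. inner h (u r) = gelfand_emb V h (u r)"
        using ae unfolding win_def by eventually_elim (simp add: gelfand_emb_def)
    qed auto
  qed
  finally show ?thesis using u_window(1)[OF t] by (simp add: gelfand_emb_def)
qed

lemma integral_near_value:
  assumes ab: "0 \<le> a" "a \<le> b" "b \<le> T"
    and osc: "\<And>r. r \<in> {a..b} \<Longrightarrow> norm (u r - c) \<le> \<kappa>"
  shows "\<bar>(\<integral>r. inner h (u r) \<partial>lebesgue_on {a<..<b}) - (b - a) * inner h c\<bar> \<le> (b - a) * (norm h * \<kappa>)"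
proof -
  interpret finite_measure "lebesgue_on {a<..<b}" by (rule finite_measure_open_interval)
  have "(\<integral>r. inner h (u r) \<partial>lebesgue_on {a<..<b}) - (b - a) * inner h c = (\<integral>r. inner h (u r) - inner h c \<partial>lebesgue_on {a<..<b})"
    unfolding Bochner_Integration.integral_diff[OF inner_u_int[OF ab(1,3), of h] integrable_const[of "inner h c"]]
      integral_const_open_interval[OF ab(2)] ..
  also have "\<bar>\<dots>\<bar> \<le> (\<integral>r. \<bar>inner h (u r) - inner h c\<bar> \<partial>lebesgue_on {a<..<b})" by (rule integral_abs_bound)
  also have "\<dots> \<le> (\<integral>r. norm h * \<kappa> \<partial>lebesgue_on {a<..<b})"
  proof (rule integral_mono)
    fix r assume "r \<in> space (lebesgue_on {a<..<b})"
    then have "norm (u r - c) \<le> \<kappa>" by (intro osc) auto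
    moreover have "\<bar>inner h (u r - c)\<bar> \<le> norm h * norm (u r - c)" by (rule Cauchy_Schwarz_ineq2)
    ultimately show "\<bar>inner h (u r) - inner h c\<bar> \<le> norm h * \<kappa>"
      by (metis inner_diff_right mult_left_mono norm_ge_zero order_trans)
  qed (use inner_u_int[OF ab(1,3), of h] in auto)
  also have "\<dots> = (b - a) * (norm h * \<kappa>)" by (rule integral_const_open_interval[OF ab(2)])
  finally show ?thesis .
qed

lemma u_window_near_u:
  assumes t: "t \<in> {0..T}" and \<kappa>: "\<kappa> \<ge> 0"
    and osc: "\<And>r. r \<in> {0..T} \<Longrightarrow> \<bar>r - t\<bar> \<le> \<delta> \<Longrightarrow> norm (u r - u t) \<le> \<kappa>"
  shows "norm (u_window \<delta> t - u t) \<le> \<kappa>"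
proof (rule norm_le_by_inner[OF _ \<kappa>])
  fix h
  note r = window_range[OF \<delta> t]
  let ?a = "(1 - \<delta> / T) * t"
  have "\<bar>(\<integral>r. inner h (u r) \<partial>lebesgue_on {?a<..<?a + \<delta>}) - (?a + \<delta> - ?a) * inner h (u t)\<bar> \<le> (?a + \<delta> - ?a) * (norm h * \<kappa>)"
    by (rule integral_near_value[OF r(1) _ r(2)]) (use r \<delta> in \<open>auto intro!: osc\<close>)
  then have "(\<integral>r. inner h (u r) \<partial>win \<delta> t) - \<delta> * inner h (u t) \<le> \<delta> * (norm h * \<kappa>)" unfolding win_def by (simp add: abs_le_iff)
  then have "(1 / \<delta>) * ((\<integral>r. inner h (u r) \<partial>win \<delta> t) - \<delta> * inner h (u t)) \<le> (1 / \<delta>) * (\<delta> * (norm h * \<kappa>))" using \<delta> by (intro mult_left_mono) auto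
  then show "inner h (u_window \<delta> t - u t) \<le> norm h * \<kappa>"
    using \<delta> by (simp add: inner_diff_right u_window_inner[OF t] diff_divide_distrib)
qed

text \<open>The difference of two window means is a difference of two short integrals, at the right
  and at the left ends of the windows. Freezing \<open>u\<close> in both costs the term with
  \<kappa>2. The length of the short intervals is \<open>1 - \<delta> / T\<close> times
  \<open>t - t'\<close>; replacing this factor by 1 costs \<open>\<delta> / T\<close> times the
  slope, which is the term \<open>\<kappa>1 / T\<close>.\<close>

lemma u_window_increment:
  assumes t: "t \<in> {0..T}" "t' \<in> {0..T}" "t' \<le> t"
    and osc1: "norm (u ((1 - \<delta> / T) * t + \<delta>) - u ((1 - \<delta> / T) * t)) \<le> \<kappa>1" "\<kappa>1 \<ge> 0"
    and osc2: "\<And>r r'. r \<in> {0..T} \<Longrightarrow> r' \<in> {0..T} \<Longrightarrow> \<bar>r - r'\<bar> \<le> t - t' \<Longrightarrow> norm (u r - u r') \<le> \<kappa>2" "\<kappa>2 \<ge> 0"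
  shows "norm (u_window \<delta> t - u_window \<delta> t' - (t - t') *\<^sub>R u_slope \<delta> t) \<le> (t - t') * (\<kappa>1 / T + 2 * \<kappa>2 / \<delta>)"
proof (rule norm_le_by_inner)
  show "0 \<le> (t - t') * (\<kappa>1 / T + 2 * \<kappa>2 / \<delta>)" using t osc1 osc2 T \<delta> by auto
  fix h
  define \<theta> where "\<theta> = 1 - \<delta> / T"
  have \<theta>: "0 \<le> \<theta>" "\<theta> \<le> 1" using \<delta> T by (auto simp: \<theta>_def)
  note r = window_range[OF \<delta> t(1), folded \<theta>_def] and r' = window_range[OF \<delta> t(2), folded \<theta>_def]
  have le: "\<theta> * t' \<le> \<theta> * t" "\<theta> * (t - t') \<le> t - t'" using \<theta> t(3) by (auto intro: mult_left_mono mult_left_le_one_le)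
  define F where "F a b = (\<integral>r. inner h (u r) \<partial>lebesgue_on {a<..<b})" for a b
  have "inner h (u_window \<delta> t) - inner h (u_window \<delta> t') = (1 / \<delta>) * (F (\<theta> * t) (\<theta> * t + \<delta>) - F (\<theta> * t') (\<theta> * t' + \<delta>))"
    unfolding u_window_inner[OF t(1)] u_window_inner[OF t(2)] win_def F_def \<theta>_def by (simp add: diff_divide_distrib)
  \<comment> \<open>All integrals are written from 0 on, so the identity holds whether or not the
    two windows overlap.\<close>
  also have "F (\<theta> * t) (\<theta> * t + \<delta>) - F (\<theta> * t') (\<theta> * t' + \<delta>) = F (\<theta> * t' + \<delta>) (\<theta> * t + \<delta>) - F (\<theta> * t') (\<theta> * t)"
  proof -
    have c: "F 0 b = F 0 a + F a b" if "0 \<le> a" "a \<le> b" "b \<le> T" for a b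
      unfolding F_def by (rule integral_open_combine[OF inner_u_int]) (use that in auto)
    show ?thesis
      using c[of "\<theta> * t" "\<theta> * t + \<delta>"] c[of "\<theta> * t'" "\<theta> * t' + \<delta>"] c[of "\<theta> * t' + \<delta>" "\<theta> * t + \<delta>"] c[of "\<theta> * t'" "\<theta> * t"] r r' le \<delta> by auto
  qed
  finally have 1: "inner h (u_window \<delta> t) - inner h (u_window \<delta> t') = (1 / \<delta>) * (F (\<theta> * t' + \<delta>) (\<theta> * t + \<delta>) - F (\<theta> * t') (\<theta> * t))" .
  have len: "\<theta> * t + \<delta> - (\<theta> * t' + \<delta>) = \<theta> * (t - t')" "\<theta> * t - \<theta> * t' = \<theta> * (t - t')" by (simp_all add: right_diff_distrib)
  have 2: "\<bar>F (\<theta> * t' + \<delta>) (\<theta> * t + \<delta>) - (\<theta> * t + \<delta> - (\<theta> * t' + \<delta>)) * inner h (u (\<theta> * t + \<delta>))\<bar> \<le> (\<theta> * t + \<delta> - (\<theta> * t' + \<delta>)) * (norm h * \<kappa>2)"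
    unfolding F_def by (rule integral_near_value) (use r r' le len \<delta> in \<open>auto intro!: osc2(1)\<close>)
  have 3: "\<bar>F (\<theta> * t') (\<theta> * t) - (\<theta> * t - \<theta> * t') * inner h (u (\<theta> * t))\<bar> \<le> (\<theta> * t - \<theta> * t') * (norm h * \<kappa>2)"
    unfolding F_def by (rule integral_near_value) (use r r' le len \<delta> in \<open>auto intro!: osc2(1)\<close>)
  define k where "k = t - t'"
  have k0: "0 \<le> k" using t(3) by (simp add: k_def)
  define D where "D = inner h (u (\<theta> * t + \<delta>)) - inner h (u (\<theta> * t))"
  have "\<theta> * k * (norm h * \<kappa>2) \<le> k * (norm h * \<kappa>2)" using \<theta> k0 osc2(2) by (intro mult_right_mono) (auto intro: mult_left_le_one_le)
  then have 4: "F (\<theta> * t' + \<delta>) (\<theta> * t + \<delta>) - F (\<theta> * t') (\<theta> * t) \<le> \<theta> * k * D + 2 * (k * (norm h * \<kappa>2))"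
    using 2 3 unfolding len D_def k_def[symmetric] by (simp add: right_diff_distrib abs_le_iff)
  have 5: "inner h (u_slope \<delta> t) = D / \<delta>" unfolding u_slope_def D_def \<theta>_def[symmetric] by (simp add: inner_diff_right)
  have "inner h (u_window \<delta> t - u_window \<delta> t' - k *\<^sub>R u_slope \<delta> t) = (1 / \<delta>) * (F (\<theta> * t' + \<delta>) (\<theta> * t + \<delta>) - F (\<theta> * t') (\<theta> * t)) - k * (D / \<delta>)"
    using 1 5 by (simp add: inner_diff_right)
  also have "\<dots> \<le> (1 / \<delta>) * (\<theta> * k * D + 2 * (k * (norm h * \<kappa>2))) - k * (D / \<delta>)"
    using 4 \<delta> by (intro diff_right_mono mult_left_mono) auto
  also have "\<dots> = - (k / T) * D + k * (norm h * (2 * \<kappa>2 / \<delta>))"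
    using \<delta> T by (simp add: \<theta>_def field_simps)
  also have "- (k / T) * D \<le> (k / T) * (norm h * \<kappa>1)"
  proof -
    have "\<bar>D\<bar> \<le> norm h * norm (u (\<theta> * t + \<delta>) - u (\<theta> * t))"
      unfolding D_def inner_diff_right[symmetric] by (rule Cauchy_Schwarz_ineq2)
    also have "\<dots> \<le> norm h * \<kappa>1" using osc1(1) unfolding \<theta>_def by (intro mult_left_mono) auto
    finally have "- D \<le> norm h * \<kappa>1" by linarith
    then have "(k / T) * (- D) \<le> (k / T) * (norm h * \<kappa>1)" using k0 T by (intro mult_left_mono) auto
    then show ?thesis by simp
  qed
  finally show "inner h (u_window \<delta> t - u_window \<delta> t' - (t - t') *\<^sub>R u_slope \<delta> t) \<le> norm h * ((t - t') * (\<kappa>1 / T + 2 * \<kappa>2 / \<delta>))"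
    unfolding k_def[symmetric] by (simp add: algebra_simps)
qed

text \<open>The mismatch between a window mean and an equal share of the slope, as a functional on
  \<open>Vl l\<close>. The shares need not match individually; only the sum vanishes, and only on a
  common argument in \<open>V\<close>.\<close>

definition "residual l t = gl_window \<delta> l t - (1 / real s) *\<^sub>R gelfand_emb (Vl l) (u_slope \<delta> t)"

lemma residual_dual: "t \<in> {0..T} \<Longrightarrow> l \<in> L \<Longrightarrow> residual l t \<in> Dl l"
  unfolding residual_def by (intro carrier_diff[OF Dl] carrier_scale[OF Dl] gl_window gelfand_emb_dual[OF Vl(1) CH(2)])

lemma residual_eval: "x \<in> Vl l \<Longrightarrow> residual l t x = gl_window \<delta> l t x - inner (u_slope \<delta> t) x / real s"
  by (simp add: residual_def scaleR_fun_def gelfand_emb_def)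

lemma residual_cancel: "t \<in> {0..T} \<Longrightarrow> x \<in> V \<Longrightarrow> (\<Sum>l=1..s. residual l t x) = 0"
proof -
  assume t: "t \<in> {0..T}" and x: "x \<in> V"
  have "(\<Sum>l=1..s. residual l t x) = (\<Sum>l=1..s. gl_window \<delta> l t x - inner (u_slope \<delta> t) x / real s)"
    using V_subset x by (intro sum.cong refl residual_eval) auto
  also have "\<dots> = 0" using gl_window_sum[OF t x] s by (simp add: sum_subtractf)
  finally show ?thesis .
qed

text \<open>Serves to make the Ehrling constant independent of time. For a fixed window length the
  functionals depend continuously on \<open>t\<close>, although \<open>gl l\<close> itself is merely
  integrable.\<close>

lemma residual_uniformly_continuous:
  assumes e: "e > 0"
  shows "\<exists>d>0. \<forall>t\<in>{0..T}. \<forall>t'\<in>{0..T}. \<bar>t - t'\<bar> < d \<longrightarrow> (\<forall>l\<in>L. dl l (residual l t - residual l t') \<le> e)"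
proof -
  define \<theta> where "\<theta> = 1 - \<delta> / T"
  have \<theta>: "0 \<le> \<theta>" "\<theta> \<le> 1" using \<delta> T by (auto simp: \<theta>_def)
  \<comment> \<open>The indefinite integral of the dual norm is continuous on \<open>[0,T]\<close>
    and hence uniformly so; a window mean changes only through such integrals near the two ends of
    the window.\<close>
  define \<Gamma> where "\<Gamma> l \<tau> = (\<integral>r. dl l (gl l r) \<partial>lebesgue_on {0<..<\<tau>})" for l \<tau>
  have \<Gamma>c: "continuous_on {0..T} (\<Gamma> l)" if l: "l \<in> L" for l
  proof -
    have *: "continuous_on {0..T} (\<lambda>\<tau>. integral {0..\<tau>} (\<lambda>r. dl l (gl l r)))"
      by (rule indefinite_integral_continuous_1[OF lebesgue_open_interval(1)[OF gl_int[OF l]]])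
    have "\<Gamma> l \<tau> = integral {0..\<tau>} (\<lambda>r. dl l (gl l r))" if "\<tau> \<in> {0..T}" for \<tau>
      unfolding \<Gamma>_def by (rule lebesgue_open_interval(2), rule subinterval(1)[OF _ _ gl_int[OF l]]) (use that in auto)
    then show ?thesis by (intro continuous_on_eq[OF *]) simp
  qed
  have "\<exists>d>0. \<forall>t\<in>{0..T}. \<forall>t'\<in>{0..T}. \<bar>t - t'\<bar> < d \<longrightarrow> dist (\<Gamma> l t) (\<Gamma> l t') \<le> e * \<delta> / 4" if "l \<in> L" for l
    by (rule continuous_oscillation[OF \<Gamma>c[OF that], of "e * \<delta> / 4"]) (use e \<delta> in auto)
  from bchoice[OF ballI[OF this]] obtain d1 where d1: "\<forall>l\<in>L. d1 l > 0 \<and> (\<forall>t\<in>{0..T}. \<forall>t'\<in>{0..T}. \<bar>t - t'\<bar> < d1 l \<longrightarrow> dist (\<Gamma> l t) (\<Gamma> l t') \<le> e * \<delta> / 4)" ..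
  obtain d2 where d2: "d2 > 0" "\<forall>t\<in>{0..T}. \<forall>t'\<in>{0..T}. \<bar>t - t'\<bar> < d2 \<longrightarrow> dist (u t) (u t') \<le> e * \<delta> / (4 * CH)"
    by (rule continuous_oscillation[OF u_cont, of "e * \<delta> / (4 * CH)"]) (use e \<delta> CH(1) in auto)
  define d where "d = Min (insert d2 (d1 ` L))"
  have d: "d > 0" "d \<le> d2" "\<And>l. l \<in> L \<Longrightarrow> d \<le> d1 l"
    unfolding d_def using d1 d2(1) by (subst Min_gr_iff, auto)[] (intro Min_le; simp)+
  have "dl l (residual l t - residual l t') \<le> e" if t: "t \<in> {0..T}" "t' \<in> {0..T}" "\<bar>t - t'\<bar> < d" and l: "l \<in> L" for t t' l
  proof (rule dual_norm_leI[OF Vl(1)[OF l]])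
    note r = window_range[OF \<delta> t(1), folded \<theta>_def] and r' = window_range[OF \<delta> t(2), folded \<theta>_def]
    have close: "\<bar>\<theta> * t - \<theta> * t'\<bar> < d"
    proof -
      have "\<bar>\<theta> * t - \<theta> * t'\<bar> = \<theta> * \<bar>t - t'\<bar>" using \<theta> by (simp add: abs_mult flip: right_diff_distrib)
      also have "\<dots> \<le> \<bar>t - t'\<bar>" using \<theta> by (intro mult_left_le_one_le) auto
      finally show ?thesis using t(3) by linarith
    qed
    fix x assume x: "x \<in> Vl l"
    have nx: "0 \<le> nl l x" by (rule carrier_norm_nonneg[OF Vl(1)[OF l] x])
    define F where "F a b = (\<integral>r. gl l r x \<partial>lebesgue_on {a<..<b})" for a b
    have comb: "F 0 b = F 0 a + F a b" if "0 \<le> a" "a \<le> b" "b \<le> T" for a b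
      unfolding F_def by (rule integral_open_combine[OF subinterval(1)[OF _ _ gl_eval_int[OF l x]]]) (use that in auto)
    have Fle1: "\<bar>F 0 b - F 0 a\<bar> \<le> \<bar>\<Gamma> l b - \<Gamma> l a\<bar> * nl l x" if ab: "0 \<le> a" "a \<le> b" "b \<le> T" for a b
    proof -
      have "\<bar>F a b\<bar> \<le> (\<integral>r. \<bar>gl l r x\<bar> \<partial>lebesgue_on {a<..<b})" unfolding F_def by (rule integral_abs_bound)
      also have "\<dots> \<le> (\<integral>r. dl l (gl l r) * nl l x \<partial>lebesgue_on {a<..<b})"
      proof (rule integral_mono_AE)
        show "AE r in lebesgue_on {a<..<b}. \<bar>gl l r x\<bar> \<le> dl l (gl l r) * nl l x"
          using subinterval(3)[OF ab(1,3) gl_AE[OF l]] by eventually_elim (rule dual_bound[OF Vl(1)[OF l] _ x])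
      qed (use subinterval(1)[OF ab(1,3) gl_eval_int[OF l x]] subinterval(1)[OF ab(1,3) gl_int[OF l]] in auto)
      also have "\<dots> = (\<integral>r. dl l (gl l r) \<partial>lebesgue_on {a<..<b}) * nl l x" by simp
      also have "(\<integral>r. dl l (gl l r) \<partial>lebesgue_on {a<..<b}) = \<Gamma> l b - \<Gamma> l a"
        unfolding \<Gamma>_def using integral_open_combine[OF subinterval(1)[OF order_refl ab(3) gl_int[OF l]] ab(1,2)] by simp
      also have "\<dots> * nl l x \<le> \<bar>\<Gamma> l b - \<Gamma> l a\<bar> * nl l x" using nx by (intro mult_right_mono) auto
      finally show ?thesis using comb[OF ab] by simp
    qed
    have Fle: "\<bar>F 0 b - F 0 a\<bar> \<le> e * \<delta> / 4 * nl l x" if ab: "a \<in> {0..T}" "b \<in> {0..T}" "\<bar>a - b\<bar> < d" for a b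
    proof -
      have "\<bar>F 0 b - F 0 a\<bar> \<le> \<bar>\<Gamma> l b - \<Gamma> l a\<bar> * nl l x"
        using Fle1[of a b] Fle1[of b a] ab(1,2) by (cases "a \<le> b") (auto simp: abs_minus_commute)
      also have "\<dots> \<le> e * \<delta> / 4 * nl l x"
      proof (rule mult_right_mono[OF _ nx])
        have "\<bar>b - a\<bar> < d1 l" using ab(3) d(3)[OF l] by linarith
        then show "\<bar>\<Gamma> l b - \<Gamma> l a\<bar> \<le> e * \<delta> / 4" using d1 l ab(1,2) unfolding dist_real_def by blast
      qed
      finally show ?thesis .
    qed
    have "gl_window \<delta> l t x - gl_window \<delta> l t' x = (1 / \<delta>) * ((F 0 (\<theta> * t + \<delta>) - F 0 (\<theta> * t' + \<delta>)) - (F 0 (\<theta> * t) - F 0 (\<theta> * t')))"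
      using comb[of "\<theta> * t" "\<theta> * t + \<delta>"] comb[of "\<theta> * t'" "\<theta> * t' + \<delta>"] r r' \<delta> x
      by (simp add: gl_window_def win_def F_def \<theta>_def diff_divide_distrib)
    also have "\<bar>\<dots>\<bar> \<le> (1 / \<delta>) * (e * \<delta> / 4 * nl l x + e * \<delta> / 4 * nl l x)"
    proof -
      have "\<bar>F 0 (\<theta> * t + \<delta>) - F 0 (\<theta> * t' + \<delta>)\<bar> \<le> e * \<delta> / 4 * nl l x" by (rule Fle) (use r r' \<delta> close in auto)
      moreover have "\<bar>F 0 (\<theta> * t) - F 0 (\<theta> * t')\<bar> \<le> e * \<delta> / 4 * nl l x" by (rule Fle) (use r r' \<delta> close in auto)
      ultimately have "\<bar>(F 0 (\<theta> * t + \<delta>) - F 0 (\<theta> * t' + \<delta>)) - (F 0 (\<theta> * t) - F 0 (\<theta> * t'))\<bar> \<le> e * \<delta> / 4 * nl l x + e * \<delta> / 4 * nl l x" by linarith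
      then have "(1 / \<delta>) * \<bar>(F 0 (\<theta> * t + \<delta>) - F 0 (\<theta> * t' + \<delta>)) - (F 0 (\<theta> * t) - F 0 (\<theta> * t'))\<bar> \<le> (1 / \<delta>) * (e * \<delta> / 4 * nl l x + e * \<delta> / 4 * nl l x)"
        using \<delta> by (intro mult_left_mono) auto
      then show ?thesis using \<delta> by (simp only: abs_mult) simp
    qed
    also have "\<dots> = e / 2 * nl l x" using \<delta> by simp
    finally have g: "\<bar>gl_window \<delta> l t x - gl_window \<delta> l t' x\<bar> \<le> e / 2 * nl l x" .
    have "\<bar>inner (u_slope \<delta> t - u_slope \<delta> t') x\<bar> \<le> norm (u_slope \<delta> t - u_slope \<delta> t') * norm x" by (rule Cauchy_Schwarz_ineq2)
    also have "norm (u_slope \<delta> t - u_slope \<delta> t') \<le> e / (2 * CH)"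
    proof -
      have u1: "norm (u (\<theta> * t + \<delta>) - u (\<theta> * t' + \<delta>)) \<le> e * \<delta> / (4 * CH)"
        unfolding dist_norm[symmetric] by (rule d2(2)[rule_format]) (use r r' \<delta> close d(2) in auto)
      have u2: "norm (u (\<theta> * t) - u (\<theta> * t')) \<le> e * \<delta> / (4 * CH)"
        unfolding dist_norm[symmetric] by (rule d2(2)[rule_format]) (use r r' \<delta> close d(2) in auto)
      have "u_slope \<delta> t - u_slope \<delta> t' = (1 / \<delta>) *\<^sub>R ((u (\<theta> * t + \<delta>) - u (\<theta> * t' + \<delta>)) - (u (\<theta> * t) - u (\<theta> * t')))"
        unfolding u_slope_def \<theta>_def by (simp add: algebra_simps)
      then have "norm (u_slope \<delta> t - u_slope \<delta> t') = (1 / \<delta>) * norm ((u (\<theta> * t + \<delta>) - u (\<theta> * t' + \<delta>)) - (u (\<theta> * t) - u (\<theta> * t')))"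
        using \<delta> by simp
      also have "\<dots> \<le> (1 / \<delta>) * (e * \<delta> / (4 * CH) + e * \<delta> / (4 * CH))"
        using u1 u2 \<delta> norm_triangle_ineq4[of "u (\<theta> * t + \<delta>) - u (\<theta> * t' + \<delta>)" "u (\<theta> * t) - u (\<theta> * t')"]
        by (intro mult_left_mono, linarith) simp
      also have "\<dots> = e / (2 * CH)" using \<delta> CH(1) by (simp add: field_simps)
      finally show ?thesis .
    qed
    then have "norm (u_slope \<delta> t - u_slope \<delta> t') * norm x \<le> e / (2 * CH) * (CH * nl l x)"
      using CH(2)[OF l x] e CH(1) by (intro mult_mono) auto
    also have "\<dots> = e / 2 * nl l x" using CH(1) by simp
    finally have w: "\<bar>inner (u_slope \<delta> t - u_slope \<delta> t') x\<bar> \<le> e / 2 * nl l x" .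
    have ws: "\<bar>inner (u_slope \<delta> t - u_slope \<delta> t') x / real s\<bar> \<le> \<bar>inner (u_slope \<delta> t - u_slope \<delta> t') x\<bar>"
      using s by (simp add: abs_divide divide_le_eq mult_le_cancel_left1)
    have "(residual l t - residual l t') x = (gl_window \<delta> l t x - gl_window \<delta> l t' x) - inner (u_slope \<delta> t - u_slope \<delta> t') x / real s"
      using residual_eval[OF x] by (simp add: inner_diff_left diff_divide_distrib)
    moreover have "e / 2 * nl l x + e / 2 * nl l x = e * nl l x" by simp
    ultimately show "\<bar>(residual l t - residual l t') x\<bar> \<le> e * nl l x" using g w ws by linarith
  qed (use e in simp)
  then show ?thesis using d(1) by blast
qed

text \<open>The inequality of Ehrling type is applied with tolerance \<open>e / 2\<close> at
  finitely many times, and uniform continuity spends the other half on the times between them. The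
  sum of the finitely many constants serves all times.\<close>

lemma residual_small:
  assumes e: "e > 0"
  shows "\<exists>K\<ge>0. \<forall>t\<in>{0..T}. \<forall>x. (\<forall>l\<in>L. x l \<in> Vl l) \<longrightarrow>
    \<bar>\<Sum>l=1..s. residual l t (x l)\<bar> \<le> e * (\<Sum>l=1..s. nl l (x l)) + K * (\<Sum>l=1..s. norm (x l - x 1))"
proof -
  obtain d where d: "d > 0" "\<forall>t\<in>{0..T}. \<forall>t'\<in>{0..T}. \<bar>t - t'\<bar> < d \<longrightarrow> (\<forall>l\<in>L. dl l (residual l t - residual l t') \<le> e / 2)"
    using residual_uniformly_continuous[of "e / 2"] e by auto
  \<comment> \<open>An auxiliary grid finer than \<open>d\<close>, unrelated to the grid of the
    scheme.\<close>
  define m where "m = nat \<lceil>T / d\<rceil> + 1"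
  have m: "m \<ge> 1" "T / real m < d"
  proof -
    show "m \<ge> 1" by (simp add: m_def)
    have "T / d < real m" unfolding m_def by linarith
    then show "T / real m < d" using d(1) T by (simp add: divide_simps mult.commute split: if_splits)
  qed
  define P where "P t K \<longleftrightarrow> (\<forall>x. (\<forall>l\<in>L. x l \<in> Vl l) \<longrightarrow>
    \<bar>\<Sum>l=1..s. residual l t (x l)\<bar> \<le> (e / 2) * (\<Sum>l=1..s. nl l (x l)) + K * (\<Sum>l=1..s. norm (x l - x 1)))" for t K
  have "\<exists>K\<ge>0. P t K" if t: "t \<in> {0..T}" for t
    unfolding P_def
    by (rule ehrling_inequality[where I=L and X=Vl and n=nl and C="\<lambda>_. CH"])
      (use s e CH(2) residual_dual[OF t] residual_cancel[OF t] V_Inter Vl in auto)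
  then have "\<forall>i\<in>{..m}. \<exists>K. K \<ge> 0 \<and> P (real i * (T / real m)) K" using node[OF m(1)] by auto
  from bchoice[OF this] obtain K where K: "\<forall>i\<in>{..m}. K i \<ge> 0 \<and> P (real i * (T / real m)) (K i)" ..
  define KK where "KK = (\<Sum>i\<le>m. K i)"
  have KK: "K i \<le> KK" if "i \<le> m" for i unfolding KK_def using K that by (intro member_le_sum) auto
  have KK0: "KK \<ge> 0" unfolding KK_def using K by (intro sum_nonneg) auto
  have "\<bar>\<Sum>l=1..s. residual l t (x l)\<bar> \<le> e * (\<Sum>l=1..s. nl l (x l)) + KK * (\<Sum>l=1..s. norm (x l - x 1))"
    if t: "t \<in> {0..T}" and x: "\<forall>l\<in>L. x l \<in> Vl l" for t x
  proof -
    have "\<exists>i\<le>m. \<bar>t - real i * (T / real m)\<bar> < d"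
    proof (cases "t = 0")
      case True then show ?thesis using d(1) by (intro exI[of _ 0]) auto
    next
      case False
      then have t0: "0 < t" "t \<le> T" using t by auto
      note si = step_index_range[OF T m(1) t0]
      have "\<bar>t - i * k\<bar> < d" if "(i - 1) * k < t" "t \<le> i * k" "k < d" for i k :: real
        using that by (simp add: left_diff_distrib)
      from this[OF si(2,3) m(2)] show ?thesis using si(1) by (intro exI[of _ "step_index T m t"]) auto
    qed
    then obtain i where i: "i \<le> m" "\<bar>t - real i * (T / real m)\<bar> < d" by blast
    let ?t = "real i * (T / real m)"
    have t': "?t \<in> {0..T}" by (rule node[OF m(1) i(1)])
    have "\<bar>\<Sum>l=1..s. residual l ?t (x l)\<bar> \<le> (e / 2) * (\<Sum>l=1..s. nl l (x l)) + K i * (\<Sum>l=1..s. norm (x l - x 1))"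
      using K i(1) x unfolding P_def by blast
    also have "\<dots> \<le> (e / 2) * (\<Sum>l=1..s. nl l (x l)) + KK * (\<Sum>l=1..s. norm (x l - x 1))"
      using KK[OF i(1)] by (intro add_left_mono mult_right_mono) (auto intro: sum_nonneg)
    finally have 1: "\<bar>\<Sum>l=1..s. residual l ?t (x l)\<bar> \<le> (e / 2) * (\<Sum>l=1..s. nl l (x l)) + KK * (\<Sum>l=1..s. norm (x l - x 1))" .
    have "\<bar>(\<Sum>l=1..s. residual l t (x l)) - (\<Sum>l=1..s. residual l ?t (x l))\<bar> \<le> (\<Sum>l=1..s. \<bar>residual l t (x l) - residual l ?t (x l)\<bar>)"
      by (simp flip: sum_subtractf)
    also have "\<dots> \<le> (\<Sum>l=1..s. e / 2 * nl l (x l))"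
    proof (rule sum_mono)
      fix l assume l: "l \<in> L"
      have xl: "x l \<in> Vl l" using x l by blast
      have "\<bar>(residual l t - residual l ?t) (x l)\<bar> \<le> dl l (residual l t - residual l ?t) * nl l (x l)"
        by (rule dual_bound[OF Vl(1)[OF l] carrier_diff[OF Dl[OF l] residual_dual[OF t l] residual_dual[OF t' l]] xl])
      also have "\<dots> \<le> e / 2 * nl l (x l)"
        using d(2) t t' i(2) l by (intro mult_right_mono carrier_norm_nonneg[OF Vl(1)[OF l] xl]) blast
      finally show "\<bar>residual l t (x l) - residual l ?t (x l)\<bar> \<le> e / 2 * nl l (x l)" by simp
    qed
    also have "\<dots> = (e / 2) * (\<Sum>l=1..s. nl l (x l))" by (simp add: sum_distrib_left)
    finally have 2: "\<bar>(\<Sum>l=1..s. residual l t (x l)) - (\<Sum>l=1..s. residual l ?t (x l))\<bar> \<le> (e / 2) * (\<Sum>l=1..s. nl l (x l))" .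
    have "(e / 2) * (\<Sum>l=1..s. nl l (x l)) + (e / 2) * (\<Sum>l=1..s. nl l (x l)) = e * (\<Sum>l=1..s. nl l (x l))" by simp
    then show ?thesis using 1 2 by linarith
  qed
  then show ?thesis using KK0 by blast
qed

end

text \<open>The conclusion of \<open>window_average_approximation\<close> for one window length and
  one grid, named so that the versions for \<open>u\<close> and for every \<open>gl l\<close> can be
  combined.\<close>

abbreviation window_approximates ::
    "'a::real_vector set \<Rightarrow> ('a \<Rightarrow> real) \<Rightarrow> (real \<Rightarrow> 'a) \<Rightarrow> real \<Rightarrow> real \<Rightarrow> real \<Rightarrow> nat \<Rightarrow> bool" where
  "window_approximates X n g r e \<delta> N \<equiv> \<forall>h. (\<forall>m\<in>{1..N}. h m \<in> X \<and> (\<forall>x\<in>X. n (h m - x) \<le> (1 / \<delta>) * (\<integral>t. n (g t - x)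
        \<partial>lebesgue_on {(1 - \<delta> / T) * (real m * (T / real N))<..<(1 - \<delta> / T) * (real m * (T / real N)) + \<delta>}))) \<longrightarrow>
     integrable M (\<lambda>t. n (g t - h (step_index T N t)) powr r) \<and> (\<integral>t. n (g t - h (step_index T N t)) powr r \<partial>M) \<le> e"

text \<open>Collects all that the convergence proof needs to know about the means. The order of the
  quantifiers matters: \<open>v\<close>, \<open>w\<close>, \<open>G\<close> and \<open>K\<close>
  depend on \<open>e\<close> only, and the grid comes afterwards.\<close>

lemma regularisation:
  assumes e: "e > 0"
  shows "\<exists>v w G K N0. (\<forall>t\<in>{0..T}. v t \<in> V \<and> norm (v t - u t) \<le> e) \<and>
    (\<forall>t\<in>{0..T}. \<forall>l\<in>L. G l t \<in> Dl l) \<and> (\<forall>t\<in>{0..T}. \<forall>x\<in>V. (\<Sum>l=1..s. G l t x) = inner (w t) x) \<and>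
    (\<forall>t\<in>{0..T}. \<forall>x. (\<forall>l\<in>L. x l \<in> Vl l) \<longrightarrow> \<bar>\<Sum>l=1..s. (G l t (x l) - inner (w t) (x l) / real s)\<bar>
        \<le> e * (\<Sum>l=1..s. nl l (x l)) + K * (\<Sum>l=1..s. norm (x l - x 1))) \<and> K \<ge> 0 \<and>
    N0 \<ge> 1 \<and> (\<forall>N\<ge>N0. (\<forall>n\<in>{1..N}. norm (v (real n * (T / real N)) - v (real (n - 1) * (T / real N)) - (T / real N) *\<^sub>R w (real n * (T / real N))) \<le> (T / real N) * e) \<and>
      integrable M (\<lambda>t. nV (u t - v (idx N t)) powr p) \<and>
      (\<integral>t. nV (u t - v (idx N t)) powr p \<partial>M) \<le> e \<and>
      (\<forall>l\<in>L. integrable M (\<lambda>t. dl l (gl l t - G l (idx N t)) powr q) \<and>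
        (\<integral>t. dl l (gl l t - G l (idx N t)) powr q \<partial>M) \<le> e))"
proof -
  define \<kappa>1 where "\<kappa>1 = min e (e * T / 2)"
  have \<kappa>1: "\<kappa>1 > 0" "\<kappa>1 \<le> e" "\<kappa>1 / T \<le> e / 2"
  proof -
    have "\<kappa>1 \<le> e * T / 2" by (simp add: \<kappa>1_def)
    then show "\<kappa>1 / T \<le> e / 2" using T by (simp add: pos_divide_le_eq)
  qed (use e T in \<open>auto simp: \<kappa>1_def\<close>)
  obtain d1 where d1: "d1 > 0" "\<forall>t\<in>{0..T}. \<forall>t'\<in>{0..T}. \<bar>t - t'\<bar> < d1 \<longrightarrow> dist (u t) (u t') \<le> \<kappa>1"
    by (rule continuous_oscillation[OF u_cont \<kappa>1(1)])
  have avg: "\<exists>\<delta>0>0. \<forall>\<delta>. 0 < \<delta> \<longrightarrow> \<delta> < \<delta>0 \<longrightarrow> (\<exists>N0\<ge>1. \<forall>N\<ge>N0. window_approximates X n g r e \<delta> N)"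
    if "normed_on X n" "g \<in> Lp_space T r X n" "r > 1" for X n g r
    by (rule window_average_approximation[OF T that e]) blast
  from avg[OF V(1) u_Lp p] obtain \<delta>V where \<delta>V: "\<delta>V > 0" "\<forall>\<delta>. 0 < \<delta> \<longrightarrow> \<delta> < \<delta>V \<longrightarrow> (\<exists>N0\<ge>1. \<forall>N\<ge>N0. window_approximates V nV u p e \<delta> N)" by blast
  have "\<forall>l\<in>L. \<exists>\<delta>0. \<delta>0 > 0 \<and> (\<forall>\<delta>. 0 < \<delta> \<longrightarrow> \<delta> < \<delta>0 \<longrightarrow> (\<exists>N0\<ge>1. \<forall>N\<ge>N0. window_approximates (Dl l) (dl l) (gl l) q e \<delta> N))"
    using avg[OF Dl gl_Lp q(1)] by blast
  from bchoice[OF this] obtain \<delta>L where \<delta>L: "\<forall>l\<in>L. \<delta>L l > 0 \<and> (\<forall>\<delta>. 0 < \<delta> \<longrightarrow> \<delta> < \<delta>L l \<longrightarrow> (\<exists>N0\<ge>1. \<forall>N\<ge>N0. window_approximates (Dl l) (dl l) (gl l) q e \<delta> N))" ..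
  \<comment> \<open>One window length has to serve \<open>u\<close> in \<open>V\<close>, each
    \<open>gl l\<close> in its dual, and the oscillation of \<open>u\<close> in \<open>H\<close>.
    Taking half of the minimum makes all the inequalities strict.\<close>
  define \<delta>m where "\<delta>m = Min (insert d1 (insert T (insert \<delta>V (\<delta>L ` L))))"
  define \<delta> where "\<delta> = \<delta>m / 2"
  have \<delta>L0: "\<And>l. l \<in> L \<Longrightarrow> \<delta>L l > 0" using \<delta>L by blast
  have \<delta>m: "\<delta>m > 0" unfolding \<delta>m_def using d1(1) T \<delta>V(1) \<delta>L0 by (subst Min_gr_iff) auto
  have \<delta>m_le: "\<delta>m \<le> d1" "\<delta>m \<le> T" "\<delta>m \<le> \<delta>V" "\<And>l. l \<in> L \<Longrightarrow> \<delta>m \<le> \<delta>L l"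
    unfolding \<delta>m_def by (intro Min_le; simp)+
  have half: "\<delta> < \<delta>m" "0 < \<delta>" unfolding \<delta>_def using \<delta>m by simp_all
  have \<delta>: "0 < \<delta>" "\<delta> < T" "\<delta> < d1" "\<delta> < \<delta>V" "\<And>l. l \<in> L \<Longrightarrow> \<delta> < \<delta>L l"
    using half less_le_trans[OF half(1)] \<delta>m_le by blast+
  obtain K where K: "K \<ge> 0" "\<forall>t\<in>{0..T}. \<forall>x. (\<forall>l\<in>L. x l \<in> Vl l) \<longrightarrow>
    \<bar>\<Sum>l=1..s. residual \<delta> l t (x l)\<bar> \<le> e * (\<Sum>l=1..s. nl l (x l)) + K * (\<Sum>l=1..s. norm (x l - x 1))"
    using residual_small[OF \<delta>(1,2) e] by blast
  obtain NV where NV: "NV \<ge> 1" "\<forall>N\<ge>NV. window_approximates V nV u p e \<delta> N" using \<delta>V(2) \<delta>(1,4) by blast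
  have "\<forall>l\<in>L. \<exists>N0. \<forall>N\<ge>N0. window_approximates (Dl l) (dl l) (gl l) q e \<delta> N"
    using \<delta>L \<delta>(1,5) by blast
  from bchoice[OF this] obtain NL where NL: "\<forall>l\<in>L. \<forall>N\<ge>NL l. window_approximates (Dl l) (dl l) (gl l) q e \<delta> N" ..
  \<comment> \<open>The error of the increment is
    \<open>\<kappa>1 / T + 2 * \<kappa>2 / \<delta>\<close> per unit of time, and each summand gets
    \<open>e / 2\<close>. Since \<delta> stands in the denominator, \<kappa>2 is fixed after it, and
    the step size after \<kappa>2.\<close>
  define \<kappa>2 where "\<kappa>2 = e * \<delta> / 4"
  have \<kappa>2: "\<kappa>2 > 0" using e \<delta>(1) by (simp add: \<kappa>2_def)
  obtain d2 where d2: "d2 > 0" "\<forall>t\<in>{0..T}. \<forall>t'\<in>{0..T}. \<bar>t - t'\<bar> < d2 \<longrightarrow> dist (u t) (u t') \<le> \<kappa>2"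
    by (rule continuous_oscillation[OF u_cont \<kappa>2])
  define N0 where "N0 = Max (insert NV (insert (nat \<lceil>T / d2\<rceil> + 1) (NL ` L)))"
  have N0: "NV \<le> N0" "nat \<lceil>T / d2\<rceil> + 1 \<le> N0" "\<And>l. l \<in> L \<Longrightarrow> NL l \<le> N0"
    unfolding N0_def by (intro Max_ge; simp)+
  have near: "norm (u_window \<delta> t - u t) \<le> e" if t: "t \<in> {0..T}" for t
  proof -
    have "norm (u_window \<delta> t - u t) \<le> \<kappa>1"
    proof (rule u_window_near_u[OF \<delta>(1,2) t])
      fix r assume r: "r \<in> {0..T}" "\<bar>r - t\<bar> \<le> \<delta>"
      then have "\<bar>r - t\<bar> < d1" using \<delta>(3) by linarith
      then show "norm (u r - u t) \<le> \<kappa>1" using d1(2) r(1) t unfolding dist_norm by blast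
    qed (use \<kappa>1 in simp)
    then show ?thesis using \<kappa>1(2) by linarith
  qed
  have inc: "norm (u_window \<delta> (real n * (T / real N)) - u_window \<delta> (real (n - 1) * (T / real N)) - (T / real N) *\<^sub>R u_slope \<delta> (real n * (T / real N))) \<le> (T / real N) * e"
    if NN: "N \<ge> N0" and n: "n \<in> {1..N}" for N n
  proof -
    let ?k = "T / real N" and ?t = "real n * (T / real N)" and ?t' = "real (n - 1) * (T / real N)"
    have N1: "N \<ge> 1" using n by simp
    have k: "?k > 0" using T N1 by simp
    have "T / d2 < real N" using N0(2) NN by linarith
    then have kd: "?k < d2" using d2(1) N1 by (simp add: divide_simps mult.commute split: if_splits)
    have "n \<le> N" "n - 1 \<le> N" using n by auto
    from node[OF N1 this(1)] node[OF N1 this(2)] have t: "?t \<in> {0..T}" "?t' \<in> {0..T}" .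
    have diff: "?t - ?t' = ?k"
    proof -
      have "a * k - (a - 1) * k = k" for a k :: real by (simp add: left_diff_distrib)
      moreover have "real (n - 1) = real n - 1" using n by (simp add: of_nat_diff)
      ultimately show ?thesis by (simp only:)
    qed
    note w = window_range[OF \<delta>(1,2) t(1)]
    have "norm (u_window \<delta> ?t - u_window \<delta> ?t' - (?t - ?t') *\<^sub>R u_slope \<delta> ?t) \<le> (?t - ?t') * (\<kappa>1 / T + 2 * \<kappa>2 / \<delta>)"
    proof (rule u_window_increment[OF \<delta>(1,2) t])
      show "?t' \<le> ?t" using diff k by linarith
      show "norm (u ((1 - \<delta> / T) * ?t + \<delta>) - u ((1 - \<delta> / T) * ?t)) \<le> \<kappa>1"
        unfolding dist_norm[symmetric] by (rule d1(2)[rule_format]) (use w \<delta> in auto)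
      show "norm (u r - u r') \<le> \<kappa>2" if "r \<in> {0..T}" "r' \<in> {0..T}" "\<bar>r - r'\<bar> \<le> ?t - ?t'" for r r'
      proof -
        have "\<bar>r - r'\<bar> < d2" using that(3) kd unfolding diff by linarith
        then show ?thesis using d2(2) that(1,2) unfolding dist_norm by blast
      qed
    qed (use \<kappa>1 \<kappa>2 in auto)
    also have "(?t - ?t') * (\<kappa>1 / T + 2 * \<kappa>2 / \<delta>) \<le> ?k * e"
    proof -
      have "2 * \<kappa>2 / \<delta> = e / 2" using \<delta>(1) by (simp add: \<kappa>2_def)
      then have "\<kappa>1 / T + 2 * \<kappa>2 / \<delta> \<le> e" using \<kappa>1(3) by linarith
      then show ?thesis unfolding diff using k by (intro mult_left_mono) auto
    qed
    finally show ?thesis unfolding diff .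
  qed
  have residual: "(\<Sum>l=1..s. (gl_window \<delta> l t (x l) - inner (u_slope \<delta> t) (x l) / real s)) = (\<Sum>l=1..s. residual \<delta> l t (x l))"
    if "\<forall>l\<in>L. x l \<in> Vl l" for t x
    using that residual_eval[OF \<delta>(1,2)] by (intro sum.cong refl) auto
  have IV: "integrable M (\<lambda>t. nV (u t - u_window \<delta> (idx N t)) powr p) \<and>
      (\<integral>t. nV (u t - u_window \<delta> (idx N t)) powr p \<partial>M) \<le> e" if NN: "N \<ge> N0" for N
  proof -
    have N1: "N \<ge> 1" "N \<ge> NV" using NN N0(1) NV(1) by auto
    show ?thesis
    proof (rule NV(2)[rule_format, OF N1(2), where h="\<lambda>m. u_window \<delta> (real m * (T / real N))"])
      fix m assume "m \<in> {1..N}"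
      then have t: "real m * (T / real N) \<in> {0..T}" using node[OF N1(1)] by auto
      show "u_window \<delta> (real m * (T / real N)) \<in> V \<and> (\<forall>x\<in>V. nV (u_window \<delta> (real m * (T / real N)) - x) \<le> (1 / \<delta>) * (\<integral>t. nV (u t - x)
        \<partial>lebesgue_on {(1 - \<delta> / T) * (real m * (T / real N))<..<(1 - \<delta> / T) * (real m * (T / real N)) + \<delta>}))"
        using u_window(1,3)[OF \<delta>(1,2) t] unfolding win_def by blast
    qed
  qed
  have IL: "integrable M (\<lambda>t. dl l (gl l t - gl_window \<delta> l (idx N t)) powr q) \<and>
      (\<integral>t. dl l (gl l t - gl_window \<delta> l (idx N t)) powr q \<partial>M) \<le> e" if NN: "N \<ge> N0" and l: "l \<in> L" for N l
  proof -
    have N1: "N \<ge> 1" "N \<ge> NL l" using NN N0(1,3) NV(1) l by (auto intro: order_trans)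
    show ?thesis
    proof (rule NL[rule_format, OF l N1(2), where h="\<lambda>m. gl_window \<delta> l (real m * (T / real N))"])
      fix m assume "m \<in> {1..N}"
      then have t: "real m * (T / real N) \<in> {0..T}" using node[OF N1(1)] by auto
      show "gl_window \<delta> l (real m * (T / real N)) \<in> Dl l \<and> (\<forall>x\<in>Dl l. dl l (gl_window \<delta> l (real m * (T / real N)) - x) \<le> (1 / \<delta>) * (\<integral>t. dl l (gl l t - x)
        \<partial>lebesgue_on {(1 - \<delta> / T) * (real m * (T / real N))<..<(1 - \<delta> / T) * (real m * (T / real N)) + \<delta>}))"
        using gl_window[OF \<delta>(1,2) t l] unfolding win_def by blast
    qed
  qed
  have "N0 \<ge> 1" using N0(1) NV(1) by simp
  show ?thesis
  proof (rule exI[of _ "u_window \<delta>"], rule exI[of _ "u_slope \<delta>"], rule exI[of _ "gl_window \<delta>"], rule exI[of _ K], rule exI[of _ N0],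
      intro conjI ballI allI impI)
    show "\<bar>\<Sum>l=1..s. (gl_window \<delta> l t (x l) - inner (u_slope \<delta> t) (x l) / real s)\<bar> \<le> e * (\<Sum>l=1..s. nl l (x l)) + K * (\<Sum>l=1..s. norm (x l - x 1))"
      if "t \<in> {0..T}" "\<forall>l\<in>L. x l \<in> Vl l" for t x
      unfolding residual[OF that(2)] using K(2) that by blast
  qed (fact near u_window(1)[OF \<delta>(1,2)] gl_window(1)[OF \<delta>(1,2)] gl_window_sum[OF \<delta>(1,2)] inc K(1) \<open>N0 \<ge> 1\<close>
      IV[THEN conjunct1] IV[THEN conjunct2] IL[THEN conjunct1] IL[THEN conjunct2])+
qed

end


section \<open>Convergence\<close>

context splitting
begin

text \<open>Applied with the stage \<open>x\<close>, the solution \<open>y = u t\<close>, its mean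
  \<open>z\<close> at the grid time \<tau>, the source \<phi> and the mean functional \<gamma>.
  Monotonicity is used between \<open>x\<close> and \<open>y\<close>, not between \<open>x\<close>
  and \<open>z\<close>, because \<gamma> is built from \<open>Al l t y\<close>. Every other product
  is split by Young's inequality into a small multiple of a quantity with bounded integral and a
  large multiple of an error that vanishes with the regularisation or with the step.\<close>

lemma pointwise_estimate:
  assumes e: "e > 0"
  shows "\<exists>C>0. \<forall>l\<in>L. \<forall>t\<in>{0..T}. \<forall>\<tau>\<in>{0..T}. \<forall>x\<in>Vl l. \<forall>y\<in>Vl l. \<forall>z\<in>Vl l. \<forall>\<phi>\<in>Dl l. \<forall>\<gamma>\<in>Dl l.
    \<phi> (x - z) - Al l \<tau> x (x - z) \<le> \<gamma> (x - z) - \<eta> * sl l (x - y) powr p + e * (1 + nl l x powr p + nl l y powr p)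
      + C * (dl l (Al l \<tau> y - Al l t y) powr q + nl l (y - z) powr p + dl l (\<phi> - Al l t y - \<gamma>) powr q)"
proof -
  \<comment> \<open>The total coefficient with which the powers of the norms of \<open>x\<close> and
    \<open>y\<close> occur: from \<open>(a + b + c) powr p\<close>, from
    \<open>(a + b) powr p\<close>, and from the growth of the two operators.\<close>
  define M0 where "M0 = 2 powr p * 2 powr p + 2 powr p + 2 * Cg"
  have M0: "M0 > 0" unfolding M0_def using Cg by (intro add_pos_pos) auto
  define e' where "e' = e / M0"
  have e': "e' > 0" "e' * M0 = e" using e M0 by (auto simp: e'_def)
  obtain C1 where C1: "C1 > 0" "\<And>a b. a \<ge> 0 \<Longrightarrow> b \<ge> 0 \<Longrightarrow> a * b \<le> e' * a powr p + C1 * b powr q"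
    by (rule young_epsilon[OF p q(1,2) e'(1)], rule that)
  obtain C2 where C2: "C2 > 0" "\<And>a b. a \<ge> 0 \<Longrightarrow> b \<ge> 0 \<Longrightarrow> a * b \<le> e' * a powr q + C2 * b powr p"
    by (rule young_epsilon[OF q(1) p q(3) e'(1)], rule that)
  define C where "C = C1 + (2 * C2 + e' * 2 powr p)"
  have C: "C > 0" "C1 \<le> C" "2 * C2 + e' * 2 powr p \<le> C" unfolding C_def using C1(1) C2(1) e'(1) by (auto intro!: add_pos_pos)
  have "\<phi> (x - z) - Al l \<tau> x (x - z) \<le> \<gamma> (x - z) - \<eta> * sl l (x - y) powr p + e * (1 + nl l x powr p + nl l y powr p)
      + C * (dl l (Al l \<tau> y - Al l t y) powr q + nl l (y - z) powr p + dl l (\<phi> - Al l t y - \<gamma>) powr q)"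
    if l: "l \<in> L" and t: "t \<in> {0..T}" and \<tau>: "\<tau> \<in> {0..T}" and x: "x \<in> Vl l" and y: "y \<in> Vl l" and z: "z \<in> Vl l"
      and \<phi>: "\<phi> \<in> Dl l" and \<gamma>: "\<gamma> \<in> Dl l" for l t \<tau> x y z \<phi> \<gamma>
  proof -
    note N = Vl(1)[OF l] and D = Dl[OF l]
    define a b c where "a = nl l x" "b = nl l y" "c = nl l (y - z)"
    define d1 d2 where "d1 = dl l (\<phi> - Al l t y - \<gamma>)" "d2 = dl l (Al l \<tau> y - Al l t y)"
    define g1 g2 where "g1 = dl l (Al l t y)" "g2 = dl l (Al l \<tau> x)"
    have xy: "x - y \<in> Vl l" and yz: "y - z \<in> Vl l" and xz: "x - z \<in> Vl l" by (intro carrier_diff[OF N] x y z)+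
    have Aty: "Al l t y \<in> Dl l" and A\<tau>y: "Al l \<tau> y \<in> Dl l" and A\<tau>x: "Al l \<tau> x \<in> Dl l"
      by (intro Al_dual[OF l l] t \<tau> x y)+
    have D1: "\<phi> - Al l t y - \<gamma> \<in> Dl l" and D2: "Al l \<tau> y - Al l t y \<in> Dl l" by (intro carrier_diff[OF D] Aty A\<tau>y \<phi> \<gamma>)+
    have nonneg: "0 \<le> a" "0 \<le> b" "0 \<le> c" "0 \<le> d1" "0 \<le> d2" "0 \<le> g1" "0 \<le> g2"
      unfolding a_b_c_def d1_d2_def g1_g2_def
      by (intro carrier_norm_nonneg[OF N] carrier_norm_nonneg[OF D] x y yz D1 D2 Aty A\<tau>x)+
    have nxy: "nl l (x - y) \<le> a + b" unfolding a_b_c_def by (rule carrier_norm_diff[OF N x y])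
    have nxz: "nl l (x - z) \<le> a + b + c" using carrier_norm_triangle[OF N x y z] nxy unfolding a_b_c_def by linarith
    have "\<bar>(\<phi> - Al l t y - \<gamma>) (x - z)\<bar> \<le> d1 * nl l (x - z)" unfolding d1_d2_def by (rule dual_bound[OF N D1 xz])
    also have "\<dots> \<le> d1 * (a + b + c)" using nxz nonneg by (intro mult_left_mono) auto
    also have "\<dots> \<le> e' * (a + b + c) powr p + C1 * d1 powr q" using C1(2)[of "a + b + c" d1] nonneg by (simp add: mult.commute)
    finally have t1: "(\<phi> - Al l t y - \<gamma>) (x - z) \<le> e' * (a + b + c) powr p + C1 * d1 powr q" by linarith
    have "\<bar>(Al l \<tau> y - Al l t y) (x - y)\<bar> \<le> d2 * nl l (x - y)" unfolding d1_d2_def by (rule dual_bound[OF N D2 xy])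
    also have "\<dots> \<le> d2 * (a + b)" using nxy nonneg by (intro mult_left_mono) auto
    also have "\<dots> \<le> e' * (a + b) powr p + C1 * d2 powr q" using C1(2)[of "a + b" d2] nonneg by (simp add: mult.commute)
    finally have t2: "- (Al l \<tau> y - Al l t y) (x - y) \<le> e' * (a + b) powr p + C1 * d2 powr q" by linarith
    have "\<bar>Al l t y (y - z)\<bar> \<le> g1 * c" unfolding g1_g2_def a_b_c_def by (rule dual_bound[OF N Aty yz])
    also have "\<dots> \<le> e' * g1 powr q + C2 * c powr p" by (rule C2(2)) (use nonneg in auto)
    finally have t3: "Al l t y (y - z) \<le> e' * g1 powr q + C2 * c powr p" by linarith
    have "\<bar>Al l \<tau> x (y - z)\<bar> \<le> g2 * c" unfolding g1_g2_def a_b_c_def by (rule dual_bound[OF N A\<tau>x yz])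
    also have "\<dots> \<le> e' * g2 powr q + C2 * c powr p" by (rule C2(2)) (use nonneg in auto)
    finally have t4: "- Al l \<tau> x (y - z) \<le> e' * g2 powr q + C2 * c powr p" by linarith
    have mono: "\<eta> * sl l (x - y) powr p \<le> Al l \<tau> x (x - y) - Al l \<tau> y (x - y)" using Al_mono[OF l l \<tau> x y] by simp
    have split: "Al l t y (x - z) = Al l t y (x - y) + Al l t y (y - z)" "Al l \<tau> x (x - z) = Al l \<tau> x (x - y) + Al l \<tau> x (y - z)"
      using dual_add[OF N Aty xy yz] dual_add[OF N A\<tau>x xy yz] by simp_all
    define P Q where "P = a powr p" "Q = b powr p"
    define R where "R = c powr p"
    have PQ: "(a + b) powr p \<le> 2 powr p * (P + Q)" unfolding P_Q_def by (rule powr_add_le) (use nonneg p in auto)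
    have "(a + b + c) powr p \<le> 2 powr p * ((a + b) powr p + R)" unfolding R_def by (rule powr_add_le) (use nonneg p in auto)
    also have "\<dots> \<le> 2 powr p * (2 powr p * (P + Q) + R)" using PQ by (intro mult_left_mono) auto
    finally have PQR: "(a + b + c) powr p \<le> 2 powr p * (2 powr p * (P + Q) + R)" .
    have g: "g1 powr q \<le> Cg * (1 + Q)" "g2 powr q \<le> Cg * (1 + P)"
      unfolding g1_g2_def P_Q_def a_b_c_def by (intro growth_powr l t \<tau> x y)+
    have "(a + b + c) powr p + (a + b) powr p + g1 powr q + g2 powr q
        \<le> 2 powr p * (2 powr p * (P + Q) + R) + 2 powr p * (P + Q) + Cg * (1 + Q) + Cg * (1 + P)"
      using PQ PQR g by linarith
    also have "\<dots> \<le> M0 * (1 + P + Q) + 2 powr p * R"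
    proof -
      have "0 \<le> P" "0 \<le> Q" unfolding P_Q_def by auto
      moreover have "m * (m * (P + Q) + R) + m * (P + Q) + Cg * (1 + Q) + Cg * (1 + P) \<le> (m * m + m + 2 * Cg) * (1 + P + Q) + m * R"
        if "m > 0" "0 \<le> P" "0 \<le> Q" for m
      proof -
        have "(m * m + m + 2 * Cg) * (1 + P + Q) + m * R - (m * (m * (P + Q) + R) + m * (P + Q) + Cg * (1 + Q) + Cg * (1 + P))
          = m * m + m + Cg * (P + Q)" by (simp add: algebra_simps)
        moreover have "0 \<le> m * m + m + Cg * (P + Q)" using that Cg by (intro add_nonneg_nonneg mult_nonneg_nonneg) auto
        ultimately show ?thesis by linarith
      qed
      ultimately show ?thesis unfolding M0_def by simp
    qed
    finally have "e' * ((a + b + c) powr p + (a + b) powr p + g1 powr q + g2 powr q) \<le> e' * (M0 * (1 + P + Q) + 2 powr p * R)"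
      using e'(1) by (intro mult_left_mono) auto
    then have small: "e' * (a + b + c) powr p + e' * (a + b) powr p + e' * g1 powr q + e' * g2 powr q \<le> e * (1 + P + Q) + e' * 2 powr p * R"
      using e'(2) by (simp only: distrib_left mult.assoc[symmetric])
    have R0: "0 \<le> R" unfolding R_def by simp
    have "(2 * C2 + e' * 2 powr p) * R \<le> C * R" "C1 * d1 powr q \<le> C * d1 powr q" "C1 * d2 powr q \<le> C * d2 powr q"
      using C R0 by (intro mult_right_mono; simp)+
    then have cs: "C1 * d1 powr q + C1 * d2 powr q + 2 * (C2 * R) + e' * 2 powr p * R \<le> C * (d2 powr q + R + d1 powr q)"
      by (simp add: distrib_left distrib_right)
    have "\<phi> (x - z) - Al l \<tau> x (x - z) = \<gamma> (x - z) + (\<phi> - Al l t y - \<gamma>) (x - z) + (- (Al l \<tau> y - Al l t y) (x - y))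
      - (Al l \<tau> x (x - y) - Al l \<tau> y (x - y)) + Al l t y (y - z) + (- Al l \<tau> x (y - z))"
      using split by simp
    also have "\<dots> \<le> \<gamma> (x - z) - \<eta> * sl l (x - y) powr p + e * (1 + P + Q) + C * (d2 powr q + R + d1 powr q)"
      using t1 t2 t3 t4 mono small cs unfolding R_def[symmetric] by linarith
    finally show ?thesis unfolding P_Q_def R_def a_b_c_def d1_d2_def .
  qed
  then show ?thesis using C(1) by blast
qed

definition "cS = 1 / (2 powr p * cN powr p)"

lemma cS: "cS > 0" using cN(1) by (simp add: cS_def)

text \<open>Exchanges the seminorm that monotonicity controls for the full norm, at the expense of
  an \<open>H\<close>-norm whose convergence is obtained separately.\<close>

lemma seminorm_powr:
  assumes l: "l \<in> L" and x: "x \<in> Vl l"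
  shows "cS * nl l x powr p - norm x powr p \<le> sl l x powr p"
proof -
  have "nl l x powr p \<le> (cN * (norm x + sl l x)) powr p"
    using cN(2)[OF l x] carrier_norm_nonneg[OF Vl(1)[OF l] x] p by (intro powr_mono2) auto
  also have "\<dots> = cN powr p * (norm x + sl l x) powr p" using cN(1) sl_nonneg[OF l x] by (simp add: powr_mult)
  also have "\<dots> \<le> cN powr p * (2 powr p * (norm x powr p + sl l x powr p))"
    using sl_nonneg[OF l x] p by (intro mult_left_mono powr_add_le) auto
  finally have "cS * nl l x powr p \<le> cS * (cN powr p * (2 powr p * (norm x powr p + sl l x powr p)))"
    using cS by (intro mult_left_mono) auto
  also have "\<dots> = norm x powr p + sl l x powr p" using cN(1) by (simp add: cS_def)
  finally show ?thesis by linarith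
qed

text \<open>The error of evaluating the operators at the grid point to the right of \<open>t\<close>
  instead of at \<open>t\<close>.\<close>

definition "drift N l t = dl l (Al l (idx N t) (u t) - Al l t (u t))"

lemma drift_measurable: "N \<ge> 1 \<Longrightarrow> l \<in> L \<Longrightarrow> drift N l \<in> borel_measurable M"
  unfolding drift_def
  by (rule strongly_measurable_norm[OF _ Dl strongly_measurable_diff[OF Dl Al_u_strong[OF _ nodes_measurable] Al_u_id_strong]]) auto

lemma drift_bound:
  assumes N: "N \<ge> 1" and l: "l \<in> L"
  shows "AE t in M. 0 \<le> drift N l t \<and> drift N l t powr q \<le> 2 powr q * (2 * (Cg * (1 + nl l (u t) powr p)))"
  using u_AE AE_space
proof eventually_elim
  fix t assume t: "u t \<in> V" "t \<in> space M"
  have t': "t \<in> {0..T}" "idx N t \<in> {0..T}" using t(2) nodes_measurable(2)[OF N, of t] by auto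
  have ut: "u t \<in> Vl l" using t(1) V_subset[OF l] by auto
  have m: "Al l (idx N t) (u t) \<in> Dl l" "Al l t (u t) \<in> Dl l" by (intro Al_dual[OF l l] t' ut)+
  have nn: "0 \<le> dl l (Al l (idx N t) (u t))" "0 \<le> dl l (Al l t (u t))" by (intro carrier_norm_nonneg[OF Dl[OF l]] m)+
  have 0: "0 \<le> drift N l t" unfolding drift_def by (intro carrier_norm_nonneg[OF Dl[OF l]] carrier_diff[OF Dl[OF l]] m)
  have "drift N l t powr q \<le> (dl l (Al l (idx N t) (u t)) + dl l (Al l t (u t))) powr q"
    using carrier_norm_diff[OF Dl[OF l] m] 0 q(1) unfolding drift_def by (intro powr_mono2) auto
  also have "\<dots> \<le> 2 powr q * (dl l (Al l (idx N t) (u t)) powr q + dl l (Al l t (u t)) powr q)"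
    by (rule powr_add_le[OF nn]) (use q(1) in linarith)
  also have "\<dots> \<le> 2 powr q * (2 * (Cg * (1 + nl l (u t) powr p)))"
    using growth_powr[OF l t'(1) ut] growth_powr[OF l t'(2) ut] by (intro mult_left_mono) auto
  finally show "0 \<le> drift N l t \<and> drift N l t powr q \<le> 2 powr q * (2 * (Cg * (1 + nl l (u t) powr p)))" using 0 by simp
qed

lemma drift_dominating: "l \<in> L \<Longrightarrow> integrable M (\<lambda>t. 2 powr q * (2 * (Cg * (1 + nl l (u t) powr p))))"
  using u_l_powr[of l] finite_measure.integrable_const[OF finite_measure_open_interval]
  by (intro integrable_mult_right Bochner_Integration.integrable_add)

lemma drift_integrable: assumes N: "N \<ge> 1" and l: "l \<in> L" shows "integrable M (\<lambda>t. drift N l t powr q)"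
proof (rule Bochner_Integration.integrable_bound[OF drift_dominating[OF l]])
  show "(\<lambda>t. drift N l t powr q) \<in> borel_measurable M" using drift_measurable[OF N l] by simp
  show "AE t in M. norm (drift N l t powr q) \<le> norm (2 powr q * (2 * (Cg * (1 + nl l (u t) powr p))))"
    using drift_bound[OF N l] by eventually_elim (simp add: abs_le_iff, linarith)
qed

text \<open>Locates both neighbours of \<open>t\<close> on the grid: the operators are evaluated at
  the right one, the preceding value of the scheme belongs to the left one.\<close>

lemma idx_near: "N \<ge> 1 \<Longrightarrow> t \<in> {0<..T} \<Longrightarrow> t \<le> idx N t \<and> idx N t \<le> t + T / real N \<and> idx N t \<le> T
    \<and> real (step_index T N t - 1) * (T / real N) \<le> t \<and> t - T / real N \<le> real (step_index T N t - 1) * (T / real N)"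
proof -
  assume N: "N \<ge> 1" and t: "t \<in> {0<..T}"
  have "0 < t" "t \<le> T" using t by auto
  note r = step_index_range[OF T N this]
  have le: "step_index T N t \<le> N" "1 \<le> step_index T N t" using r(1) by auto
  have "(m - 1) * k = m * k - k" for m k :: real by (simp add: left_diff_distrib)
  then have 1: "(real (step_index T N t) - 1) * (T / real N) = idx N t - T / real N" .
  have "real (step_index T N t - 1) = real (step_index T N t) - 1" using le by simp
  then have 2: "real (step_index T N t - 1) * (T / real N) = idx N t - T / real N" using 1 by (simp only:)
  have 3: "idx N t \<le> T" using node[OF N le(1)] unfolding atLeastAtMost_iff by (rule conjunct2)
  show ?thesis unfolding 2 using r(2,3) 3 unfolding 1 by (intro conjI; linarith)
qed

lemma steps_tendsto_0: "(\<lambda>N. T / real N) \<longlonglongrightarrow> 0"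
  by (rule lim_const_over_n)

text \<open>Continuity of the operators in time is assumed for each fixed vector only, without
  uniformity, so convergence holds for almost every \<open>t\<close> separately and the growth
  condition supplies the dominating function.\<close>

lemma drift_tendsto: assumes l: "l \<in> L" shows "(\<lambda>N. \<integral>t. drift N l t powr q \<partial>M) \<longlonglongrightarrow> 0"
proof -
  \<comment> \<open>The shift to \<open>Suc N\<close> avoids the grid with no cells.\<close>
  have "(\<lambda>N. \<integral>t. drift (Suc N) l t powr q \<partial>M) \<longlonglongrightarrow> (\<integral>t. 0 \<partial>M)"
  proof (rule integral_dominated_convergence[OF _ _ drift_dominating[OF l]])
    show "(\<lambda>t. drift (Suc N) l t powr q) \<in> borel_measurable M" for N using drift_measurable[OF _ l, of "Suc N"] by simp
    show "AE t in M. norm (drift (Suc N) l t powr q) \<le> 2 powr q * (2 * (Cg * (1 + nl l (u t) powr p)))" for N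
      using drift_bound[OF _ l, of "Suc N"] by auto
    show "AE t in M. (\<lambda>N. drift (Suc N) l t powr q) \<longlonglongrightarrow> 0"
      using u_AE AE_space
    proof eventually_elim
      fix t assume t: "u t \<in> V" "t \<in> space M"
      have t0: "t \<in> {0<..T}" and t': "t \<in> {0..T}" using t(2) by auto
      have ut: "u t \<in> Vl l" using t(1) V_subset[OF l] by auto
      have near: "\<And>N. t \<le> idx (Suc N) t \<and> idx (Suc N) t \<le> t + T / real (Suc N) \<and> idx (Suc N) t \<le> T"
        by (intro conjI conjunct1[OF idx_near[OF _ t0]] conjunct1[OF conjunct2[OF idx_near[OF _ t0]]]
            conjunct1[OF conjunct2[OF conjunct2[OF idx_near[OF _ t0]]]]; simp)
      have up: "(\<lambda>N. t + T / real (Suc N)) \<longlonglongrightarrow> t" using tendsto_add[OF tendsto_const LIMSEQ_Suc[OF steps_tendsto_0], of t] by simp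
      have lim: "(\<lambda>N. idx (Suc N) t) \<longlonglongrightarrow> t"
      proof (rule tendsto_sandwich[OF _ _ tendsto_const up])
        show "\<forall>\<^sub>F N in sequentially. t \<le> idx (Suc N) t" using near by (rule always_eventually[OF allI, OF conjunct1])
        show "\<forall>\<^sub>F N in sequentially. idx (Suc N) t \<le> t + T / real (Suc N)"
          using near by (rule always_eventually[OF allI, OF conjunct1[OF conjunct2]])
      qed
      define F where "F r = dl l (Al l r (u t) - Al l t (u t))" for r
      have F0: "F t = 0" unfolding F_def using carrier_norm_0[OF Dl[OF l]] by simp
      have "(F \<longlongrightarrow> F t) (at t within {0..T})" using Al_cont[OF l l ut t'] F0 unfolding F_def by simp
      then have "continuous (at t within {0..T}) F" by (simp add: continuous_within)
      then have "(\<lambda>N. F (idx (Suc N) t)) \<longlonglongrightarrow> F t"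
        by (rule continuous_within_tendsto_compose[OF _ _ lim]) (use near t' in \<open>auto intro!: always_eventually\<close>)
      then have c0: "(\<lambda>N. drift (Suc N) l t) \<longlonglongrightarrow> 0" unfolding F0 unfolding F_def drift_def .
      show "(\<lambda>N. drift (Suc N) l t powr q) \<longlonglongrightarrow> 0"
      proof (rule tendsto_zero_powrI[OF c0 tendsto_const])
        show "\<forall>\<^sub>F N in sequentially. 0 \<le> drift (Suc N) l t" unfolding drift_def
          by (intro always_eventually allI carrier_norm_nonneg[OF Dl[OF l]] carrier_diff[OF Dl[OF l]] Al_dual[OF l l] ut t') (use near t' in auto)
      qed (use q(1) in simp)
    qed
  qed auto
  then show ?thesis by (intro LIMSEQ_imp_Suc[of "\<lambda>N. \<integral>t. drift N l t powr q \<partial>M"]) simp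
qed

section \<open>Errors of the stages and the energy estimate\<close>

definition "stage_error N t = (\<Sum>l=1..s. nl l (Ul N l (step_index T N t) - u t) powr p)"
definition "stage_error_H N t = (\<Sum>l=1..s. norm (Ul N l (step_index T N t) - u t) powr p)"

lemma step_range: "N \<ge> 1 \<Longrightarrow> t \<in> space M \<Longrightarrow> step_index T N t \<in> {1..N}"
  using step_index_range(1)[OF T, of N t] by auto

lemma Ul_step_strong: "N \<ge> 1 \<Longrightarrow> l \<in> L \<Longrightarrow> strongly_measurable_on M (Vl l) (nl l) (\<lambda>t. Ul N l (step_index T N t))"
  by (rule strongly_measurable_simple[OF Vl(1) step_simple_on[OF T]]) (auto intro: Ul_mem)

lemma error_strong: "N \<ge> 1 \<Longrightarrow> l \<in> L \<Longrightarrow> strongly_measurable_on M (Vl l) (nl l) (\<lambda>t. Ul N l (step_index T N t) - u t)"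
  by (rule strongly_measurable_diff[OF Vl(1) Ul_step_strong u_l_strong])

lemma error_mem: assumes N: "N \<ge> 1" and l: "l \<in> L"
  shows "AE t in M. Ul N l (step_index T N t) \<in> Vl l \<and> u t \<in> Vl l \<and> Ul N l (step_index T N t) - u t \<in> Vl l"
  using u_AE AE_space
proof eventually_elim
  fix t assume t: "u t \<in> V" "t \<in> space M"
  have "Ul N l (step_index T N t) \<in> Vl l" "u t \<in> Vl l" using Ul_mem[OF N step_range[OF N t(2)] l] t(1) V_subset[OF l] by auto
  then show "Ul N l (step_index T N t) \<in> Vl l \<and> u t \<in> Vl l \<and> Ul N l (step_index T N t) - u t \<in> Vl l"
    using carrier_diff[OF Vl(1)[OF l]] by blast
qed

lemma error_powr: assumes N: "N \<ge> 1" and l: "l \<in> L"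
  shows "integrable M (\<lambda>t. nl l (Ul N l (step_index T N t) - u t) powr p)"
proof (rule integrable_powr_bound(1)[OF _ _ step_integrable[OF T N, of "\<lambda>m. nl l (Ul N l m) powr p"] u_l_powr[OF l]])
  show "(\<lambda>t. nl l (Ul N l (step_index T N t) - u t)) \<in> borel_measurable M"
    by (rule strongly_measurable_norm[OF _ Vl(1)[OF l] error_strong[OF N l]]) simp
  show "AE t in M. 0 \<le> nl l (Ul N l (step_index T N t) - u t) \<and>
      nl l (Ul N l (step_index T N t) - u t) \<le> nl l (Ul N l (step_index T N t)) + nl l (u t) \<and>
      0 \<le> nl l (Ul N l (step_index T N t)) \<and> 0 \<le> nl l (u t)"
    using error_mem[OF N l]
    by eventually_elim (intro conjI carrier_norm_nonneg[OF Vl(1)[OF l]] carrier_norm_diff[OF Vl(1)[OF l]]; blast)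
qed (use p in simp)

lemma error_norm_powr: assumes N: "N \<ge> 1" and l: "l \<in> L"
  shows "integrable M (\<lambda>t. norm (Ul N l (step_index T N t) - u t) powr p)"
proof (rule Bochner_Integration.integrable_bound[OF integrable_mult_right[OF error_powr[OF N l], of "CH powr p"]])
  have "(\<lambda>t. norm (Ul N l (step_index T N t) - u t)) \<in> borel_measurable M"
  proof (rule strongly_measurable_lipschitz[OF _ error_strong[OF N l], where C=CH])
    fix x y assume "x \<in> Vl l" "y \<in> Vl l"
    then have "norm (x - y) \<le> CH * nl l (x - y)" by (intro CH(2)[OF l] carrier_diff[OF Vl(1)[OF l]])
    then show "\<bar>norm x - norm y\<bar> \<le> CH * nl l (x - y)" using norm_triangle_ineq3[of x y] by linarith
  qed auto
  then show "(\<lambda>t. norm (Ul N l (step_index T N t) - u t) powr p) \<in> borel_measurable M" by simp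
  show "AE t in M. norm (norm (Ul N l (step_index T N t) - u t) powr p) \<le> norm (CH powr p * nl l (Ul N l (step_index T N t) - u t) powr p)"
    using error_mem[OF N l]
  proof eventually_elim
    fix t assume t: "Ul N l (step_index T N t) \<in> Vl l \<and> u t \<in> Vl l \<and> Ul N l (step_index T N t) - u t \<in> Vl l"
    let ?x = "Ul N l (step_index T N t) - u t"
    have "norm ?x powr p \<le> (CH * nl l ?x) powr p" using CH(2)[OF l, of ?x] t p by (intro powr_mono2) auto
    also have "\<dots> = CH powr p * nl l ?x powr p" using CH(1) carrier_norm_nonneg[OF Vl(1)[OF l], of ?x] t by (simp add: powr_mult)
    finally show "norm (norm ?x powr p) \<le> norm (CH powr p * nl l ?x powr p)" by simp
  qed
qed

lemma stage_error_int: "N \<ge> 1 \<Longrightarrow> integrable M (stage_error N)" and stage_error_H_int: "N \<ge> 1 \<Longrightarrow> integrable M (stage_error_H N)"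
  unfolding stage_error_def stage_error_H_def by (intro Bochner_Integration.integrable_sum error_powr error_norm_powr; simp)+

lemma stage_error_nonneg: "0 \<le> stage_error N t" and stage_error_H_nonneg: "0 \<le> stage_error_H N t"
  unfolding stage_error_def stage_error_H_def by (simp_all add: sum_nonneg)

text \<open>The vector \<open>z'\<close> is free; later it is the comparison function at the
  preceding grid point. Two nonnegative terms are dropped: the square of the increment of the error,
  and the variance of the stages, which allows testing each stage equation with
  \<open>Ul N l n - z\<close> although the energy contains only the mean of the stages.\<close>

lemma energy_step:
  assumes N: "N \<ge> 1" and n: "n \<in> {1..N}" and z: "z \<in> V"
  shows "(norm (U N n - z))\<^sup>2 / 2 - (norm (U N (n - 1) - z'))\<^sup>2 / 2
    \<le> (\<Sum>l=1..s. (\<integral>t. fl l t (Ul N l n - z) \<partial>cell N n) - (T / real N) * Al l (real n * (T / real N)) (Ul N l n) (Ul N l n - z))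
      - inner (z - z') (U N n - z)"
proof -
  let ?e = "U N n - z" and ?e' = "U N (n - 1) - z'" and ?m = "U N n" and ?p = "U N (n - 1)"
  have sq: "(norm ?e)\<^sup>2 / 2 - (norm ?e')\<^sup>2 / 2 \<le> inner (?e - ?e') ?e"
  proof -
    have "0 \<le> (norm (?e - ?e'))\<^sup>2" by simp
    also have "(norm (?e - ?e'))\<^sup>2 = 2 * inner (?e - ?e') ?e - (norm ?e)\<^sup>2 + (norm ?e')\<^sup>2"
      by (simp add: power2_norm_eq_inner inner_diff_left inner_diff_right inner_commute)
    finally show ?thesis by simp
  qed
  have "inner (?e - ?e') ?e = inner (?m - ?p) ?e - inner (z - z') ?e"
    by (simp add: inner_diff_left)
  moreover have "inner (?m - ?p) ?e \<le> (1 / real s) * (\<Sum>l=1..s. inner (Ul N l n - ?p) (Ul N l n - z))"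
  proof -
    have sm: "(\<Sum>l=1..s. Ul N l n) = real s *\<^sub>R ?m" using s U_mean[OF N n] by simp
    have "(\<Sum>l=1..s. inner (Ul N l n - ?p) (Ul N l n - z))
      = (\<Sum>l=1..s. (norm (Ul N l n))\<^sup>2 - inner (Ul N l n) (?p + z) + inner ?p z)"
      by (intro sum.cong refl) (simp add: power2_norm_eq_inner inner_diff_left inner_diff_right inner_add_right inner_commute)
    also have "\<dots> = (\<Sum>l=1..s. (norm (Ul N l n))\<^sup>2) - inner (\<Sum>l=1..s. Ul N l n) (?p + z) + real s * inner ?p z"
      by (simp add: sum.distrib sum_subtractf inner_sum_left)
    also have "inner (\<Sum>l=1..s. Ul N l n) (?p + z) = real s * inner ?m (?p + z)" unfolding sm by simp
    finally have "(1 / real s) * (\<Sum>l=1..s. inner (Ul N l n - ?p) (Ul N l n - z))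
      = (1 / real s) * (\<Sum>l=1..s. (norm (Ul N l n))\<^sup>2) - inner ?m (?p + z) + inner ?p z"
      using s by (simp add: field_simps)
    also have "\<dots> \<ge> (norm ?m)\<^sup>2 - inner ?m (?p + z) + inner ?p z"
    proof -
      have "0 \<le> (1 / real s) * (\<Sum>l=1..s. (norm (Ul N l n - ?m))\<^sup>2)" by (intro mult_nonneg_nonneg sum_nonneg) auto
      then show ?thesis using norm_mean_sq_le[OF s U_mean[OF N n]] by linarith
    qed
    finally show ?thesis by (simp add: power2_norm_eq_inner inner_diff_left inner_diff_right inner_add_right inner_commute)
  qed
  moreover have "(1 / real s) * (\<Sum>l=1..s. inner (Ul N l n - ?p) (Ul N l n - z))
    = (\<Sum>l=1..s. (\<integral>t. fl l t (Ul N l n - z) \<partial>cell N n) - (T / real N) * Al l (real n * (T / real N)) (Ul N l n) (Ul N l n - z))"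
    unfolding sum_distrib_left
  proof (intro sum.cong refl)
    fix l assume l: "l \<in> L"
    have "Ul N l n - z \<in> Vl l" using Ul_mem[OF N n l] z V_subset[OF l] carrier_diff[OF Vl(1)[OF l]] by blast
    from scheme_weak[OF N n l this]
    show "1 / real s * inner (Ul N l n - ?p) (Ul N l n - z)
      = (\<integral>t. fl l t (Ul N l n - z) \<partial>cell N n) - (T / real N) * Al l (real n * (T / real N)) (Ul N l n) (Ul N l n - z)" by linarith
  qed
  ultimately show ?thesis using sq by linarith
qed

lemma u_bounded: "\<exists>S\<ge>0. \<forall>t\<in>{0..T}. norm (u t) \<le> S"
proof -
  have "bounded (u ` {0..T})" by (intro compact_imp_bounded compact_continuous_image u_cont) simp
  then obtain S where "\<forall>x\<in>u ` {0..T}. norm x \<le> S" unfolding bounded_iff by blast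
  then have S: "\<forall>t\<in>{0..T}. norm (u t) \<le> S" by blast
  have "0 \<le> norm (u 0)" by simp
  also have "norm (u 0) \<le> S" using S T by auto
  finally show ?thesis using S by blast
qed

lemma sum_cells_mono:
  fixes F :: "nat \<Rightarrow> real"
  assumes "j \<le> N" "\<And>n. n \<in> {1..N} \<Longrightarrow> 0 \<le> F n"
  shows "(\<Sum>n=1..j. F n) \<le> (\<Sum>n=1..N. F n)"
  using assms by (intro sum_mono2) auto

text \<open>Rests on \<open>r \<le> \<kappa> + r\<^sup>2 / \<kappa>\<close> for the distance
  \<open>r\<close> of a stage from the preceding value. The squares carry a bound without the factor
  \<open>T / real N\<close>, so the second term vanishes with the step for fixed \<kappa>, and the
  first is made small by the choice of \<kappa>.\<close>

lemma spread_bound: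
  assumes N: "N \<ge> 1" and \<kappa>: "\<kappa> > 0"
    and K0: "(\<Sum>n=1..N. \<Sum>l=1..s. (norm (Ul N l n - U N (n - 1)))\<^sup>2) \<le> K0"
  shows "(T / real N) * (\<Sum>n=1..N. \<Sum>l=1..s. norm (Ul N l n - Ul N 1 n)) \<le> (1 + real s) * (real s * T * \<kappa> + (T / real N) * K0 / \<kappa>)"
proof -
  let ?k = "T / real N"
  have k: "?k > 0" using T N by simp
  have "(\<Sum>l=1..s. norm (Ul N l n - Ul N 1 n)) \<le> (1 + real s) * (real s * \<kappa> + (\<Sum>l=1..s. (norm (Ul N l n - U N (n - 1)))\<^sup>2) / \<kappa>)" for n
  proof -
    define r where "r l = norm (Ul N l n - U N (n - 1))" for l
    have r1: "r 1 \<le> (\<Sum>l=1..s. r l)" unfolding r_def using s by (intro member_le_sum) auto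
    have "(\<Sum>l=1..s. norm (Ul N l n - Ul N 1 n)) \<le> (\<Sum>l=1..s. r l + r 1)"
    proof (rule sum_mono)
      fix l
      show "norm (Ul N l n - Ul N 1 n) \<le> r l + r 1"
        unfolding r_def using norm_triangle_ineq4[of "Ul N l n - U N (n - 1)" "Ul N 1 n - U N (n - 1)"] by simp
    qed
    also have "\<dots> = (\<Sum>l=1..s. r l) + real s * r 1" by (simp add: sum.distrib)
    also have "\<dots> \<le> (\<Sum>l=1..s. r l) + real s * (\<Sum>l=1..s. r l)" using r1 by (intro add_left_mono mult_left_mono) auto
    also have "\<dots> = (1 + real s) * (\<Sum>l=1..s. r l)" by (simp add: distrib_right)
    also have "\<dots> \<le> (1 + real s) * (\<Sum>l=1..s. \<kappa> + (r l)\<^sup>2 / \<kappa>)"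
    proof (intro mult_left_mono sum_mono)
      fix l
      have r0: "0 \<le> r l" by (simp add: r_def)
      show "r l \<le> \<kappa> + (r l)\<^sup>2 / \<kappa>"
      proof (cases "r l \<le> \<kappa>")
        case False
        then have "r l * \<kappa> \<le> (r l)\<^sup>2" using r0 by (simp add: power2_eq_square mult_left_mono)
        then have "r l \<le> (r l)\<^sup>2 / \<kappa>" using \<kappa> by (simp add: pos_le_divide_eq)
        then show ?thesis using \<kappa> by linarith
      qed (use \<kappa> in \<open>simp add: add_increasing2\<close>)
    qed simp
    also have "\<dots> = (1 + real s) * (real s * \<kappa> + (\<Sum>l=1..s. (r l)\<^sup>2) / \<kappa>)" by (simp add: sum.distrib sum_divide_distrib)
    finally show ?thesis unfolding r_def .
  qed
  then have "?k * (\<Sum>n=1..N. \<Sum>l=1..s. norm (Ul N l n - Ul N 1 n))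
    \<le> ?k * (\<Sum>n=1..N. (1 + real s) * (real s * \<kappa> + (\<Sum>l=1..s. (norm (Ul N l n - U N (n - 1)))\<^sup>2) / \<kappa>))"
    using k by (intro mult_left_mono sum_mono) auto
  also have "\<dots> = (1 + real s) * (?k * (real N * (real s * \<kappa>)) + ?k * ((\<Sum>n=1..N. \<Sum>l=1..s. (norm (Ul N l n - U N (n - 1)))\<^sup>2) / \<kappa>))"
    by (simp only: sum_distrib_left[symmetric] sum.distrib sum_divide_distrib[symmetric] sum_constant card_atLeastAtMost distrib_left mult.left_commute diff_Suc_1)
  also have "\<dots> \<le> (1 + real s) * (?k * (real N * (real s * \<kappa>)) + ?k * (K0 / \<kappa>))"
    using K0 k \<kappa> by (intro mult_left_mono add_left_mono divide_right_mono) auto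
  also have "?k * (real N * (real s * \<kappa>)) = real s * T * \<kappa>" using N by simp
  finally show ?thesis by simp
qed

text \<open>The parameter \<open>h\<close> is the share of the monotonicity constant that is kept.
  With \<open>h = 0\<close> the estimate gives uniform convergence at the grid points; this shows
  that \<open>stage_error_H\<close> vanishes, after which \<open>h = \<eta>\<close> gives the bound
  for the stages in full norm.\<close>

lemma energy_estimate:
  assumes h: "0 \<le> h" "h \<le> \<eta>" and \<epsilon>0: "\<epsilon>0 > 0"
  shows "\<exists>N0\<ge>1. \<forall>N\<ge>N0. \<forall>j\<le>N. (norm (U N j - u (real j * (T / real N))))\<^sup>2 / 4 + h * (cS * (\<Sum>n=1..j. \<integral>t. stage_error N t \<partial>cell N n))
    \<le> \<epsilon>0 + h * (\<integral>t. stage_error_H N t \<partial>M)"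
proof -
  obtain K0 where K0: "K0 > 0" and ap: "\<forall>N\<ge>1. (\<forall>n\<in>{1..N}. \<forall>l\<in>L. norm (Ul N l n) \<le> K0) \<and>
     (\<Sum>n=1..N. \<Sum>l=1..s. (norm (Ul N l n - U N (n - 1)))\<^sup>2) \<le> K0 \<and>
     (T / real N) * (\<Sum>n=1..N. \<Sum>l=1..s. nl l (Ul N l n) powr p) \<le> K0" using a_priori by blast
  obtain Su where Su: "Su \<ge> 0" "\<forall>t\<in>{0..T}. norm (u t) \<le> Su" using u_bounded by blast
  define Cu where "Cu = (\<Sum>l=1..s. \<integral>t. nl l (u t) powr p \<partial>M)"
  have Cu0: "Cu \<ge> 0" unfolding Cu_def by (intro sum_nonneg integral_nonneg_AE AE_I2) simp
  define B1 where "B1 = real s * T + K0 + Cu"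
  have B1: "B1 > 0" unfolding B1_def using K0 Cu0 T by (intro add_pos_nonneg add_nonneg_pos) auto
  \<comment> \<open>The budget consists of four shares \<open>\<epsilon>0 / 4\<close>: one for the
    weight \<epsilon> of Young's inequality against the bounds in \<open>B1\<close>, one for all
    terms proportional to \<open>e\<close>, collected in \<open>Bt\<close>, and two for the spread
    of the stages, ruled by \<kappa> and by \<nu>.\<close>
  define \<epsilon> where "\<epsilon> = \<epsilon>0 / (4 * B1)"
  have \<epsilon>: "\<epsilon> > 0" "\<epsilon> * B1 = \<epsilon>0 / 4" using \<epsilon>0 B1 by (auto simp: \<epsilon>_def)
  obtain C where C: "C > 0" and pw: "\<forall>l\<in>L. \<forall>t\<in>{0..T}. \<forall>\<tau>\<in>{0..T}. \<forall>x\<in>Vl l. \<forall>y\<in>Vl l. \<forall>z\<in>Vl l. \<forall>\<phi>\<in>Dl l. \<forall>\<gamma>\<in>Dl l.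
    \<phi> (x - z) - Al l \<tau> x (x - z) \<le> \<gamma> (x - z) - \<eta> * sl l (x - y) powr p + \<epsilon> * (1 + nl l x powr p + nl l y powr p)
      + C * (dl l (Al l \<tau> y - Al l t y) powr q + nl l (y - z) powr p + dl l (\<phi> - Al l t y - \<gamma>) powr q)"
    using pointwise_estimate[OF \<epsilon>(1)] by blast
  define B2 where "B2 = C * (real s * (1 + CV powr p + 1))"
  define B3 where "B3 = real s * T + K0 + T * (K0 + Su + 1)"
  define Bt where "Bt = 1 + B2 + B3"
  have B23: "B2 \<ge> 0" "B3 \<ge> 0" unfolding B2_def B3_def using C K0 T Su(1) by (auto intro!: add_nonneg_nonneg mult_nonneg_nonneg)
  have Bt: "Bt > 0" using B23 by (simp add: Bt_def)
  define e where "e = min 1 (\<epsilon>0 / (4 * Bt))"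
  have e: "e > 0" "e \<le> 1" unfolding e_def using \<epsilon>0 Bt by auto
  have eBt: "e * Bt \<le> \<epsilon>0 / 4"
  proof -
    have "e * Bt \<le> \<epsilon>0 / (4 * Bt) * Bt" unfolding e_def using Bt by (intro mult_right_mono) auto
    then show ?thesis using Bt by simp
  qed
  obtain v w G K NR where reg: "(\<forall>t\<in>{0..T}. v t \<in> V \<and> norm (v t - u t) \<le> e) \<and>
    (\<forall>t\<in>{0..T}. \<forall>l\<in>L. G l t \<in> Dl l) \<and> (\<forall>t\<in>{0..T}. \<forall>x\<in>V. (\<Sum>l=1..s. G l t x) = inner (w t) x) \<and>
    (\<forall>t\<in>{0..T}. \<forall>x. (\<forall>l\<in>L. x l \<in> Vl l) \<longrightarrow> \<bar>\<Sum>l=1..s. (G l t (x l) - inner (w t) (x l) / real s)\<bar>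
        \<le> e * (\<Sum>l=1..s. nl l (x l)) + K * (\<Sum>l=1..s. norm (x l - x 1))) \<and> K \<ge> 0 \<and>
    NR \<ge> 1 \<and> (\<forall>N\<ge>NR. (\<forall>n\<in>{1..N}. norm (v (real n * (T / real N)) - v (real (n - 1) * (T / real N)) - (T / real N) *\<^sub>R w (real n * (T / real N))) \<le> (T / real N) * e) \<and>
      integrable M (\<lambda>t. nV (u t - v (idx N t)) powr p) \<and>
      (\<integral>t. nV (u t - v (idx N t)) powr p \<partial>M) \<le> e \<and>
      (\<forall>l\<in>L. integrable M (\<lambda>t. dl l (gl l t - G l (idx N t)) powr q) \<and>
        (\<integral>t. dl l (gl l t - G l (idx N t)) powr q \<partial>M) \<le> e))"
    using regularisation[OF e(1)] by (elim exE)
  have v: "\<And>t. t \<in> {0..T} \<Longrightarrow> v t \<in> V" "\<And>t. t \<in> {0..T} \<Longrightarrow> norm (v t - u t) \<le> e" using reg by blast+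
  have G: "\<And>t l. t \<in> {0..T} \<Longrightarrow> l \<in> L \<Longrightarrow> G l t \<in> Dl l" using reg by blast
  have Gw: "\<And>t x. t \<in> {0..T} \<Longrightarrow> x \<in> V \<Longrightarrow> (\<Sum>l=1..s. G l t x) = inner (w t) x" using reg by blast
  have Gsmall: "\<And>t x. t \<in> {0..T} \<Longrightarrow> \<forall>l\<in>L. x l \<in> Vl l \<Longrightarrow> \<bar>\<Sum>l=1..s. (G l t (x l) - inner (w t) (x l) / real s)\<bar>
        \<le> e * (\<Sum>l=1..s. nl l (x l)) + K * (\<Sum>l=1..s. norm (x l - x 1))" using reg by blast
  have K: "K \<ge> 0" and NR: "NR \<ge> 1" using reg by blast+
  have winc: "\<And>N n. N \<ge> NR \<Longrightarrow> n \<in> {1..N} \<Longrightarrow> norm (v (real n * (T / real N)) - v (real (n - 1) * (T / real N)) - (T / real N) *\<^sub>R w (real n * (T / real N))) \<le> (T / real N) * e"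
    using reg by blast
  have h4: "\<And>N. N \<ge> NR \<Longrightarrow> integrable M (\<lambda>t. nV (u t - v (idx N t)) powr p)" "\<And>N. N \<ge> NR \<Longrightarrow> (\<integral>t. nV (u t - v (idx N t)) powr p \<partial>M) \<le> e"
    using reg by blast+
  have h5: "\<And>N l. N \<ge> NR \<Longrightarrow> l \<in> L \<Longrightarrow> integrable M (\<lambda>t. dl l (gl l t - G l (idx N t)) powr q)"
    "\<And>N l. N \<ge> NR \<Longrightarrow> l \<in> L \<Longrightarrow> (\<integral>t. dl l (gl l t - G l (idx N t)) powr q \<partial>M) \<le> e"
    using reg by blast+
  \<comment> \<open>The Ehrling constant \<open>K\<close> is known only now; \<kappa> is chosen
    small against it, and \<nu>, the bound for the step size, small against both.
    \<open>K + 1\<close> keeps the divisor positive.\<close>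
  define H where "H = (K + 1) * (1 + real s)"
  have H: "H > 0" unfolding H_def using K by (intro mult_pos_pos) auto
  define \<kappa> where "\<kappa> = \<epsilon>0 / (4 * H * (real s * T))"
  have \<kappa>: "\<kappa> > 0" "H * (real s * T * \<kappa>) = \<epsilon>0 / 4" using \<epsilon>0 H s T by (auto simp: \<kappa>_def)
  define \<nu> where "\<nu> = \<epsilon>0 * \<kappa> / (4 * H * K0)"
  have \<nu>: "\<nu> > 0" "H * (\<nu> * K0 / \<kappa>) = \<epsilon>0 / 4" using \<epsilon>0 H \<kappa>(1) K0 by (auto simp: \<nu>_def)
  have "\<forall>\<^sub>F N in sequentially. T / real N < \<nu>" by (rule order_tendstoD(2)[OF steps_tendsto_0 \<nu>(1)])
  moreover have "\<forall>\<^sub>F N in sequentially. \<forall>l\<in>L. (\<integral>t. drift N l t powr q \<partial>M) < e"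
    by (rule eventually_ball_finite) (auto intro!: order_tendstoD(2)[OF drift_tendsto e(1)])
  ultimately have "\<forall>\<^sub>F N in sequentially. T / real N < \<nu> \<and> (\<forall>l\<in>L. (\<integral>t. drift N l t powr q \<partial>M) < e)" by (rule eventually_conj)
  then obtain N1 where N1: "\<And>N. N \<ge> N1 \<Longrightarrow> T / real N < \<nu>" "\<And>N l. N \<ge> N1 \<Longrightarrow> l \<in> L \<Longrightarrow> (\<integral>t. drift N l t powr q \<partial>M) < e"
    unfolding eventually_sequentially by blast
  have "(norm (U N j - u (real j * (T / real N))))\<^sup>2 / 4 + h * (cS * (\<Sum>n=1..j. \<integral>t. stage_error N t \<partial>cell N n))
    \<le> \<epsilon>0 + h * (\<integral>t. stage_error_H N t \<partial>M)" if NN: "N \<ge> max NR N1" and j: "j \<le> N" for N j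
  proof -
    have N: "N \<ge> 1" "N \<ge> NR" "N \<ge> N1" using NN NR by auto
    define k where "k = T / real N"
    have k: "k > 0" "real N * k = T" using T N by (auto simp: k_def)
    define tn where "tn n = real n * k" for n
    have tn: "tn n \<in> {0..T}" if "n \<le> N" for n unfolding tn_def k_def by (rule node[OF N(1) that])
    define vn where "vn n = v (tn n)" for n
    have vn: "vn n \<in> V" if "n \<le> N" for n unfolding vn_def by (rule v(1)[OF tn[OF that]])
    note apN = ap[rule_format, OF N(1)]
    have Ub: "norm (Ul N l n) \<le> K0" if "n \<in> {1..N}" "l \<in> L" for n l using apN that by blast
    have Ubm: "norm (U N n) \<le> K0" if n: "n \<in> {1..N}" for n
    proof -
      have "norm (U N n) \<le> (1 / real s) * (\<Sum>l=1..s. norm (Ul N l n))"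
        unfolding U_mean[OF N(1) n] norm_scaleR using norm_sum[of "\<lambda>l. Ul N l n" L] by (simp add: divide_right_mono)
      also have "\<dots> \<le> (1 / real s) * (\<Sum>l=1..s. K0)" using Ub[OF n] by (intro mult_left_mono sum_mono) auto
      finally show ?thesis using s by simp
    qed
    define h1 where "h1 l t = nl l (Ul N l (step_index T N t)) powr p" for l t
    define h2 where "h2 l t = nl l (u t) powr p" for l t
    define h3 where "h3 l t = drift N l t powr q" for l t
    define h4' where "h4' t = nV (u t - v (idx N t)) powr p" for t
    define h5' where "h5' l t = dl l (gl l t - G l (idx N t)) powr q" for l t
    define x1 where "x1 l t = nl l (Ul N l (step_index T N t) - u t) powr p" for l t
    define y1 where "y1 l t = norm (Ul N l (step_index T N t) - u t) powr p" for l t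
    have ih: "integrable M (h1 l)" "integrable M (h2 l)" "integrable M (h3 l)" "integrable M (h5' l)" "integrable M (x1 l)" "integrable M (y1 l)" if l: "l \<in> L" for l
      unfolding h1_def h2_def h3_def h5'_def x1_def y1_def
      by (rule step_integrable[OF T N(1)] u_l_powr[OF l] drift_integrable[OF N(1) l] h5(1)[OF N(2) l] error_powr[OF N(1) l] error_norm_powr[OF N(1) l])+
    have ih4: "integrable M h4'" unfolding h4'_def by (rule h4(1)[OF N(2)])
    have ic: "integrable M (\<lambda>t. c::real)" for c by (rule finite_measure.integrable_const[OF finite_measure_open_interval])
    define Z where "Z l t = \<epsilon> * (1 + h1 l t + h2 l t) + C * (h3 l t + CV powr p * h4' t + h5' l t)" for l t
    have iZ: "integrable M (Z l)" if l: "l \<in> L" for l unfolding Z_def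
      by (intro Bochner_Integration.integrable_add integrable_mult_right ic ih[OF l] ih4)
    have Z0: "0 \<le> Z l t" for l t unfolding Z_def h1_def h2_def h3_def h4'_def h5'_def using \<epsilon>(1) C
      by (intro add_nonneg_nonneg mult_nonneg_nonneg) auto
    define \<psi> where "\<psi> l t = Z l t + (h * y1 l t - h * (cS * x1 l t))" for l t
    have i\<psi>: "integrable M (\<psi> l)" if l: "l \<in> L" for l unfolding \<psi>_def
      by (intro Bochner_Integration.integrable_add Bochner_Integration.integrable_diff integrable_mult_right iZ[OF l] ih[OF l])
    define a where "a n = (norm (U N n - vn n))\<^sup>2 / 2" for n
    define S1 where "S1 n = (\<Sum>l=1..s. nl l (Ul N l n))" for n
    define S2 where "S2 n = (\<Sum>l=1..s. norm (Ul N l n - Ul N 1 n))" for n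
    define S3 where "S3 n = norm (U N n - vn n)" for n
    define \<rho> where "\<rho> n = k * (e * S1 n + K * S2 n + e * S3 n)" for n
    have S0: "0 \<le> S1 n" "0 \<le> S2 n" "0 \<le> S3 n" if n: "n \<in> {1..N}" for n
      unfolding S1_def S2_def S3_def using carrier_norm_nonneg[OF Vl(1) Ul_mem[OF N(1) n]] by (auto intro!: sum_nonneg)
    have step: "a n \<le> a (n - 1) + (\<Sum>l=1..s. \<integral>t. \<psi> l t \<partial>cell N n) + \<rho> n" if n: "n \<in> {1..N}" for n
    proof -
      have nN: "n \<le> N" "n - 1 \<le> N" using n by auto
      let ?w = "w (tn n)"
      have each: "(\<integral>t. fl l t (Ul N l n - vn n) \<partial>cell N n) - k * Al l (tn n) (Ul N l n) (Ul N l n - vn n)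
          \<le> (\<integral>t. \<psi> l t \<partial>cell N n) + k * G l (tn n) (Ul N l n - vn n)" if l: "l \<in> L" for l
      proof -
        define x where "x = Ul N l n"
        have xm: "x \<in> Vl l" unfolding x_def by (rule Ul_mem[OF N(1) n l])
        have zm: "vn n \<in> Vl l" using vn[OF nN(1)] V_subset[OF l] by blast
        have xz: "x - vn n \<in> Vl l" by (rule carrier_diff[OF Vl(1)[OF l] xm zm])
        \<comment> \<open>Collects the terms that are constant on the cell, so that the pointwise
          estimate can be integrated over it; their integral is \<open>k * c\<close>.\<close>
        define c where "c = Al l (tn n) x (x - vn n) + G l (tn n) (x - vn n)"
        have ifl: "integrable (cell N n) (\<lambda>t. fl l t (x - vn n))"
          by (intro cell_integrable[OF N(1) n] dual_eval_integrable[OF _ Vl(1)[OF l] fl_strong[OF l] fl_int[OF l] xz]) auto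
        have icc: "integrable (cell N n) (\<lambda>t. c)" by (rule finite_measure.integrable_const[OF finite_measure_open_interval])
        have "(\<integral>t. fl l t (x - vn n) \<partial>cell N n) - k * c = (\<integral>t. fl l t (x - vn n) - c \<partial>cell N n)"
          unfolding Bochner_Integration.integral_diff[OF ifl icc] cell_const[OF N(1)] k_def ..
        also have "\<dots> \<le> (\<integral>t. \<psi> l t \<partial>cell N n)"
        proof (rule integral_mono_AE)
          show "integrable (cell N n) (\<lambda>t. fl l t (x - vn n) - c)" by (rule Bochner_Integration.integrable_diff[OF ifl icc])
          show "integrable (cell N n) (\<psi> l)" by (rule cell_integrable[OF N(1) n i\<psi>[OF l]])
          show "AE t in cell N n. fl l t (x - vn n) - c \<le> \<psi> l t"
            using cell_AE[OF N(1) n u_AE] cell_AE[OF N(1) n fl_AE[OF l]] AE_space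
          proof eventually_elim
            fix t assume t: "u t \<in> V" "fl l t \<in> Dl l" "t \<in> space (cell N n)"
            have tc: "(real n - 1) * (T / real N) < t" "t < real n * (T / real N)" using t(3) by auto
            have "n \<ge> 1" using n by simp
            have si: "step_index T N t = n" unfolding step_index_eq[OF T N(1) \<open>n \<ge> 1\<close>] using tc by simp
            have tT: "t \<in> {0..T}" using t(3) cell_subset[OF N(1) n] by auto
            have ix: "idx N t = tn n" unfolding si tn_def k_def ..
            have ut: "u t \<in> Vl l" using t(1) V_subset[OF l] by blast
            have xu: "x - u t \<in> Vl l" by (rule carrier_diff[OF Vl(1)[OF l] xm ut])
            have uvV: "u t - vn n \<in> V" by (rule carrier_diff[OF V(1) t(1) vn[OF nN(1)]])
            have p1: "fl l t (x - vn n) - Al l (tn n) x (x - vn n) \<le> G l (tn n) (x - vn n) - \<eta> * sl l (x - u t) powr p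
              + \<epsilon> * (1 + nl l x powr p + nl l (u t) powr p)
              + C * (dl l (Al l (tn n) (u t) - Al l t (u t)) powr q + nl l (u t - vn n) powr p + dl l (fl l t - Al l t (u t) - G l (tn n)) powr q)"
              using pw l tT tn[OF nN(1)] xm ut zm t(2) G[OF tn[OF nN(1)] l] by blast
            have "h * (cS * nl l (x - u t) powr p - norm (x - u t) powr p) \<le> h * sl l (x - u t) powr p"
              using seminorm_powr[OF l xu] h(1) by (intro mult_left_mono) auto
            also have "\<dots> \<le> \<eta> * sl l (x - u t) powr p" using h(2) by (intro mult_right_mono) auto
            finally have p2: "h * (cS * x1 l t) - h * y1 l t \<le> \<eta> * sl l (x - u t) powr p"
              unfolding x1_def y1_def si x_def[symmetric] by (simp only: right_diff_distrib)
            have "nl l (u t - vn n) powr p \<le> (CV * nV (u t - vn n)) powr p"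
              using CV(2)[OF l uvV] carrier_norm_nonneg[OF Vl(1)[OF l] carrier_diff[OF Vl(1)[OF l] ut zm]] p by (intro powr_mono2) auto
            also have "\<dots> = CV powr p * h4' t" unfolding h4'_def ix vn_def[symmetric] using CV(1) carrier_norm_nonneg[OF V(1) uvV] by (simp add: powr_mult)
            finally have p3: "nl l (u t - vn n) powr p \<le> CV powr p * h4' t" .
            have p4: "C * (dl l (Al l (tn n) (u t) - Al l t (u t)) powr q + nl l (u t - vn n) powr p + dl l (fl l t - Al l t (u t) - G l (tn n)) powr q)
              \<le> C * (h3 l t + CV powr p * h4' t + h5' l t)"
              using p3 C unfolding h3_def h5'_def drift_def ix gl_def by (intro mult_left_mono) auto
            have p5: "\<epsilon> * (1 + nl l x powr p + nl l (u t) powr p) = \<epsilon> * (1 + h1 l t + h2 l t)" unfolding h1_def h2_def si x_def ..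
            show "fl l t (x - vn n) - c \<le> \<psi> l t" using p1 p2 p4 p5 unfolding c_def \<psi>_def Z_def by linarith
          qed
        qed
        finally show ?thesis unfolding c_def x_def distrib_left by linarith
      qed
      have "(\<Sum>l=1..s. (\<integral>t. fl l t (Ul N l n - vn n) \<partial>cell N n) - k * Al l (tn n) (Ul N l n) (Ul N l n - vn n))
        \<le> (\<Sum>l=1..s. (\<integral>t. \<psi> l t \<partial>cell N n) + k * G l (tn n) (Ul N l n - vn n))"
        using each by (intro sum_mono) auto
      also have "\<dots> = (\<Sum>l=1..s. \<integral>t. \<psi> l t \<partial>cell N n) + k * (\<Sum>l=1..s. G l (tn n) (Ul N l n - vn n))"
        by (simp only: sum.distrib sum_distrib_left)
      finally have A: "(\<Sum>l=1..s. (\<integral>t. fl l t (Ul N l n - vn n) \<partial>cell N n) - k * Al l (tn n) (Ul N l n) (Ul N l n - vn n))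
        \<le> (\<Sum>l=1..s. \<integral>t. \<psi> l t \<partial>cell N n) + k * (\<Sum>l=1..s. G l (tn n) (Ul N l n - vn n))" .
      \<comment> \<open>On \<open>vn n\<close>, a vector of \<open>V\<close>, the functionals
        \<open>G l\<close> add up to \<open>w\<close>. On the stages they are compared with equal
        shares of \<open>w\<close>, with the error that \<open>Gsmall\<close> controls. What remains
        is \<open>w\<close> tested with \<open>U N n - vn n\<close>.\<close>
      have "(\<Sum>l=1..s. G l (tn n) (Ul N l n - vn n)) = (\<Sum>l=1..s. G l (tn n) (Ul N l n) - G l (tn n) (vn n))"
        using V_subset vn[OF nN(1)] by (intro sum.cong refl dual_diff[OF Vl(1) G[OF tn[OF nN(1)]] Ul_mem[OF N(1) n]]) auto
      also have "\<dots> = (\<Sum>l=1..s. G l (tn n) (Ul N l n)) - inner ?w (vn n)"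
        unfolding sum_subtractf Gw[OF tn[OF nN(1)] vn[OF nN(1)]] ..
      also have "(\<Sum>l=1..s. G l (tn n) (Ul N l n)) = (\<Sum>l=1..s. (G l (tn n) (Ul N l n) - inner ?w (Ul N l n) / real s)) + inner ?w (U N n)"
        unfolding U_mean[OF N(1) n] by (simp add: sum_subtractf inner_sum_right sum_divide_distrib)
      also have "(\<Sum>l=1..s. (G l (tn n) (Ul N l n) - inner ?w (Ul N l n) / real s)) \<le> e * S1 n + K * S2 n"
        using Gsmall[OF tn[OF nN(1)], of "\<lambda>l. Ul N l n"] Ul_mem[OF N(1) n] unfolding S1_def S2_def by (auto simp: abs_le_iff)
      finally have B: "(\<Sum>l=1..s. G l (tn n) (Ul N l n - vn n)) \<le> e * S1 n + K * S2 n + inner ?w (U N n - vn n)"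
        by (simp add: inner_diff_right)
      \<comment> \<open>The increment of the comparison function is \<open>k *\<^sub>R ?w\<close> up
        to an error of norm \<open>k * e\<close>, so it cancels the remaining term with
        \<open>w\<close>.\<close>
      have "- (inner (vn n - vn (n - 1) - k *\<^sub>R ?w) (U N n - vn n)) \<le> norm (vn n - vn (n - 1) - k *\<^sub>R ?w) * norm (U N n - vn n)"
        using Cauchy_Schwarz_ineq2[of "vn n - vn (n - 1) - k *\<^sub>R ?w" "U N n - vn n"] by linarith
      also have "\<dots> \<le> (k * e) * S3 n"
        unfolding S3_def using winc[OF N(2) n] unfolding vn_def tn_def k_def by (intro mult_right_mono) auto
      finally have D: "- inner (vn n - vn (n - 1)) (U N n - vn n) \<le> k * e * S3 n - k * inner ?w (U N n - vn n)"
        by (simp add: inner_diff_left)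
      have "k * (\<Sum>l=1..s. G l (tn n) (Ul N l n - vn n)) \<le> k * (e * S1 n + K * S2 n + inner ?w (U N n - vn n))"
        using B k by (intro mult_left_mono) auto
      moreover have "a n - a (n - 1) \<le> (\<Sum>l=1..s. (\<integral>t. fl l t (Ul N l n - vn n) \<partial>cell N n) - k * Al l (tn n) (Ul N l n) (Ul N l n - vn n))
        - inner (vn n - vn (n - 1)) (U N n - vn n)"
        using energy_step[OF N(1) n vn[OF nN(1)], of "vn (n - 1)"] unfolding a_def tn_def k_def .
      ultimately show ?thesis using A D unfolding \<rho>_def by (simp add: distrib_left)
    qed
    have tel: "a i \<le> a 0 + (\<Sum>n=1..i. (\<Sum>l=1..s. \<integral>t. \<psi> l t \<partial>cell N n)) + (\<Sum>n=1..i. \<rho> n)" if "i \<le> N" for i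
      using that
    proof (induction i)
      case (Suc i)
      then show ?case using step[of "Suc i"] by simp
    qed simp
    have iZs: "integrable M (\<lambda>t. \<Sum>l=1..s. Z l t)" by (intro Bochner_Integration.integrable_sum iZ)
    have cell\<psi>: "(\<Sum>l=1..s. \<integral>t. \<psi> l t \<partial>cell N n) = (\<integral>t. (\<Sum>l=1..s. Z l t) \<partial>cell N n) + h * (\<integral>t. stage_error_H N t \<partial>cell N n) - h * (cS * (\<integral>t. stage_error N t \<partial>cell N n))"
      if n: "n \<in> {1..N}" for n
    proof -
      note ci = cell_integrable[OF N(1) n]
      have "(\<Sum>l=1..s. \<integral>t. \<psi> l t \<partial>cell N n) = (\<integral>t. (\<Sum>l=1..s. \<psi> l t) \<partial>cell N n)"
        by (rule Bochner_Integration.integral_sum[symmetric]) (rule ci[OF i\<psi>])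
      also have "(\<lambda>t. \<Sum>l=1..s. \<psi> l t) = (\<lambda>t. (\<Sum>l=1..s. Z l t) + (h * stage_error_H N t - h * (cS * stage_error N t)))"
        unfolding \<psi>_def stage_error_def stage_error_H_def x1_def y1_def by (simp only: sum.distrib sum_subtractf sum_distrib_left)
      also have "(\<integral>t. (\<Sum>l=1..s. Z l t) + (h * stage_error_H N t - h * (cS * stage_error N t)) \<partial>cell N n)
        = (\<integral>t. (\<Sum>l=1..s. Z l t) \<partial>cell N n) + (\<integral>t. h * stage_error_H N t - h * (cS * stage_error N t) \<partial>cell N n)"
        by (rule Bochner_Integration.integral_add[OF ci[OF iZs]])
          (intro Bochner_Integration.integrable_diff integrable_mult_right ci stage_error_int stage_error_H_int N(1))
      also have "(\<integral>t. h * stage_error_H N t - h * (cS * stage_error N t) \<partial>cell N n) = (\<integral>t. h * stage_error_H N t \<partial>cell N n) - (\<integral>t. h * (cS * stage_error N t) \<partial>cell N n)"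
        by (rule Bochner_Integration.integral_diff) (intro integrable_mult_right ci stage_error_int stage_error_H_int N(1))+
      finally show ?thesis by simp
    qed
    have sum\<psi>: "(\<Sum>n=1..j. (\<Sum>l=1..s. \<integral>t. \<psi> l t \<partial>cell N n)) \<le> (\<integral>t. (\<Sum>l=1..s. Z l t) \<partial>M) + h * (\<integral>t. stage_error_H N t \<partial>M) - h * (cS * (\<Sum>n=1..j. \<integral>t. stage_error N t \<partial>cell N n))"
    proof -
      have "(\<Sum>n=1..j. (\<Sum>l=1..s. \<integral>t. \<psi> l t \<partial>cell N n)) = (\<Sum>n=1..j. (\<integral>t. (\<Sum>l=1..s. Z l t) \<partial>cell N n) + h * (\<integral>t. stage_error_H N t \<partial>cell N n) - h * (cS * (\<integral>t. stage_error N t \<partial>cell N n)))"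
        using j by (intro sum.cong refl cell\<psi>) auto
      also have "\<dots> = (\<Sum>n=1..j. \<integral>t. (\<Sum>l=1..s. Z l t) \<partial>cell N n) + h * (\<Sum>n=1..j. \<integral>t. stage_error_H N t \<partial>cell N n) - h * (cS * (\<Sum>n=1..j. \<integral>t. stage_error N t \<partial>cell N n))"
        by (simp only: sum.distrib sum_subtractf sum_distrib_left)
      also have "(\<Sum>n=1..j. \<integral>t. (\<Sum>l=1..s. Z l t) \<partial>cell N n) \<le> (\<integral>t. (\<Sum>l=1..s. Z l t) \<partial>M)"
        using Z0 by (intro cell_sum[OF N(1) iZs _ j] AE_I2 sum_nonneg) auto
      also have "h * (\<Sum>n=1..j. \<integral>t. stage_error_H N t \<partial>cell N n) \<le> h * (\<integral>t. stage_error_H N t \<partial>M)"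
        using stage_error_H_nonneg by (intro mult_left_mono[OF _ h(1)] cell_sum[OF N(1) stage_error_H_int[OF N(1)] _ j] AE_I2) auto
      finally show ?thesis by simp
    qed
    have intZ: "(\<integral>t. (\<Sum>l=1..s. Z l t) \<partial>M) \<le> \<epsilon> * B1 + e * B2"
    proof -
      have one: "(\<integral>t. Z l t \<partial>M) \<le> \<epsilon> * (T + k * (\<Sum>n=1..N. nl l (Ul N l n) powr p) + (\<integral>t. h2 l t \<partial>M)) + C * (e * (1 + CV powr p + 1))" if l: "l \<in> L" for l
      proof -
        have "(\<integral>t. Z l t \<partial>M) = \<epsilon> * (T + (\<integral>t. h1 l t \<partial>M) + (\<integral>t. h2 l t \<partial>M)) + C * ((\<integral>t. h3 l t \<partial>M) + CV powr p * (\<integral>t. h4' t \<partial>M) + (\<integral>t. h5' l t \<partial>M))"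
          unfolding Z_def using ih[OF l] ih4 ic T by (simp add: measure_restrict_space)
        also have "(\<integral>t. h1 l t \<partial>M) = k * (\<Sum>n=1..N. nl l (Ul N l n) powr p)" unfolding h1_def k_def by (rule step_integral[OF T N(1)])
        also have "C * ((\<integral>t. h3 l t \<partial>M) + CV powr p * (\<integral>t. h4' t \<partial>M) + (\<integral>t. h5' l t \<partial>M)) \<le> C * (e + CV powr p * e + e)"
          using N1(2)[OF N(3) l] h4(2)[OF N(2)] h5(2)[OF N(2) l] C unfolding h3_def h4'_def h5'_def
          by (intro mult_left_mono add_mono) auto
        also have "C * (e + CV powr p * e + e) = C * (e * (1 + CV powr p + 1))" by (simp add: algebra_simps)
        finally show ?thesis by simp
      qed
      have "(\<integral>t. (\<Sum>l=1..s. Z l t) \<partial>M) = (\<Sum>l=1..s. \<integral>t. Z l t \<partial>M)" by (rule Bochner_Integration.integral_sum) (rule iZ)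
      also have "\<dots> \<le> (\<Sum>l=1..s. \<epsilon> * (T + k * (\<Sum>n=1..N. nl l (Ul N l n) powr p) + (\<integral>t. h2 l t \<partial>M)) + C * (e * (1 + CV powr p + 1)))"
        by (rule sum_mono) (rule one)
      also have "\<dots> = \<epsilon> * (real s * T + k * (\<Sum>l=1..s. \<Sum>n=1..N. nl l (Ul N l n) powr p) + Cu) + real s * (C * (e * (1 + CV powr p + 1)))"
        unfolding Cu_def h2_def by (simp add: sum.distrib sum_distrib_left[symmetric])
      also have "(\<Sum>l=1..s. \<Sum>n=1..N. nl l (Ul N l n) powr p) = (\<Sum>n=1..N. \<Sum>l=1..s. nl l (Ul N l n) powr p)" by (rule sum.swap)
      also have "\<epsilon> * (real s * T + k * (\<Sum>n=1..N. \<Sum>l=1..s. nl l (Ul N l n) powr p) + Cu) \<le> \<epsilon> * B1"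
        unfolding B1_def using apN \<epsilon>(1) unfolding k_def by (intro mult_left_mono) auto
      also have "real s * (C * (e * (1 + CV powr p + 1))) = e * B2" by (simp add: B2_def)
      finally show ?thesis by simp
    qed
    have rest: "(\<Sum>n=1..j. \<rho> n) \<le> e * B3 + \<epsilon>0 / 2"
    proof -
      have "(\<Sum>n=1..j. \<rho> n) \<le> (\<Sum>n=1..N. \<rho> n)"
        by (rule sum_cells_mono[OF j]) (use S0 k e K in \<open>auto simp: \<rho>_def intro!: mult_nonneg_nonneg add_nonneg_nonneg\<close>)
      also have "\<dots> = e * (k * (\<Sum>n=1..N. S1 n)) + K * (k * (\<Sum>n=1..N. S2 n)) + e * (k * (\<Sum>n=1..N. S3 n))"
        unfolding \<rho>_def by (simp add: sum.distrib distrib_left sum_distrib_left mult.left_commute)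
      also have "k * (\<Sum>n=1..N. S1 n) \<le> real s * T + K0"
      proof -
        have "k * (\<Sum>n=1..N. S1 n) \<le> k * (\<Sum>n=1..N. \<Sum>l=1..s. 1 + nl l (Ul N l n) powr p)"
          unfolding S1_def
        proof (intro mult_left_mono sum_mono)
          fix n l assume "n \<in> {1..N}" "l \<in> L"
          have "x \<le> 1 + x powr p" for x :: real
          proof (cases "x \<le> 1")
            case False
            then have "x powr 1 \<le> x powr p" using p by (intro powr_mono) auto
            then show ?thesis using False by simp
          qed (simp add: add_increasing2)
          then show "nl l (Ul N l n) \<le> 1 + nl l (Ul N l n) powr p" .
        qed (use k in simp)
        also have "\<dots> = real N * k * real s + k * (\<Sum>n=1..N. \<Sum>l=1..s. nl l (Ul N l n) powr p)"
          by (simp add: sum.distrib distrib_left)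
        finally show ?thesis using apN k(2) unfolding k_def by (simp add: mult.commute)
      qed
      also have "k * (\<Sum>n=1..N. S3 n) \<le> T * (K0 + Su + 1)"
      proof -
        have "S3 n \<le> K0 + Su + 1" if n: "n \<in> {1..N}" for n
        proof -
          have nN: "n \<le> N" using n by simp
          have "norm (vn n) \<le> norm (u (tn n)) + norm (vn n - u (tn n))" using norm_triangle_ineq[of "u (tn n)" "vn n - u (tn n)"] by simp
          also have "\<dots> \<le> Su + 1" using Su(2) tn[OF nN] v(2)[OF tn[OF nN]] e(2) unfolding vn_def by (intro add_mono) auto
          finally show ?thesis unfolding S3_def using Ubm[OF n] norm_triangle_ineq4[of "U N n" "vn n"] by linarith
        qed
        then have "k * (\<Sum>n=1..N. S3 n) \<le> k * (\<Sum>n=1..N. K0 + Su + 1)" using k by (intro mult_left_mono sum_mono) auto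
        also have "\<dots> = T * (K0 + Su + 1)" using k(2) by (simp add: mult.assoc[symmetric] mult.commute)
        finally show ?thesis .
      qed
      also have "K * (k * (\<Sum>n=1..N. S2 n)) \<le> \<epsilon>0 / 2"
      proof -
        have "k * (\<Sum>n=1..N. S2 n) \<le> (1 + real s) * (real s * T * \<kappa> + k * K0 / \<kappa>)"
          unfolding S2_def k_def using apN by (intro spread_bound[OF N(1) \<kappa>(1)]) simp
        also have "\<dots> \<le> (1 + real s) * (real s * T * \<kappa> + \<nu> * K0 / \<kappa>)"
          using N1(1)[OF N(3)] K0 \<kappa>(1) unfolding k_def by (intro mult_left_mono add_left_mono divide_right_mono mult_right_mono) auto
        finally have "K * (k * (\<Sum>n=1..N. S2 n)) \<le> K * ((1 + real s) * (real s * T * \<kappa> + \<nu> * K0 / \<kappa>))" using K by (intro mult_left_mono)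
        also have "\<dots> \<le> (K + 1) * ((1 + real s) * (real s * T * \<kappa> + \<nu> * K0 / \<kappa>))"
          using \<kappa>(1) \<nu>(1) K0 T by (intro mult_right_mono mult_nonneg_nonneg add_nonneg_nonneg) auto
        also have "\<dots> = H * (real s * T * \<kappa>) + H * (\<nu> * K0 / \<kappa>)" unfolding H_def mult.assoc[symmetric, of "K + 1"] by (rule distrib_left)
        also have "\<dots> = \<epsilon>0 / 2" unfolding \<kappa>(2) \<nu>(2) by simp
        finally show ?thesis .
      qed
      finally have "(\<Sum>n=1..j. \<rho> n) \<le> e * (real s * T + K0) + \<epsilon>0 / 2 + e * (T * (K0 + Su + 1))" using e(1) by simp
      then show ?thesis unfolding B3_def by (simp only: distrib_left)
    qed
    have e2: "e\<^sup>2 \<le> e" using e by (simp add: power2_eq_square mult_left_le)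
    have a0: "a 0 \<le> e / 2"
    proof -
      have "U N 0 = u (tn 0)" using scheme_U0[OF N(1)] u_0 by (simp add: tn_def)
      then have "norm (U N 0 - vn 0) \<le> e" using v(2)[OF tn[of 0]] by (simp add: vn_def norm_minus_commute)
      then have "(norm (U N 0 - vn 0))\<^sup>2 \<le> e\<^sup>2" by (intro power_mono) auto
      then show ?thesis unfolding a_def using e2 by linarith
    qed
    \<comment> \<open>Returns from the comparison function to \<open>u\<close>: \<open>a j\<close>
      is half of a square, and squaring the triangle inequality costs another factor 2, whence the
      coefficient \<open>1 / 4\<close>.\<close>
    have aj: "(norm (U N j - u (tn j)))\<^sup>2 / 4 \<le> a j + e / 2"
    proof -
      have "norm (U N j - u (tn j)) \<le> norm (U N j - vn j) + norm (vn j - u (tn j))"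
        using norm_triangle_ineq[of "U N j - vn j" "vn j - u (tn j)"] by simp
      also have "\<dots> \<le> norm (U N j - vn j) + e" using v(2)[OF tn[OF j]] unfolding vn_def by simp
      finally have "(norm (U N j - u (tn j)))\<^sup>2 \<le> (norm (U N j - vn j) + e)\<^sup>2" by (intro power_mono) auto
      also have "\<dots> \<le> 2 * (norm (U N j - vn j))\<^sup>2 + 2 * e\<^sup>2"
        using sum_squares_bound[of "norm (U N j - vn j)" e] by (simp add: power2_sum)
      finally show ?thesis unfolding a_def using e2 by linarith
    qed
    have "e + e * B2 + e * B3 = e * Bt" by (simp add: Bt_def distrib_left)
    then have "(norm (U N j - u (tn j)))\<^sup>2 / 4 + h * (cS * (\<Sum>n=1..j. \<integral>t. stage_error N t \<partial>cell N n)) \<le> \<epsilon>0 + h * (\<integral>t. stage_error_H N t \<partial>M)"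
      using aj a0 tel[OF j] sum\<psi> intZ rest eBt \<epsilon>(2) by linarith
    then show ?thesis unfolding tn_def k_def .
  qed
  moreover have "max NR N1 \<ge> 1" using NR by simp
  ultimately show ?thesis by blast
qed

text \<open>The case \<open>h = 0\<close>, in which the stage errors drop out on both sides.\<close>

lemma nodal_convergence:
  assumes "\<epsilon> > 0"
  shows "\<exists>N0\<ge>1. \<forall>N\<ge>N0. \<forall>j\<le>N. norm (U N j - u (real j * (T / real N))) \<le> \<epsilon>"
proof -
  have "\<epsilon>\<^sup>2 / 4 > 0" using assms by simp
  from energy_estimate[OF order_refl eta this] obtain N0 where N0: "N0 \<ge> 1"
    "\<forall>N\<ge>N0. \<forall>j\<le>N. (norm (U N j - u (real j * (T / real N))))\<^sup>2 / 4 \<le> \<epsilon>\<^sup>2 / 4" by auto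
  have "norm (U N j - u (real j * (T / real N))) \<le> \<epsilon>" if "N \<ge> N0" "j \<le> N" for N j
  proof (rule power2_le_imp_le)
    have "(norm (U N j - u (real j * (T / real N))))\<^sup>2 / 4 \<le> \<epsilon>\<^sup>2 / 4" using N0(2) that by blast
    then show "(norm (U N j - u (real j * (T / real N))))\<^sup>2 \<le> \<epsilon>\<^sup>2" by linarith
  qed (use assms in simp)
  then show ?thesis using N0(1) by blast
qed

text \<open>For \<open>r < 2\<close> the power is not dominated by the square near 0, and for
  \<open>r > 2\<close> not for large arguments; the threshold \<delta> handles the former, the bound
  \<open>B\<close> the latter.\<close>

lemma powr_le_square:
  fixes x \<delta> B :: real
  assumes "0 \<le> x" "x \<le> B" "\<delta> > 0" "r > 0"
  shows "x powr r \<le> \<delta> powr r + (B powr r / \<delta>\<^sup>2) * x\<^sup>2"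
proof (cases "x \<le> \<delta>")
  case True
  then have "x powr r \<le> \<delta> powr r" using assms by (intro powr_mono2) auto
  moreover have "0 \<le> (B powr r / \<delta>\<^sup>2) * x\<^sup>2" by simp
  ultimately show ?thesis by linarith
next
  case False
  have "\<delta>\<^sup>2 \<le> x\<^sup>2" using False assms by (intro power_mono) auto
  then have "1 \<le> x\<^sup>2 / \<delta>\<^sup>2" using assms by simp
  then have "B powr r * 1 \<le> B powr r * (x\<^sup>2 / \<delta>\<^sup>2)" by (intro mult_left_mono) auto
  moreover have "x powr r \<le> B powr r" using assms by (intro powr_mono2) auto
  moreover have "0 \<le> \<delta> powr r" by simp
  ultimately show ?thesis unfolding times_divide_eq_right times_divide_eq_left by linarith
qed

text \<open>Square summability is known for the distance of a stage from the preceding value of the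
  scheme. The comparison therefore goes through the left grid point, where nodal convergence and the
  continuity of \<open>u\<close> finish the argument.\<close>

lemma stage_error_H_tendsto: "(\<lambda>N. \<integral>t. stage_error_H N t \<partial>M) \<longlonglongrightarrow> 0"
proof (rule LIMSEQ_I)
  fix \<epsilon> :: real assume \<epsilon>: "\<epsilon> > 0"
  obtain K0 where K0: "K0 > 0" and ap: "\<forall>N\<ge>1. (\<forall>n\<in>{1..N}. \<forall>l\<in>L. norm (Ul N l n) \<le> K0) \<and>
     (\<Sum>n=1..N. \<Sum>l=1..s. (norm (Ul N l n - U N (n - 1)))\<^sup>2) \<le> K0 \<and>
     (T / real N) * (\<Sum>n=1..N. \<Sum>l=1..s. nl l (Ul N l n) powr p) \<le> K0" using a_priori by blast
  obtain Su where Su: "Su \<ge> 0" "\<forall>t\<in>{0..T}. norm (u t) \<le> Su" using u_bounded by blast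
  define sT where "sT = real s * T"
  have sT: "sT > 0" using s T by (simp add: sT_def)
  \<comment> \<open>Three shares \<open>\<epsilon> / 4\<close>: the threshold \<delta> of
    \<open>powr_le_square\<close>, then \<kappa> for the nodal error and the oscillation of
    \<open>u\<close>, and finally \<nu>, a bound for the step size that outweighs the large constant
    \<open>B\<close>.\<close>
  define \<delta> where "\<delta> = (\<epsilon> / (4 * sT)) powr (1 / p)"
  have \<delta>: "\<delta> > 0" "sT * \<delta> powr p = \<epsilon> / 4" using \<epsilon> sT p by (auto simp: \<delta>_def powr_powr)
  define B where "B = (K0 + Su) powr p / \<delta>\<^sup>2"
  have B: "B > 0" unfolding B_def using K0 Su \<delta>(1) by auto
  define \<kappa> where "\<kappa> = sqrt (\<epsilon> / (32 * (B * sT)))"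
  have \<kappa>: "\<kappa> > 0" "B * (8 * \<kappa>\<^sup>2 * sT) = \<epsilon> / 4" using \<epsilon> B sT by (auto simp: \<kappa>_def)
  obtain N1 where N1: "N1 \<ge> 1" "\<forall>N\<ge>N1. \<forall>j\<le>N. norm (U N j - u (real j * (T / real N))) \<le> \<kappa>" using nodal_convergence[OF \<kappa>(1)] by blast
  obtain d where d: "d > 0" "\<forall>t\<in>{0..T}. \<forall>t'\<in>{0..T}. \<bar>t - t'\<bar> < d \<longrightarrow> dist (u t) (u t') \<le> \<kappa>"
    by (rule continuous_oscillation[OF u_cont \<kappa>(1)])
  define \<nu> where "\<nu> = min d (\<epsilon> / (8 * (B * K0)))"
  have \<nu>: "\<nu> > 0" "\<nu> \<le> d" "\<nu> \<le> \<epsilon> / (8 * (B * K0))" using d(1) \<epsilon> B K0 by (auto simp: \<nu>_def)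
  obtain N2 where N2: "\<And>N. N \<ge> N2 \<Longrightarrow> T / real N < \<nu>"
    using order_tendstoD(2)[OF steps_tendsto_0 \<nu>(1)] unfolding eventually_sequentially by blast
  have "(\<integral>t. stage_error_H N t \<partial>M) < \<epsilon>" if NN: "N \<ge> max N1 N2" for N
  proof -
    have N: "N \<ge> 1" "N \<ge> N1" "N \<ge> N2" using NN N1(1) by auto
    let ?k = "T / real N"
    define r where "r l m = (norm (Ul N l m - U N (m - 1)))\<^sup>2" for l m
    have pt: "norm (Ul N l (step_index T N t) - u t) powr p \<le> \<delta> powr p + B * (8 * \<kappa>\<^sup>2 + 2 * r l (step_index T N t))"
      if t: "t \<in> space M" and l: "l \<in> L" for t l
    proof -
      let ?i = "step_index T N t"
      let ?x = "norm (Ul N l ?i - u t)"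
      have i: "?i \<in> {1..N}" by (rule step_range[OF N(1) t])
      have i1: "?i - 1 \<le> N" using i by auto
      have tT: "t \<in> {0<..T}" "t \<in> {0..T}" using t by auto
      have "norm (u t) \<le> Su" using Su(2) tT(2) by blast
      moreover have "norm (Ul N l ?i) \<le> K0" using ap N(1) i l by blast
      ultimately have xB: "?x \<le> K0 + Su" using norm_triangle_ineq4[of "Ul N l ?i" "u t"] by linarith
      let ?t = "real (?i - 1) * ?k"
      have "norm (u ?t - u t) \<le> \<kappa>"
        unfolding dist_norm[symmetric]
      proof (rule d(2)[rule_format])
        show "?t \<in> {0..T}" by (rule node[OF N(1) i1])
        have "?t \<le> t" "t - ?k \<le> ?t" using idx_near[OF N(1) tT(1)] by blast+
        moreover have "\<bar>a - t\<bar> < d" if "a \<le> t" "t - k \<le> a" "k < \<nu>" for a k using that \<nu>(2) by linarith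
        ultimately show "\<bar>?t - t\<bar> < d" using N2[OF N(3)] by blast
      qed (rule tT)
      moreover have "norm (U N (?i - 1) - u ?t) \<le> \<kappa>" using N1(2) N(2) i1 by blast
      moreover have "?x \<le> norm (Ul N l ?i - U N (?i - 1)) + norm (U N (?i - 1) - u ?t) + norm (u ?t - u t)"
        using norm_triangle_ineq[of "Ul N l ?i - U N (?i - 1)" "U N (?i - 1) - u t"]
          norm_triangle_ineq[of "U N (?i - 1) - u ?t" "u ?t - u t"] by simp
      ultimately have "?x \<le> norm (Ul N l ?i - U N (?i - 1)) + 2 * \<kappa>" by linarith
      then have "?x\<^sup>2 \<le> (norm (Ul N l ?i - U N (?i - 1)) + 2 * \<kappa>)\<^sup>2" by (intro power_mono) auto
      also have "\<dots> \<le> 2 * r l ?i + 8 * \<kappa>\<^sup>2"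
        unfolding r_def using sum_squares_bound[of "norm (Ul N l ?i - U N (?i - 1))" "2 * \<kappa>"] by (simp add: power2_sum power_mult_distrib)
      finally have x2: "?x\<^sup>2 \<le> 8 * \<kappa>\<^sup>2 + 2 * r l ?i" by linarith
      have "?x powr p \<le> \<delta> powr p + B * ?x\<^sup>2" unfolding B_def by (rule powr_le_square) (use xB \<delta> p in auto)
      also have "B * ?x\<^sup>2 \<le> B * (8 * \<kappa>\<^sup>2 + 2 * r l ?i)" using x2 B by (intro mult_left_mono) auto
      finally show ?thesis by simp
    qed
    define F where "F m = (\<Sum>l=1..s. \<delta> powr p + B * (8 * \<kappa>\<^sup>2 + 2 * r l m))" for m
    have "(\<integral>t. stage_error_H N t \<partial>M) \<le> (\<integral>t. F (step_index T N t) \<partial>M)"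
      by (rule integral_mono[OF stage_error_H_int[OF N(1)] step_integrable[OF T N(1)]]) (auto simp only: stage_error_H_def F_def intro!: sum_mono pt)
    also have "\<dots> = ?k * (\<Sum>m=1..N. F m)" by (rule step_integral[OF T N(1)])
    also have "(\<Sum>m=1..N. F m) = real N * (real s * (\<delta> powr p + B * (8 * \<kappa>\<^sup>2))) + 2 * B * (\<Sum>m=1..N. \<Sum>l=1..s. r l m)"
      unfolding F_def by (simp add: distrib_left sum.distrib mult.left_commute flip: sum_distrib_left)
    also have "?k * (real N * (real s * (\<delta> powr p + B * (8 * \<kappa>\<^sup>2))) + 2 * B * (\<Sum>m=1..N. \<Sum>l=1..s. r l m))
      \<le> ?k * (real N * (real s * (\<delta> powr p + B * (8 * \<kappa>\<^sup>2))) + 2 * B * K0)"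
      using ap N(1) B T unfolding r_def by (intro mult_left_mono add_left_mono) auto
    also have "\<dots> = sT * \<delta> powr p + B * (8 * \<kappa>\<^sup>2 * sT) + ?k * (2 * (B * K0))" using N(1) by (simp add: sT_def algebra_simps)
    also have "?k * (2 * (B * K0)) \<le> \<epsilon> / (8 * (B * K0)) * (2 * (B * K0))"
      using N2[OF N(3)] \<nu>(3) B K0 by (intro mult_right_mono) auto
    also have "\<epsilon> / (8 * (B * K0)) * (2 * (B * K0)) = \<epsilon> / 4" using B K0 by simp
    finally have "(\<integral>t. stage_error_H N t \<partial>M) \<le> \<epsilon> / 4 + \<epsilon> / 4 + \<epsilon> / 4" unfolding \<delta>(2) \<kappa>(2) by simp
    then show ?thesis using \<epsilon> by linarith
  qed
  moreover have "0 \<le> (\<integral>t. stage_error_H N t \<partial>M)" for N using stage_error_H_nonneg by (intro integral_nonneg_AE AE_I2)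
  ultimately show "\<exists>no. \<forall>N\<ge>no. norm ((\<integral>t. stage_error_H N t \<partial>M) - 0) < \<epsilon>" by (intro exI[of _ "max N1 N2"]) simp
qed

text \<open>The case \<open>h = \<eta>\<close> at the last grid point, where the cells fill the
  whole interval; division by \<open>\<eta> * cS\<close> is the place where strict positivity of
  \<eta> enters.\<close>

lemma stage_error_tendsto: assumes \<eta>: "\<eta> > 0" shows "(\<lambda>N. \<integral>t. stage_error N t \<partial>M) \<longlonglongrightarrow> 0"
proof (rule LIMSEQ_I)
  fix \<epsilon> :: real assume \<epsilon>: "\<epsilon> > 0"
  have c: "\<eta> * cS > 0" using \<eta> cS by simp
  define \<epsilon>' where "\<epsilon>' = \<eta> * cS * \<epsilon> / 4"
  have \<epsilon>': "\<epsilon>' > 0" unfolding \<epsilon>'_def using c \<epsilon> by simp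
  obtain N0 where N0: "N0 \<ge> 1" "\<forall>N\<ge>N0. \<forall>j\<le>N. (norm (U N j - u (real j * (T / real N))))\<^sup>2 / 4 + \<eta> * (cS * (\<Sum>n=1..j. \<integral>t. stage_error N t \<partial>cell N n))
    \<le> \<epsilon>' + \<eta> * (\<integral>t. stage_error_H N t \<partial>M)" using energy_estimate[OF eta order_refl \<epsilon>'] by blast
  have "(\<lambda>N. \<eta> * (\<integral>t. stage_error_H N t \<partial>M)) \<longlonglongrightarrow> 0" using tendsto_mult_right_zero[OF stage_error_H_tendsto] .
  from order_tendstoD(2)[OF this \<epsilon>'] obtain N1 where N1: "\<And>N. N \<ge> N1 \<Longrightarrow> \<eta> * (\<integral>t. stage_error_H N t \<partial>M) < \<epsilon>'"
    unfolding eventually_sequentially by blast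
  have "(\<integral>t. stage_error N t \<partial>M) < \<epsilon>" if NN: "N \<ge> max N0 N1" for N
  proof -
    have N: "N \<ge> 1" "N \<ge> N0" "N \<ge> N1" using NN N0(1) by auto
    have eq: "(\<Sum>n=1..N. \<integral>t. stage_error N t \<partial>cell N n) = (\<integral>t. stage_error N t \<partial>M)"
    proof -
      have "real N * (T / real N) = T" using N(1) by simp
      then show ?thesis using integral_split_grid[OF T N(1) stage_error_int[OF N(1)] order_refl] by (simp only:)
    qed
    have "(norm (U N N - u (real N * (T / real N))))\<^sup>2 / 4 + \<eta> * (cS * (\<integral>t. stage_error N t \<partial>M)) \<le> \<epsilon>' + \<eta> * (\<integral>t. stage_error_H N t \<partial>M)"
      using N0(2)[rule_format, OF N(2) order_refl] unfolding eq .
    moreover have "0 \<le> (norm (U N N - u (real N * (T / real N))))\<^sup>2 / 4" by simp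
    ultimately have "\<eta> * (cS * (\<integral>t. stage_error N t \<partial>M)) < 2 * \<epsilon>'" using N1[OF N(3)] by linarith
    also have "2 * \<epsilon>' = \<eta> * cS * (\<epsilon> / 2)" by (simp add: \<epsilon>'_def)
    finally have "\<eta> * cS * (\<integral>t. stage_error N t \<partial>M) < \<eta> * cS * (\<epsilon> / 2)" by (simp only: mult.assoc)
    then have "(\<integral>t. stage_error N t \<partial>M) < \<epsilon> / 2" using c by (simp only: mult_less_cancel_left_pos)
    then show ?thesis using \<epsilon> by linarith
  qed
  moreover have "0 \<le> (\<integral>t. stage_error N t \<partial>M)" for N using stage_error_nonneg by (intro integral_nonneg_AE AE_I2)
  ultimately show "\<exists>no. \<forall>N\<ge>no. norm ((\<integral>t. stage_error N t \<partial>M) - 0) < \<epsilon>" by (intro exI[of _ "max N0 N1"]) simp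
qed

text \<open>The prolongation takes the value at a grid point at most one step to the right of
  \<open>t\<close>, so nodal convergence and the continuity of \<open>u\<close> suffice; at 0 it
  equals the initial value by definition.\<close>

lemma pointwise_convergence:
  assumes t: "t \<in> {0..T}"
  shows "(\<lambda>N. prolongation T N u0 (U N) t) \<longlonglongrightarrow> u t"
proof (cases "t = 0")
  case True
  then show ?thesis by (simp add: prolongation_def u_0)
next
  case False
  then have t0: "t \<in> {0<..T}" "0 < t" "t \<le> T" using t by auto
  show ?thesis
  proof (rule LIMSEQ_I)
    fix \<epsilon> :: real assume \<epsilon>: "\<epsilon> > 0"
    then have \<epsilon>3: "\<epsilon> / 3 > 0" by simp
    obtain N1 where N1: "N1 \<ge> 1" "\<forall>N\<ge>N1. \<forall>j\<le>N. norm (U N j - u (real j * (T / real N))) \<le> \<epsilon> / 3" using nodal_convergence[OF \<epsilon>3] by blast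
    obtain d where d: "d > 0" "\<forall>t\<in>{0..T}. \<forall>t'\<in>{0..T}. \<bar>t - t'\<bar> < d \<longrightarrow> dist (u t) (u t') \<le> \<epsilon> / 3"
      by (rule continuous_oscillation[OF u_cont \<epsilon>3])
    obtain N2 where N2: "\<And>N. N \<ge> N2 \<Longrightarrow> T / real N < d"
      using order_tendstoD(2)[OF steps_tendsto_0 d(1)] unfolding eventually_sequentially by blast
    have "norm (prolongation T N u0 (U N) t - u t) < \<epsilon>" if NN: "N \<ge> max N1 N2" for N
    proof -
      have N: "N \<ge> 1" "N \<ge> N1" "N \<ge> N2" using NN N1(1) by auto
      have iN: "step_index T N t \<le> N" using step_index_range(1)[OF T N(1) t0(2,3)] by simp
      have "norm (u (idx N t) - u t) \<le> \<epsilon> / 3"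
        unfolding dist_norm[symmetric]
      proof (rule d(2)[rule_format])
        show "idx N t \<in> {0..T}" by (rule node[OF N(1) iN])
        have "t \<le> idx N t" "idx N t \<le> t + T / real N" using idx_near[OF N(1) t0(1)] by blast+
        moreover have "\<bar>a - t\<bar> < d" if "t \<le> a" "a \<le> t + k" "k < d" for a k using that by linarith
        ultimately show "\<bar>idx N t - t\<bar> < d" using N2[OF N(3)] by blast
      qed (rule t)
      moreover have "norm (U N (step_index T N t) - u (idx N t)) \<le> \<epsilon> / 3" using N1(2) N(2) iN by blast
      ultimately have "norm (U N (step_index T N t) - u t) < \<epsilon>"
        using norm_triangle_ineq[of "U N (step_index T N t) - u (idx N t)" "u (idx N t) - u t"] \<epsilon> by simp
      then show ?thesis by (simp only: prolongation_eq[OF T N(1) t0(2,3)])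
    qed
    then show "\<exists>no. \<forall>N\<ge>no. norm (prolongation T N u0 (U N) t - u t) < \<epsilon>" by blast
  qed
qed

lemma Lp_convergence:
  assumes \<eta>: "\<eta> > 0" and l: "l \<in> L"
  shows "converges_Lp T p (Vl l) (nl l) (\<lambda>N. prolongation T N u0 (Ul N l)) u"
  unfolding converges_Lp_def
proof (intro conjI allI impI)
  have pr: "prolongation T N u0 (Ul N l) t = Ul N l (step_index T N t)" if "N \<ge> 1" "t \<in> space M" for N t
    using that by (intro prolongation_eq[OF T]) auto
  fix N :: nat assume N: "N \<ge> 1"
  show "prolongation T N u0 (Ul N l) \<in> Lp_space T p (Vl l) (nl l)"
    unfolding Lp_space_def mem_Collect_eq
  proof
    have "simple_on M (Vl l) (\<lambda>t. Ul N l (step_index T N t))" by (rule step_simple_on[OF T N]) (rule Ul_mem[OF N _ l])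
    then have "simple_on M (Vl l) (prolongation T N u0 (Ul N l))"
      unfolding simple_on_def using simple_function_cong[of M "prolongation T N u0 (Ul N l)" "\<lambda>t. Ul N l (step_index T N t)"] pr[OF N]
      by (auto simp only: image_subset_iff)
    then show "strongly_measurable_on M (Vl l) (nl l) (prolongation T N u0 (Ul N l))" by (rule strongly_measurable_simple[OF Vl(1)[OF l]])
    show "integrable M (\<lambda>t. nl l (prolongation T N u0 (Ul N l) t) powr p)"
      using step_integrable[OF T N, of "\<lambda>m. nl l (Ul N l m) powr p"] pr[OF N]
      by (simp only: cong: Bochner_Integration.integrable_cong)
  qed
next
  show "u \<in> Lp_space T p (Vl l) (nl l)" using u_l_strong[OF l] u_l_powr[OF l] by (simp add: Lp_space_def)
next
  have bd: "0 \<le> (\<integral>t. nl l (prolongation T N u0 (Ul N l) t - u t) powr p \<partial>M) \<and>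
    (\<integral>t. nl l (prolongation T N u0 (Ul N l) t - u t) powr p \<partial>M) \<le> (\<integral>t. stage_error N t \<partial>M)" if N: "N \<ge> 1" for N
  proof
    show "0 \<le> (\<integral>t. nl l (prolongation T N u0 (Ul N l) t - u t) powr p \<partial>M)" by (intro integral_nonneg_AE AE_I2) simp
    have "(\<integral>t. nl l (prolongation T N u0 (Ul N l) t - u t) powr p \<partial>M) = (\<integral>t. nl l (Ul N l (step_index T N t) - u t) powr p \<partial>M)"
      by (rule Bochner_Integration.integral_cong[OF refl]) (simp only: prolongation_eq[OF T N] space_restrict_space2 greaterThanLessThan_iff sets_completionI_sets borel_open open_greaterThanLessThan less_imp_le sets_lborel)
    also have "\<dots> \<le> (\<integral>t. stage_error N t \<partial>M)"
    proof (rule integral_mono[OF error_powr[OF N l] stage_error_int[OF N]])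
      show "nl l (Ul N l (step_index T N t) - u t) powr p \<le> stage_error N t" for t
        unfolding stage_error_def using l by (intro member_le_sum) auto
    qed
    finally show "(\<integral>t. nl l (prolongation T N u0 (Ul N l) t - u t) powr p \<partial>M) \<le> (\<integral>t. stage_error N t \<partial>M)" .
  qed
  \<comment> \<open>The comparison with \<open>stage_error\<close> holds from \<open>N = 1\<close>
    on, since the scheme is posed for positive \<open>N\<close> only; the limits are therefore taken
    eventually.\<close>
  have "(\<lambda>N. \<integral>t. nl l (prolongation T N u0 (Ul N l) t - u t) powr p \<partial>M) \<longlonglongrightarrow> 0"
    by (rule tendsto_sandwich[OF _ _ tendsto_const stage_error_tendsto[OF \<eta>]]; rule eventually_sequentiallyI[of 1]) (use bd in blast)+
  then show "(\<lambda>N. Lp_norm T p (nl l) (\<lambda>t. prolongation T N u0 (Ul N l) t - u t)) \<longlonglongrightarrow> 0"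
    unfolding Lp_norm_def
    by (rule tendsto_zero_powrI[OF _ tendsto_const]) (use p bd in \<open>auto intro!: eventually_sequentiallyI[of 1]\<close>)
qed

end

theorem theorem4p6:
  fixes T p q :: real and s :: nat
    and V :: "'h::{real_inner, banach, second_countable_topology} set"
    and nV sV :: "'h \<Rightarrow> real"
    and Vl :: "nat \<Rightarrow> 'h set" and nl sl :: "nat \<Rightarrow> 'h \<Rightarrow> real"
    and A :: "real \<Rightarrow> 'h \<Rightarrow> 'h \<Rightarrow> real" and Al :: "nat \<Rightarrow> real \<Rightarrow> 'h \<Rightarrow> 'h \<Rightarrow> real"
    and \<beta> \<eta> lam \<mu> :: real
    and f :: "real \<Rightarrow> 'h \<Rightarrow> real" and fl :: "nat \<Rightarrow> real \<Rightarrow> 'h \<Rightarrow> real"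
    and u0 :: 'h and u :: "real \<Rightarrow> 'h"
    and U :: "nat \<Rightarrow> nat \<Rightarrow> 'h" and Ul :: "nat \<Rightarrow> nat \<Rightarrow> nat \<Rightarrow> 'h"
  assumes "T > 0" and "p > 1" and "q = p / (p - 1)" and "s \<ge> 1"
    and "space_decomposition s V nV sV Vl nl sl"
    and "\<beta> > 0" and "\<eta> \<ge> 0" and "lam \<ge> 0" and "\<mu> > 0"
    and "operator_family T p \<beta> \<eta> lam \<mu> V nV sV A"
    and "\<And>l. l \<in> {1..s} \<Longrightarrow> operator_family T p \<beta> \<eta> lam \<mu> (Vl l) (nl l) (sl l) (Al l)"
    and "operator_decomposition s T V A Al"
    and "source_decomposition s T q V nV Vl nl f fl"
    and "evolution_solution T p V nV A f u0 u"
    and "\<And>N. N \<ge> 1 \<Longrightarrow> sum_splitting s T N Vl nl Al fl u0 (U N) (Ul N)"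
  shows "(\<forall>t\<in>{0..T}. (\<lambda>N. prolongation T N u0 (U N) t) \<longlonglongrightarrow> u t) \<and>
    (\<eta> > 0 \<longrightarrow>
      (\<forall>l\<in>{1..s}. converges_Lp T p (Vl l) (nl l) (\<lambda>N. prolongation T N u0 (Ul N l)) u))"
proof -
  interpret splitting T p q s V nV sV Vl nl sl A Al \<beta> \<eta> lam \<mu> f fl u0 u U Ul
    by (rule splitting.intro) fact+
  show ?thesis using pointwise_convergence Lp_convergence by blast
qed

end
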